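(* Let $h,k,m,n$ be positive integers with $$m<h,\qquad n<k,\qquad nh+mk\ge hk .$$ Let $\lambda,\sigma>0$, $\mu,\nu\ge 0$, $p\in\mathbb R$, and $q=1-p$. Then the operator on $\mathcal S'(\mathbb R^2)$ $$B=\lambda(x-qD_y)^{2h}+\mu(x-qD_y)^m(y+pD_x)^{2n}(x-qD_y)^m+\nu(y+pD_x)^n(x-qD_y)^{2m}(y+pD_x)^n+\sigma(y+pD_x)^{2k}$$ is regular.
   Context: $D_x=-i\partial_x$, $D_y=-i\partial_y$; $(x,y)$ are the variables in $\mathbb R^2$, and $x$, $y$ inside operators denote multiplication by the corresponding variable; products of operators are compositions. A linear operator $B$ on $\mathcal S'(\mathbb R^2)$ is regular if, for every $u\in\mathcal S'(\mathbb R^2)$, $Bu\in\mathcal S(\mathbb R^2)$ implies $u\in\mathcal S(\mathbb R^2)$. *)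

theory Defs
  imports "HOL-Analysis.Analysis"
begin

section \<open>Iterated partial derivatives and Schwartz functions\<close>

definition partial :: "'a::euclidean_space \<Rightarrow> ('a \<Rightarrow> complex) \<Rightarrow> 'a \<Rightarrow> complex" where
  "partial b f = (\<lambda>z. frechet_derivative f (at z) b)"

definition partials :: "'a::euclidean_space list \<Rightarrow> ('a \<Rightarrow> complex) \<Rightarrow> 'a \<Rightarrow> complex" where
  "partials bs f = foldr partial bs f"

text \<open>Every iterated partial derivative is Frechet differentiable, hence continuous, so this
  is \<open>C\<^sup>\<infinity>\<close>.  Multi-indices are words in the standard basis vectors; by symmetry of mixed
  partial derivatives the order of the letters is immaterial for smooth functions.\<close>

definition smooth :: "('a::euclidean_space \<Rightarrow> complex) \<Rightarrow> bool" where
  "smooth f \<longleftrightarrow> (\<forall>bs\<in>lists Basis. \<forall>z. partials bs f differentiable at z)"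

definition schwartz_function :: "('a::euclidean_space \<Rightarrow> complex) \<Rightarrow> bool" where
  "schwartz_function f \<longleftrightarrow> smooth f \<and>
     (\<forall>N. \<forall>bs\<in>lists Basis. bdd_above (range (\<lambda>z. norm z ^ N * cmod (partials bs f z))))"

lemma partials_Nil [simp]: "partials [] f = f"
  by (simp add: partials_def)

lemma partials_Cons [simp]: "partials (b # bs) f = partial b (partials bs f)"
  by (simp add: partials_def)

lemma partials_append: "partials (as @ bs) f = partials as (partials bs f)"
  by (simp add: partials_def)

lemma smoothD: "smooth f \<Longrightarrow> bs \<in> lists Basis \<Longrightarrow> partials bs f differentiable at z"
  by (simp add: smooth_def)

lemma partial_eqI: "(\<And>z. (f has_derivative f' z) (at z)) \<Longrightarrow> partial b f = (\<lambda>z. f' z b)"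
  unfolding partial_def using frechet_derivative_at by metis

lemma has_derivative_frechet:
  "f differentiable at z \<Longrightarrow> (f has_derivative frechet_derivative f (at z)) (at z)"
  by (simp add: frechet_derivative_works)

lemma partials_add:
  assumes "smooth f" "smooth g" "bs \<in> lists Basis"
  shows "partials bs (\<lambda>z. f z + g z) = (\<lambda>z. partials bs f z + partials bs g z)"
  using assms(3)
proof (induction bs)
  case (Cons b bs)
  then have bs: "bs \<in> lists Basis" by simp
  have "partial b (\<lambda>z. partials bs f z + partials bs g z) =
    (\<lambda>z. frechet_derivative (partials bs f) (at z) b + frechet_derivative (partials bs g) (at z) b)"
    by (rule partial_eqI has_derivative_add has_derivative_frechet smoothD assms bs)+
  then show ?case using Cons bs by (simp add: partial_def)
qed simp

lemma partials_scale:
  assumes "smooth f" "bs \<in> lists Basis"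
  shows "partials bs (\<lambda>z. c * f z) = (\<lambda>z. c * partials bs f z)"
  using assms(2)
proof (induction bs)
  case (Cons b bs)
  then have bs: "bs \<in> lists Basis" by simp
  have "partial b (\<lambda>z. c * partials bs f z) =
    (\<lambda>z. c * frechet_derivative (partials bs f) (at z) b)"
    by (rule partial_eqI has_derivative_mult_right has_derivative_frechet smoothD assms bs)+
  then show ?case using Cons bs by (simp add: partial_def)
qed simp

text \<open>The words obtained from \<open>bs\<close> by deleting one occurrence of \<open>e\<close>, for the Leibniz rule.\<close>

fun deletions :: "'b \<Rightarrow> 'b list \<Rightarrow> 'b list list" where
  "deletions e [] = []"
| "deletions e (b # bs) = (if b = e then [bs] else []) @ map ((#) b) (deletions e bs)"

lemma deletions_in: "w \<in> set (deletions e bs) \<Longrightarrow> set w \<subseteq> set bs \<and> length w \<le> length bs"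
  by (induction bs arbitrary: w) (fastforce split: if_splits)+

lemma length_deletions: "length (deletions e bs) \<le> length bs"
  by (induction bs) auto

lemma differentiableI: "(f has_derivative f') F \<Longrightarrow> f differentiable F"
  by (auto simp: differentiable_def)

lemma has_derivative_sum_list_frechet:
  fixes F :: "'c \<Rightarrow> 'a::euclidean_space \<Rightarrow> complex"
  assumes "\<And>w z. w \<in> set ws \<Longrightarrow> F w differentiable at z"
  shows "((\<lambda>z. \<Sum>w\<leftarrow>ws. F w z) has_derivative (\<lambda>h. \<Sum>w\<leftarrow>ws. frechet_derivative (F w) (at z) h)) (at z)"
  using assms
proof (induction ws)
  case (Cons w ws)
  then show ?case
    by (auto intro!: has_derivative_add has_derivative_frechet)
qed simp

lemma partials_coord:
  assumes f: "smooth f" and bs: "bs \<in> lists Basis" and e: "e \<in> Basis"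
  shows "partials bs (\<lambda>z. of_real (z \<bullet> e) * f z) =
    (\<lambda>z. of_real (z \<bullet> e) * partials bs f z + (\<Sum>w\<leftarrow>deletions e bs. partials w f z))"
  using bs
proof (induction bs)
  case (Cons b bs)
  then have bs: "bs \<in> lists Basis" and b: "b \<in> Basis" by auto
  have del: "partials w f differentiable at z" if "w \<in> set (deletions e bs)" for w z
    using deletions_in[OF that] bs f by (intro smoothD) auto
  have "partial b (\<lambda>z. of_real (z \<bullet> e) * partials bs f z + (\<Sum>w\<leftarrow>deletions e bs. partials w f z)) =
    (\<lambda>z. (of_real (z \<bullet> e) * frechet_derivative (partials bs f) (at z) b + of_real (b \<bullet> e) * partials bs f z)
       + (\<Sum>w\<leftarrow>deletions e bs. frechet_derivative (partials w f) (at z) b))"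
  proof (rule partial_eqI, rule has_derivative_add)
    fix z
    show "((\<lambda>z. \<Sum>w\<leftarrow>deletions e bs. partials w f z) has_derivative
      (\<lambda>a. \<Sum>w\<leftarrow>deletions e bs. frechet_derivative (partials w f) (at z) a)) (at z)"
      by (rule has_derivative_sum_list_frechet) (rule del)
    have "((\<lambda>z. complex_of_real (z \<bullet> e)) has_derivative (\<lambda>a. of_real (a \<bullet> e))) (at z)"
      by (auto intro!: derivative_eq_intros)
    from has_derivative_mult[OF this has_derivative_frechet[OF smoothD[OF f bs]]]
    show "((\<lambda>z. of_real (z \<bullet> e) * partials bs f z) has_derivative
      (\<lambda>a. of_real (z \<bullet> e) * frechet_derivative (partials bs f) (at z) a
         + of_real (a \<bullet> e) * partials bs f z)) (at z)" .
  qed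
  moreover have "partials bs (\<lambda>z. of_real (z \<bullet> e) * f z) =
    (\<lambda>z. of_real (z \<bullet> e) * partials bs f z + (\<Sum>w\<leftarrow>deletions e bs. partials w f z))"
    using Cons by simp
  ultimately show ?case unfolding partials_Cons using b e
    by (auto simp: partial_def inner_Basis o_def algebra_simps)
qed simp

lemma smooth_add: "smooth f \<Longrightarrow> smooth g \<Longrightarrow> smooth (\<lambda>z. f z + g z)"
  unfolding smooth_def[of "\<lambda>z. f z + g z"]
  by (intro ballI allI) (simp only: partials_add, intro differentiable_add smoothD)

lemma smooth_scale: "smooth f \<Longrightarrow> smooth (\<lambda>z. c * f z)"
  unfolding smooth_def[of "\<lambda>z. c * f z"]
  by (intro ballI allI) (simp only: partials_scale, intro differentiable_mult differentiable_const smoothD)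

lemma smooth_partial: "smooth f \<Longrightarrow> b \<in> Basis \<Longrightarrow> smooth (partial b f)"
  unfolding smooth_def[of "partial b f"]
proof (intro ballI allI)
  fix bs :: "'a list" and z assume "smooth f" "b \<in> Basis" "bs \<in> lists Basis"
  then show "partials bs (partial b f) differentiable at z"
    using smoothD[of f "bs @ [b]" z] by (simp add: partials_append)
qed

lemma smooth_coord:
  assumes "smooth f" "e \<in> Basis"
  shows "smooth (\<lambda>z. of_real (z \<bullet> e) * f z)"
  unfolding smooth_def[of "\<lambda>z. of_real (z \<bullet> e) * f z"]
proof (intro ballI allI)
  fix bs :: "'a list" and z assume bs: "bs \<in> lists Basis"
  have "partials w f differentiable at z" if "w \<in> set (deletions e bs)" for w z
    using deletions_in[OF that] bs assms by (intro smoothD) auto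
  then have "(\<lambda>z. \<Sum>w\<leftarrow>deletions e bs. partials w f z) differentiable at z"
    by (rule differentiableI[OF has_derivative_sum_list_frechet])
  moreover have "(\<lambda>z. complex_of_real (z \<bullet> e)) differentiable at z"
    by (intro differentiableI[where f' = "\<lambda>a. of_real (a \<bullet> e)"]) (auto intro!: derivative_eq_intros)
  ultimately show "partials bs (\<lambda>z. of_real (z \<bullet> e) * f z) differentiable at z"
    unfolding partials_coord[OF assms(1) bs assms(2)]
    by (intro differentiable_add differentiable_mult smoothD assms bs)
qed

lemma schwartz_functionD:
  assumes "schwartz_function f"
  shows "smooth f"
    and "bs \<in> lists Basis \<Longrightarrow> \<exists>C. \<forall>z. norm z ^ N * cmod (partials bs f z) \<le> C"
  using assms by (auto simp: schwartz_function_def bdd_above_def)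

lemma schwartz_functionI:
  assumes "smooth f"
    and "\<And>N bs. bs \<in> lists Basis \<Longrightarrow> \<exists>C. \<forall>z. norm z ^ N * cmod (partials bs f z) \<le> C"
  shows "schwartz_function f"
  unfolding schwartz_function_def bdd_above_def using assms by (auto simp: image_iff) 

lemma schwartz_zero: "schwartz_function (\<lambda>z::'a::euclidean_space. 0)"
proof (rule schwartz_functionI)
  have p: "partials bs (\<lambda>z::'a. 0) = (\<lambda>z. 0)" for bs :: "'a list"
    by (induction bs) (auto simp: partial_def frechet_derivative_const)
  show "smooth (\<lambda>z::'a. 0)" by (simp add: smooth_def p)
  show "\<exists>C. \<forall>z. norm z ^ N * cmod (partials bs (\<lambda>z::'a. 0) z) \<le> C" for N bs
    by (auto simp: p)
qed

lemma schwartz_add: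
  assumes f: "schwartz_function f" and g: "schwartz_function g"
  shows "schwartz_function (\<lambda>z. f z + g z)"
proof (rule schwartz_functionI)
  show "smooth (\<lambda>z. f z + g z)" by (intro smooth_add schwartz_functionD f g)
  fix N and bs :: "'a list" assume bs: "bs \<in> lists Basis"
  obtain C D where C: "\<And>z. norm z ^ N * cmod (partials bs f z) \<le> C"
    and D: "\<And>z. norm z ^ N * cmod (partials bs g z) \<le> D"
    using schwartz_functionD(2)[OF f bs] schwartz_functionD(2)[OF g bs] by meson
  have "norm z ^ N * cmod (partials bs f z + partials bs g z) \<le> C + D" for z
  proof -
    have "norm z ^ N * cmod (partials bs f z + partials bs g z)
      \<le> norm z ^ N * (cmod (partials bs f z) + cmod (partials bs g z))"
      by (intro mult_left_mono norm_triangle_ineq) auto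
    with C[of z] D[of z] show ?thesis by (simp add: distrib_left)
  qed
  then show "\<exists>C. \<forall>z. norm z ^ N * cmod (partials bs (\<lambda>z. f z + g z) z) \<le> C"
    using partials_add[OF schwartz_functionD(1)[OF f] schwartz_functionD(1)[OF g] bs] by auto
qed

lemma schwartz_scale:
  assumes f: "schwartz_function f"
  shows "schwartz_function (\<lambda>z. c * f z)"
proof (rule schwartz_functionI)
  show "smooth (\<lambda>z. c * f z)" by (intro smooth_scale schwartz_functionD f)
  fix N and bs :: "'a list" assume bs: "bs \<in> lists Basis"
  obtain C where C: "\<And>z. norm z ^ N * cmod (partials bs f z) \<le> C"
    using schwartz_functionD(2)[OF f bs] by meson
  have "norm z ^ N * cmod (c * partials bs f z) \<le> cmod c * C" for z
    using mult_left_mono[OF C[of z], of "cmod c"] by (simp add: norm_mult mult_ac)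
  then show "\<exists>C. \<forall>z. norm z ^ N * cmod (partials bs (\<lambda>z. c * f z) z) \<le> C"
    using partials_scale[OF schwartz_functionD(1)[OF f] bs] by auto
qed

lemma schwartz_partial:
  assumes f: "schwartz_function f" and b: "b \<in> Basis"
  shows "schwartz_function (partial b f)"
proof (rule schwartz_functionI)
  show "smooth (partial b f)" by (intro smooth_partial schwartz_functionD f b)
  fix N and bs :: "'a list" assume "bs \<in> lists Basis"
  then show "\<exists>C. \<forall>z. norm z ^ N * cmod (partials bs (partial b f) z) \<le> C"
    using schwartz_functionD(2)[OF f, of "bs @ [b]" N] b by (auto simp: partials_append)
qed

lemma coord_pointwise:
  assumes f: "smooth f" and bs: "bs \<in> lists Basis" and e: "e \<in> Basis"
  shows "norm z ^ N * cmod (partials bs (\<lambda>z. of_real (z \<bullet> e) * f z) z)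
    \<le> norm z ^ Suc N * cmod (partials bs f z)
       + (\<Sum>w\<leftarrow>deletions e bs. norm z ^ N * cmod (partials w f z))"
proof -
  have s: "cmod (\<Sum>w\<leftarrow>ws. F w) \<le> (\<Sum>w\<leftarrow>ws. cmod (F w))" for ws and F :: "'a list \<Rightarrow> complex"
    by (induction ws) (auto intro: order_trans[OF norm_triangle_ineq])
  have "cmod (partials bs (\<lambda>z. of_real (z \<bullet> e) * f z) z)
    \<le> cmod (of_real (z \<bullet> e) * partials bs f z) + (\<Sum>w\<leftarrow>deletions e bs. cmod (partials w f z))"
    unfolding partials_coord[OF assms]
    by (rule order_trans[OF norm_triangle_ineq]) (rule add_left_mono[OF s])
  also have "cmod (of_real (z \<bullet> e) * partials bs f z) \<le> norm z * cmod (partials bs f z)"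
    using Basis_le_norm[OF e, of z] by (auto simp: norm_mult intro!: mult_right_mono)
  finally have "norm z ^ N * cmod (partials bs (\<lambda>z. of_real (z \<bullet> e) * f z) z)
    \<le> norm z ^ N * (norm z * cmod (partials bs f z) + (\<Sum>w\<leftarrow>deletions e bs. cmod (partials w f z)))"
    by (simp add: mult_left_mono)
  then show ?thesis
    by (simp add: distrib_left sum_list_const_mult mult_ac)
qed

lemma schwartz_coord:
  assumes f: "schwartz_function f" and e: "e \<in> Basis"
  shows "schwartz_function (\<lambda>z. of_real (z \<bullet> e) * f z)"
proof (rule schwartz_functionI)
  note sf = schwartz_functionD(1)[OF f]
  show "smooth (\<lambda>z. of_real (z \<bullet> e) * f z)" by (intro smooth_coord sf e)
  fix N and bs :: "'a list" assume bs: "bs \<in> lists Basis"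
  obtain C where C: "\<And>z. norm z ^ Suc N * cmod (partials bs f z) \<le> C"
    using schwartz_functionD(2)[OF f bs] by meson
  have "\<exists>D. \<forall>w\<in>set (deletions e bs). \<forall>z. norm z ^ N * cmod (partials w f z) \<le> D w"
  proof (rule bchoice, rule ballI)
    fix w assume "w \<in> set (deletions e bs)"
    then have "w \<in> lists Basis" using deletions_in bs by fastforce
    then show "\<exists>D. \<forall>z. norm z ^ N * cmod (partials w f z) \<le> D"
      by (rule schwartz_functionD(2)[OF f])
  qed
  then obtain D where D: "\<And>w z. w \<in> set (deletions e bs) \<Longrightarrow> norm z ^ N * cmod (partials w f z) \<le> D w"
    by blast
  have "norm z ^ N * cmod (partials bs (\<lambda>z. of_real (z \<bullet> e) * f z) z) \<le> C + sum_list (map D (deletions e bs))" for z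
    by (rule order_trans[OF coord_pointwise[OF sf bs e]]) (intro add_mono C sum_list_mono D)
  then show "\<exists>C. \<forall>z. norm z ^ N * cmod (partials bs (\<lambda>z. of_real (z \<bullet> e) * f z) z) \<le> C" by blast
qed


section \<open>Complex vector spaces\<close>

class complex_vector = ab_group_add +
  fixes scaleC :: "complex \<Rightarrow> 'a \<Rightarrow> 'a" (infixr "*\<^sub>C" 75)
  assumes scaleC_add_right: "c *\<^sub>C (u + v) = c *\<^sub>C u + c *\<^sub>C v"
    and scaleC_add_left: "(c + d) *\<^sub>C u = c *\<^sub>C u + d *\<^sub>C u"
    and scaleC_scaleC: "c *\<^sub>C d *\<^sub>C u = (c * d) *\<^sub>C u"
    and scaleC_one: "1 *\<^sub>C u = u"

lemma vector_space_scaleC: "vector_space (scaleC :: complex \<Rightarrow> 'a::complex_vector \<Rightarrow> 'a)"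
  by unfold_locales (simp_all add: scaleC_add_right scaleC_add_left scaleC_scaleC scaleC_one)

interpretation complex_vector: vector_space "scaleC :: complex \<Rightarrow> 'a::complex_vector \<Rightarrow> 'a"
  by (rule vector_space_scaleC)

instantiation complex :: complex_vector
begin
definition scaleC_complex :: "complex \<Rightarrow> complex \<Rightarrow> complex" where
  "scaleC_complex c z = c * z"
instance
  by standard (simp_all add: scaleC_complex_def algebra_simps)
end

abbreviation clinear :: "('a::complex_vector \<Rightarrow> 'b::complex_vector) \<Rightarrow> bool" where
  "clinear \<equiv> Vector_Spaces.linear scaleC scaleC"

lemma clinear_iff:
  "clinear f \<longleftrightarrow> (\<forall>u v. f (u + v) = f u + f v) \<and> (\<forall>c u. f (c *\<^sub>C u) = c *\<^sub>C f u)"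
  by (simp add: Vector_Spaces.linear_iff vector_space_scaleC)


section \<open>The Schwartz space\<close>

typedef (overloaded) 'a schwartz = "{f :: 'a::euclidean_space \<Rightarrow> complex. schwartz_function f}"
  morphisms sfun Abs_schwartz
  using schwartz_zero by blast

setup_lifting type_definition_schwartz

instantiation schwartz :: (euclidean_space) complex_vector
begin
lift_definition zero_schwartz :: "'a schwartz" is "\<lambda>z. 0" by (rule schwartz_zero)
lift_definition plus_schwartz :: "'a schwartz \<Rightarrow> 'a schwartz \<Rightarrow> 'a schwartz"
  is "\<lambda>f g z. f z + g z" by (rule schwartz_add)
lift_definition scaleC_schwartz :: "complex \<Rightarrow> 'a schwartz \<Rightarrow> 'a schwartz"
  is "\<lambda>c f z. c * f z" by (rule schwartz_scale)
lift_definition uminus_schwartz :: "'a schwartz \<Rightarrow> 'a schwartz"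
  is "\<lambda>f z. - f z" using schwartz_scale[of _ "-1"] by simp
lift_definition minus_schwartz :: "'a schwartz \<Rightarrow> 'a schwartz \<Rightarrow> 'a schwartz"
  is "\<lambda>f g z. f z - g z" using schwartz_add schwartz_scale[of _ "-1"] by fastforce
instance
  by standard (transfer; simp add: fun_eq_iff algebra_simps)+
end

definition seminorm :: "nat \<Rightarrow> 'a::euclidean_space list \<Rightarrow> 'a schwartz \<Rightarrow> real" where
  "seminorm N bs f = (SUP z. norm z ^ N * cmod (partials bs (sfun f) z))"

definition total_seminorm :: "nat \<Rightarrow> 'a::euclidean_space schwartz \<Rightarrow> real" where
  "total_seminorm n f =
     (\<Sum>N\<le>n. \<Sum>bs | bs \<in> lists Basis \<and> length bs \<le> n. seminorm N bs f)"

lemma smooth_sfun: "smooth (sfun f)"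
  using sfun[of f] by (simp add: schwartz_functionD)

lemma seminorm_upper:
  "bs \<in> lists Basis \<Longrightarrow> norm z ^ N * cmod (partials bs (sfun f) z) \<le> seminorm N bs f"
  unfolding seminorm_def using sfun[of f]
  by (intro cSUP_upper) (auto simp: schwartz_function_def)

lemma seminorm_least:
  "(\<And>z. norm z ^ N * cmod (partials bs (sfun f) z) \<le> C) \<Longrightarrow> seminorm N bs f \<le> C"
  unfolding seminorm_def by (intro cSUP_least) auto

lemma seminorm_nonneg: "bs \<in> lists Basis \<Longrightarrow> 0 \<le> seminorm N bs f"
  by (rule order_trans[OF _ seminorm_upper[of bs 0]]) auto

lemma finite_words: "finite {bs :: 'a::euclidean_space list. bs \<in> lists Basis \<and> length bs \<le> n}"
  using finite_lists_length_le[OF finite_Basis, of n] by (simp add: lists_eq_set)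

lemma seminorm_le_total:
  fixes f :: "'a::euclidean_space schwartz"
  assumes bs: "bs \<in> lists Basis" and "length bs \<le> n" "N \<le> n"
  shows "seminorm N bs f \<le> total_seminorm n f"
proof -
  let ?W = "{bs :: 'a list. bs \<in> lists Basis \<and> length bs \<le> n}"
  have "seminorm N bs f \<le> (\<Sum>bs\<in>?W. seminorm N bs f)"
    using assms by (intro member_le_sum finite_words) (auto intro: seminorm_nonneg)
  also have "\<dots> \<le> total_seminorm n f"
    unfolding total_seminorm_def using assms
    by (intro member_le_sum[of N "{..n}" "\<lambda>N. \<Sum>bs\<in>?W. seminorm N bs f"])
      (auto intro!: sum_nonneg seminorm_nonneg)
  finally show ?thesis .
qed

lemma total_seminorm_nonneg: "0 \<le> total_seminorm n f"
  unfolding total_seminorm_def by (auto intro!: sum_nonneg seminorm_nonneg)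


section \<open>Tempered distributions\<close>

text \<open>The estimate is continuity for the locally convex topology of the Schwartz space.\<close>

typedef (overloaded) 'a tempered =
  "{u :: 'a::euclidean_space schwartz \<Rightarrow> complex.
     clinear u \<and> (\<exists>C n. \<forall>f. cmod (u f) \<le> C * total_seminorm n f)}"
  morphisms dapply Abs_tempered
proof -
  have "(\<lambda>f::'a schwartz. 0) \<in> {u. clinear u \<and> (\<exists>C n. \<forall>f. cmod (u f) \<le> C * total_seminorm n f)}"
    by (auto simp: clinear_iff scaleC_complex_def intro!: exI[of _ 0])
  then show ?thesis by blast
qed

setup_lifting type_definition_tempered

lemma total_seminorm_mono:
  assumes "n \<le> n'"
  shows "total_seminorm n f \<le> total_seminorm n' f"
proof -
  have "total_seminorm n f \<le> (\<Sum>N\<le>n. \<Sum>bs | bs \<in> lists Basis \<and> length bs \<le> n'. seminorm N bs f)"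
    unfolding total_seminorm_def using assms
    by (intro sum_mono sum_mono2 finite_words) (auto intro: seminorm_nonneg)
  also have "\<dots> \<le> total_seminorm n' f"
    unfolding total_seminorm_def using assms
    by (intro sum_mono2) (auto intro!: sum_nonneg seminorm_nonneg)
  finally show ?thesis .
qed

instantiation tempered :: (euclidean_space) complex_vector
begin
lift_definition zero_tempered :: "'a tempered" is "\<lambda>f. 0"
  by (auto simp: clinear_iff scaleC_complex_def intro!: exI[of _ 0])
lift_definition plus_tempered :: "'a tempered \<Rightarrow> 'a tempered \<Rightarrow> 'a tempered"
  is "\<lambda>u v f. u f + v f"
proof (elim conjE exE, intro conjI)
  fix u v :: "'a schwartz \<Rightarrow> complex" and C D n m
  assume lin: "clinear u" "clinear v"
    and C: "\<forall>f. cmod (u f) \<le> C * total_seminorm n f"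
    and D: "\<forall>f. cmod (v f) \<le> D * total_seminorm m f"
  show "clinear (\<lambda>f. u f + v f)"
    using lin by (simp add: clinear_iff scaleC_complex_def algebra_simps)
  have "cmod (u f + v f) \<le> (\<bar>C\<bar> + \<bar>D\<bar>) * total_seminorm (max n m) f" for f
  proof -
    have "C * total_seminorm n f \<le> \<bar>C\<bar> * total_seminorm (max n m) f"
      by (intro mult_mono total_seminorm_mono total_seminorm_nonneg) auto
    moreover have "D * total_seminorm m f \<le> \<bar>D\<bar> * total_seminorm (max n m) f"
      by (intro mult_mono total_seminorm_mono total_seminorm_nonneg) auto
    ultimately show ?thesis
      using norm_triangle_ineq[of "u f" "v f"] C[rule_format, of f] D[rule_format, of f]
      by (simp add: distrib_right)
  qed
  then show "\<exists>C n. \<forall>f. cmod (u f + v f) \<le> C * total_seminorm n f" by blast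
qed
lift_definition scaleC_tempered :: "complex \<Rightarrow> 'a tempered \<Rightarrow> 'a tempered"
  is "\<lambda>c u f. c * u f"
proof (elim conjE exE, intro conjI)
  fix c and u :: "'a schwartz \<Rightarrow> complex" and C n
  assume lin: "clinear u" and C: "\<forall>f. cmod (u f) \<le> C * total_seminorm n f"
  show "clinear (\<lambda>f. c * u f)"
    using lin by (simp add: clinear_iff scaleC_complex_def algebra_simps)
  have "cmod (c * u f) \<le> (cmod c * C) * total_seminorm n f" for f
    using mult_left_mono[OF C[rule_format, of f], of "cmod c"] by (simp add: norm_mult mult_ac)
  then show "\<exists>C n. \<forall>f. cmod (c * u f) \<le> C * total_seminorm n f" by blast
qed
definition uminus_tempered :: "'a tempered \<Rightarrow> 'a tempered" where
  "uminus_tempered u = (-1) *\<^sub>C u"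
definition minus_tempered :: "'a tempered \<Rightarrow> 'a tempered \<Rightarrow> 'a tempered" where
  "minus_tempered u v = u + (-1) *\<^sub>C v"
lemma tempered_eqI:
  fixes u v :: "'a tempered"
  shows "(\<And>f. dapply u f = dapply v f) \<Longrightarrow> u = v"
  by (simp add: dapply_inject[symmetric] fun_eq_iff)
lemma dapply_simps [simp]:
  fixes u v :: "'a tempered"
  shows "dapply 0 f = 0" "dapply (u + v) f = dapply u f + dapply v f"
    "dapply (c *\<^sub>C u) f = c * dapply u f"
    "dapply (- u) f = - dapply u f" "dapply (u - v) f = dapply u f - dapply v f"
  unfolding uminus_tempered_def minus_tempered_def by (transfer, simp)+
instance
  by standard (rule tempered_eqI, simp add: algebra_simps)+
end


section \<open>Position and momentum operators on tempered distributions\<close>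

lemma Basis_R2: "(1, 0) \<in> (Basis :: (real \<times> real) set)" "(0, 1) \<in> (Basis :: (real \<times> real) set)"
  by (auto simp: Basis_prod_def)

lift_definition test_x :: "(real \<times> real) schwartz \<Rightarrow> (real \<times> real) schwartz"
  is "\<lambda>f z. of_real (fst z) * f z"
  using schwartz_coord[OF _ Basis_R2(1)] by (simp add: inner_prod_def)

lift_definition test_y :: "(real \<times> real) schwartz \<Rightarrow> (real \<times> real) schwartz"
  is "\<lambda>f z. of_real (snd z) * f z"
  using schwartz_coord[OF _ Basis_R2(2)] by (simp add: inner_prod_def)

lift_definition test_Dx :: "(real \<times> real) schwartz \<Rightarrow> (real \<times> real) schwartz"
  is "\<lambda>f z. - \<i> * partial (1, 0) f z"
  by (intro schwartz_scale schwartz_partial Basis_R2)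

lift_definition test_Dy :: "(real \<times> real) schwartz \<Rightarrow> (real \<times> real) schwartz"
  is "\<lambda>f z. - \<i> * partial (0, 1) f z"
  by (intro schwartz_scale schwartz_partial Basis_R2)

lemma tempered_comp:
  fixes T :: "'a::euclidean_space schwartz \<Rightarrow> 'a schwartz"
  assumes u: "clinear u \<and> (\<exists>C n. \<forall>f. cmod (u f) \<le> C * total_seminorm n f)"
    and T: "clinear T"
    and bd: "\<And>N bs. bs \<in> lists Basis \<Longrightarrow>
      \<exists>C n. \<forall>f. seminorm N bs (T f) \<le> C * total_seminorm n f"
  shows "clinear (\<lambda>f. u (T f)) \<and> (\<exists>C n. \<forall>f. cmod (u (T f)) \<le> C * total_seminorm n f)"
proof
  show "clinear (\<lambda>f. u (T f))" using u T by (simp add: clinear_iff)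
  let ?P = "\<lambda>F :: 'a schwartz \<Rightarrow> real. \<exists>C n. \<forall>f. F f \<le> C * total_seminorm n f"
  have add: "?P (\<lambda>f. F f + G f)" if FG: "?P F" "?P G" for F G
  proof -
    obtain C n D m where C: "\<And>f. F f \<le> C * total_seminorm n f"
      and D: "\<And>f. G f \<le> D * total_seminorm m f" using FG by metis
    have "F f + G f \<le> (\<bar>C\<bar> + \<bar>D\<bar>) * total_seminorm (max n m) f" for f
    proof -
      have "C * total_seminorm n f \<le> \<bar>C\<bar> * total_seminorm (max n m) f"
        by (intro mult_mono total_seminorm_mono total_seminorm_nonneg) auto
      moreover have "D * total_seminorm m f \<le> \<bar>D\<bar> * total_seminorm (max n m) f"
        by (intro mult_mono total_seminorm_mono total_seminorm_nonneg) auto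
      ultimately show ?thesis using C[of f] D[of f] by (simp add: distrib_right)
    qed
    then show ?thesis by blast
  qed
  have zero: "?P (\<lambda>f. 0)" by (auto intro!: exI[of _ 0])
  have sum: "?P (\<lambda>f. \<Sum>i\<in>I. F i f)" if "finite I" "\<And>i. i \<in> I \<Longrightarrow> ?P (F i)"
    for I :: "'i set" and F
    using that
  proof (induction I)
    case empty
    show ?case using zero by simp
  next
    case (insert i I)
    have "?P (\<lambda>f. F i f + (\<Sum>i\<in>I. F i f))"
      by (rule add[OF insert.prems insert.IH]) (use insert.prems in auto)
    then show ?case using insert.hyps by simp
  qed
  obtain C n where C: "\<And>f. cmod (u f) \<le> C * total_seminorm n f" using u by metis
  have "?P (\<lambda>f. total_seminorm n (T f))"
    unfolding total_seminorm_def[of n] by (intro sum finite_words finite_atMost bd) auto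
  then obtain D m where D: "\<And>f. total_seminorm n (T f) \<le> D * total_seminorm m f" by metis
  have "cmod (u (T f)) \<le> (\<bar>C\<bar> * D) * total_seminorm m f" for f
  proof -
    have "cmod (u (T f)) \<le> C * total_seminorm n (T f)" by (rule C)
    also have "\<dots> \<le> \<bar>C\<bar> * total_seminorm n (T f)"
      by (intro mult_right_mono total_seminorm_nonneg) auto
    also have "\<dots> \<le> \<bar>C\<bar> * (D * total_seminorm m f)"
      by (intro mult_left_mono D) auto
    finally show ?thesis by (simp add: mult_ac)
  qed
  then show "\<exists>C n. \<forall>f. cmod (u (T f)) \<le> C * total_seminorm n f" by blast
qed

lemma test_x_bound:
  assumes bs: "bs \<in> lists Basis" and e: "e \<in> Basis"
    and T: "\<And>f. sfun (T f) = (\<lambda>z. of_real (z \<bullet> e) * sfun f z)"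
  shows "\<exists>C n. \<forall>f. seminorm N bs (T f) \<le> C * total_seminorm n f"
proof (intro exI allI)
  fix f
  let ?n = "Suc (N + length bs)"
  have del: "w \<in> lists Basis" "length w \<le> ?n" if "w \<in> set (deletions e bs)" for w
    using deletions_in[OF that] bs by auto
  have "norm z ^ N * cmod (partials bs (sfun (T f)) z) \<le> real ?n * total_seminorm ?n f" for z
  proof -
    have "norm z ^ N * cmod (partials bs (sfun (T f)) z)
      \<le> norm z ^ Suc N * cmod (partials bs (sfun f) z)
         + (\<Sum>w\<leftarrow>deletions e bs. norm z ^ N * cmod (partials w (sfun f) z))"
      unfolding T by (rule coord_pointwise[OF smooth_sfun bs e])
    also have "\<dots> \<le> total_seminorm ?n f + (\<Sum>w\<leftarrow>deletions e bs. total_seminorm ?n f)"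
    proof (intro add_mono sum_list_mono)
      show "norm z ^ Suc N * cmod (partials bs (sfun f) z) \<le> total_seminorm ?n f"
        by (intro order_trans[OF seminorm_upper seminorm_le_total] bs) auto
      show "norm z ^ N * cmod (partials w (sfun f) z) \<le> total_seminorm ?n f"
        if "w \<in> set (deletions e bs)" for w
        by (intro order_trans[OF seminorm_upper seminorm_le_total] del[OF that]) auto
    qed
    also have "\<dots> = real (Suc (length (deletions e bs))) * total_seminorm ?n f"
      by (simp add: sum_list_triv distrib_right)
    also have "\<dots> \<le> real ?n * total_seminorm ?n f"
      using length_deletions[of e bs] by (intro mult_right_mono total_seminorm_nonneg) auto
    finally show ?thesis .
  qed
  then show "seminorm N bs (T f) \<le> real ?n * total_seminorm ?n f" by (rule seminorm_least)
qed

lemma test_D_bound: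
  assumes bs: "bs \<in> lists Basis" and e: "e \<in> Basis"
    and T: "\<And>f. sfun (T f) = (\<lambda>z. - \<i> * partial e (sfun f) z)"
  shows "\<exists>C n. \<forall>f. seminorm N bs (T f) \<le> C * total_seminorm n f"
proof (intro exI allI)
  fix f
  let ?n = "Suc (N + length bs)"
  have "norm z ^ N * cmod (partials bs (sfun (T f)) z) \<le> 1 * total_seminorm ?n f" for z
  proof -
    have "norm z ^ N * cmod (partials bs (sfun (T f)) z)
      = norm z ^ N * cmod (partials (bs @ [e]) (sfun f) z)"
      unfolding T using partials_scale[OF smooth_partial[OF smooth_sfun e] bs, of "-\<i>"]
      by (simp add: partials_append norm_mult)
    also have "\<dots> \<le> total_seminorm ?n f"
      using bs e by (intro order_trans[OF seminorm_upper seminorm_le_total]) auto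
    finally show ?thesis by simp
  qed
  then show "seminorm N bs (T f) \<le> 1 * total_seminorm ?n f" by (rule seminorm_least)
qed

lemma clinear_test: "clinear test_x" "clinear test_y" "clinear test_Dx" "clinear test_Dy"
proof -
  have *: "partial b (\<lambda>z. f z + g z) = (\<lambda>z. partial b f z + partial b g z)"
    "partial b (\<lambda>z. c * f z) = (\<lambda>z. c * partial b f z)"
    if "schwartz_function f" "schwartz_function g" "b \<in> Basis"
    for b :: "real \<times> real" and f g c
    using partials_add[of f g "[b]"] partials_scale[of f "[b]" c] that
    by (auto dest: schwartz_functionD)
  show "clinear test_x" "clinear test_y"
    unfolding clinear_iff by (transfer; simp add: fun_eq_iff algebra_simps)+
  show "clinear test_Dx" "clinear test_Dy"
    unfolding clinear_iff
    by (transfer; simp add: fun_eq_iff algebra_simps * Basis_R2)+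
qed

lift_definition mult_x :: "(real \<times> real) tempered \<Rightarrow> (real \<times> real) tempered"
  is "\<lambda>u f. u (test_x f)"
  by (rule tempered_comp[OF _ clinear_test(1)])
    (auto intro!: test_x_bound[OF _ Basis_R2(1)] simp: test_x.rep_eq inner_prod_def)

lift_definition mult_y :: "(real \<times> real) tempered \<Rightarrow> (real \<times> real) tempered"
  is "\<lambda>u f. u (test_y f)"
  by (rule tempered_comp[OF _ clinear_test(2)])
    (auto intro!: test_x_bound[OF _ Basis_R2(2)] simp: test_y.rep_eq inner_prod_def)

lift_definition transpose_Dx :: "(real \<times> real) tempered \<Rightarrow> (real \<times> real) tempered"
  is "\<lambda>u f. u (test_Dx f)"
  by (rule tempered_comp[OF _ clinear_test(3)])
    (auto intro!: test_D_bound[OF _ Basis_R2(1)] simp: test_Dx.rep_eq)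

lift_definition transpose_Dy :: "(real \<times> real) tempered \<Rightarrow> (real \<times> real) tempered"
  is "\<lambda>u f. u (test_Dy f)"
  by (rule tempered_comp[OF _ clinear_test(4)])
    (auto intro!: test_D_bound[OF _ Basis_R2(2)] simp: test_Dy.rep_eq)

text \<open>Integration by parts: \<open>\<langle>D u, f\<rangle> = - \<langle>u, D f\<rangle>\<close>.\<close>

definition Dx :: "(real \<times> real) tempered \<Rightarrow> (real \<times> real) tempered" where
  "Dx u = - transpose_Dx u"

definition Dy :: "(real \<times> real) tempered \<Rightarrow> (real \<times> real) tempered" where
  "Dy u = - transpose_Dy u"

lemma dapply_ops:
  "dapply (mult_x u) f = dapply u (test_x f)"
  "dapply (mult_y u) f = dapply u (test_y f)"
  "dapply (Dx u) f = - dapply u (test_Dx f)"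
  "dapply (Dy u) f = - dapply u (test_Dy f)"
  by (simp_all add: mult_x.rep_eq mult_y.rep_eq Dx_def Dy_def transpose_Dx.rep_eq transpose_Dy.rep_eq)

lemma clinear_ops: "clinear mult_x" "clinear mult_y" "clinear Dx" "clinear Dy"
  unfolding clinear_iff by (auto intro!: tempered_eqI simp: dapply_ops)


section \<open>Regular operators\<close>

text \<open>Membership of a tempered distribution in the Schwartz space, under the bilinear pairing
  that identifies a function with a distribution.\<close>

definition in_schwartz :: "'a::euclidean_space tempered \<Rightarrow> bool" where
  "in_schwartz u \<longleftrightarrow>
     (\<exists>g :: 'a schwartz. \<forall>f. dapply u f = integral\<^sup>L lborel (\<lambda>z. sfun g z * sfun f z))"

definition regular :: "('a::euclidean_space tempered \<Rightarrow> 'a tempered) \<Rightarrow> bool" where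
  "regular B \<longleftrightarrow> clinear B \<and> (\<forall>u. in_schwartz (B u) \<longrightarrow> in_schwartz u)"

definition twisted_x :: "real \<Rightarrow> (real \<times> real) tempered \<Rightarrow> (real \<times> real) tempered" where
  "twisted_x q u = mult_x u - complex_of_real q *\<^sub>C Dy u"

definition twisted_y :: "real \<Rightarrow> (real \<times> real) tempered \<Rightarrow> (real \<times> real) tempered" where
  "twisted_y p u = mult_y u + complex_of_real p *\<^sub>C Dx u"

end

theory Submission
  imports Defs "HOL-Probability.Sinc_Integral" "HOL-Library.Nat_Bijection"
begin

text \<open>Since \<open>p + q = 1\<close>, the operators \<open>X = x - q D\<^sub>y\<close> and \<open>Y = y + p D\<^sub>x\<close> satisfy \<open>[X, Y] = \<i>\<close>, and
  \<open>X' = x + p D\<^sub>y\<close>, \<open>Y' = y - q D\<^sub>x\<close> form a second canonical pair which commutes with the first.  A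
  complex Gaussian is annihilated by both lowering operators, and the raising operators generate from
  it an orthonormal Hermite family \<open>herm i j\<close> of Schwartz functions.  In the coefficients of a tempered
  distribution with respect to this family, \<open>X\<close> and \<open>R = \<i> Y\<close> become real tridiagonal matrices which act
  on the index \<open>i\<close> only, so \<open>B\<close> becomes a banded real matrix on sequences in \<open>i\<close>, the same one for
  every \<open>j\<close>.

  On sequences, conjugating \<open>B\<close> with a diagonal weight \<open>g\<close> replaces \<open>X\<close>, \<open>R\<close> by \<open>X + E\<close>, \<open>R + F\<close>, where
  \<open>E\<close>, \<open>F\<close> and all their iterated commutators with \<open>X\<close>, \<open>R\<close> are bounded.  Expanding the words in the
  quadratic form of \<open>g B g\<^sup>-\<^sup>1\<close>, each error term contains a proper subword, and such words are negligible
  with respect to the energy: pure powers by log-convexity of \<open>l \<mapsto> \<parallel>X\<^sup>l w\<parallel>\<close>, mixed words by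
  interpolating in one letter at a time, reordering modulo shorter words.  This Garding estimate is uniform in a
  regularization of the weights \<open>(1 + i)\<^sup>s\<close>, and letting the regularization tend to \<open>1\<close> it bounds
  \<open>(1 + i)\<^sup>s v\<^sub>i\<close> by \<open>(1 + i)\<^sup>s (B v)\<^sub>i\<close> for sequences of polynomial growth.  Hence the coefficients of \<open>u\<close>
  decay rapidly whenever those of \<open>B u\<close> do, and since the Hermite family is complete,
  \<open>u\<close> is a Schwartz function.\<close>

section \<open>Operators of order zero and their commutators\<close>

text \<open>Coefficients of tempered distributions grow polynomially, so \<open>B v\<close> cannot
  be paired with \<open>v\<close> directly; this dictates the regularization of the weights and the
  truncation to finite sequences. Conjugation by a weight adds to a ladder letter its product with
  (ratio of neighbouring weights - 1), of size 1 / (1 + i), while the letter grows like the square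
  root of i. The addition and its commutators thus stay bounded, and bounded perturbations of the
  letters are all that the form estimate has to tolerate. There \<open>m < h\<close> and
  \<open>n < k\<close> enter: the pure powers met in mixed words are strictly intermediate, hence
  absorbable. Since \<open>B\<close> does not act on \<open>j\<close>, it gains nothing in that
  index: decay in \<open>j\<close> must be inherited from \<open>B u\<close>, which forces an
  estimate that is linear in the data with one constant for all \<open>j\<close>. The Garding
  estimate alone leaves finitely many low coefficients on the right. They are removed by strict
  positivity of the unweighted form, which comes from the uncertainty inequality.\<close>

definition commutator :: "('v::real_vector \<Rightarrow> 'v) \<Rightarrow> ('v \<Rightarrow> 'v) \<Rightarrow> 'v \<Rightarrow> 'v" where
  "commutator P T = (\<lambda>w. P (T w) - T (P w))"

definition uniformly_bounded :: "('p \<Rightarrow> 'v::real_normed_vector \<Rightarrow> 'v) \<Rightarrow> bool" where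
  "uniformly_bounded T \<longleftrightarrow> (\<forall>p. linear (T p)) \<and> (\<exists>C. \<forall>p w. norm (T p w) \<le> C * norm w)"

text \<open>\<open>p\<close> indexes a family, and every constant is chosen once for all
  \<open>p\<close>; this uniformity is what survives when the regularization is removed.
  \<open>l\<close> is the depth of nested commutators under control.\<close>

primrec admissible :: "('v \<Rightarrow> 'v) set \<Rightarrow> nat \<Rightarrow> ('p \<Rightarrow> 'v::real_normed_vector \<Rightarrow> 'v) \<Rightarrow> bool" where
  "admissible \<X> 0 T \<longleftrightarrow> uniformly_bounded T"
| "admissible \<X> (Suc l) T \<longleftrightarrow> uniformly_bounded T \<and> (\<forall>P\<in>\<X>. admissible \<X> l (\<lambda>p. commutator P (T p)))"

lemma uniformly_boundedD:
  assumes "uniformly_bounded T"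
  obtains C where "C \<ge> 0" "\<And>p w. norm (T p w) \<le> C * norm w"
proof -
  obtain C where C: "\<And>p w. norm (T p w) \<le> C * norm w"
    using assms by (auto simp: uniformly_bounded_def)
  have "norm (T p w) \<le> \<bar>C\<bar> * norm w" for p w
    by (rule order_trans[OF C]) (auto intro: mult_right_mono)
  then show thesis using that[of "\<bar>C\<bar>"] by auto
qed

lemma uniformly_bounded_linear: "uniformly_bounded T \<Longrightarrow> linear (T p)"
  by (simp add: uniformly_bounded_def)

lemma uniformly_bounded_add:
  assumes "uniformly_bounded S" "uniformly_bounded T"
  shows "uniformly_bounded (\<lambda>p w. S p w + T p w)"
proof -
  obtain C D where "\<And>p w. norm (S p w) \<le> C * norm w" "\<And>p w. norm (T p w) \<le> D * norm w"
    using assms by (auto simp: uniformly_bounded_def)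
  then have "norm (S p w + T p w) \<le> (C + D) * norm w" for p w
    by (metis (no_types) add_mono distrib_right norm_triangle_le)
  then show ?thesis
    using assms by (auto simp: uniformly_bounded_def intro!: linear_compose_add)
qed

lemma uniformly_bounded_scale:
  assumes "uniformly_bounded T"
  shows "uniformly_bounded (\<lambda>p w. c *\<^sub>R T p w)"
proof -
  obtain C where "\<And>p w. norm (T p w) \<le> C * norm w"
    using assms by (auto simp: uniformly_bounded_def)
  then have "norm (c *\<^sub>R T p w) \<le> (\<bar>c\<bar> * C) * norm w" for p w
    by (simp add: mult_left_mono mult.assoc)
  then show ?thesis
    using assms unfolding uniformly_bounded_def
    by (intro conjI allI linear_compose_scale_right) blast+
qed

lemma uniformly_bounded_comp:
  assumes "uniformly_bounded S" "uniformly_bounded T"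
  shows "uniformly_bounded (\<lambda>p w. S p (T p w))"
proof -
  obtain C where C: "C \<ge> 0" "\<And>p w. norm (S p w) \<le> C * norm w"
    using uniformly_boundedD[OF assms(1)] by blast
  obtain D where D: "\<And>p w. norm (T p w) \<le> D * norm w"
    using uniformly_boundedD[OF assms(2)] by blast
  have "norm (S p (T p w)) \<le> (C * D) * norm w" for p w
    using C(2)[of p "T p w"] mult_left_mono[OF D[of p w] C(1)] by (simp add: mult.assoc)
  moreover have "linear (\<lambda>w. S p (T p w))" for p
    using linear_compose[OF uniformly_bounded_linear[OF assms(2)] uniformly_bounded_linear[OF assms(1)], of p p]
    by (simp add: o_def)
  ultimately show ?thesis by (auto simp: uniformly_bounded_def)
qed

lemma admissible_bounded: "admissible \<X> l T \<Longrightarrow> uniformly_bounded T"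
  by (cases l) auto

lemma admissible_Suc: "admissible \<X> (Suc l) T \<Longrightarrow> admissible \<X> l T"
proof (induction l arbitrary: T)
  case (Suc l)
  then show ?case by (simp only: admissible.simps(2)[of \<X> "Suc l"] admissible.simps(2)[of \<X> l]) blast
qed simp

lemma admissible_add:
  assumes "\<And>P. P \<in> \<X> \<Longrightarrow> linear P"
  shows "admissible \<X> l S \<Longrightarrow> admissible \<X> l T \<Longrightarrow> admissible \<X> l (\<lambda>p w. S p w + T p w)"
proof (induction l arbitrary: S T)
  case (Suc l)
  have "commutator P (\<lambda>w. S p w + T p w) = (\<lambda>w. commutator P (S p) w + commutator P (T p) w)"
    if "P \<in> \<X>" for P p
    by (auto simp: commutator_def linear_add[OF assms[OF that]])
  then show ?case using Suc by (simp add: uniformly_bounded_add)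
qed (simp add: uniformly_bounded_add)

lemma admissible_scale:
  assumes "\<And>P. P \<in> \<X> \<Longrightarrow> linear P"
  shows "admissible \<X> l T \<Longrightarrow> admissible \<X> l (\<lambda>p w. c *\<^sub>R T p w)"
proof (induction l arbitrary: T)
  case (Suc l)
  have "commutator P (\<lambda>w. c *\<^sub>R T p w) = (\<lambda>w. c *\<^sub>R commutator P (T p) w)"
    if "P \<in> \<X>" for P p
    by (auto simp: commutator_def linear_scale[OF assms[OF that]] scaleR_diff_right)
  then show ?case using Suc by (simp add: uniformly_bounded_scale)
qed (simp add: uniformly_bounded_scale)

text \<open>The commutator is a derivation, [P, S T] = [P, S] T + S [P, T], and all factors on the
  right are controlled to depth \<open>l\<close>, the uncommuted ones by
  \<open>admissible_Suc\<close>.\<close>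

lemma admissible_comp:
  assumes "\<And>P. P \<in> \<X> \<Longrightarrow> linear P"
  shows "admissible \<X> l S \<Longrightarrow> admissible \<X> l T \<Longrightarrow> admissible \<X> l (\<lambda>p w. S p (T p w))"
proof (induction l arbitrary: S T)
  case (Suc l)
  have "linear (S p)" for p
    using Suc.prems by (simp add: uniformly_bounded_linear)
  then have "commutator P (\<lambda>w. S p (T p w)) =
      (\<lambda>w. commutator P (S p) (T p w) + S p (commutator P (T p) w))" for P p
    by (auto simp: commutator_def linear_diff)
  moreover have "admissible \<X> l (\<lambda>p w. commutator P (S p) (T p w) + S p (commutator P (T p) w))"
    if "P \<in> \<X>" for P
  proof (rule admissible_add[OF assms])
    have "admissible \<X> l (\<lambda>p. commutator P (S p))" "admissible \<X> l (\<lambda>p. commutator P (T p))"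
      using Suc.prems that by auto
    then show "admissible \<X> l (\<lambda>p w. commutator P (S p) (T p w))"
      "admissible \<X> l (\<lambda>p w. S p (commutator P (T p) w))"
      using Suc.IH admissible_Suc Suc.prems by blast+
  qed
  ultimately show ?case using Suc.prems by (simp add: uniformly_bounded_comp)
qed (simp add: uniformly_bounded_comp)

text \<open>The commutator criterion of Beals for operators of order zero, used as a definition. It
  yields an algebra that is stable under commutators with the letters.\<close>

definition order_zero :: "('v \<Rightarrow> 'v) set \<Rightarrow> ('p \<Rightarrow> 'v::real_normed_vector \<Rightarrow> 'v) \<Rightarrow> bool" where
  "order_zero \<X> T \<longleftrightarrow> (\<forall>P\<in>\<X>. linear P) \<and> (\<forall>l. admissible \<X> l T)"

lemma order_zero_linear: "order_zero \<X> T \<Longrightarrow> linear (T p)"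
  unfolding order_zero_def by (metis admissible_bounded uniformly_bounded_linear)

lemma order_zero_bounded: "order_zero \<X> T \<Longrightarrow> uniformly_bounded T"
  unfolding order_zero_def by (metis admissible_bounded)

lemma order_zero_add: "order_zero \<X> S \<Longrightarrow> order_zero \<X> T \<Longrightarrow> order_zero \<X> (\<lambda>p w. S p w + T p w)"
  unfolding order_zero_def using admissible_add[of \<X> _ S T] by blast

lemma order_zero_scale: "order_zero \<X> T \<Longrightarrow> order_zero \<X> (\<lambda>p w. c *\<^sub>R T p w)"
  unfolding order_zero_def using admissible_scale[of \<X> _ T c] by blast

lemma order_zero_comp: "order_zero \<X> S \<Longrightarrow> order_zero \<X> T \<Longrightarrow> order_zero \<X> (\<lambda>p w. S p (T p w))"
  unfolding order_zero_def using admissible_comp[of \<X> _ S T] by blast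

lemma order_zero_commutator:
  "order_zero \<X> T \<Longrightarrow> P \<in> \<X> \<Longrightarrow> order_zero \<X> (\<lambda>p. commutator P (T p))"
  unfolding order_zero_def using admissible.simps(2)[of \<X> _ T] by blast

lemma admissible_zero:
  assumes "\<And>P. P \<in> \<X> \<Longrightarrow> linear P"
  shows "admissible \<X> l (\<lambda>p w. 0)"
proof (induction l)
  case 0
  show ?case by (auto simp: uniformly_bounded_def linear_iff intro: exI[of _ 0])
next
  case (Suc l)
  have "commutator P (\<lambda>w. 0) = (\<lambda>w. 0)" if "P \<in> \<X>" for P
    by (auto simp: commutator_def linear_0[OF assms[OF that]])
  then show ?case using Suc by (auto simp: uniformly_bounded_def linear_iff intro: exI[of _ 0])
qed

lemma order_zero_scalar:
  assumes "\<And>P. P \<in> \<X> \<Longrightarrow> linear P"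
  shows "order_zero \<X> (\<lambda>p w. c *\<^sub>R w)"
proof -
  have "admissible \<X> l (\<lambda>p w. c *\<^sub>R w)" for l
  proof (cases l)
    case 0
    show ?thesis unfolding 0 by (auto simp: uniformly_bounded_def linear_iff algebra_simps intro: exI[of _ "\<bar>c\<bar>"])
  next
    case (Suc l')
    have "commutator P (\<lambda>w. c *\<^sub>R w) = (\<lambda>w. 0)" if "P \<in> \<X>" for P
      by (auto simp: commutator_def linear_scale[OF assms[OF that]])
    then show ?thesis
      unfolding Suc using admissible_zero[OF assms, of \<X> l']
      by (auto simp: uniformly_bounded_def linear_iff algebra_simps intro: exI[of _ "\<bar>c\<bar>"])
  qed
  then show ?thesis using assms unfolding order_zero_def by blast
qed

text \<open>Coefficients of order zero stay on the left of the words, so that norms are controlled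
  by those of the words alone (\<open>lower_order_norm\<close>).\<close>

inductive lower_order :: "('v \<Rightarrow> 'v) set \<Rightarrow> ('v \<Rightarrow> 'v) set \<Rightarrow> ('p \<Rightarrow> 'v::real_normed_vector \<Rightarrow> 'v) \<Rightarrow> bool"
  for \<X> Z where
  zero: "lower_order \<X> Z (\<lambda>p w. 0)"
| base: "order_zero \<X> T \<Longrightarrow> z \<in> Z \<Longrightarrow> lower_order \<X> Z (\<lambda>p w. T p (z w))"
| add: "lower_order \<X> Z V \<Longrightarrow> lower_order \<X> Z W \<Longrightarrow> lower_order \<X> Z (\<lambda>p w. V p w + W p w)"

lemma lower_order_mono: "lower_order \<X> Z W \<Longrightarrow> Z \<subseteq> Z' \<Longrightarrow> lower_order \<X> Z' W"
proof (induction rule: lower_order.induct)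
  case (base T z)
  then show ?case by (intro lower_order.base) auto
qed (intro lower_order.zero lower_order.add; simp)+

lemma lower_order_norm:
  assumes "lower_order \<X> Z W" "finite Z"
  shows "\<exists>C\<ge>0. \<forall>p w. norm (W p w) \<le> C * (\<Sum>z\<in>Z. norm (z w))"
  using assms(1)
proof (induction rule: lower_order.induct)
  case zero
  show ?case by (auto intro: exI[of _ 0])
next
  case (base T z)
  obtain C where C: "C \<ge> 0" "\<And>p w. norm (T p w) \<le> C * norm w"
    using uniformly_boundedD[OF order_zero_bounded[OF base(1)]] by blast
  have "norm (T p (z w)) \<le> C * (\<Sum>z\<in>Z. norm (z w))" for p w
    using C(2)[of p "z w"] C(1) base(2) assms(2)
    by (meson member_le_sum mult_left_mono norm_ge_zero order_trans)
  then show ?case using C(1) by blast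
next
  case (add V W)
  then obtain C D where C: "C \<ge> 0" "\<And>p w. norm (V p w) \<le> C * (\<Sum>z\<in>Z. norm (z w))"
    and D: "D \<ge> 0" "\<And>p w. norm (W p w) \<le> D * (\<Sum>z\<in>Z. norm (z w))"
    by metis
  have "norm (V p w + W p w) \<le> (C + D) * (\<Sum>z\<in>Z. norm (z w))" for p w
    using C(2)[of p w] D(2)[of p w] norm_triangle_ineq[of "V p w" "W p w"] by (simp add: distrib_right)
  then show ?case using C(1) D(1) by (intro exI[of _ "C + D"]) auto
qed

lemma lower_order_comp:
  assumes "lower_order \<X> Z W" "order_zero \<X> T"
  shows "lower_order \<X> Z (\<lambda>p w. T p (W p w))"
  using assms(1)
proof (induction rule: lower_order.induct)
  case zero
  show ?case using lower_order.zero by (simp add: linear_0[OF order_zero_linear[OF assms(2)]])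
next
  case (base S z)
  show ?case using lower_order.base[OF order_zero_comp[OF assms(2) base(1)] base(2)] .
next
  case (add V W)
  show ?case using lower_order.add[OF add.IH] by (simp add: linear_add[OF order_zero_linear[OF assms(2)]])
qed

text \<open>P T z = T P z + [P, T] z: the letter passes the coefficient at the price of a
  commutator, which is again of order zero. This is the reason for controlling commutators of every
  depth.\<close>

lemma lower_order_left:
  fixes W :: "'p \<Rightarrow> 'v::real_normed_vector \<Rightarrow> 'v"
  assumes "lower_order \<X> Z W" "P \<in> \<X>" "linear P" "Z \<subseteq> Z'"
    and lower: "\<And>z. z \<in> Z \<Longrightarrow> lower_order \<X> Z' (\<lambda>(p::'p) w. P (z w))"
  shows "lower_order \<X> Z' (\<lambda>p w. P (W p w))"
  using assms(1)
proof (induction rule: lower_order.induct)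
  case zero
  show ?case using lower_order.zero by (simp add: linear_0[OF assms(3)])
next
  case (base T z)
  have "lower_order \<X> Z' (\<lambda>p w. T p (P (z w)) + commutator P (T p) (z w))"
    using base assms
    by (intro lower_order.add lower_order_comp[OF lower] lower_order.base order_zero_commutator) auto
  then show ?case by (simp add: commutator_def)
next
  case (add V W)
  show ?case using lower_order.add[OF add.IH] by (simp add: linear_add[OF assms(3)])
qed

lemma lower_order_scaled_mem:
  fixes Z :: "('v \<Rightarrow> 'v::real_normed_vector) set"
  assumes "\<And>P. P \<in> \<X> \<Longrightarrow> linear P" "z \<in> Z"
  shows "lower_order \<X> Z (\<lambda>p w. c *\<^sub>R z w)"
  using lower_order.base[OF order_zero_scalar[OF assms(1)] assms(2)] .

lemma lower_order_mem:
  fixes Z :: "('v \<Rightarrow> 'v::real_normed_vector) set"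
  assumes "\<And>P. P \<in> \<X> \<Longrightarrow> linear P" "z \<in> Z"
  shows "lower_order \<X> Z (\<lambda>p. z)"
  using lower_order_scaled_mem[OF assms, where c = 1] by simp

text \<open>Prefixing one perturbed letter: (Q + F) x - Q y = Q (x - y) + F y + F (x - y), and each
  summand is of lower order over \<open>Z'\<close>.\<close>

lemma lower_order_step:
  assumes W: "lower_order \<X> Z (\<lambda>p w. x p w - y w)" and F: "order_zero \<X> F"
    and Q: "Q \<in> \<X>" "linear Q" and Z: "Z \<subseteq> Z'" "y \<in> Z'" "\<And>z. z \<in> Z \<Longrightarrow> (\<lambda>w. Q (z w)) \<in> Z'"
  shows "lower_order \<X> Z' (\<lambda>p w. (Q (x p w) + F p (x p w)) - Q (y w))"
proof -
  have "lower_order \<X> Z' (\<lambda>p w. Q (x p w - y w) + (F p (y w) + F p (x p w - y w)))"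
    using F by (intro lower_order.add lower_order_left[OF W Q] lower_order.base[OF F] Z
        lower_order_mem lower_order_mono[OF lower_order_comp[OF W F]]) (auto simp: order_zero_def)
  then show ?thesis
    by (simp add: linear_diff[OF Q(2)] linear_diff[OF order_zero_linear[OF F]] algebra_simps)
qed

definition subwords :: "('v \<Rightarrow> 'v) \<Rightarrow> nat \<Rightarrow> ('v \<Rightarrow> 'v) \<Rightarrow> nat \<Rightarrow> ('v \<Rightarrow> 'v) set" where
  "subwords Q n P m = (\<lambda>(j, i) w. (Q ^^ j) ((P ^^ i) w)) ` ({..n} \<times> {..m} - {(n, m)})"

lemma subwordsI: "j \<le> n \<Longrightarrow> i \<le> m \<Longrightarrow> (j, i) \<noteq> (n, m) \<Longrightarrow> (\<lambda>w. (Q ^^ j) ((P ^^ i) w)) \<in> subwords Q n P m"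
  unfolding subwords_def by (rule image_eqI[of _ _ "(j, i)"]) auto

lemma subwordsE:
  assumes "z \<in> subwords Q n P m"
  obtains j i where "j \<le> n" "i \<le> m" "(j, i) \<noteq> (n, m)" "z = (\<lambda>w. (Q ^^ j) ((P ^^ i) w))"
  using assms unfolding subwords_def by auto

lemma finite_subwords: "finite (subwords Q n P m)"
  unfolding subwords_def by simp

text \<open>Commuting the bounded errors to the left leaves a proper subword to the right of each of them.\<close>

lemma perturbed_word:
  assumes "P \<in> \<X>" "Q \<in> \<X>" "linear P" "linear Q" "order_zero \<X> E" "order_zero \<X> F"
  shows "lower_order \<X> (subwords Q n P m)
    (\<lambda>p w. ((\<lambda>w. Q w + F p w) ^^ n) (((\<lambda>w. P w + E p w) ^^ m) w) - (Q ^^ n) ((P ^^ m) w))"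
proof (induction n)
  case 0
  show ?case
  proof (induction m)
    case 0
    show ?case by (simp add: lower_order.zero)
  next
    case (Suc m)
    have *: "lower_order \<X> (subwords Q 0 P m) (\<lambda>p w. ((\<lambda>w. P w + E p w) ^^ m) w - (P ^^ m) w)"
      using Suc by simp
    show ?case
      unfolding funpow_0 id_apply funpow.simps(2) o_def
    proof (rule lower_order_step[OF * assms(5,1,3)])
      show "subwords Q 0 P m \<subseteq> subwords Q 0 P (Suc m)"
        by (auto elim!: subwordsE intro!: subwordsI[of 0, simplified])
      show "P ^^ m \<in> subwords Q 0 P (Suc m)" using subwordsI[of 0 0 m "Suc m" Q P] by simp
      fix z assume "z \<in> subwords Q 0 P m"
      then show "(\<lambda>w. P (z w)) \<in> subwords Q 0 P (Suc m)"
      proof (rule subwordsE)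
        fix j i assume "j \<le> 0" "i \<le> m" "(j, i) \<noteq> (0, m)" "z = (\<lambda>w. (Q ^^ j) ((P ^^ i) w))"
        then show ?thesis using subwordsI[of 0 0 "Suc i" "Suc m" Q P] by simp
      qed
    qed
  qed
next
  case (Suc n)
  show ?case
    unfolding funpow.simps(2)[of n] o_def
  proof (rule lower_order_step[OF Suc assms(6,2,4)])
    show "subwords Q n P m \<subseteq> subwords Q (Suc n) P m"
      by (auto elim!: subwordsE intro!: subwordsI)
    show "(\<lambda>w. (Q ^^ n) ((P ^^ m) w)) \<in> subwords Q (Suc n) P m" by (intro subwordsI) auto
    fix z assume "z \<in> subwords Q n P m"
    then show "(\<lambda>w. Q (z w)) \<in> subwords Q (Suc n) P m"
    proof (rule subwordsE)
      fix j i assume "j \<le> n" "i \<le> m" "(j, i) \<noteq> (n, m)" "z = (\<lambda>w. (Q ^^ j) ((P ^^ i) w))"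
      then show ?thesis using subwordsI[of "Suc j" "Suc n" i m Q P] by simp
    qed
  qed
qed

text \<open>Here \<open>c\<close> is the scalar commutator of \<open>P\<close> and \<open>Q\<close>.
  At \<open>n = 0\<close> the truncated exponent \<open>n - 1\<close> is harmless, since its
  coefficient vanishes.\<close>

lemma commute_power:
  assumes "linear Q" "\<And>w. P (Q w) = Q (P w) + c *\<^sub>R w"
  shows "P ((Q ^^ n) w) = (Q ^^ n) (P w) + (real n * c) *\<^sub>R (Q ^^ (n - 1)) w"
proof (induction n)
  case (Suc n)
  have "P ((Q ^^ Suc n) w) = Q (P ((Q ^^ n) w)) + c *\<^sub>R (Q ^^ n) w"
    using assms(2) by simp
  also have "\<dots> = (Q ^^ Suc n) (P w) + (real n * c) *\<^sub>R (Q ((Q ^^ (n - 1)) w)) + c *\<^sub>R (Q ^^ n) w"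
    using Suc by (simp add: linear_add[OF assms(1)] linear_scale[OF assms(1)])
  also have "(real n * c) *\<^sub>R (Q ((Q ^^ (n - 1)) w)) = (real n * c) *\<^sub>R (Q ^^ n) w"
    by (cases n) auto
  finally show ?case by (simp add: algebra_simps)
qed simp

text \<open>Each exchange of neighbouring letters costs a scalar and removes one \<open>P\<close>
  and one \<open>Q\<close>, so both exponents of every correction drop strictly. The drop in the
  exponent of \<open>Q\<close> feeds the induction of \<open>mixed_negligible\<close>. The parameter
  has type \<open>unit\<close> because a single operator is meant, not a family.\<close>

lemma reorder_word:
  fixes P Q :: "'v::real_normed_vector \<Rightarrow> 'v"
  assumes "linear P" "linear Q" "\<And>w. P (Q w) = Q (P w) + c *\<^sub>R w"
  shows "lower_order {P, Q} ((\<lambda>(j, i) w. (Q ^^ j) ((P ^^ i) w)) ` ({..<n} \<times> {..<m}))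
     (\<lambda>(p::unit) w. (P ^^ m) ((Q ^^ n) w) - (Q ^^ n) ((P ^^ m) w))"
proof (induction m)
  case 0
  show ?case by (simp add: lower_order.zero)
next
  case (Suc m)
  have lin: "\<And>A. A \<in> {P, Q} \<Longrightarrow> linear A" using assms by auto
  let ?Z = "\<lambda>m. (\<lambda>(j, i) w. (Q ^^ j) ((P ^^ i) w)) ` ({..<n} \<times> {..<m})"
  have mem: "(\<lambda>w. (Q ^^ j) ((P ^^ i) w)) \<in> ?Z k" if "j < n" "i < k" for j i k
    using that by (intro image_eqI[of _ _ "(j, i)"]) auto
  have PQ: "P ((Q ^^ j) ((P ^^ i) w)) = (Q ^^ j) ((P ^^ Suc i) w) + (real j * c) *\<^sub>R (Q ^^ (j - 1)) ((P ^^ i) w)"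
    for j i w
    using commute_power[OF assms(2,3), of j "(P ^^ i) w"] by simp
  have 1: "lower_order {P, Q} (?Z (Suc m)) (\<lambda>(p::unit) w. P ((P ^^ m) ((Q ^^ n) w) - (Q ^^ n) ((P ^^ m) w)))"
  proof (rule lower_order_left[OF Suc])
    fix z assume "z \<in> ?Z m"
    then obtain j i where ji: "j < n" "i < m" "z = (\<lambda>w. (Q ^^ j) ((P ^^ i) w))" by auto
    show "lower_order {P, Q} (?Z (Suc m)) (\<lambda>(p::unit) w. P (z w))"
      unfolding ji(3) PQ
      using ji by (intro lower_order.add lower_order_scaled_mem[OF lin mem] lower_order_mem[OF lin mem]) auto
  qed (use assms in \<open>auto intro: less_SucI\<close>)
  have 2: "lower_order {P, Q} (?Z (Suc m)) (\<lambda>(p::unit) w. (real n * c) *\<^sub>R (Q ^^ (n - 1)) ((P ^^ m) w))"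
  proof (cases n)
    case 0
    then show ?thesis by (simp add: lower_order.zero)
  next
    case (Suc n')
    then show ?thesis by (intro lower_order_scaled_mem[OF lin mem]) auto
  qed
  have "(\<lambda>(p::unit) w. (P ^^ Suc m) ((Q ^^ n) w) - (Q ^^ n) ((P ^^ Suc m) w)) =
    (\<lambda>p w. P ((P ^^ m) ((Q ^^ n) w) - (Q ^^ n) ((P ^^ m) w)) + (real n * c) *\<^sub>R (Q ^^ (n - 1)) ((P ^^ m) w))"
    using PQ[of n m] by (auto simp: linear_diff[OF assms(1)])
  then show ?case using lower_order.add[OF 1 2] by simp
qed

section \<open>The Garding inequality for a canonical pair\<close>

text \<open>With \<open>a\<close>, \<open>c\<close>, \<open>b\<close> consecutive terms, c^2 <= a b
  gives c <= e b / 2 + a / (2 e); inserting the bound for \<open>a\<close> from the induction leaves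
  c / 2 on the right, which is absorbed. \<open>C\<close> is chosen before \<open>t\<close>, so one
  constant later serves all vectors.\<close>

lemma log_convex_step:
  assumes "0 < e"
  shows "\<exists>C\<ge>0. \<forall>t :: nat \<Rightarrow> real. (\<forall>i. 0 \<le> t i) \<longrightarrow> (\<forall>i. i + 2 \<le> Suc k \<longrightarrow> (t (i + 1))\<^sup>2 \<le> t i * t (i + 2))
    \<longrightarrow> t k \<le> e * t (Suc k) + C * t 0"
proof (induction k)
  case 0
  show ?case using assms by (intro exI[of _ 1]) auto
next
  case (Suc k)
  then obtain C where C: "C \<ge> 0" and C': "\<And>t :: nat \<Rightarrow> real. (\<forall>i. 0 \<le> t i) \<Longrightarrow>
      (\<forall>i. i + 2 \<le> Suc k \<longrightarrow> (t (i + 1))\<^sup>2 \<le> t i * t (i + 2)) \<Longrightarrow> t k \<le> e * t (Suc k) + C * t 0"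
    by blast
  show ?case
  proof (rule exI[of _ "C / e"], intro conjI allI impI)
    fix t :: "nat \<Rightarrow> real"
    assume pos: "\<forall>i. 0 \<le> t i" and conv: "\<forall>i. i + 2 \<le> Suc (Suc k) \<longrightarrow> (t (i + 1))\<^sup>2 \<le> t i * t (i + 2)"
    define a b c where "a = t k" and "b = t (Suc (Suc k))" and "c = t (Suc k)"
    have nn: "a \<ge> 0" "b \<ge> 0" "c \<ge> 0" using pos by (auto simp: a_def b_def c_def)
    have "c\<^sup>2 \<le> a * b" using conv[rule_format, of k] by (simp add: a_def b_def c_def)
    also have "a * b \<le> (e / 2 * b + a / (2 * e))\<^sup>2"
    proof -
      have "(e / 2 * b + a / (2 * e))\<^sup>2 - a * b = (e / 2 * b - a / (2 * e))\<^sup>2"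
        using assms by (simp add: power2_eq_square field_simps)
      then show ?thesis by (metis diff_ge_0_iff_ge zero_le_power2)
    qed
    finally have "c \<le> e / 2 * b + a / (2 * e)"
      by (rule power2_le_imp_le) (use nn assms in auto)
    moreover have "a \<le> e * c + C * t 0" using C'[OF pos] conv by (simp add: a_def c_def)
    then have "a / (2 * e) \<le> c / 2 + C * t 0 / (2 * e)"
      using assms by (simp add: field_simps)
    moreover have "C * t 0 / (2 * e) = (C / e * t 0) / 2" using assms by (simp add: field_simps)
    moreover have "c \<le> x + D" if "c \<le> x / 2 + A" "A \<le> c / 2 + D / 2" for x A D :: real
      using that by linarith
    ultimately have "c \<le> e * b + C / e * t 0" by simp
    then show "t (Suc k) \<le> e * t (Suc (Suc k)) + C / e * t 0" by (simp add: b_def c_def)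
  qed (use C assms in auto)
qed

text \<open>Climbing from \<open>k\<close> to \<open>Suc k\<close> only needs the crude factor 1 in
  front of \<open>t (Suc k)\<close>, because \<open>t k\<close> already carries the factor
  \<open>e\<close>.\<close>

lemma log_convex_interpolation:
  assumes "0 < e" "j < k"
  shows "\<exists>C\<ge>0. \<forall>t :: nat \<Rightarrow> real. (\<forall>i. 0 \<le> t i) \<longrightarrow> (\<forall>i. i + 2 \<le> k \<longrightarrow> (t (i + 1))\<^sup>2 \<le> t i * t (i + 2))
    \<longrightarrow> t j \<le> e * t k + C * t 0"
proof -
  from assms(2) have "Suc j \<le> k" by simp
  then show ?thesis
  proof (induction k rule: dec_induct)
    case base
    show ?case by (rule log_convex_step[OF assms(1)])
  next
    case (step k)
    obtain C where C: "C \<ge> 0" and C': "\<And>t :: nat \<Rightarrow> real. (\<forall>i. 0 \<le> t i) \<Longrightarrow>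
      (\<forall>i. i + 2 \<le> k \<longrightarrow> (t (i + 1))\<^sup>2 \<le> t i * t (i + 2)) \<Longrightarrow> t j \<le> e * t k + C * t 0"
      using step.IH by blast
    obtain D where D: "D \<ge> 0" and D': "\<And>t :: nat \<Rightarrow> real. (\<forall>i. 0 \<le> t i) \<Longrightarrow>
      (\<forall>i. i + 2 \<le> Suc k \<longrightarrow> (t (i + 1))\<^sup>2 \<le> t i * t (i + 2)) \<Longrightarrow> t k \<le> 1 * t (Suc k) + D * t 0"
      using log_convex_step[of 1 k] by auto
    show ?case
    proof (rule exI[of _ "e * D + C"], intro conjI allI impI)
      fix t :: "nat \<Rightarrow> real"
      assume pos: "\<forall>i. 0 \<le> t i" and conv: "\<forall>i. i + 2 \<le> Suc k \<longrightarrow> (t (i + 1))\<^sup>2 \<le> t i * t (i + 2)"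
      have "t j \<le> e * t k + C * t 0" by (rule C'[OF pos]) (use conv in auto)
      moreover have "e * t k \<le> e * (t (Suc k) + D * t 0)"
        using D'[OF pos conv] assms by (intro mult_left_mono) auto
      ultimately show "t j \<le> e * t (Suc k) + (e * D + C) * t 0" by (simp add: algebra_simps)
    qed (use C D assms in auto)
  qed
qed

text \<open>The sign \<open>s\<close> treats \<open>X\<close> (s = 1) and \<open>R\<close> (s = -1)
  at once.\<close>

definition self_or_skew_adjoint :: "('v::real_inner \<Rightarrow> 'v) \<Rightarrow> bool" where
  "self_or_skew_adjoint Z \<longleftrightarrow> (\<exists>s. \<bar>s\<bar> = 1 \<and> (\<forall>f g. inner (Z f) g = s * inner f (Z g)))"

text \<open>One \<open>Z\<close> is moved across the inner product, then Cauchy-Schwarz applies; the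
  sign is lost in the absolute value.\<close>

lemma norm_power_log_convex:
  assumes "self_or_skew_adjoint Z"
  shows "(norm ((Z ^^ Suc i) w))\<^sup>2 \<le> norm ((Z ^^ i) w) * norm ((Z ^^ Suc (Suc i)) w)"
proof -
  let ?x = "(Z ^^ i) w"
  obtain s where s: "\<bar>s\<bar> = 1" "\<And>f g. inner (Z f) g = s * inner f (Z g)"
    using assms by (auto simp: self_or_skew_adjoint_def)
  have "(norm (Z ?x))\<^sup>2 = s * inner ?x (Z (Z ?x))"
    using s(2)[of ?x "Z ?x"] by (simp add: power2_norm_eq_inner)
  also have "\<dots> \<le> \<bar>s\<bar> * \<bar>inner ?x (Z (Z ?x))\<bar>" by (metis abs_ge_self abs_mult)
  also have "\<dots> \<le> norm ?x * norm (Z (Z ?x))" using s(1) by (simp add: Cauchy_Schwarz_ineq2)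
  finally show ?thesis by simp
qed

lemma interpolate_powers:
  assumes "self_or_skew_adjoint Z" "0 < e" "j < k"
  shows "\<exists>C\<ge>0. \<forall>w. norm ((Z ^^ j) w) \<le> e * norm ((Z ^^ k) w) + C * norm w"
proof -
  obtain C where C: "C \<ge> 0" and C': "\<And>t :: nat \<Rightarrow> real. (\<forall>i. 0 \<le> t i) \<Longrightarrow>
    (\<forall>i. i + 2 \<le> k \<longrightarrow> (t (i + 1))\<^sup>2 \<le> t i * t (i + 2)) \<Longrightarrow> t j \<le> e * t k + C * t 0"
    using log_convex_interpolation[OF assms(2,3)] by blast
  have "norm ((Z ^^ j) w) \<le> e * norm ((Z ^^ k) w) + C * norm w" for w
    using C'[of "\<lambda>i. norm ((Z ^^ i) w)"] norm_power_log_convex[OF assms(1), of _ w] by simp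
  then show ?thesis using C by blast
qed

text \<open>The sequence of norms read backwards from \<open>k\<close> is log-convex as well, and
  interpolating it puts the small factor on \<open>norm w\<close> instead of the top power.
  Coercivity needs this form: there \<open>norm w\<close> is absorbed by the uncertainty
  inequality.\<close>

lemma interpolate_first_power:
  assumes "self_or_skew_adjoint Z" "0 < e" "0 < k"
  shows "\<exists>C\<ge>0. \<forall>w. norm (Z w) \<le> e * norm w + C * norm ((Z ^^ k) w)"
proof -
  obtain C where C: "C \<ge> 0" and C': "\<And>t :: nat \<Rightarrow> real. (\<forall>i. 0 \<le> t i) \<Longrightarrow>
    (\<forall>i. i + 2 \<le> k \<longrightarrow> (t (i + 1))\<^sup>2 \<le> t i * t (i + 2)) \<Longrightarrow> t (k - 1) \<le> e * t k + C * t 0"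
    using log_convex_interpolation[OF assms(2), of "k - 1" k] assms(3) by auto
  have "norm (Z w) \<le> e * norm w + C * norm ((Z ^^ k) w)" for w
  proof -
    have "(norm ((Z ^^ (k - (i + 1))) w))\<^sup>2 \<le> norm ((Z ^^ (k - i)) w) * norm ((Z ^^ (k - (i + 2))) w)"
      if "i + 2 \<le> k" for i
    proof -
      have "k - (i + 1) = Suc (k - (i + 2))" "k - i = Suc (Suc (k - (i + 2)))" using that by auto
      then show ?thesis using norm_power_log_convex[OF assms(1), of "k - (i + 2)" w]
        by (metis mult.commute)
    qed
    then have "norm ((Z ^^ (k - (k - 1))) w) \<le> e * norm ((Z ^^ (k - k)) w) + C * norm ((Z ^^ (k - 0)) w)"
      by (intro C') auto
    moreover have "k - (k - 1) = 1" using assms(3) by auto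
    ultimately show ?thesis by simp
  qed
  then show ?thesis using C by blast
qed

text \<open>Relative bound zero in the sense of Kato, with \<open>norm\<close> as reference;
  \<open>dominated_by\<close> is plain relative boundedness. Positivity of \<open>en\<close> is part
  of the notion so that most closure rules carry no side condition.\<close>

definition negligible_wrt :: "('v::real_normed_vector \<Rightarrow> real) \<Rightarrow> ('v \<Rightarrow> real) \<Rightarrow> bool" where
  "negligible_wrt en \<Phi> \<longleftrightarrow>
    (\<forall>w. 0 \<le> en w) \<and> (\<forall>e>0. \<exists>C\<ge>0. \<forall>w. \<Phi> w \<le> e * en w + C * norm w)"

definition dominated_by :: "('v::real_normed_vector \<Rightarrow> real) \<Rightarrow> ('v \<Rightarrow> real) \<Rightarrow> bool" where
  "dominated_by en \<Phi> \<longleftrightarrow> (\<exists>C\<ge>0. \<forall>w. \<Phi> w \<le> C * en w + C * norm w)"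

lemma negligible_wrtD:
  assumes "negligible_wrt en \<Phi>" "0 < e"
  obtains C where "C \<ge> 0" "\<And>w. \<Phi> w \<le> e * en w + C * norm w"
  using assms unfolding negligible_wrt_def by blast

lemma negligible_wrt_mono: "negligible_wrt en \<Psi> \<Longrightarrow> (\<And>w. \<Phi> w \<le> \<Psi> w) \<Longrightarrow> negligible_wrt en \<Phi>"
  unfolding negligible_wrt_def by (meson order_trans)

lemma negligible_wrt_add:
  assumes "negligible_wrt en \<Phi>" "negligible_wrt en \<Psi>"
  shows "negligible_wrt en (\<lambda>w. \<Phi> w + \<Psi> w)"
  unfolding negligible_wrt_def
proof (intro conjI allI impI)
  show "0 \<le> en w" for w using assms(1) by (simp add: negligible_wrt_def)
  fix e :: real assume "0 < e"
  then have "0 < e / 2" by simp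
  obtain C D where "C \<ge> 0" "\<And>w. \<Phi> w \<le> e / 2 * en w + C * norm w" "D \<ge> 0" "\<And>w. \<Psi> w \<le> e / 2 * en w + D * norm w"
    by (metis negligible_wrtD[OF assms(1) \<open>0 < e / 2\<close>] negligible_wrtD[OF assms(2) \<open>0 < e / 2\<close>])
  then have "\<Phi> w + \<Psi> w \<le> e * en w + (C + D) * norm w" for w
    using add_mono[of "\<Phi> w" "e / 2 * en w + C * norm w" "\<Psi> w" "e / 2 * en w + D * norm w"]
    by (simp add: algebra_simps)
  then show "\<exists>C\<ge>0. \<forall>w. \<Phi> w + \<Psi> w \<le> e * en w + C * norm w"
    using \<open>C \<ge> 0\<close> \<open>D \<ge> 0\<close> by (intro exI[of _ "C + D"]) auto
qed

lemma negligible_wrt_zero: "(\<And>w. 0 \<le> en w) \<Longrightarrow> negligible_wrt en (\<lambda>w. 0)"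
  unfolding negligible_wrt_def by (auto intro!: exI[of _ 0])

lemma negligible_wrt_scale:
  assumes "negligible_wrt en \<Phi>" "0 \<le> c"
  shows "negligible_wrt en (\<lambda>w. c * \<Phi> w)"
proof (cases "c = 0")
  case True
  then show ?thesis using assms(1) negligible_wrt_zero[of en] by (simp add: negligible_wrt_def)
next
  case False
  then have c: "c > 0" using assms(2) by simp
  have "\<exists>C\<ge>0. \<forall>w. c * \<Phi> w \<le> e * en w + C * norm w" if e: "0 < e" for e
  proof -
    obtain C where C: "C \<ge> 0" "\<And>w. \<Phi> w \<le> e / c * en w + C * norm w"
      using negligible_wrtD[OF assms(1), of "e / c"] e c by auto
    have "c * (e / c * en w + C * norm w) = e * en w + (c * C) * norm w" for w
      using c by (simp add: field_simps)
    then have "c * \<Phi> w \<le> e * en w + (c * C) * norm w" for w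
      using mult_left_mono[OF C(2)[of w], of c] c by simp
    then show ?thesis using C(1) c by (intro exI[of _ "c * C"]) auto
  qed
  then show ?thesis using assms(1) by (simp add: negligible_wrt_def)
qed

lemma negligible_wrt_sum:
  assumes "\<And>w. 0 \<le> en w" "finite Z" "\<And>z. z \<in> Z \<Longrightarrow> negligible_wrt en (\<Phi> z)"
  shows "negligible_wrt en (\<lambda>w. \<Sum>z\<in>Z. \<Phi> z w)"
  using assms(2,3)
  by (induction Z) (auto intro: negligible_wrt_zero assms(1) negligible_wrt_add)

lemma negligible_imp_dominated: "negligible_wrt en \<Phi> \<Longrightarrow> dominated_by en \<Phi>"
proof -
  assume n: "negligible_wrt en \<Phi>"
  then have pos: "\<And>w. 0 \<le> en w" by (simp add: negligible_wrt_def)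
  obtain C where C: "C \<ge> 0" "\<And>w. \<Phi> w \<le> 1 * en w + C * norm w"
    using negligible_wrtD[OF n zero_less_one] by blast
  have "\<Phi> w \<le> (C + 1) * en w + (C + 1) * norm w" for w
  proof -
    have "0 \<le> C * en w" using pos[of w] C(1) by simp
    then show ?thesis using C(2)[of w] norm_ge_zero[of w] unfolding distrib_right mult_1 by linarith
  qed
  then show ?thesis unfolding dominated_by_def using C(1) by (intro exI[of _ "C + 1"]) auto
qed

lemma dominated_by_mono: "dominated_by en \<Psi> \<Longrightarrow> (\<And>w. \<Phi> w \<le> \<Psi> w) \<Longrightarrow> dominated_by en \<Phi>"
  unfolding dominated_by_def by (meson order_trans)

lemma dominated_by_add:
  assumes "dominated_by en \<Phi>" "dominated_by en \<Psi>"
  shows "dominated_by en (\<lambda>w. \<Phi> w + \<Psi> w)"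
proof -
  obtain C D where C: "C \<ge> 0" "\<And>w. \<Phi> w \<le> C * en w + C * norm w"
    and D: "D \<ge> 0" "\<And>w. \<Psi> w \<le> D * en w + D * norm w"
    using assms unfolding dominated_by_def by blast
  have "\<Phi> w + \<Psi> w \<le> (C + D) * en w + (C + D) * norm w" for w
    using add_mono[OF C(2)[of w] D(2)[of w]] by (simp add: algebra_simps)
  then show ?thesis unfolding dominated_by_def using C(1) D(1) by (intro exI[of _ "C + D"]) auto
qed

text \<open>The order of choices matters: the small factor is fixed first, against the domination
  constant \<open>D\<close>; the constant \<open>C\<close> that it produces is then beaten by the
  negligibility of \<Theta>.\<close>

lemma negligible_wrt_interpolate:
  assumes interp: "\<And>e. 0 < e \<Longrightarrow> \<exists>C\<ge>0. \<forall>w. \<Phi> w \<le> e * \<Psi> w + C * \<Theta> w"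
    and dom: "dominated_by en \<Psi>" and neg: "negligible_wrt en \<Theta>"
  shows "negligible_wrt en \<Phi>"
proof -
  have pos: "\<And>w. 0 \<le> en w" using neg by (simp add: negligible_wrt_def)
  obtain D where D: "D \<ge> 0" "\<And>w. \<Psi> w \<le> D * en w + D * norm w"
    using dom unfolding dominated_by_def by blast
  have "\<exists>C\<ge>0. \<forall>w. \<Phi> w \<le> e * en w + C * norm w" if e: "0 < e" for e
  proof -
    define d where "d = e / (2 * (D + 1))"
    have d: "0 < d" using e D(1) by (simp add: d_def)
    have dD: "d * D \<le> e / 2" using e D(1) by (simp add: d_def field_simps)
    obtain C where C: "C \<ge> 0" "\<And>w. \<Phi> w \<le> d * \<Psi> w + C * \<Theta> w" using interp[OF d] by blast
    obtain B where B: "B \<ge> 0" "\<And>w. C * \<Theta> w \<le> e / 2 * en w + B * norm w"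
      using negligible_wrtD[OF negligible_wrt_scale[OF neg C(1)], of "e / 2"] e by auto
    have "\<Phi> w \<le> e * en w + (e / 2 + B) * norm w" for w
    proof -
      have "\<Phi> w \<le> d * (D * en w + D * norm w) + (e / 2 * en w + B * norm w)"
        using C(2)[of w] B(2)[of w] mult_left_mono[OF D(2)[of w], of d] d by linarith
      also have "\<dots> = (d * D) * en w + (d * D) * norm w + e / 2 * en w + B * norm w"
        by (simp add: algebra_simps)
      also have "\<dots> \<le> e / 2 * en w + e / 2 * norm w + e / 2 * en w + B * norm w"
        by (intro add_mono mult_right_mono dD pos norm_ge_zero order_refl)
      finally show ?thesis by (simp add: algebra_simps)
    qed
    then show ?thesis using e B(1) by (intro exI[of _ "e / 2 + B"]) auto
  qed
  then show ?thesis using pos by (simp add: negligible_wrt_def)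
qed

text \<open>One letter is lowered at a time. With \<open>P\<close> at full power, \<open>Q\<close>
  is interpolated between Q^n P^m (dominated) and P^m (negligible); then, with \<open>Q\<close> at
  power \<open>j\<close>, \<open>P\<close> is interpolated between P^m Q^j and Q^j. The second move
  needs the letters in the opposite order, and the reordering corrections have a smaller exponent of
  \<open>Q\<close>, whence the strong induction on \<open>j\<close>.\<close>

lemma mixed_negligible:
  fixes P Q :: "'v::real_inner \<Rightarrow> 'v"
  assumes lin: "linear P" "linear Q" and PQ: "\<And>w. P (Q w) = Q (P w) + c *\<^sub>R w"
    and adj: "self_or_skew_adjoint P" "self_or_skew_adjoint Q"
    and dom: "dominated_by en (\<lambda>w. norm ((Q ^^ n) ((P ^^ m) w)))"
    and negP: "\<And>i. i \<le> m \<Longrightarrow> negligible_wrt en (\<lambda>w. norm ((P ^^ i) w))"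
    and negQ: "\<And>j. j \<le> n \<Longrightarrow> negligible_wrt en (\<lambda>w. norm ((Q ^^ j) w))"
  shows "j \<le> n \<Longrightarrow> i \<le> m \<Longrightarrow> (j, i) \<noteq> (n, m) \<Longrightarrow> negligible_wrt en (\<lambda>w. norm ((Q ^^ j) ((P ^^ i) w)))"
proof (induction j arbitrary: i rule: less_induct)
  case (less j)
  have pos: "\<And>w. 0 \<le> en w" using negP[of 0] by (simp add: negligible_wrt_def)
  have reorder: "negligible_wrt en (\<lambda>w. norm ((P ^^ i) ((Q ^^ j) w) - (Q ^^ j) ((P ^^ i) w)))"
    if "i \<le> m" for i
  proof -
    let ?Z = "(\<lambda>(j, i) w. (Q ^^ j) ((P ^^ i) w)) ` ({..<j} \<times> {..<i})"
    obtain C where C: "C \<ge> 0" "\<And>w. norm ((P ^^ i) ((Q ^^ j) w) - (Q ^^ j) ((P ^^ i) w)) \<le> C * (\<Sum>z\<in>?Z. norm (z w))"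
      using lower_order_norm[OF reorder_word[OF lin PQ, of j i]] by auto
    have "negligible_wrt en (\<lambda>w. \<Sum>z\<in>?Z. norm (z w))"
      using less.prems that by (intro negligible_wrt_sum pos) (auto intro!: less.IH)
    then show ?thesis by (rule negligible_wrt_mono[OF negligible_wrt_scale[OF _ C(1)] C(2)])
  qed
  have top: "negligible_wrt en (\<lambda>w. norm ((Q ^^ j) ((P ^^ m) w)))" if "j < n"
  proof (rule negligible_wrt_interpolate[OF _ dom negP[OF order_refl]])
    fix e :: real assume "0 < e"
    from interpolate_powers[OF adj(2) this that]
    show "\<exists>C\<ge>0. \<forall>w. norm ((Q ^^ j) ((P ^^ m) w)) \<le> e * norm ((Q ^^ n) ((P ^^ m) w)) + C * norm ((P ^^ m) w)"
      by blast
  qed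
  then have dom': "dominated_by en (\<lambda>w. norm ((Q ^^ j) ((P ^^ m) w)))"
    using negligible_imp_dominated dom less.prems(1) by (cases "j = n") auto
  have dom'': "dominated_by en (\<lambda>w. norm ((P ^^ m) ((Q ^^ j) w)))"
    by (rule dominated_by_mono[OF dominated_by_add[OF dom' negligible_imp_dominated[OF reorder[OF order_refl]]]])
      (metis add.commute diff_add_cancel norm_triangle_ineq)
  show ?case
  proof (cases "i = m")
    case True
    then show ?thesis using top less.prems by auto
  next
    case False
    then have "i < m" using less.prems by simp
    have "negligible_wrt en (\<lambda>w. norm ((P ^^ i) ((Q ^^ j) w)))"
    proof (rule negligible_wrt_interpolate[OF _ dom'' negQ[OF less.prems(1)]])
      fix e :: real assume "0 < e"
      from interpolate_powers[OF adj(1) this \<open>i < m\<close>]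
      show "\<exists>C\<ge>0. \<forall>w. norm ((P ^^ i) ((Q ^^ j) w)) \<le> e * norm ((P ^^ m) ((Q ^^ j) w)) + C * norm ((Q ^^ j) w)"
        by blast
    qed
    from negligible_wrt_add[OF this reorder[OF less.prems(2)]] show ?thesis
      by (rule negligible_wrt_mono) (metis norm_minus_commute norm_triangle_sub)
  qed
qed

text \<open>Writing x1 = y + u and x2 = y + v, the cross terms are products of \<open>y\<close> with
  negligible quantities and the last term is quadratic in them. Negligibility is requested for c > 0
  only: a term with coefficient zero contributes nothing to the energy that could dominate its
  subwords.\<close>

lemma perturbed_term:
  fixes x1 x2 :: "'p \<Rightarrow> 'v::real_inner \<Rightarrow> 'v"
  assumes c: "0 \<le> c" and e: "0 < e" and y: "\<And>w. c * (norm (y w))\<^sup>2 \<le> (en w)\<^sup>2"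
    and neg: "0 < c \<Longrightarrow> negligible_wrt en S"
    and x1: "\<And>p w. norm (x1 p w - y w) \<le> S w" and x2: "\<And>p w. norm (x2 p w - y w) \<le> S w"
  shows "\<exists>C. \<forall>p w. c * inner (x1 p w) (x2 p w) \<ge> c * (norm (y w))\<^sup>2 - e * (en w)\<^sup>2 - C * (norm w)\<^sup>2"
proof (cases "c = 0")
  case True
  then show ?thesis using e by (intro exI[of _ 0]) auto
next
  case False
  with c have c: "c > 0" by simp
  have pos: "\<And>w. 0 \<le> en w" using neg[OF c] by (simp add: negligible_wrt_def)
  define s where "s = sqrt c"
  have s: "s > 0" "s\<^sup>2 = c" using c by (auto simp: s_def)
  \<comment> \<open>Chosen so that the multiples of (en w)^2 caused by \<open>d\<close> add up to at
    most e / 2, as recorded in \<open>d2\<close>; the other half of \<open>e\<close> pays for the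
    mixed products of \<open>en w\<close> and \<open>norm w\<close>.\<close>
  define d where "d = min 1 (e / (2 * (2 * s + 2 * c)))"
  have d: "0 < d" "d \<le> 1" "d \<le> e / (2 * (2 * s + 2 * c))" using e s c by (auto simp: d_def)
  have d2: "2 * s * d + 2 * c * d\<^sup>2 \<le> e / 2"
  proof -
    have "d\<^sup>2 \<le> d" using d by (simp add: power2_eq_square mult_le_cancel_left1)
    then have "2 * s * d + 2 * c * d\<^sup>2 \<le> (2 * s + 2 * c) * d"
      using c by (simp add: algebra_simps)
    also have "\<dots> \<le> (2 * s + 2 * c) * (e / (2 * (2 * s + 2 * c)))"
      using d s c by (intro mult_left_mono) auto
    also have "\<dots> = e / 2" using s c by (simp add: field_simps)
    finally show ?thesis .
  qed
  obtain D where D: "D \<ge> 0" "\<And>w. S w \<le> d * en w + D * norm w"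
    using negligible_wrtD[OF neg[OF c] d(1)] by blast
  show ?thesis
  proof (intro exI allI)
    fix p w
    define T Y where "T = d * en w + D * norm w" and "Y = norm (y w)"
    define u v where "u = x1 p w - y w" and "v = x2 p w - y w"
    have T0: "T \<ge> 0" using pos[of w] d D by (simp add: T_def)
    have u: "norm u \<le> T" and v: "norm v \<le> T"
      using x1[of p w] x2[of p w] D(2)[of w] by (auto simp: u_def v_def T_def)
    have "inner (x1 p w) (x2 p w) = Y\<^sup>2 + inner (y w) v + inner u (y w) + inner u v"
      by (simp add: u_def v_def Y_def power2_norm_eq_inner inner_diff_left inner_diff_right inner_commute)
    moreover have "\<bar>inner (y w) v\<bar> \<le> Y * T"
      by (rule order_trans[OF Cauchy_Schwarz_ineq2]) (auto simp: Y_def intro: mult_left_mono v)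
    moreover have "\<bar>inner u (y w)\<bar> \<le> Y * T"
      by (rule order_trans[OF Cauchy_Schwarz_ineq2]) (auto simp: Y_def mult.commute[of _ T] intro: mult_right_mono u)
    moreover have "\<bar>inner u v\<bar> \<le> T\<^sup>2"
      unfolding power2_eq_square
      by (rule order_trans[OF Cauchy_Schwarz_ineq2]) (auto intro: mult_mono u v T0)
    ultimately have "inner (x1 p w) (x2 p w) \<ge> Y\<^sup>2 - 2 * (Y * T) - T\<^sup>2" by linarith
    then have "c * (Y\<^sup>2 - 2 * (Y * T) - T\<^sup>2) \<le> c * inner (x1 p w) (x2 p w)"
      using c by (intro mult_left_mono) auto
    moreover have "c * (Y * T) \<le> s * en w * T"
    proof -
      have "s * Y \<le> en w"
      proof (rule power2_le_imp_le[OF _ pos])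
        show "(s * Y)\<^sup>2 \<le> (en w)\<^sup>2" using y[of w] s by (simp add: power_mult_distrib Y_def)
      qed
      then have "s * (s * Y) * T \<le> s * en w * T" using s T0 by (intro mult_right_mono mult_left_mono) auto
      then show ?thesis unfolding s(2)[symmetric] power2_eq_square by (simp only: mult.assoc)
    qed
    moreover have "s * en w * T \<le> s * d * (en w)\<^sup>2 + e / 4 * (en w)\<^sup>2 + (s\<^sup>2 * D\<^sup>2 / e) * (norm w)\<^sup>2"
    proof -
      \<comment> \<open>The two squares are balanced so that the product term is exactly s * D * en
        w * norm w.\<close>
      have "0 \<le> (sqrt e / 2 * en w - s * D / sqrt e * norm w)\<^sup>2" by simp
      also have "\<dots> = e / 4 * (en w)\<^sup>2 + (s\<^sup>2 * D\<^sup>2 / e) * (norm w)\<^sup>2 - s * D * en w * norm w"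
        using e by (simp add: power2_diff power_mult_distrib power_divide field_simps)
      finally show ?thesis by (simp add: T_def algebra_simps power2_eq_square)
    qed
    moreover have "c * T\<^sup>2 \<le> 2 * c * d\<^sup>2 * (en w)\<^sup>2 + 2 * c * D\<^sup>2 * (norm w)\<^sup>2"
    proof -
      have "T\<^sup>2 \<le> 2 * (d * en w)\<^sup>2 + 2 * (D * norm w)\<^sup>2"
        unfolding T_def using zero_le_power2[of "d * en w - D * norm w"]
        by (simp add: power2_sum power2_diff)
      from mult_left_mono[OF this, of c] show ?thesis using c by (simp add: power_mult_distrib algebra_simps)
    qed
    moreover have "(2 * s * d + 2 * c * d\<^sup>2) * (en w)\<^sup>2 \<le> e / 2 * (en w)\<^sup>2"
      by (rule mult_right_mono[OF d2]) simp
    ultimately show "c * inner (x1 p w) (x2 p w)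
      \<ge> c * (norm (y w))\<^sup>2 - e * (en w)\<^sup>2 - (2 * (s\<^sup>2 * D\<^sup>2 / e) + 2 * c * D\<^sup>2) * (norm w)\<^sup>2"
      unfolding Y_def[symmetric] by (simp add: algebra_simps)
  qed
qed

text \<open>The model is multiplication and differentiation on the line, with \<open>R\<close> as
  the derivative. A bare inner product space with operators acting everywhere fits finite sequences
  and avoids all domain questions.\<close>

locale canonical_pair =
  fixes X R :: "'v::real_inner \<Rightarrow> 'v"
  assumes linear_X: "linear X" and linear_R: "linear R"
    and X_adjoint: "inner (X f) g = inner f (X g)"
    and R_adjoint: "inner (R f) g = - inner f (R g)"
    and X_R: "X (R w) = R (X w) - w"
begin

lemma adj_X: "self_or_skew_adjoint X"
  unfolding self_or_skew_adjoint_def by (intro exI[of _ 1]) (simp add: X_adjoint)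

lemma adj_R: "self_or_skew_adjoint R"
  unfolding self_or_skew_adjoint_def by (intro exI[of _ "- 1"]) (simp add: R_adjoint)

text \<open>The uncertainty inequality: |w|^2 is the expectation of the commutator R X - X R, which
  equals -2 <X w, R w>.\<close>

lemma norm_le_X_R: "(norm w)\<^sup>2 \<le> (norm (X w))\<^sup>2 + (norm (R w))\<^sup>2"
proof -
  have "(norm w)\<^sup>2 = inner (R (X w)) w - inner (X (R w)) w"
    by (simp add: X_R inner_diff_left power2_norm_eq_inner)
  also have "\<dots> = - 2 * inner (X w) (R w)"
    using X_adjoint[of "R w" w] R_adjoint[of "X w" w] inner_commute[of "R w" "X w"] by linarith
  also have "\<dots> \<le> 2 * (norm (X w) * norm (R w))"
    using abs_le_D2[OF Cauchy_Schwarz_ineq2[of "X w" "R w"]] by linarith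
  also have "\<dots> \<le> (norm (X w))\<^sup>2 + (norm (R w))\<^sup>2"
    using sum_squares_bound[of "norm (X w)" "norm (R w)"] by linarith
  finally show ?thesis .
qed

definition energy :: "nat \<Rightarrow> nat \<Rightarrow> nat \<Rightarrow> nat \<Rightarrow> real \<Rightarrow> real \<Rightarrow> real \<Rightarrow> real \<Rightarrow> 'v \<Rightarrow> real" where
  "energy h k m n lam mu nu sg w =
     lam * (norm ((X ^^ h) w))\<^sup>2 + mu * (norm ((R ^^ n) ((X ^^ m) w)))\<^sup>2
   + nu * (norm ((X ^^ m) ((R ^^ n) w)))\<^sup>2 + sg * (norm ((R ^^ k) w))\<^sup>2"

text \<open>A conjugated operator is no longer symmetric, so moving letters across the inner product
  replaces \<open>X1\<close>, \<open>R1\<close> by different perturbations \<open>X2\<close>,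
  \<open>R2\<close>. Without perturbations the form is \<open>energy\<close>.\<close>

definition perturbed_form where
  "perturbed_form h k m n lam mu nu sg X1 X2 R1 R2 w =
     lam * inner ((X1 ^^ h) w) ((X2 ^^ h) w)
   + mu * inner ((R1 ^^ n) ((X1 ^^ m) w)) ((R2 ^^ n) ((X2 ^^ m) w))
   + nu * inner ((X1 ^^ m) ((R1 ^^ n) w)) ((X2 ^^ m) ((R2 ^^ n) w))
   + sg * inner ((R1 ^^ k) w) ((R2 ^^ k) (w :: 'v))"

section \<open>The energy and the words that are negligible against it\<close>

context
  fixes h k m n :: nat and lam mu nu sg :: real
  assumes hk: "0 < h" "0 < k" and mn: "m < h" "n < k"
    and coeffs: "0 < lam" "0 < sg" "0 \<le> mu" "0 \<le> nu"
begin

abbreviation "En \<equiv> energy h k m n lam mu nu sg"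

lemma energy_terms:
  "lam * (norm ((X ^^ h) w))\<^sup>2 \<le> En w" "mu * (norm ((R ^^ n) ((X ^^ m) w)))\<^sup>2 \<le> En w"
  "nu * (norm ((X ^^ m) ((R ^^ n) w)))\<^sup>2 \<le> En w" "sg * (norm ((R ^^ k) w))\<^sup>2 \<le> En w"
  using coeffs unfolding energy_def by (auto intro!: add_nonneg_nonneg simp: add_increasing add_increasing2)

lemma energy_nonneg: "0 \<le> En w"
  using coeffs unfolding energy_def by (auto intro!: add_nonneg_nonneg)

lemma dominated_energy:
  assumes "0 < c" "\<And>w. c * (norm (y w))\<^sup>2 \<le> En w"
  shows "dominated_by (\<lambda>w. sqrt (En w)) (\<lambda>w. norm (y w))"
proof -
  have "norm (y w) \<le> 1 / sqrt c * sqrt (En w) + 1 / sqrt c * norm w" for w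
  proof -
    have "sqrt c * norm (y w) \<le> sqrt (En w)"
      using real_sqrt_le_mono[OF assms(2)[of w]] by (simp add: real_sqrt_mult)
    then have "norm (y w) \<le> 1 / sqrt c * sqrt (En w)" using assms(1) by (simp add: field_simps)
    then show ?thesis using assms(1) by (simp add: add_increasing2)
  qed
  then show ?thesis unfolding dominated_by_def using assms(1) by (intro exI[of _ "1 / sqrt c"]) auto
qed

lemma negligible_norm: "negligible_wrt (\<lambda>w. sqrt (En w)) norm"
  unfolding negligible_wrt_def using energy_nonneg by (auto intro!: exI[of _ 1])

lemma negligible_X: "i < h \<Longrightarrow> negligible_wrt (\<lambda>w. sqrt (En w)) (\<lambda>w. norm ((X ^^ i) w))"
  by (rule negligible_wrt_interpolate[OF interpolate_powers[OF adj_X]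
      dominated_energy[OF coeffs(1) energy_terms(1)] negligible_norm])

lemma negligible_R: "j < k \<Longrightarrow> negligible_wrt (\<lambda>w. sqrt (En w)) (\<lambda>w. norm ((R ^^ j) w))"
  by (rule negligible_wrt_interpolate[OF interpolate_powers[OF adj_R]
      dominated_energy[OF coeffs(2) energy_terms(4)] negligible_norm])

text \<open>Here the strict inequalities enter: the pure powers of \<open>X\<close> up to
  \<open>m\<close> and of \<open>R\<close> up to \<open>n\<close> lie strictly below
  \<open>h\<close> and \<open>k\<close>, hence are negligible by the pure terms of the energy, and
  the mixed words follow from them.\<close>

lemma negligible_RX:
  assumes "0 < mu" "z \<in> subwords R n X m"
  shows "negligible_wrt (\<lambda>w. sqrt (En w)) (\<lambda>w. norm (z w))"
  using assms(2)
proof (rule subwordsE)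
  fix j i assume "j \<le> n" "i \<le> m" "(j, i) \<noteq> (n, m)" "z = (\<lambda>w. (R ^^ j) ((X ^^ i) w))"
  then show ?thesis
    using mixed_negligible[OF linear_X linear_R _ adj_X adj_R, of "- 1"]
      dominated_energy[OF assms(1) energy_terms(2)] negligible_X negligible_R mn X_R
    by simp
qed

lemma negligible_XR:
  assumes "0 < nu" "z \<in> subwords X m R n"
  shows "negligible_wrt (\<lambda>w. sqrt (En w)) (\<lambda>w. norm (z w))"
  using assms(2)
proof (rule subwordsE)
  fix j i assume "j \<le> m" "i \<le> n" "(j, i) \<noteq> (m, n)" "z = (\<lambda>w. (X ^^ j) ((R ^^ i) w))"
  then show ?thesis
    using mixed_negligible[OF linear_R linear_X _ adj_R adj_X, of 1]
      dominated_energy[OF assms(1) energy_terms(3)] negligible_X negligible_R mn X_R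
    by simp
qed

text \<open>A loss of 1 / 8 of the energy is allotted to each of the four terms, so that half of it
  survives in \<open>garding\<close>.\<close>

lemma garding_term:
  assumes c: "0 \<le> c" "\<And>w. c * (norm ((Q ^^ a) ((P ^^ b) w)))\<^sup>2 \<le> En w"
    and neg: "\<And>z. 0 < c \<Longrightarrow> z \<in> subwords Q a P b \<Longrightarrow> negligible_wrt (\<lambda>w. sqrt (En w)) (\<lambda>w. norm (z w))"
    and PQ: "P \<in> {X, R}" "Q \<in> {X, R}"
    and ops: "order_zero {X, R} E1" "order_zero {X, R} F1" "order_zero {X, R} E2" "order_zero {X, R} F2"
  shows "\<exists>C. \<forall>p w. c * inner (((\<lambda>w. Q w + F1 p w) ^^ a) (((\<lambda>w. P w + E1 p w) ^^ b) w))
        (((\<lambda>w. Q w + F2 p w) ^^ a) (((\<lambda>w. P w + E2 p w) ^^ b) w))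
      \<ge> c * (norm ((Q ^^ a) ((P ^^ b) w)))\<^sup>2 - 1 / 8 * En w - C * (norm w)\<^sup>2"
proof -
  have lin: "linear P" "linear Q" using PQ linear_X linear_R by auto
  let ?\<Sigma> = "\<lambda>w. \<Sum>z\<in>subwords Q a P b. norm (z w)"
  obtain C1 where C1: "C1 \<ge> 0" "\<And>p w. norm (((\<lambda>w. Q w + F1 p w) ^^ a) (((\<lambda>w. P w + E1 p w) ^^ b) w) - (Q ^^ a) ((P ^^ b) w)) \<le> C1 * ?\<Sigma> w"
    using lower_order_norm[OF perturbed_word[OF PQ lin ops(1,2), of a b] finite_subwords] by blast
  obtain C2 where C2: "C2 \<ge> 0" "\<And>p w. norm (((\<lambda>w. Q w + F2 p w) ^^ a) (((\<lambda>w. P w + E2 p w) ^^ b) w) - (Q ^^ a) ((P ^^ b) w)) \<le> C2 * ?\<Sigma> w"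
    using lower_order_norm[OF perturbed_word[OF PQ lin ops(3,4), of a b] finite_subwords] by blast
  have \<Sigma>: "0 \<le> ?\<Sigma> w" for w by (simp add: sum_nonneg)
  have "negligible_wrt (\<lambda>w. sqrt (En w)) (\<lambda>w. (C1 + C2) * ?\<Sigma> w)" if "0 < c"
    using C1(1) C2(1) that
    by (intro negligible_wrt_scale negligible_wrt_sum finite_subwords neg) (auto simp: energy_nonneg)
  moreover have "C1 * ?\<Sigma> w \<le> (C1 + C2) * ?\<Sigma> w" "C2 * ?\<Sigma> w \<le> (C1 + C2) * ?\<Sigma> w" for w
    using C1(1) C2(1) \<Sigma> by (auto intro!: mult_right_mono)
  moreover have "c * (norm ((Q ^^ a) ((P ^^ b) w)))\<^sup>2 \<le> (sqrt (En w))\<^sup>2" for w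
    using c(2) energy_nonneg by simp
  ultimately have "\<exists>C. \<forall>p w. c * inner (((\<lambda>w. Q w + F1 p w) ^^ a) (((\<lambda>w. P w + E1 p w) ^^ b) w))
        (((\<lambda>w. Q w + F2 p w) ^^ a) (((\<lambda>w. P w + E2 p w) ^^ b) w))
      \<ge> c * (norm ((Q ^^ a) ((P ^^ b) w)))\<^sup>2 - 1 / 8 * (sqrt (En w))\<^sup>2 - C * (norm w)\<^sup>2"
    by (intro perturbed_term[OF c(1), where S = "\<lambda>w. (C1 + C2) * ?\<Sigma> w"] order_trans[OF C1(2)] order_trans[OF C2(2)]) auto
  then show ?thesis using energy_nonneg by simp
qed

text \<open>A pure power is regarded as a word with an empty left block, which brings it under
  \<open>garding_term\<close>; its proper subwords are then just the lower powers.\<close>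

lemma subwords_power:
  assumes "z \<in> subwords X 0 P b"
  obtains i where "i < b" "z = (\<lambda>w. (P ^^ i) w)"
proof (rule subwordsE[OF assms])
  fix j i assume *: "j \<le> 0" "i \<le> b" "(j, i) \<noteq> (0, b)" "z = (\<lambda>w. (X ^^ j) ((P ^^ i) w))"
  then have "i < b" "z = (\<lambda>w. (P ^^ i) w)" by auto
  then show ?thesis by (rule that)
qed

theorem garding:
  assumes ops: "order_zero {X, R} E1" "order_zero {X, R} E2" "order_zero {X, R} F1" "order_zero {X, R} F2"
  shows "\<exists>C. \<forall>p w. perturbed_form h k m n lam mu nu sg (\<lambda>w. X w + E1 p w) (\<lambda>w. X w + E2 p w)
      (\<lambda>w. R w + F1 p w) (\<lambda>w. R w + F2 p w) w \<ge> En w / 2 - C * (norm w)\<^sup>2"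
proof -
  let ?X1 = "\<lambda>p w. X w + E1 p w" and ?X2 = "\<lambda>p w. X w + E2 p w"
  let ?R1 = "\<lambda>p w. R w + F1 p w" and ?R2 = "\<lambda>p w. R w + F2 p w"
  have "\<exists>C. \<forall>p w. lam * inner ((?X1 p ^^ h) w) ((?X2 p ^^ h) w)
      \<ge> lam * (norm ((X ^^ h) w))\<^sup>2 - 1 / 8 * En w - C * (norm w)\<^sup>2"
    using garding_term[where c = lam and Q = X and a = 0 and P = X and b = h and ?E1.0 = E1 and ?F1.0 = E1 and ?E2.0 = E2 and ?F2.0 = E2] coeffs energy_terms(1) negligible_X ops
    by (force elim!: subwords_power)
  then obtain C1 where C1: "\<And>p w. lam * inner ((?X1 p ^^ h) w) ((?X2 p ^^ h) w)
      \<ge> lam * (norm ((X ^^ h) w))\<^sup>2 - 1 / 8 * En w - C1 * (norm w)\<^sup>2" by blast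
  have "\<exists>C. \<forall>p w. sg * inner ((?R1 p ^^ k) w) ((?R2 p ^^ k) w)
      \<ge> sg * (norm ((R ^^ k) w))\<^sup>2 - 1 / 8 * En w - C * (norm w)\<^sup>2"
    using garding_term[where c = sg and Q = X and a = 0 and P = R and b = k and ?E1.0 = F1 and ?F1.0 = E1 and ?E2.0 = F2 and ?F2.0 = E2] coeffs energy_terms(4) negligible_R ops
    by (force elim!: subwords_power)
  then obtain C4 where C4: "\<And>p w. sg * inner ((?R1 p ^^ k) w) ((?R2 p ^^ k) w)
      \<ge> sg * (norm ((R ^^ k) w))\<^sup>2 - 1 / 8 * En w - C4 * (norm w)\<^sup>2" by blast
  obtain C2 where C2: "\<And>p w. mu * inner ((?R1 p ^^ n) ((?X1 p ^^ m) w)) ((?R2 p ^^ n) ((?X2 p ^^ m) w))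
      \<ge> mu * (norm ((R ^^ n) ((X ^^ m) w)))\<^sup>2 - 1 / 8 * En w - C2 * (norm w)\<^sup>2"
    using garding_term[OF coeffs(3) energy_terms(2) negligible_RX _ _ ops(1,3,2,4)] by auto
  obtain C3 where C3: "\<And>p w. nu * inner ((?X1 p ^^ m) ((?R1 p ^^ n) w)) ((?X2 p ^^ m) ((?R2 p ^^ n) w))
      \<ge> nu * (norm ((X ^^ m) ((R ^^ n) w)))\<^sup>2 - 1 / 8 * En w - C3 * (norm w)\<^sup>2"
    using garding_term[OF coeffs(4) energy_terms(3) negligible_XR _ _ ops(3,1,4,2)] by auto
  have "perturbed_form h k m n lam mu nu sg (?X1 p) (?X2 p) (?R1 p) (?R2 p) w
      \<ge> En w / 2 - (C1 + C2 + C3 + C4) * (norm w)\<^sup>2" for p w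
  proof -
    have "En w = lam * (norm ((X ^^ h) w))\<^sup>2 + mu * (norm ((R ^^ n) ((X ^^ m) w)))\<^sup>2
   + nu * (norm ((X ^^ m) ((R ^^ n) w)))\<^sup>2 + sg * (norm ((R ^^ k) w))\<^sup>2" by (simp add: energy_def)
    then show ?thesis
      using C1[of w p] C2[of w p] C3[of w p] C4[of w p]
      unfolding perturbed_form_def distrib_right by linarith
  qed
  then show ?thesis by blast
qed

text \<open>No term in \<open>norm w\<close> is left over. Both first powers are interpolated with
  factor 1 / 4 on \<open>norm w\<close>; after squaring and adding this costs |w|^2 / 4, which the
  uncertainty inequality absorbs into the left-hand side.\<close>

theorem energy_coercive: "\<exists>c>0. \<forall>w. c * ((norm (X w))\<^sup>2 + (norm (R w))\<^sup>2) \<le> En w"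
proof -
  obtain C where C: "C \<ge> 0" "\<And>w. norm (X w) \<le> 1 / 4 * norm w + C * norm ((X ^^ h) w)"
    using interpolate_first_power[OF adj_X _ hk(1), of "1 / 4"] by auto
  obtain D where D: "D \<ge> 0" "\<And>w. norm (R w) \<le> 1 / 4 * norm w + D * norm ((R ^^ k) w)"
    using interpolate_first_power[OF adj_R _ hk(2), of "1 / 4"] by auto
  have sq: "a\<^sup>2 \<le> b\<^sup>2 / 8 + 2 * B\<^sup>2 * d\<^sup>2" if "a \<le> 1 / 4 * b + B * d" "0 \<le> a" for a b B d :: real
  proof -
    have "a\<^sup>2 \<le> (1 / 4 * b + B * d)\<^sup>2" using that by (intro power_mono) auto
    also have "\<dots> \<le> 2 * (1 / 4 * b)\<^sup>2 + 2 * (B * d)\<^sup>2"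
      using zero_le_power2[of "1 / 4 * b - B * d"] by (simp only: power2_sum power2_diff)
    finally show ?thesis by (simp add: power2_eq_square mult_ac)
  qed
  define K where "K = 2 * C\<^sup>2 / lam + 2 * D\<^sup>2 / sg + 1"
  have K: "K > 0" using coeffs by (simp add: K_def add_nonneg_pos)
  have "(norm (X w))\<^sup>2 + (norm (R w))\<^sup>2 \<le> 2 * K * En w" for w
  proof -
    have "(norm (X w))\<^sup>2 + (norm (R w))\<^sup>2
      \<le> (norm w)\<^sup>2 / 4 + 2 * C\<^sup>2 * (norm ((X ^^ h) w))\<^sup>2 + 2 * D\<^sup>2 * (norm ((R ^^ k) w))\<^sup>2"
      using sq[OF C(2)[of w]] sq[OF D(2)[of w]] by simp
    also have "2 * C\<^sup>2 * (norm ((X ^^ h) w))\<^sup>2 \<le> 2 * C\<^sup>2 * (En w / lam)"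
      using energy_terms(1)[of w] coeffs by (intro mult_left_mono) (auto simp: field_simps)
    also have "2 * D\<^sup>2 * (norm ((R ^^ k) w))\<^sup>2 \<le> 2 * D\<^sup>2 * (En w / sg)"
      using energy_terms(4)[of w] coeffs by (intro mult_left_mono) (auto simp: field_simps)
    finally have "(norm (X w))\<^sup>2 + (norm (R w))\<^sup>2 \<le> (norm w)\<^sup>2 / 4 + (K - 1) * En w"
      by (simp add: K_def algebra_simps)
    then show ?thesis
      using norm_le_X_R[of w] energy_nonneg[of w] mult_nonneg_nonneg[OF less_imp_le[OF K] energy_nonneg[of w]]
      unfolding left_diff_distrib mult_1 mult.assoc by linarith
  qed
  then have "1 / (2 * K) * ((norm (X w))\<^sup>2 + (norm (R w))\<^sup>2) \<le> En w" for w
    using K by (simp add: field_simps)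
  then show ?thesis using K by (intro exI[of _ "1 / (2 * K)"]) auto
qed

end

end

section \<open>The canonical pair on finite sequences\<close>

text \<open>On finitely supported sequences the ladder operators act everywhere and every series is
  a finite sum, so the form estimate meets no convergence question; general sequences are reached by
  truncation.\<close>

typedef fseq = "{f :: nat \<Rightarrow> real. finite {i. f i \<noteq> 0}}"
  morphisms fs Abs_fseq
  by (intro exI[of _ "\<lambda>_. 0"]) auto

setup_lifting type_definition_fseq

instantiation fseq :: real_vector
begin
lift_definition zero_fseq :: fseq is "\<lambda>_. 0" by simp
lift_definition plus_fseq :: "fseq \<Rightarrow> fseq \<Rightarrow> fseq" is "\<lambda>f g i. f i + g i"
  subgoal for f g by (rule finite_subset[of _ "{i. f i \<noteq> 0} \<union> {i. g i \<noteq> 0}"]) auto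
  done
lift_definition uminus_fseq :: "fseq \<Rightarrow> fseq" is "\<lambda>f i. - f i" by simp
lift_definition minus_fseq :: "fseq \<Rightarrow> fseq \<Rightarrow> fseq" is "\<lambda>f g i. f i - g i"
  subgoal for f g by (rule finite_subset[of _ "{i. f i \<noteq> 0} \<union> {i. g i \<noteq> 0}"]) auto
  done
lift_definition scaleR_fseq :: "real \<Rightarrow> fseq \<Rightarrow> fseq" is "\<lambda>c f i. c * f i"
  by (erule rev_finite_subset) auto
instance by standard (transfer; simp add: fun_eq_iff algebra_simps)+
end

lemma summable_fs: "summable (\<lambda>i. fs f i * g i)"
  using fs[of f] by (intro summable_finite[of "{i. fs f i \<noteq> 0}"]) auto

lemma fs_simps [simp]:
  "fs 0 i = 0" "fs (f + g) i = fs f i + fs g i" "fs (- f) i = - fs f i"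
  "fs (f - g) i = fs f i - fs g i" "fs (c *\<^sub>R f) i = c * fs f i"
  by (transfer, simp)+

lemma fseq_eqI: "(\<And>i. fs f i = fs g i) \<Longrightarrow> f = g"
  by (simp add: fs_inject[symmetric] fun_eq_iff)

instantiation fseq :: real_inner
begin
definition inner_fseq :: "fseq \<Rightarrow> fseq \<Rightarrow> real" where "inner_fseq f g = (\<Sum>i. fs f i * fs g i)"
definition norm_fseq :: "fseq \<Rightarrow> real" where "norm_fseq f = sqrt (inner f f)"
definition dist_fseq :: "fseq \<Rightarrow> fseq \<Rightarrow> real" where "dist_fseq f g = norm (f - g)"
definition sgn_fseq :: "fseq \<Rightarrow> fseq" where "sgn_fseq f = f /\<^sub>R norm f"
definition uniformity_fseq :: "(fseq \<times> fseq) filter" where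
  "uniformity_fseq = (INF e\<in>{0<..}. principal {(x, y). dist x y < e})"
definition open_fseq :: "fseq set \<Rightarrow> bool" where
  "open_fseq U \<longleftrightarrow> (\<forall>x\<in>U. eventually (\<lambda>(x', y). x' = x \<longrightarrow> y \<in> U) uniformity)"
instance
proof
  fix f g k :: fseq and c :: real
  show "dist f g = norm (f - g)" by (rule dist_fseq_def)
  show "sgn f = f /\<^sub>R norm f" by (rule sgn_fseq_def)
  show "uniformity = (INF e\<in>{0<..}. principal {(x :: fseq, y). dist x y < e})" by (rule uniformity_fseq_def)
  show "open U \<longleftrightarrow> (\<forall>x\<in>U. eventually (\<lambda>(x', y). x' = x \<longrightarrow> y \<in> U) uniformity)" for U :: "fseq set"
    by (rule open_fseq_def)
  show "norm f = sqrt (inner f f)" by (rule norm_fseq_def)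
  show "inner f g = inner g f" by (simp add: inner_fseq_def mult.commute)
  show "inner (f + g) k = inner f k + inner g k"
    by (simp add: inner_fseq_def distrib_right suminf_add summable_fs)
  show "inner (c *\<^sub>R f) g = c * inner f g"
    by (simp add: inner_fseq_def mult.assoc suminf_mult summable_fs)
  show "0 \<le> inner f f" unfolding inner_fseq_def by (intro suminf_nonneg summable_fs) simp
  show "inner f f = 0 \<longleftrightarrow> f = 0"
  proof
    assume "inner f f = 0"
    then have "fs f i * fs f i = 0" for i
      using suminf_eq_zero_iff[OF summable_fs[of f "fs f"]] by (simp add: inner_fseq_def)
    then show "f = 0" by (intro fseq_eqI) simp
  qed (simp add: inner_fseq_def)
qed
end

lift_definition lowering :: "fseq \<Rightarrow> fseq" is "\<lambda>f i. sqrt (real (Suc i)) * f (Suc i)"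
proof -
  fix f :: "nat \<Rightarrow> real" assume "finite {i. f i \<noteq> 0}"
  then have "finite ((\<lambda>i. i - 1) ` {i. f i \<noteq> 0})" by simp
  then show "finite {i. sqrt (real (Suc i)) * f (Suc i) \<noteq> 0}"
    by (rule rev_finite_subset) (auto simp: image_iff intro!: exI[of _ "Suc _"])
qed

text \<open>At \<open>i = 0\<close> the truncated index \<open>i - 1\<close> does no harm, since the
  factor is \<open>sqrt 0\<close>.\<close>

lift_definition raising :: "fseq \<Rightarrow> fseq" is "\<lambda>f i. sqrt (real i) * f (i - 1)"
proof -
  fix f :: "nat \<Rightarrow> real" assume "finite {i. f i \<noteq> 0}"
  then have "finite (Suc ` {i. f i \<noteq> 0})" by simp
  moreover have "{i. sqrt (real i) * f (i - 1) \<noteq> 0} \<subseteq> Suc ` {i. f i \<noteq> 0}"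
  proof
    fix i assume "i \<in> {i. sqrt (real i) * f (i - 1) \<noteq> 0}"
    then show "i \<in> Suc ` {i. f i \<noteq> 0}" by (cases i) auto
  qed
  ultimately show "finite {i. sqrt (real i) * f (i - 1) \<noteq> 0}" by (rule rev_finite_subset)
qed

lift_definition diag :: "(nat \<Rightarrow> real) \<Rightarrow> fseq \<Rightarrow> fseq" is "\<lambda>g f i. g i * f i"
  by (erule rev_finite_subset) auto

lemma fs_ops [simp]:
  "fs (lowering f) i = sqrt (real (Suc i)) * fs f (Suc i)"
  "fs (raising f) i = sqrt (real i) * fs f (i - 1)"
  "fs (diag g f) i = g i * fs f i"
  by (transfer, simp)+

lemma linear_ops: "linear lowering" "linear raising" "linear (diag g)"
  by (auto simp: linear_iff algebra_simps intro!: fseq_eqI)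

lemma inner_low: "inner (lowering f) g = inner f (raising g)"
proof -
  have "inner f (raising g) = (\<Sum>i. fs f (Suc i) * fs (raising g) (Suc i)) + fs f 0 * fs (raising g) 0"
    unfolding inner_fseq_def using suminf_split_head[OF summable_fs[of f "fs (raising g)"]] by simp
  then show ?thesis by (simp add: inner_fseq_def mult_ac)
qed

lemma inner_rais: "inner (raising f) g = inner f (lowering g)"
  by (metis inner_commute inner_low)

lemma inner_diag: "inner (diag g f) k = inner f (diag g k)"
  by (simp add: inner_fseq_def mult_ac)

lemma low_rais: "lowering (raising w) = raising (lowering w) + w"
proof (rule fseq_eqI)
  fix i
  have sq: "sqrt x * (sqrt x * y) = x * y" if "0 \<le> x" for x y
    using that by (simp only: mult.assoc[symmetric] real_sqrt_mult_self abs_of_nonneg)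
  have "fs (lowering (raising w)) i = (real i + 1) * fs w i" by (simp add: sq)
  moreover have "fs (raising (lowering w)) i = real i * fs w i" by (cases i) (simp_all add: sq)
  ultimately show "fs (lowering (raising w)) i = fs (raising (lowering w) + w) i" by (simp add: distrib_right)
qed

definition X_op :: "fseq \<Rightarrow> fseq" where "X_op w = (1 / sqrt 2) *\<^sub>R (raising w + lowering w)"
definition R_op :: "fseq \<Rightarrow> fseq" where "R_op w = (1 / sqrt 2) *\<^sub>R (lowering w - raising w)"

lemma linear_XR: "linear X_op" "linear R_op"
  unfolding X_op_def R_op_def
  by (auto simp: linear_iff linear_add[OF linear_ops(1)] linear_add[OF linear_ops(2)]
      linear_scale[OF linear_ops(1)] linear_scale[OF linear_ops(2)] algebra_simps)

interpretation fseq: canonical_pair X_op R_op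
proof (rule canonical_pair.intro)
  show "linear X_op" "linear R_op" by (fact linear_XR)+
  show "inner (X_op f) g = inner f (X_op g)" for f g
    by (simp add: X_op_def inner_add_left inner_add_right inner_low inner_rais)
  show "inner (R_op f) g = - inner f (R_op g)" for f g
    by (simp add: R_op_def inner_diff_left inner_diff_right inner_low inner_rais algebra_simps)
  show "X_op (R_op w) = R_op (X_op w) - w" for w
    by (rule fseq_eqI)
      (simp add: X_op_def R_op_def linear_add[OF linear_ops(1)] linear_add[OF linear_ops(2)]
      linear_diff[OF linear_ops(1)] linear_diff[OF linear_ops(2)]
      linear_scale[OF linear_ops(1)] linear_scale[OF linear_ops(2)] low_rais field_simps del: fs_ops)
qed

text \<open>Difference analogue of the classical symbol classes: each difference in \<open>i\<close> gains a factor
  \<open>1 / (1 + i)\<close>, uniformly in \<open>p\<close>.\<close>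

primrec symbol_upto :: "nat \<Rightarrow> nat \<Rightarrow> ('p \<Rightarrow> nat \<Rightarrow> real) \<Rightarrow> bool" where
  "symbol_upto 0 r g \<longleftrightarrow> (\<exists>C. \<forall>p i. \<bar>g p i\<bar> * (1 + real i) ^ r \<le> C)"
| "symbol_upto (Suc l) r g \<longleftrightarrow> (\<exists>C. \<forall>p i. \<bar>g p i\<bar> * (1 + real i) ^ r \<le> C) \<and>
     symbol_upto l (Suc r) (\<lambda>p i. g p (Suc i) - g p i)"

lemma symbol_upto_bound: "symbol_upto l r g \<Longrightarrow> \<exists>C. \<forall>p i. \<bar>g p i\<bar> * (1 + real i) ^ r \<le> C"
  by (cases l) auto

lemma symbol_upto_Suc: "symbol_upto (Suc l) r g \<Longrightarrow> symbol_upto l r g"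
proof (induction l arbitrary: r g)
  case (Suc l)
  note * = iffD1[OF symbol_upto.simps(2) Suc.prems]
  show ?case
    by (rule iffD2[OF symbol_upto.simps(2)], rule conjI[OF conjunct1[OF *] Suc.IH[OF conjunct2[OF *]]])
qed simp

lemma symbol_upto_weaken: "symbol_upto l (Suc r) g \<Longrightarrow> symbol_upto l r g"
proof (induction l arbitrary: r g)
  case 0
  then obtain C where C: "\<And>p i. \<bar>g p i\<bar> * (1 + real i) ^ Suc r \<le> C" by auto
  have "\<bar>g p i\<bar> * (1 + real i) ^ r \<le> C" for p i
    by (rule order_trans[OF mult_left_mono C[of p i]]) (auto intro: power_increasing)
  then show ?case by auto
next
  case (Suc l)
  have "symbol_upto l r g" by (rule Suc.IH[OF symbol_upto_Suc[OF Suc.prems]])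
  then have "\<exists>C. \<forall>p i. \<bar>g p i\<bar> * (1 + real i) ^ r \<le> C" by (rule symbol_upto_bound)
  then show ?case using Suc by simp
qed

lemma symbol_upto_add: "symbol_upto l r f \<Longrightarrow> symbol_upto l r g \<Longrightarrow> symbol_upto l r (\<lambda>p i. f p i + g p i)"
proof (induction l arbitrary: r f g)
  have bd: "\<exists>C. \<forall>p i. \<bar>f p i + g p i\<bar> * (1 + real i) ^ r \<le> C"
    if *: "\<exists>C. \<forall>p i. \<bar>f p i\<bar> * (1 + real i) ^ r \<le> C" "\<exists>C. \<forall>p i. \<bar>g p i\<bar> * (1 + real i) ^ r \<le> C"
    for r and f g :: "'p \<Rightarrow> nat \<Rightarrow> real"
  proof -
    obtain C D where C: "\<And>p i. \<bar>f p i\<bar> * (1 + real i) ^ r \<le> C" and D: "\<And>p i. \<bar>g p i\<bar> * (1 + real i) ^ r \<le> D"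
      using * by blast
    have "\<bar>f p i + g p i\<bar> * (1 + real i) ^ r \<le> (\<bar>f p i\<bar> + \<bar>g p i\<bar>) * (1 + real i) ^ r" for p i
      by (intro mult_right_mono) auto
    also have "\<dots> p i \<le> C + D" for p i using C[of p i] D[of p i] by (simp add: distrib_right)
    finally show ?thesis by blast
  qed
  {
    case 0
    then show ?case using bd[of f r g] by simp
  next
    case (Suc l)
    have eq: "(\<lambda>p i. f p (Suc i) + g p (Suc i) - (f p i + g p i)) =
      (\<lambda>p i. (f p (Suc i) - f p i) + (g p (Suc i) - g p i))"
      by (intro ext) (simp add: algebra_simps)
    show ?case
      unfolding symbol_upto.simps(2) eq using Suc.prems
      by (intro conjI bd symbol_upto_bound[of "Suc l"] Suc.IH) auto
  }
qed

text \<open>Discrete Leibniz rule: besides the two usual terms, the difference of a product contains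
  the product of both differences. That term decays by one order more than required and is
  weakened.\<close>

lemma symbol_upto_mult:
  "symbol_upto l r f \<Longrightarrow> symbol_upto l s g \<Longrightarrow> symbol_upto l (r + s) (\<lambda>p i. f p i * g p i)"
proof (induction l arbitrary: r s f g)
  have bd: "\<exists>C. \<forall>p i. \<bar>f p i * g p i\<bar> * (1 + real i) ^ (r + s) \<le> C"
    if *: "\<exists>C. \<forall>p i. \<bar>f p i\<bar> * (1 + real i) ^ r \<le> C" "\<exists>C. \<forall>p i. \<bar>g p i\<bar> * (1 + real i) ^ s \<le> C"
    for r s and f g :: "'p \<Rightarrow> nat \<Rightarrow> real"
  proof -
    obtain C D where C: "\<And>p i. \<bar>f p i\<bar> * (1 + real i) ^ r \<le> C" and D: "\<And>p i. \<bar>g p i\<bar> * (1 + real i) ^ s \<le> D"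
      using * by blast
    have "\<bar>f p i * g p i\<bar> * (1 + real i) ^ (r + s) \<le> C * D" for p i
    proof -
      have "0 \<le> \<bar>f p i\<bar> * (1 + real i) ^ r" by simp
      then have "0 \<le> C" using C[of p i] by linarith
      then have "(\<bar>f p i\<bar> * (1 + real i) ^ r) * (\<bar>g p i\<bar> * (1 + real i) ^ s) \<le> C * D"
        by (intro mult_mono C D) auto
      then show ?thesis by (simp add: abs_mult power_add mult_ac)
    qed
    then show ?thesis by blast
  qed
  {
    case 0
    then show ?case using bd[of f r g s] by simp
  next
    case (Suc l)
    let ?df = "\<lambda>p i. f p (Suc i) - f p i" and ?dg = "\<lambda>p i. g p (Suc i) - g p i"
    have d: "symbol_upto l (Suc r) ?df" "symbol_upto l (Suc s) ?dg" using Suc.prems by auto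
    have "symbol_upto l (Suc r + s) (\<lambda>p i. ?df p i * g p i)"
      by (rule Suc.IH[OF d(1) symbol_upto_Suc[OF Suc.prems(2)]])
    moreover have "symbol_upto l (r + Suc s) (\<lambda>p i. f p i * ?dg p i)"
      by (rule Suc.IH[OF symbol_upto_Suc[OF Suc.prems(1)] d(2)])
    moreover have "symbol_upto l (Suc r + Suc s) (\<lambda>p i. ?df p i * ?dg p i)"
      by (rule Suc.IH[OF d])
    then have "symbol_upto l (Suc (r + s)) (\<lambda>p i. ?df p i * ?dg p i)"
      using symbol_upto_weaken by simp
    ultimately have "symbol_upto l (Suc (r + s)) (\<lambda>p i. (?df p i * g p i + f p i * ?dg p i) + ?df p i * ?dg p i)"
      by (intro symbol_upto_add) auto
    moreover have "(\<lambda>p i. (?df p i * g p i + f p i * ?dg p i) + ?df p i * ?dg p i) =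
       (\<lambda>p i. f p (Suc i) * g p (Suc i) - f p i * g p i)"
      by (intro ext) (simp add: algebra_simps)
    ultimately show ?case using Suc.prems bd[of f r g s] symbol_upto_bound by simp
  }
qed

lemma symbol_upto_const: "symbol_upto l 0 (\<lambda>p i. c)"
proof -
  have z: "symbol_upto l r (\<lambda>p i. 0)" for l r by (induction l arbitrary: r) auto
  show ?thesis by (cases l) (auto simp: z)
qed

definition symbol :: "nat \<Rightarrow> ('p \<Rightarrow> nat \<Rightarrow> real) \<Rightarrow> bool" where
  "symbol r g \<longleftrightarrow> (\<forall>l. symbol_upto l r g)"

lemma symbol_add: "symbol r f \<Longrightarrow> symbol r g \<Longrightarrow> symbol r (\<lambda>p i. f p i + g p i)"
  by (simp add: symbol_def symbol_upto_add)

lemma symbol_mult: "symbol r f \<Longrightarrow> symbol s g \<Longrightarrow> symbol (r + s) (\<lambda>p i. f p i * g p i)"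
  by (simp add: symbol_def symbol_upto_mult)

lemma symbol_const: "symbol 0 (\<lambda>p i. c)"
  by (simp add: symbol_def symbol_upto_const)

lemma symbol_weaken: "symbol (Suc r) g \<Longrightarrow> symbol r g"
  by (simp add: symbol_def symbol_upto_weaken)

lemma symbol_diff: "symbol r g \<Longrightarrow> symbol (Suc r) (\<lambda>p i. g p (Suc i) - g p i)"
  unfolding symbol_def by (metis symbol_upto.simps(2))

lemma symbol_uminus: "symbol r g \<Longrightarrow> symbol r (\<lambda>p i. - g p i)"
  using symbol_mult[OF symbol_const[of "- 1"], of r g] by simp

text \<open>The difference of 1 / (a + i) is minus the product of two functions of the same kind
  with consecutive offsets, so the induction runs over all offsets \<open>j\<close> at once. The
  case \<open>c = 1\<close> serves the regularizing factor, uniformly in \<open>p\<close>, and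
  \<open>c = 0\<close> the plain power.\<close>

lemma symbol_inverse_linear: "symbol 1 (\<lambda>(p::nat) i. 1 / (real (c * p) + real (Suc j) + real i))"
proof -
  have "symbol_upto l 1 (\<lambda>(p::nat) i. 1 / (real (c * p) + real (Suc j) + real i))" for l j
  proof (induction l arbitrary: j)
    have bd: "\<bar>1 / (real (c * p) + real (Suc j) + real i)\<bar> * (1 + real i) ^ 1 \<le> 1" for p i j
    proof -
      have D: "0 < real (c * p) + real (Suc j) + real i" "1 + real i \<le> real (c * p) + real (Suc j) + real i"
        using of_nat_0_le_iff[of "c * p", where ?'a = real] unfolding of_nat_Suc by linarith+
      then show ?thesis by (simp only: abs_of_pos zero_less_divide_1_iff power_one_right times_divide_eq_left mult_1 divide_le_eq_1_pos)
    qed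
    {
      case 0
      show ?case using bd by auto
    next
      case (Suc l)
      have "symbol_upto l (0 + (1 + 1)) (\<lambda>(p::nat) i. - 1 * (1 / (real (c * p) + real (Suc j) + real i) * (1 / (real (c * p) + real (Suc (Suc j)) + real i))))"
        by (intro symbol_upto_mult Suc.IH symbol_upto_const)
      moreover have "(\<lambda>(p::nat) i. - 1 * (1 / (real (c * p) + real (Suc j) + real i) * (1 / (real (c * p) + real (Suc (Suc j)) + real i))))
         = (\<lambda>p i. 1 / (real (c * p) + real (Suc j) + real (Suc i)) - 1 / (real (c * p) + real (Suc j) + real i))"
      proof (intro ext)
        fix p i
        have "real (c * p) + real (Suc j) + real i > 0" "real (c * p) + real (Suc (Suc j)) + real i > 0"
          using of_nat_0_le_iff[of "c * p", where ?'a = real] unfolding of_nat_Suc by linarith+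
        then show "- 1 * (1 / (real (c * p) + real (Suc j) + real i) * (1 / (real (c * p) + real (Suc (Suc j)) + real i)))
          = 1 / (real (c * p) + real (Suc j) + real (Suc i)) - 1 / (real (c * p) + real (Suc j) + real i)"
          by (simp add: field_simps)
      qed
      ultimately show ?case using bd by (auto simp: numeral_2_eq_2)
    }
  qed
  then show ?thesis by (simp add: symbol_def)
qed

text \<open>(1 + u)^(s + 1) - 1 = ((1 + u)^s - 1) (1 + u) + u, where 1 + u has order zero.\<close>

lemma symbol_power_minus_one:
  assumes "symbol 1 u"
  shows "symbol 1 (\<lambda>p i. (1 + u p i) ^ s - 1)"
proof (induction s)
  case 0
  have "symbol (1 + 0) (\<lambda>p i. u p i * 0)" by (rule symbol_mult[OF assms symbol_const])
  then show ?case by simp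
next
  case (Suc s)
  have "symbol 0 (\<lambda>p i. 1 + u p i)"
    using symbol_add[OF symbol_const symbol_weaken] assms by simp
  from symbol_add[OF symbol_mult[OF Suc this] ] assms
  have "symbol 1 (\<lambda>p i. ((1 + u p i) ^ s - 1) * (1 + u p i) + u p i)" by simp
  then show ?case by (simp add: algebra_simps)
qed

lemma symbol_mult_minus_one:
  assumes "symbol 1 (\<lambda>p i. f p i - 1)" "symbol 1 (\<lambda>p i. g p i - 1)"
  shows "symbol 1 (\<lambda>p i. f p i * g p i - 1)"
proof -
  have "symbol 2 (\<lambda>p i. (f p i - 1) * (g p i - 1))"
    using symbol_mult[OF assms] by (simp add: numeral_2_eq_2)
  then have "symbol 1 (\<lambda>p i. (f p i - 1) * (g p i - 1))"
    using symbol_weaken[of 1] by (simp add: numeral_2_eq_2)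
  from symbol_add[OF symbol_add[OF this assms(1)] assms(2)] show ?thesis by (simp add: algebra_simps)
qed

text \<open>A word with \<open>a\<close> raising and \<open>b\<close> lowering letters carries the
  entry with index j + b to index j + a; hence the two shifts.\<close>

lemma norm_fseq_shift_le:
  assumes K: "0 \<le> K" and zero: "\<And>i. i < a \<Longrightarrow> fs u i = 0"
    and le: "\<And>j. \<bar>fs u (j + a)\<bar> \<le> K * \<bar>fs w (j + b)\<bar>"
  shows "norm u \<le> K * norm w"
proof (rule power2_le_imp_le)
  have sq: "(norm f)\<^sup>2 = (\<Sum>i. fs f i * fs f i)" for f :: fseq
    by (simp add: power2_norm_eq_inner inner_fseq_def)
  have "(norm u)\<^sup>2 = (\<Sum>j. fs u (j + a) * fs u (j + a))"
    unfolding sq suminf_split_initial_segment[OF summable_fs[of u "fs u"], of a] by (simp add: zero)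
  also have "\<dots> \<le> (\<Sum>j. K\<^sup>2 * (fs w (j + b) * fs w (j + b)))"
  proof (rule suminf_le)
    fix j
    have "\<bar>fs u (j + a)\<bar> * \<bar>fs u (j + a)\<bar> \<le> (K * \<bar>fs w (j + b)\<bar>) * (K * \<bar>fs w (j + b)\<bar>)"
      using K by (intro mult_mono le) auto
    moreover have "\<dots> = K\<^sup>2 * (\<bar>fs w (j + b)\<bar> * \<bar>fs w (j + b)\<bar>)" by (simp add: power2_eq_square)
    ultimately show "fs u (j + a) * fs u (j + a) \<le> K\<^sup>2 * (fs w (j + b) * fs w (j + b))" by simp
  qed (intro summable_mult summable_ignore_initial_segment[of "\<lambda>i. fs _ i * fs _ i"] summable_fs)+
  also have "\<dots> = K\<^sup>2 * (\<Sum>j. fs w (j + b) * fs w (j + b))"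
    by (intro suminf_mult summable_ignore_initial_segment[of "\<lambda>i. fs _ i * fs _ i"] summable_fs)
  also have "\<dots> \<le> K\<^sup>2 * (norm w)\<^sup>2"
    unfolding sq suminf_split_initial_segment[OF summable_fs[of w "fs w"], of b]
    by (intro mult_left_mono) (auto intro: sum_nonneg)
  finally show "(norm u)\<^sup>2 \<le> (K * norm w)\<^sup>2" by (simp add: power_mult_distrib)
qed (use K in simp)

section \<open>Words in the ladder operators\<close>

lemma low_power_bound: "\<bar>fs ((lowering ^^ b) w) i\<bar> \<le> sqrt (real (i + b)) ^ b * \<bar>fs w (i + b)\<bar>"
proof (induction b arbitrary: i)
  case (Suc b)
  have "\<bar>fs ((lowering ^^ Suc b) w) i\<bar> = sqrt (real (Suc i)) * \<bar>fs ((lowering ^^ b) w) (Suc i)\<bar>"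
    by (simp add: abs_mult)
  also have "\<dots> \<le> sqrt (real (i + Suc b)) * (sqrt (real (Suc i + b)) ^ b * \<bar>fs w (Suc i + b)\<bar>)"
    by (intro mult_mono Suc) auto
  finally show ?case by simp
qed simp

lemma rais_power_bound:
  "\<bar>fs ((raising ^^ a) w) i\<bar> \<le> (if a \<le> i then sqrt (real i) ^ a * \<bar>fs w (i - a)\<bar> else 0)"
proof (induction a arbitrary: i)
  case (Suc a)
  show ?case
  proof (cases i)
    case 0
    then show ?thesis by simp
  next
    case (Suc i')
    have "\<bar>fs ((raising ^^ Suc a) w) i\<bar> = sqrt (real i) * \<bar>fs ((raising ^^ a) w) i'\<bar>"
      using Suc by (simp add: abs_mult)
    also have "\<dots> \<le> sqrt (real i) * (if a \<le> i' then sqrt (real i') ^ a * \<bar>fs w (i' - a)\<bar> else 0)"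
      by (intro mult_left_mono Suc.IH) auto
    also have "\<dots> \<le> sqrt (real i) * (if a \<le> i' then sqrt (real i) ^ a * \<bar>fs w (i' - a)\<bar> else 0)"
      using Suc by (auto intro!: mult_left_mono mult_right_mono power_mono)
    finally show ?thesis using Suc by (auto split: if_splits)
  qed
qed simp

text \<open>Normal ordering with a diagonal factor in the middle. Commuting such a word with a
  ladder letter gives words of the same shape: either a letter is added and \<open>g\<close> is
  replaced by its difference, or a letter is lost.\<close>

definition ladder_word :: "nat \<Rightarrow> (nat \<Rightarrow> real) \<Rightarrow> nat \<Rightarrow> fseq \<Rightarrow> fseq" where
  "ladder_word a g b w = (raising ^^ a) (diag g ((lowering ^^ b) w))"

lemma linear_funpow: "linear (f :: 'v::real_vector \<Rightarrow> 'v) \<Longrightarrow> linear (f ^^ n)"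
  by (induction n) (auto simp: linear_iff)

lemma linear_ladder_word: "linear (ladder_word a g b)"
  using linear_compose[OF linear_compose[OF linear_funpow[OF linear_ops(1), of b] linear_ops(3)[of g]] linear_funpow[OF linear_ops(2), of a]]
  by (simp add: ladder_word_def[abs_def] o_def)

text \<open>Every ladder letter costs a factor of order sqrt (1 + i), so \<open>r\<close> powers of
  decay of \<open>g\<close> pay for up to \<open>2 * r\<close> letters.\<close>

lemma ladder_word_bounded:
  assumes g: "symbol_upto l r g" and ab: "a + b \<le> 2 * r"
  shows "uniformly_bounded (\<lambda>p. ladder_word a (g p) b)"
proof -
  obtain C where C: "\<And>p i. \<bar>g p i\<bar> * (1 + real i) ^ r \<le> C"
    using symbol_upto_bound[OF g] by blast
  define K where "K = sqrt (1 + real a) ^ a * sqrt (1 + real b) ^ b * C"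
  have "0 \<le> \<bar>g p i\<bar> * (1 + real i) ^ r" for p i by simp
  from order_trans[OF this C] have C0: "0 \<le> C" .
  then have K: "0 \<le> K" by (simp add: K_def)
  have rt: "sqrt (real (j + c)) \<le> sqrt (1 + real c) * sqrt (1 + real j)" for j c
    unfolding real_sqrt_mult[symmetric] by (simp add: algebra_simps)
  have "norm (ladder_word a (g p) b w) \<le> K * norm w" for p w
  proof (rule norm_fseq_shift_le[OF K])
    show "fs (ladder_word a (g p) b w) i = 0" if "i < a" for i
      using rais_power_bound[of a "diag (g p) ((lowering ^^ b) w)" i] that by (simp add: ladder_word_def)
    fix j
    have "\<bar>fs (ladder_word a (g p) b w) (j + a)\<bar> \<le> sqrt (real (j + a)) ^ a * (\<bar>g p j\<bar> * \<bar>fs ((lowering ^^ b) w) j\<bar>)"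
      using rais_power_bound[of a "diag (g p) ((lowering ^^ b) w)" "j + a"] by (simp add: ladder_word_def abs_mult)
    also have "\<dots> \<le> (sqrt (1 + real a) * sqrt (1 + real j)) ^ a
        * (\<bar>g p j\<bar> * ((sqrt (1 + real b) * sqrt (1 + real j)) ^ b * \<bar>fs w (j + b)\<bar>))"
      by (intro mult_mono power_mono rt order_trans[OF low_power_bound] mult_left_mono mult_right_mono order_refl) auto
    also have "\<dots> = sqrt (1 + real a) ^ a * sqrt (1 + real b) ^ b * (\<bar>g p j\<bar> * sqrt (1 + real j) ^ (a + b)) * \<bar>fs w (j + b)\<bar>"
      by (simp add: power_mult_distrib power_add mult_ac)
    also have "\<bar>g p j\<bar> * sqrt (1 + real j) ^ (a + b) \<le> C"
    proof -
      have "sqrt (1 + real j) ^ (a + b) \<le> sqrt (1 + real j) ^ (2 * r)"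
        by (rule power_increasing[OF ab]) simp
      also have "\<dots> = (1 + real j) ^ r" by (simp add: power_mult)
      finally show ?thesis by (intro order_trans[OF mult_left_mono C]) auto
    qed
    finally show "\<bar>fs (ladder_word a (g p) b w) (j + a)\<bar> \<le> K * \<bar>fs w (j + b)\<bar>"
      by (simp add: K_def mult_left_mono mult_right_mono)
  qed
  then show ?thesis by (auto simp: uniformly_bounded_def linear_ladder_word)
qed

lemma low_diag: "lowering (diag g w) = diag g (lowering w) + diag (\<lambda>i. g (Suc i) - g i) (lowering w)"
  by (rule fseq_eqI) (simp add: algebra_simps)

lemma diag_rais: "diag g (raising w) = raising (diag g w) + raising (diag (\<lambda>i. g (Suc i) - g i) w)"
proof (rule fseq_eqI)
  show "fs (diag g (raising w)) i = fs (raising (diag g w) + raising (diag (\<lambda>i. g (Suc i) - g i) w)) i" for i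
    by (cases i) (simp_all add: algebra_simps)
qed

lemma linear_rais_power: "(raising ^^ a) (f + g) = (raising ^^ a) f + (raising ^^ a) g"
  "(raising ^^ a) (f - g) = (raising ^^ a) f - (raising ^^ a) g"
  "(raising ^^ a) (c *\<^sub>R f) = c *\<^sub>R (raising ^^ a) f"
  using linear_add linear_diff linear_scale linear_funpow[OF linear_ops(2)] by blast+

lemma commutator_low_ladder_word:
  "commutator lowering (ladder_word a g b) w =
     ladder_word a (\<lambda>i. g (Suc i) - g i) (Suc b) w + real a *\<^sub>R ladder_word (a - 1) g b w"
proof -
  have "lowering ((raising ^^ a) y) = (raising ^^ a) (lowering y) + (real a * 1) *\<^sub>R (raising ^^ (a - 1)) y" for y
    by (rule commute_power[OF linear_ops(2)]) (simp add: low_rais)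
  then show ?thesis
    by (simp add: commutator_def ladder_word_def low_diag linear_rais_power funpow_swap1)
qed

lemma commutator_rais_ladder_word:
  "commutator raising (ladder_word a g b) w =
     - 1 *\<^sub>R ladder_word (Suc a) (\<lambda>i. g (Suc i) - g i) b w + (- real b) *\<^sub>R ladder_word a g (b - 1) w"
proof -
  have "raising ((lowering ^^ b) w) = (lowering ^^ b) (raising w) + (real b * - 1) *\<^sub>R (lowering ^^ (b - 1)) w"
    by (rule commute_power[OF linear_ops(1)]) (simp add: low_rais)
  then have "(lowering ^^ b) (raising w) = raising ((lowering ^^ b) w) + real b *\<^sub>R (lowering ^^ (b - 1)) w" by simp
  then show ?thesis
    by (simp add: commutator_def ladder_word_def diag_rais linear_rais_power funpow_swap1
        linear_add[OF linear_ops(3)] linear_scale[OF linear_ops(3)])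
qed

lemma commutator_XR:
  assumes "linear T"
  shows "commutator X_op T w = (1 / sqrt 2) *\<^sub>R (commutator raising T w + commutator lowering T w)"
    "commutator R_op T w = (1 / sqrt 2) *\<^sub>R (commutator lowering T w + (- 1) *\<^sub>R commutator raising T w)"
  by (simp_all add: commutator_def X_op_def R_op_def linear_add[OF assms] linear_diff[OF assms]
      linear_scale[OF assms] algebra_simps)

text \<open>The balance a + b <= 2 r survives commutators: one more letter comes with one more order
  of decay of the differenced \<open>g\<close>, which would pay for two.\<close>

lemma admissible_ladder_word:
  "symbol r g \<Longrightarrow> a + b \<le> 2 * r \<Longrightarrow> admissible {X_op, R_op} l (\<lambda>p. ladder_word a (g p) b)"
proof (induction l arbitrary: r g a b)
  case 0
  then show ?case using ladder_word_bounded[of 0 r g a b] unfolding symbol_def by (auto simp del: symbol_upto.simps)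
next
  case (Suc l)
  have lin: "\<And>P. P \<in> {X_op, R_op} \<Longrightarrow> linear P" using linear_XR by auto
  let ?d = "\<lambda>p i. g p (Suc i) - g p i"
  have d: "symbol (Suc r) ?d" by (rule symbol_diff[OF Suc.prems(1)])
  have 1: "admissible {X_op, R_op} l (\<lambda>p. commutator lowering (ladder_word a (g p) b))"
    unfolding commutator_low_ladder_word[abs_def]
    by (intro admissible_add admissible_scale lin Suc.IH[OF d] Suc.IH[OF Suc.prems(1)]) (use Suc.prems in auto)
  have 2: "admissible {X_op, R_op} l (\<lambda>p. commutator raising (ladder_word a (g p) b))"
    unfolding commutator_rais_ladder_word[abs_def]
    by (intro admissible_add admissible_scale lin Suc.IH[OF d] Suc.IH[OF Suc.prems(1)]) (use Suc.prems in auto)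
  have "admissible {X_op, R_op} l (\<lambda>p. commutator P (ladder_word a (g p) b))" if "P \<in> {X_op, R_op}" for P
    using that
  proof (elim insertE emptyE)
    assume "P = X_op"
    then show ?thesis
      unfolding \<open>P = X_op\<close> commutator_XR(1)[OF linear_ladder_word, abs_def]
      by (intro admissible_add admissible_scale lin 1 2)
  next
    assume "P = R_op"
    then show ?thesis
      unfolding \<open>P = R_op\<close> commutator_XR(2)[OF linear_ladder_word, abs_def]
      by (intro admissible_add admissible_scale lin 1 2)
  qed
  moreover have "uniformly_bounded (\<lambda>p. ladder_word a (g p) b)"
    using ladder_word_bounded Suc.prems unfolding symbol_def by blast
  ultimately show ?case by simp
qed

lemma order_zero_ladder_word:
  "symbol r g \<Longrightarrow> a + b \<le> 2 * r \<Longrightarrow> order_zero {X_op, R_op} (\<lambda>p. ladder_word a (g p) b)"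
  unfolding order_zero_def using admissible_ladder_word linear_XR by blast

text \<open>The factor \<open>((p + 1) / (p + 1 + i))^r\<close> makes the weight decay faster than the growth of the
  sequences; it tends to \<open>1\<close> as \<open>p\<close> tends to infinity, and all estimates are uniform in \<open>p\<close>.\<close>

definition weight :: "nat \<Rightarrow> nat \<Rightarrow> nat \<Rightarrow> nat \<Rightarrow> real" where
  "weight s r p i = (1 + real i) ^ s * ((1 + real p) / (1 + real p + real i)) ^ r"

text \<open>Quotient of the weights at \<open>Suc i\<close> and \<open>i\<close>, minus one;
  \<open>down_ratio\<close> belongs to the reverse quotient. Subtracting one leaves a symbol of
  order 1, which outweighs the single ladder letter that it will accompany.\<close>

definition up_ratio :: "nat \<Rightarrow> nat \<Rightarrow> nat \<Rightarrow> nat \<Rightarrow> real" where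
  "up_ratio s r p i = (1 + 1 / (1 + real i)) ^ s * (1 - 1 / (2 + real p + real i)) ^ r - 1"

definition down_ratio :: "nat \<Rightarrow> nat \<Rightarrow> nat \<Rightarrow> nat \<Rightarrow> real" where
  "down_ratio s r p i = (1 - 1 / (2 + real i)) ^ s * (1 + 1 / (1 + real p + real i)) ^ r - 1"

lemma symbol_ratios: "symbol 1 (up_ratio s r)" "symbol 1 (down_ratio s r)"
proof -
  have a: "symbol 1 (\<lambda>(p::nat) i. 1 / (1 + real i))" using symbol_inverse_linear[of 0 0] by simp
  have b: "symbol 1 (\<lambda>(p::nat) i. - (1 / (2 + real p + real i)))"
    using symbol_uminus[OF symbol_inverse_linear[of 1 1]] by (simp add: add_ac)
  have c: "symbol 1 (\<lambda>(p::nat) i. - (1 / (2 + real i)))"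
    using symbol_uminus[OF symbol_inverse_linear[of 0 1]] by simp
  have d: "symbol 1 (\<lambda>(p::nat) i. 1 / (1 + real p + real i))"
    using symbol_inverse_linear[of 1 0] by (simp add: add_ac)
  show "symbol 1 (up_ratio s r)"
    using symbol_mult_minus_one[OF symbol_power_minus_one[OF a, of s] symbol_power_minus_one[OF b, of r]]
    by (simp add: up_ratio_def[abs_def])
  show "symbol 1 (down_ratio s r)"
    using symbol_mult_minus_one[OF symbol_power_minus_one[OF c, of s] symbol_power_minus_one[OF d, of r]]
    by (simp add: down_ratio_def[abs_def])
qed

lemma weight_pos: "weight s r p i > 0"
  by (simp add: weight_def)

lemma weight_ratios:
  "weight s r p (Suc i) = (1 + up_ratio s r p i) * weight s r p i"
  "weight s r p i = (1 + down_ratio s r p i) * weight s r p (Suc i)"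
proof -
  have u: "1 + 1 / (1 + real i) = (1 + real (Suc i)) / (1 + real i)"
    "1 - 1 / (2 + real p + real i) = (1 + real p + real i) / (1 + real p + real (Suc i))"
    "1 - 1 / (2 + real i) = (1 + real i) / (1 + real (Suc i))"
    "1 + 1 / (1 + real p + real i) = (1 + real p + real (Suc i)) / (1 + real p + real i)"
    by (simp_all add: field_simps)
  have pos: "1 + real i > 0" "1 + real (Suc i) > 0" "1 + real p + real i > 0" "1 + real p + real (Suc i) > 0" by auto
  show "weight s r p (Suc i) = (1 + up_ratio s r p i) * weight s r p i"
    "weight s r p i = (1 + down_ratio s r p i) * weight s r p (Suc i)"
    unfolding up_ratio_def down_ratio_def weight_def u power_divide using pos
    by (simp_all add: field_simps del: of_nat_Suc)
qed

section \<open>Conjugation by the weights\<close>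

abbreviation "inv_sqrt2 \<equiv> 1 / sqrt 2 :: real"

text \<open>\<open>X_pert\<close> and \<open>R_pert\<close> are what conjugation by the weight adds
  to \<open>X_op\<close> and \<open>R_op\<close>. Taking adjoints exchanges raising and lowering
  letters but keeps the diagonal factors, so the primed versions have the two ratios
  swapped.\<close>

definition X_pert where "X_pert s r p w = inv_sqrt2 *\<^sub>R (ladder_word 1 (up_ratio s r p) 0 w + ladder_word 0 (down_ratio s r p) 1 w)"
definition X_pert' where "X_pert' s r p w = inv_sqrt2 *\<^sub>R (ladder_word 1 (down_ratio s r p) 0 w + ladder_word 0 (up_ratio s r p) 1 w)"
definition R_pert where "R_pert s r p w = inv_sqrt2 *\<^sub>R (ladder_word 0 (down_ratio s r p) 1 w + (- 1) *\<^sub>R ladder_word 1 (up_ratio s r p) 0 w)"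
definition R_pert' where "R_pert' s r p w = inv_sqrt2 *\<^sub>R (ladder_word 0 (up_ratio s r p) 1 w + (- 1) *\<^sub>R ladder_word 1 (down_ratio s r p) 0 w)"

lemma order_zero_pert:
  "order_zero {X_op, R_op} (X_pert s r)" "order_zero {X_op, R_op} (X_pert' s r)"
  "order_zero {X_op, R_op} (R_pert s r)" "order_zero {X_op, R_op} (R_pert' s r)"
proof -
  have "order_zero {X_op, R_op} (\<lambda>p. ladder_word 1 (up_ratio s r p) 0)"
    "order_zero {X_op, R_op} (\<lambda>p. ladder_word 0 (up_ratio s r p) 1)"
    "order_zero {X_op, R_op} (\<lambda>p. ladder_word 1 (down_ratio s r p) 0)"
    "order_zero {X_op, R_op} (\<lambda>p. ladder_word 0 (down_ratio s r p) 1)"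
    using order_zero_ladder_word[OF symbol_ratios(1)] order_zero_ladder_word[OF symbol_ratios(2)] by simp_all
  note ladder = this
  show "order_zero {X_op, R_op} (X_pert s r)"
    unfolding X_pert_def[abs_def] by (intro order_zero_scale order_zero_add ladder)
  show "order_zero {X_op, R_op} (X_pert' s r)"
    unfolding X_pert'_def[abs_def] by (intro order_zero_scale order_zero_add ladder)
  show "order_zero {X_op, R_op} (R_pert s r)"
    unfolding R_pert_def[abs_def] by (intro order_zero_scale order_zero_add ladder)
  show "order_zero {X_op, R_op} (R_pert' s r)"
    unfolding R_pert'_def[abs_def] by (intro order_zero_scale order_zero_add ladder)
qed

text \<open>An intertwining relation in place of conjugation, so that inverse weights never
  occur.\<close>

lemma diag_weight_low:
  "diag (weight s r p) (lowering w) = lowering (diag (weight s r p) w) + ladder_word 0 (down_ratio s r p) 1 (diag (weight s r p) w)"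
proof (rule fseq_eqI)
  fix i
  show "fs (diag (weight s r p) (lowering w)) i =
    fs (lowering (diag (weight s r p) w) + ladder_word 0 (down_ratio s r p) 1 (diag (weight s r p) w)) i"
    unfolding fs_simps fs_ops ladder_word_def funpow_0 funpow.simps(1) One_nat_def funpow.simps(2) o_def id_def
      weight_ratios(2)[of s r p i] by algebra
qed

lemma diag_weight_rais:
  "diag (weight s r p) (raising w) = raising (diag (weight s r p) w) + ladder_word 1 (up_ratio s r p) 0 (diag (weight s r p) w)"
proof (rule fseq_eqI)
  fix i
  show "fs (diag (weight s r p) (raising w)) i =
    fs (raising (diag (weight s r p) w) + ladder_word 1 (up_ratio s r p) 0 (diag (weight s r p) w)) i"
  proof (cases i)
    case (Suc j)
    show ?thesis
      unfolding Suc fs_simps fs_ops ladder_word_def funpow_0 funpow.simps(1) One_nat_def funpow.simps(2) o_def id_def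
        diff_Suc_Suc diff_zero weight_ratios(1)[of s r p j] by algebra
  qed (simp add: ladder_word_def)
qed

lemma linear_diag: "diag g (f + k) = diag g f + diag g k" "diag g (f - k) = diag g f - diag g k"
  "diag g (c *\<^sub>R f) = c *\<^sub>R diag g f"
  using linear_add linear_diff linear_scale linear_ops(3) by blast+

lemma diag_weight_XR:
  "diag (weight s r p) (X_op w) = X_op (diag (weight s r p) w) + X_pert s r p (diag (weight s r p) w)"
  "diag (weight s r p) (R_op w) = R_op (diag (weight s r p) w) + R_pert s r p (diag (weight s r p) w)"
  by (simp_all add: X_op_def R_op_def X_pert_def R_pert_def linear_diag diag_weight_low diag_weight_rais
      algebra_simps)

lemma inner_X_pert: "inner (X_op f + X_pert s r p f) g = inner f (X_op g + X_pert' s r p g)"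
  by (simp add: inner_add_left inner_add_right fseq.X_adjoint X_pert_def X_pert'_def ladder_word_def
      inner_low inner_rais inner_diag)

lemma inner_R_pert: "inner (R_op f + R_pert s r p f) g = - inner f (R_op g + R_pert' s r p g)"
  by (simp add: inner_add_left inner_add_right inner_diff_left inner_diff_right fseq.R_adjoint
      R_pert_def R_pert'_def ladder_word_def inner_low inner_rais inner_diag algebra_simps)

lemma funpow_intertwine:
  assumes "\<And>w. D (f w) = f' (D w)"
  shows "D ((f ^^ n) w) = (f' ^^ n) (D w)"
  by (induction n) (auto simp: assms)

lemma inner_funpow:
  fixes f :: "'v::real_inner \<Rightarrow> 'v"
  assumes "\<And>u v. inner (f u) v = e * inner u (f' v)"
  shows "inner ((f ^^ n) u) v = e ^ n * inner u ((f' ^^ n) v)"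
  by (induction n arbitrary: v) (auto simp: assms funpow_swap1[of f'])

text \<open>Since Y = - \<i> R, the even powers of Y produce the signs (-1)^n and (-1)^k; skewness
  of \<open>R\<close> cancels them again in the quadratic form (\<open>inner_B_op\<close>).\<close>

definition B_op where
  "B_op h k m n lam mu nu sg X R w =
     lam *\<^sub>R (X ^^ (2 * h)) w
   + ((- 1) ^ n * mu) *\<^sub>R (X ^^ m) ((R ^^ (2 * n)) ((X ^^ m) w))
   + ((- 1) ^ n * nu) *\<^sub>R (R ^^ n) ((X ^^ (2 * m)) ((R ^^ n) w))
   + ((- 1) ^ k * sg) *\<^sub>R (R ^^ (2 * k)) w"

lemma inner_B_op:
  fixes X1 :: "fseq \<Rightarrow> fseq"
  assumes X: "\<And>u v. inner (X1 u) v = inner u (X2 v)" and R: "\<And>u v. inner (R1 u) v = - inner u (R2 v)"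
  shows "inner (B_op h k m n lam mu nu sg X1 R1 w) w =
    fseq.perturbed_form h k m n lam mu nu sg X1 X2 R1 R2 w"
proof -
  have x: "inner ((X1 ^^ j) u) v = inner u ((X2 ^^ j) v)" for j u v
    using inner_funpow[of X1 1 X2] X by simp
  have r: "inner ((R1 ^^ j) u) v = (- 1) ^ j * inner u ((R2 ^^ j) v)" for j u v
    using inner_funpow[of R1 "- 1" R2] R by simp
  have two: "(f ^^ (2 * j)) u = (f ^^ j) ((f ^^ j) u)" for f :: "fseq \<Rightarrow> fseq" and j u
    by (simp add: mult_2 funpow_add)
  have rr: "(- 1) ^ j * inner ((R1 ^^ j) u) v = inner u ((R2 ^^ j) v)" for j u v
    unfolding r by (simp add: mult.assoc[symmetric] power_mult_distrib[symmetric])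
  have "inner ((X1 ^^ (2 * h)) w) w = inner ((X1 ^^ h) w) ((X2 ^^ h) w)"
    unfolding two by (rule x)
  moreover have "(- 1) ^ n * inner ((X1 ^^ m) ((R1 ^^ (2 * n)) ((X1 ^^ m) w))) w =
      inner ((R1 ^^ n) ((X1 ^^ m) w)) ((R2 ^^ n) ((X2 ^^ m) w))"
    unfolding two x by (rule rr)
  moreover have "(- 1) ^ n * inner ((R1 ^^ n) ((X1 ^^ (2 * m)) ((R1 ^^ n) w))) w =
      inner ((X1 ^^ m) ((R1 ^^ n) w)) ((X2 ^^ m) ((R2 ^^ n) w))"
    unfolding rr two by (rule x)
  moreover have "(- 1) ^ k * inner ((R1 ^^ (2 * k)) w) w = inner ((R1 ^^ k) w) ((R2 ^^ k) w)"
    unfolding two by (rule rr)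
  moreover have "(e * c) * z = c * z'" if "e * z = z'" for e c z z' :: real
    using that by (simp add: mult_ac)
  ultimately show ?thesis
    unfolding B_op_def fseq.perturbed_form_def by (simp only: inner_add_left inner_scaleR_left)
qed

lemma diag_weight_B_op:
  "diag (weight s r p) (B_op h k m n lam mu nu sg X_op R_op w) =
   B_op h k m n lam mu nu sg (\<lambda>w. X_op w + X_pert s r p w) (\<lambda>w. R_op w + R_pert s r p w) (diag (weight s r p) w)"
proof -
  have x: "diag (weight s r p) ((X_op ^^ j) u) = ((\<lambda>w. X_op w + X_pert s r p w) ^^ j) (diag (weight s r p) u)" for j u
    by (rule funpow_intertwine) (rule diag_weight_XR)
  have r: "diag (weight s r p) ((R_op ^^ j) u) = ((\<lambda>w. R_op w + R_pert s r p w) ^^ j) (diag (weight s r p) u)" for j u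
    by (rule funpow_intertwine) (rule diag_weight_XR)
  show ?thesis unfolding B_op_def by (simp add: linear_diag x r)
qed

text \<open>Only \<open>lowering\<close> is kept, because the square of its norm is the diagonal
  form with entries \<open>i\<close>. Its growth later absorbs the multiple of |w|^2 lost in the
  Garding estimate, up to finitely many indices.\<close>

lemma norm_XR_eq_low: "(norm (lowering w))\<^sup>2 \<le> (norm (X_op w))\<^sup>2 + (norm (R_op w))\<^sup>2"
proof -
  have "(norm (X_op w))\<^sup>2 + (norm (R_op w))\<^sup>2 = (norm (lowering w))\<^sup>2 + (norm (raising w))\<^sup>2"
    unfolding power2_norm_eq_inner X_op_def R_op_def
    by (simp add: inner_add_left inner_add_right inner_diff_left inner_diff_right field_simps)
  then show ?thesis by simp
qed

section \<open>Coercivity on finite sequences, with and without weight\<close>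

context
  fixes h k m n :: nat and lam mu nu sg :: real
  assumes hk: "0 < h" "0 < k" and mn: "m < h" "n < k"
    and coeffs: "0 < lam" "0 < sg" "0 \<le> mu" "0 \<le> nu"
begin

abbreviation "BV \<equiv> B_op h k m n lam mu nu sg X_op R_op"

lemma weighted_coercivity:
  "\<exists>c>0. \<exists>C. \<forall>p w. c * (norm (lowering (diag (weight s r p) w)))\<^sup>2 - C * (norm (diag (weight s r p) w))\<^sup>2
     \<le> inner (diag (weight s r p) (BV w)) (diag (weight s r p) w)"
proof -
  obtain C where C: "\<And>p w. fseq.perturbed_form h k m n lam mu nu sg (\<lambda>w. X_op w + X_pert s r p w) (\<lambda>w. X_op w + X_pert' s r p w)
      (\<lambda>w. R_op w + R_pert s r p w) (\<lambda>w. R_op w + R_pert' s r p w) w \<ge> fseq.energy h k m n lam mu nu sg w / 2 - C * (norm w)\<^sup>2"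
    using fseq.garding[OF hk mn coeffs order_zero_pert] by blast
  obtain c where c: "c > 0" "\<And>w. c * ((norm (X_op w))\<^sup>2 + (norm (R_op w))\<^sup>2) \<le> fseq.energy h k m n lam mu nu sg w"
    using fseq.energy_coercive[OF hk mn coeffs] by blast
  have "c / 2 * (norm (lowering (diag (weight s r p) w)))\<^sup>2 - C * (norm (diag (weight s r p) w))\<^sup>2
     \<le> inner (diag (weight s r p) (BV w)) (diag (weight s r p) w)" for p w
  proof -
    let ?w = "diag (weight s r p) w"
    have "c * (norm (lowering ?w))\<^sup>2 \<le> c * ((norm (X_op ?w))\<^sup>2 + (norm (R_op ?w))\<^sup>2)"
      using c(1) norm_XR_eq_low by (intro mult_left_mono) auto
    also have "\<dots> \<le> fseq.energy h k m n lam mu nu sg ?w" by (rule c)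
    finally show ?thesis
      using C[of ?w p] unfolding diag_weight_B_op inner_B_op[OF inner_X_pert[of _ s r p] inner_R_pert[of _ s r p]] by simp
  qed
  then show ?thesis using c(1) by (intro exI[of _ "c / 2"] conjI exI[of _ C]) auto
qed

text \<open>Without weights there is no perturbation and thus no loss: the form is exactly the
  energy. This is uniqueness in quantitative form, used to remove the low coefficients from the
  right-hand side.\<close>

lemma coercivity: "\<exists>c>0. \<forall>w. c * (norm w)\<^sup>2 \<le> inner (BV w) w"
proof -
  obtain c where c: "c > 0" "\<And>w. c * ((norm (X_op w))\<^sup>2 + (norm (R_op w))\<^sup>2) \<le> fseq.energy h k m n lam mu nu sg w"
    using fseq.energy_coercive[OF hk mn coeffs] by blast
  have "c * (norm w)\<^sup>2 \<le> inner (BV w) w" for w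
  proof -
    have "c * (norm w)\<^sup>2 \<le> c * ((norm (X_op w))\<^sup>2 + (norm (R_op w))\<^sup>2)"
      using c(1) fseq.norm_le_X_R by (intro mult_left_mono) auto
    also have "\<dots> \<le> fseq.energy h k m n lam mu nu sg w" by (rule c)
    also have "\<dots> = inner (BV w) w"
      using inner_B_op[OF fseq.X_adjoint fseq.R_adjoint, where h = h and k = k and m = m and n = n
          and lam = lam and mu = mu and nu = nu and sg = sg and w = w]
      by (simp add: fseq.perturbed_form_def fseq.energy_def power2_norm_eq_inner)
    finally show ?thesis .
  qed
  then show ?thesis using c(1) by blast
qed

end

section \<open>Regularity on sequences of polynomial growth\<close>

definition X_seq :: "(nat \<Rightarrow> real) \<Rightarrow> nat \<Rightarrow> real" where
  "X_seq v = (\<lambda>i. inv_sqrt2 * (sqrt (real i) * v (i - 1) + sqrt (real (Suc i)) * v (Suc i)))"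

definition R_seq :: "(nat \<Rightarrow> real) \<Rightarrow> nat \<Rightarrow> real" where
  "R_seq v = (\<lambda>i. inv_sqrt2 * (sqrt (real (Suc i)) * v (Suc i) - sqrt (real i) * v (i - 1)))"

definition B_seq where
  "B_seq h k m n lam mu nu sg v = (\<lambda>i.
     lam * (X_seq ^^ (2 * h)) v i
   + (- 1) ^ n * mu * (X_seq ^^ m) ((R_seq ^^ (2 * n)) ((X_seq ^^ m) v)) i
   + (- 1) ^ n * nu * (R_seq ^^ n) ((X_seq ^^ (2 * m)) ((R_seq ^^ n) v)) i
   + (- 1) ^ k * sg * (R_seq ^^ (2 * k)) v i)"

lemma fs_B_op: "fs (B_op h k m n lam mu nu sg X_op R_op w) = B_seq h k m n lam mu nu sg (fs w)"
proof -
  have x: "fs ((X_op ^^ j) u) = (X_seq ^^ j) (fs u)" for j u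
    by (rule funpow_intertwine[where D = fs]) (simp add: fun_eq_iff X_op_def X_seq_def)
  have r: "fs ((R_op ^^ j) u) = (R_seq ^^ j) (fs u)" for j u
    by (rule funpow_intertwine[where D = fs]) (simp add: fun_eq_iff R_op_def R_seq_def)
  show ?thesis by (intro ext) (simp add: B_op_def B_seq_def x r)
qed

lift_definition trunc :: "nat \<Rightarrow> (nat \<Rightarrow> real) \<Rightarrow> fseq" is "\<lambda>n v i. if i < n then v i else 0"
  by (rule finite_subset[of _ "{..<_}"]) (auto split: if_splits)

lemma fs_trunc [simp]: "fs (trunc n v) i = (if i < n then v i else 0)"
  by (transfer, simp)

text \<open>Suited to banded matrices: each entry of the image involves finitely many entries, so
  applying \<open>B\<close> to longer and longer truncations reproduces every entry of
  \<open>B v\<close> exactly from some point on.\<close>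

definition stabilizes :: "(nat \<Rightarrow> nat \<Rightarrow> real) \<Rightarrow> (nat \<Rightarrow> real) \<Rightarrow> bool" where
  "stabilizes u v \<longleftrightarrow> (\<forall>i. \<forall>\<^sub>F n in sequentially. u n i = v i)"

lemma stabilizes_XR:
  assumes "stabilizes u v"
  shows "stabilizes (\<lambda>n. X_seq (u n)) (X_seq v)" "stabilizes (\<lambda>n. R_seq (u n)) (R_seq v)"
proof -
  have *: "\<forall>\<^sub>F n in sequentially. u n (i - 1) = v (i - 1) \<and> u n (Suc i) = v (Suc i)" for i
    using assms by (auto simp: stabilizes_def intro: eventually_conj)
  show "stabilizes (\<lambda>n. X_seq (u n)) (X_seq v)"
    unfolding stabilizes_def X_seq_def
  proof
    show "\<forall>\<^sub>F n in sequentially. inv_sqrt2 * (sqrt (real i) * u n (i - 1) + sqrt (real (Suc i)) * u n (Suc i)) =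
      inv_sqrt2 * (sqrt (real i) * v (i - 1) + sqrt (real (Suc i)) * v (Suc i))" for i
      using *[of i] by eventually_elim simp
  qed
  show "stabilizes (\<lambda>n. R_seq (u n)) (R_seq v)"
    unfolding stabilizes_def R_seq_def
  proof
    show "\<forall>\<^sub>F n in sequentially. inv_sqrt2 * (sqrt (real (Suc i)) * u n (Suc i) - sqrt (real i) * u n (i - 1)) =
      inv_sqrt2 * (sqrt (real (Suc i)) * v (Suc i) - sqrt (real i) * v (i - 1))" for i
      using *[of i] by eventually_elim simp
  qed
qed

lemma stabilizes_funpow:
  assumes "stabilizes u v"
  shows "stabilizes (\<lambda>n. (X_seq ^^ j) (u n)) ((X_seq ^^ j) v)" "stabilizes (\<lambda>n. (R_seq ^^ j) (u n)) ((R_seq ^^ j) v)"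
  using assms by (induction j) (auto intro: stabilizes_XR)

lemma stabilizes_add: "stabilizes u v \<Longrightarrow> stabilizes u' v' \<Longrightarrow> stabilizes (\<lambda>n i. u n i + u' n i) (\<lambda>i. v i + v' i)"
  unfolding stabilizes_def
proof
  fix i assume "\<forall>i. \<forall>\<^sub>F n in sequentially. u n i = v i" "\<forall>i. \<forall>\<^sub>F n in sequentially. u' n i = v' i"
  then have "\<forall>\<^sub>F n in sequentially. u n i = v i" "\<forall>\<^sub>F n in sequentially. u' n i = v' i" by auto
  then show "\<forall>\<^sub>F n in sequentially. u n i + u' n i = v i + v' i" by eventually_elim simp
qed

lemma stabilizes_scale: "stabilizes u v \<Longrightarrow> stabilizes (\<lambda>n i. c * u n i) (\<lambda>i. c * v i)"
  unfolding stabilizes_def by (auto elim: eventually_mono)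

lemma stabilizes_B: "stabilizes u v \<Longrightarrow> stabilizes (\<lambda>l. B_seq h k m n lam mu nu sg (u l)) (B_seq h k m n lam mu nu sg v)"
  unfolding B_seq_def by (intro stabilizes_add stabilizes_scale stabilizes_funpow)

lemma stabilizes_trunc: "stabilizes (\<lambda>n. fs (trunc n v)) v"
  unfolding stabilizes_def
proof
  show "\<forall>\<^sub>F n in sequentially. fs (trunc n v) i = v i" for i
    using eventually_gt_at_top[of i] by eventually_elim simp
qed

text \<open>The bound is uniform in the truncation index \<open>n\<close>, as dominated convergence
  requires.\<close>

definition grows :: "nat \<Rightarrow> (nat \<Rightarrow> nat \<Rightarrow> real) \<Rightarrow> bool" where
  "grows M u \<longleftrightarrow> (\<exists>C. \<forall>n i. \<bar>u n i\<bar> \<le> C * (1 + real i) ^ M)"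

lemma growsE:
  assumes "grows M u"
  obtains C where "C \<ge> 0" "\<And>n i. \<bar>u n i\<bar> \<le> C * (1 + real i) ^ M"
proof -
  obtain C where C: "\<And>n i. \<bar>u n i\<bar> \<le> C * (1 + real i) ^ M" using assms by (auto simp: grows_def)
  have "0 \<le> C" using order_trans[OF abs_ge_zero C[of 0 0]] by simp
  then show ?thesis using that C by blast
qed

lemma grows_weaken: "grows M u \<Longrightarrow> M \<le> M' \<Longrightarrow> grows M' u"
proof (elim growsE)
  fix C assume "M \<le> M'" "C \<ge> 0" and C: "\<And>n i. \<bar>u n i\<bar> \<le> C * (1 + real i) ^ M"
  then have "C * (1 + real i) ^ M \<le> C * (1 + real i) ^ M'" for i
    by (intro mult_left_mono power_increasing) auto
  then show ?thesis unfolding grows_def using C by (meson order_trans)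
qed

lemma grows_add: "grows M u \<Longrightarrow> grows M v \<Longrightarrow> grows M (\<lambda>n i. u n i + v n i)"
proof (elim growsE)
  fix C D assume C: "\<And>n i. \<bar>u n i\<bar> \<le> C * (1 + real i) ^ M" and D: "\<And>n i. \<bar>v n i\<bar> \<le> D * (1 + real i) ^ M"
  have "\<bar>u n i + v n i\<bar> \<le> (C + D) * (1 + real i) ^ M" for n i
    using C[of n i] D[of n i] by (simp add: distrib_right)
  then show ?thesis by (auto simp: grows_def)
qed

lemma grows_scale: "grows M u \<Longrightarrow> grows M (\<lambda>n i. c * u n i)"
proof (elim growsE)
  fix C assume C: "\<And>n i. \<bar>u n i\<bar> \<le> C * (1 + real i) ^ M"
  have "\<bar>c * u n i\<bar> \<le> (\<bar>c\<bar> * C) * (1 + real i) ^ M" for n i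
    using mult_left_mono[OF C[of n i], of "\<bar>c\<bar>"] by (simp add: abs_mult mult.assoc)
  then show ?thesis by (auto simp: grows_def)
qed

lemma grows_XR:
  assumes "grows M u"
  shows "grows (Suc M) (\<lambda>n. X_seq (u n))" "grows (Suc M) (\<lambda>n. R_seq (u n))"
proof -
  obtain C where C: "C \<ge> 0" "\<And>n i. \<bar>u n i\<bar> \<le> C * (1 + real i) ^ M" using growsE[OF assms] by blast
  have sqrt_le: "sqrt x \<le> 1 + x" if "0 \<le> x" for x :: real
    using that by (intro real_le_lsqrt) (auto simp: power2_eq_square algebra_simps)
  have "grows (Suc M) (\<lambda>n i. sqrt (real i) * u n (i - 1))"
    unfolding grows_def
  proof (intro exI allI)
    fix n i
    have "\<bar>sqrt (real i) * u n (i - 1)\<bar> \<le> (1 + real i) * (C * (1 + real (i - 1)) ^ M)"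
      unfolding abs_mult using C sqrt_le[of "real i"] by (intro mult_mono) auto
    also have "\<dots> \<le> (1 + real i) * (C * (1 + real i) ^ M)"
      using C by (intro mult_left_mono power_mono) auto
    finally show "\<bar>sqrt (real i) * u n (i - 1)\<bar> \<le> C * (1 + real i) ^ Suc M" by (simp add: mult_ac)
  qed
  moreover have "grows (Suc M) (\<lambda>n i. sqrt (real (Suc i)) * u n (Suc i))"
    unfolding grows_def
  proof (intro exI allI)
    fix n i
    have "\<bar>sqrt (real (Suc i)) * u n (Suc i)\<bar> \<le> (1 + real (Suc i)) * (C * (1 + real (Suc i)) ^ M)"
      unfolding abs_mult using C(1) C(2)[of n "Suc i"] sqrt_le[of "real (Suc i)"] by (intro mult_mono) auto
    also have "\<dots> = C * (1 + real (Suc i)) ^ Suc M" by simp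
    also have "\<dots> \<le> C * (2 * (1 + real i)) ^ Suc M"
      using C by (intro mult_left_mono power_mono) auto
    finally show "\<bar>sqrt (real (Suc i)) * u n (Suc i)\<bar> \<le> (C * 2 ^ Suc M) * (1 + real i) ^ Suc M"
      by (simp only: power_mult_distrib mult.assoc)
  qed
  ultimately have *: "grows (Suc M) (\<lambda>n i. sqrt (real i) * u n (i - 1))"
    "grows (Suc M) (\<lambda>n i. sqrt (real (Suc i)) * u n (Suc i))" by auto
  show "grows (Suc M) (\<lambda>n. X_seq (u n))"
    unfolding X_seq_def by (intro grows_scale grows_add *)
  show "grows (Suc M) (\<lambda>n. R_seq (u n))"
    unfolding R_seq_def using grows_scale[OF grows_add[OF *(2) grows_scale[OF *(1), of "- 1"]], of inv_sqrt2] by simp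
qed

lemma grows_funpow:
  assumes "grows M u"
  shows "grows (M + j) (\<lambda>n. (X_seq ^^ j) (u n))" "grows (M + j) (\<lambda>n. (R_seq ^^ j) (u n))"
  using assms by (induction j) (auto intro: grows_XR)

lemma grows_B:
  assumes u: "grows M u"
  shows "grows (M + (2 * h + 2 * k + 2 * m + 2 * n)) (\<lambda>l. B_seq h k m n lam mu nu sg (u l))"
proof -
  have "grows (M + 2 * h) (\<lambda>l. (X_seq ^^ (2 * h)) (u l))" by (intro grows_funpow u)
  moreover have "grows (M + m + 2 * n + m) (\<lambda>l. (X_seq ^^ m) ((R_seq ^^ (2 * n)) ((X_seq ^^ m) (u l))))"
    by (intro grows_funpow u)
  moreover have "grows (M + n + 2 * m + n) (\<lambda>l. (R_seq ^^ n) ((X_seq ^^ (2 * m)) ((R_seq ^^ n) (u l))))"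
    by (intro grows_funpow u)
  moreover have "grows (M + 2 * k) (\<lambda>l. (R_seq ^^ (2 * k)) (u l))" by (intro grows_funpow u)
  ultimately show ?thesis
    unfolding B_seq_def by (intro grows_add grows_scale; elim grows_weaken; simp)
qed

lemma grows_trunc:
  assumes "\<And>i. \<bar>v i\<bar> \<le> C * (1 + real i) ^ M"
  shows "grows M (\<lambda>n. fs (trunc n v))"
  unfolding grows_def
proof (intro exI allI)
  fix n i
  have "0 \<le> C * (1 + real i) ^ M" using order_trans[OF abs_ge_zero assms] .
  then show "\<bar>fs (trunc n v) i\<bar> \<le> C * (1 + real i) ^ M" using assms[of i] by simp
qed

lemma summable_inverse_square: "summable (\<lambda>i. 1 / (1 + real i)\<^sup>2)"
  using inverse_squares_sums by (simp add: sums_iff add.commute)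

lemma norm_diag_trunc: "(norm (diag g (trunc n v)))\<^sup>2 = (\<Sum>i<n. (g i * v i)\<^sup>2)"
proof -
  have "(norm (diag g (trunc n v)))\<^sup>2 = (\<Sum>i\<in>{..<n}. fs (diag g (trunc n v)) i * fs (diag g (trunc n v)) i)"
    unfolding power2_norm_eq_inner inner_fseq_def by (rule suminf_finite) auto
  then show ?thesis by (simp add: power2_eq_square)
qed

lemma norm_low_diag_trunc: "(norm (lowering (diag g (trunc n v))))\<^sup>2 = (\<Sum>i<n. real i * (g i * v i)\<^sup>2)"
proof -
  let ?w = "diag g (trunc n v)"
  have rl: "fs (raising (lowering w)) i = real i * fs w i" for w i
    by (cases i) (simp_all add: mult.assoc[symmetric])
  have "(norm (lowering ?w))\<^sup>2 = inner ?w (raising (lowering ?w))"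
    by (simp only: power2_norm_eq_inner inner_low)
  also have "\<dots> = (\<Sum>i. fs ?w i * fs (raising (lowering ?w)) i)" by (rule inner_fseq_def)
  also have "\<dots> = (\<Sum>i\<in>{..<n}. fs ?w i * fs (raising (lowering ?w)) i)"
    by (rule suminf_finite) auto
  finally show ?thesis unfolding rl by (simp add: power2_eq_square mult_ac)
qed

lemma weighted_square:
  fixes x f :: real
  assumes "0 < x"
  shows "(x ^ s * f)\<^sup>2 = (\<bar>f\<bar> * x ^ (s + 1))\<^sup>2 * (1 / x\<^sup>2)"
proof -
  have "(\<bar>f\<bar> * x ^ (s + 1))\<^sup>2 = (x ^ s * f)\<^sup>2 * x\<^sup>2"
    by (simp only: power_mult_distrib power2_abs power_add power_one_right mult_ac)
  then show ?thesis using assms by simp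
qed

lemma weight_le: "weight s r p i \<le> (1 + real i) ^ s"
proof -
  have "((1 + real p) / (1 + real p + real i)) ^ r \<le> 1" by (intro power_le_one) auto
  then show ?thesis unfolding weight_def by (intro mult_left_le) auto
qed

text \<open>For fixed \<open>p\<close> the exponent \<open>s + d\<close> of the regularizing factor
  beats (1 + i)^s by \<open>d\<close> powers. The constant blows up with \<open>p\<close>, so this
  serves convergence only and never enters the final bounds.\<close>

lemma weight_decay: "weight s (s + d) p i * (1 + real i) ^ d \<le> (1 + real p) ^ (s + d)"
proof -
  have "((1 + real p) / (1 + real p + real i)) ^ (s + d) \<le> ((1 + real p) / (1 + real i)) ^ (s + d)"
    by (intro power_mono divide_left_mono) auto
  then have "weight s (s + d) p i * (1 + real i) ^ d \<le> (1 + real i) ^ s * ((1 + real p) / (1 + real i)) ^ (s + d) * (1 + real i) ^ d"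
    unfolding weight_def by (intro mult_right_mono mult_left_mono) auto
  also have "\<dots> = (1 + real p) ^ (s + d)"
    by (simp add: power_divide power_add)
  finally show ?thesis .
qed

lemma weight_tendsto: "(\<lambda>p. weight s r p i) \<longlonglongrightarrow> (1 + real i) ^ s"
proof -
  have "(\<lambda>p. (1 + real p) / (1 + real p + real i)) \<longlonglongrightarrow> 1"
  proof -
    have "(\<lambda>p. real i / (1 + real i + real p)) \<longlonglongrightarrow> 0"
      by (intro tendsto_divide_0[OF tendsto_const] filterlim_at_top_imp_at_infinity
          filterlim_tendsto_add_at_top[OF tendsto_const] filterlim_real_sequentially)
    then have "(\<lambda>p. 1 - real i / (1 + real i + real p)) \<longlonglongrightarrow> 1 - 0" by (intro tendsto_intros)
    moreover have "1 - real i / (1 + real i + real p) = (1 + real p) / (1 + real p + real i)" for p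
      by (simp add: field_simps)
    ultimately show ?thesis by simp
  qed
  then have "(\<lambda>p. weight s r p i) \<longlonglongrightarrow> (1 + real i) ^ s * 1 ^ r"
    unfolding weight_def by (intro tendsto_intros)
  then show ?thesis by simp
qed

definition rapidly_decreasing :: "(nat \<Rightarrow> real) \<Rightarrow> bool" where
  "rapidly_decreasing f \<longleftrightarrow> (\<forall>t. \<exists>C. \<forall>i. \<bar>f i\<bar> * (1 + real i) ^ t \<le> C)"

lemma rapidly_decreasing_summable:
  assumes "rapidly_decreasing f"
  shows "summable (\<lambda>i. ((1 + real i) ^ s * f i)\<^sup>2)"
proof -
  obtain C where C: "\<And>i. \<bar>f i\<bar> * (1 + real i) ^ (s + 1) \<le> C"
    using assms unfolding rapidly_decreasing_def by blast
  show ?thesis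
  proof (rule summable_comparison_test'[OF summable_mult[OF summable_inverse_square, of "C\<^sup>2"], of 0])
    fix i
    have "((1 + real i) ^ s * f i)\<^sup>2 = (\<bar>f i\<bar> * (1 + real i) ^ (s + 1))\<^sup>2 * (1 / (1 + real i)\<^sup>2)"
      by (rule weighted_square) simp
    also have "\<dots> \<le> C\<^sup>2 * (1 / (1 + real i)\<^sup>2)"
      by (intro mult_right_mono power_mono C) auto
    finally show "norm (((1 + real i) ^ s * f i)\<^sup>2) \<le> C\<^sup>2 * (1 / (1 + real i)\<^sup>2)" by simp
  qed
qed

context
  fixes h k m n :: nat and lam mu nu sg :: real
  assumes hk: "0 < h" "0 < k" and mn: "m < h" "n < k"
    and coeffs: "0 < lam" "0 < sg" "0 \<le> mu" "0 \<le> nu"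
begin

abbreviation "BS \<equiv> B_seq h k m n lam mu nu sg"
abbreviation "deg \<equiv> 2 * h + 2 * k + 2 * m + 2 * n"

text \<open>The form estimates hold for finite sequences, and \<open>B\<close> applied to a
  truncation has spurious entries near the cut. They obey the uniform growth bound with exponent
  \<open>M + deg\<close>, and the decay of \<open>g\<close> turns this into a summable majorant (the
  surplus exponent 2), so that Tannery's theorem applies.\<close>

lemma pairing_limit:
  assumes v: "\<And>i. \<bar>v i\<bar> \<le> C * (1 + real i) ^ M"
    and g: "\<And>i. (g i)\<^sup>2 * \<bar>v i\<bar> * (1 + real i) ^ (M + deg + 2) \<le> D"
  shows "summable (\<lambda>i. g i * BS v i * (g i * v i))"
    "(\<lambda>l. inner (diag g (B_op h k m n lam mu nu sg X_op R_op (trunc l v))) (diag g (trunc l v)))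
      \<longlonglongrightarrow> (\<Sum>i. g i * BS v i * (g i * v i))"
proof -
  obtain E where E: "E \<ge> 0" "\<And>l i. \<bar>BS (fs (trunc l v)) i\<bar> \<le> E * (1 + real i) ^ (M + deg)"
    using growsE[OF grows_B[OF grows_trunc[OF v], where h = h and k = k and m = m and n = n and lam = lam and mu = mu and nu = nu and sg = sg]] by blast
  let ?a = "\<lambda>i l. g i * BS (fs (trunc l v)) i * (g i * fs (trunc l v) i)"
  have bound: "norm (?a i l) \<le> E * D * (1 / (1 + real i)\<^sup>2)" for i l
  proof -
    have "norm (?a i l) = (g i)\<^sup>2 * \<bar>fs (trunc l v) i\<bar> * \<bar>BS (fs (trunc l v)) i\<bar>"
      by (simp add: abs_mult power2_eq_square)
    also have "\<dots> \<le> (g i)\<^sup>2 * \<bar>v i\<bar> * (E * (1 + real i) ^ (M + deg))"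
      by (intro mult_mono E) auto
    also have "\<dots> = E * ((g i)\<^sup>2 * \<bar>v i\<bar> * (1 + real i) ^ (M + deg + 2)) * (1 / (1 + real i)\<^sup>2)"
    proof -
      have "a * b * (E * q) = E * (a * b * (q * z)) * (1 / z)" if "z \<noteq> 0" for a b q z :: real
        using that by (simp add: field_simps)
      then show ?thesis unfolding power_add[of _ "M + deg" 2] by auto
    qed
    also have "\<dots> \<le> E * D * (1 / (1 + real i)\<^sup>2)"
      by (intro mult_right_mono mult_left_mono g E) auto
    finally show ?thesis .
  qed
  have lim: "((\<lambda>l. ?a i l) \<longlongrightarrow> g i * BS v i * (g i * v i)) sequentially" for i
  proof (rule tendsto_eventually)
    have "\<forall>\<^sub>F l in sequentially. fs (trunc l v) i = v i"
      using stabilizes_trunc[of v] by (simp add: stabilizes_def)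
    moreover have "\<forall>\<^sub>F l in sequentially. BS (fs (trunc l v)) i = BS v i"
      using stabilizes_B[OF stabilizes_trunc] by (simp add: stabilizes_def)
    ultimately show "\<forall>\<^sub>F l in sequentially. ?a i l = g i * BS v i * (g i * v i)"
      by eventually_elim (simp only:)
  qed
  have ev: "eventually (\<lambda>(i, l). norm (?a i l) \<le> E * D * (1 / (1 + real i)\<^sup>2)) (sequentially \<times>\<^sub>F sequentially)"
    by (rule always_eventually, rule allI, simp only: split_beta bound)
  have T: "eventually (\<lambda>l. summable (\<lambda>i. norm (?a i l))) sequentially \<and>
     summable (\<lambda>i. norm (g i * BS v i * (g i * v i))) \<and>
     ((\<lambda>l. suminf (\<lambda>i. ?a i l)) \<longlongrightarrow> (\<Sum>i. g i * BS v i * (g i * v i))) sequentially"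
    by (rule tannerys_theorem[OF lim ev summable_mult[OF summable_inverse_square, of "E * D"]]) simp
  show "summable (\<lambda>i. g i * BS v i * (g i * v i))"
    by (rule summable_norm_cancel[OF conjunct1[OF conjunct2[OF T]]])
  show "(\<lambda>l. inner (diag g (B_op h k m n lam mu nu sg X_op R_op (trunc l v))) (diag g (trunc l v)))
      \<longlonglongrightarrow> (\<Sum>i. g i * BS v i * (g i * v i))"
    unfolding inner_fseq_def fs_ops fs_B_op by (rule conjunct2[OF conjunct2[OF T]])
qed

text \<open>The form estimate bounds the weighted square sum of \<open>v\<close> by the pairing plus
  low terms, and the pairing is at most half the data plus half of that same square sum. The
  regularization makes the sum finite, so half of it may be subtracted. No constant in the result
  depends on \<open>p\<close>, which finally tends to infinity.\<close>

lemma weighted_bound: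
  "\<exists>D\<ge>0. \<exists>i0. \<forall>v. (\<exists>C. \<forall>i. \<bar>v i\<bar> \<le> C * (1 + real i) ^ M) \<longrightarrow> rapidly_decreasing (BS v) \<longrightarrow>
     (\<forall>N. (\<Sum>i<N. ((1 + real i) ^ s * v i)\<^sup>2) \<le> (\<Sum>i. ((1 + real i) ^ s * BS v i)\<^sup>2) + D * (\<Sum>i<i0. (v i)\<^sup>2))"
proof -
  \<comment> \<open>Large enough for the hypothesis of \<open>pairing_limit\<close>: |v| contributes
    \<open>M\<close> powers, and 2 d >= 2 M + deg + 2.\<close>
  define d where "d = M + deg + 1"
  obtain c C0 where c: "c > 0" and C0: "\<And>p w. c * (norm (lowering (diag (weight s (s + d) p) w)))\<^sup>2
      - C0 * (norm (diag (weight s (s + d) p) w))\<^sup>2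
     \<le> inner (diag (weight s (s + d) p) (B_op h k m n lam mu nu sg X_op R_op w)) (diag (weight s (s + d) p) w)"
    using weighted_coercivity[OF hk mn coeffs] by blast
  \<comment> \<open>From \<open>i0\<close> on, c * i is at least C0 + 1, so the diagonal form of
    \<open>lowering\<close> dominates the loss with 1 to spare.\<close>
  obtain i0 :: nat where i0: "(C0 + 1) / c \<le> real i0" using real_arch_simple by blast
  \<comment> \<open>Makes (c * i - C0) + ?A at least 1 also at the finitely many indices below
    \<open>i0\<close>.\<close>
  let ?A = "\<bar>C0\<bar> + 1"
  show ?thesis
  proof (rule exI[of _ "2 * ?A * ((1 + real i0) ^ s)\<^sup>2"], intro conjI exI[of _ i0] allI impI)
    show "0 \<le> 2 * ?A * ((1 + real i0) ^ s)\<^sup>2" by simp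
    fix v N
    assume "\<exists>C. \<forall>i. \<bar>v i\<bar> \<le> C * (1 + real i) ^ M" and f: "rapidly_decreasing (BS v)"
    then obtain C where C: "\<And>i. \<bar>v i\<bar> \<le> C * (1 + real i) ^ M" by blast
    let ?F = "\<Sum>i. ((1 + real i) ^ s * BS v i)\<^sup>2"
    have sumF: "summable (\<lambda>i. ((1 + real i) ^ s * BS v i)\<^sup>2)" by (rule rapidly_decreasing_summable[OF f])
    have main: "(\<Sum>i<N. (weight s (s + d) p i * v i)\<^sup>2) \<le> ?F + 2 * ?A * ((1 + real i0) ^ s)\<^sup>2 * (\<Sum>i<i0. (v i)\<^sup>2)" for p N
    proof -
      let ?g = "weight s (s + d) p"
      let ?G = "\<Sum>i<i0. (?g i * v i)\<^sup>2"
      have "(?g i)\<^sup>2 * \<bar>v i\<bar> * (1 + real i) ^ (M + deg + 2) \<le> ((1 + real p) ^ (s + d))\<^sup>2 * C" for i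
      proof -
        have C': "0 \<le> C" using order_trans[OF abs_ge_zero C[of 0]] by simp
        have "(?g i)\<^sup>2 * \<bar>v i\<bar> * (1 + real i) ^ (M + deg + 2)
          \<le> (?g i)\<^sup>2 * (C * (1 + real i) ^ M) * (1 + real i) ^ (M + deg + 2)"
          by (intro mult_right_mono mult_left_mono C) auto
        also have "\<dots> = ((?g i)\<^sup>2 * C) * (1 + real i) ^ (M + (M + deg + 2))"
          by (simp only: power_add mult_ac)
        also have "\<dots> \<le> ((?g i)\<^sup>2 * C) * (1 + real i) ^ (2 * d)"
          using C' by (intro mult_left_mono power_increasing) (auto simp: d_def)
        also have "\<dots> = (?g i * (1 + real i) ^ d)\<^sup>2 * C"
          by (simp add: power_mult_distrib power_mult[symmetric] mult_ac)
        also have "\<dots> \<le> ((1 + real p) ^ (s + d))\<^sup>2 * C"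
          using C' weight_pos[of s "s + d" p i] by (intro mult_right_mono power_mono weight_decay) auto
        finally show ?thesis .
      qed
      note lim = pairing_limit[OF C this]
      let ?T = "\<lambda>l. inner (diag ?g (B_op h k m n lam mu nu sg X_op R_op (trunc l v))) (diag ?g (trunc l v))"
      let ?L = "\<Sum>i. ?g i * BS v i * (?g i * v i)"
      have fin: "(\<Sum>i<l. (?g i * v i)\<^sup>2) \<le> ?T l + ?A * ?G" for l
      proof -
        have "(?g i * v i)\<^sup>2 \<le> (c * real i - C0) * (?g i * v i)\<^sup>2 + (if i < i0 then ?A * (?g i * v i)\<^sup>2 else 0)" for i
        proof (cases "i < i0")
          case True
          have "1 \<le> (c * real i - C0) + ?A" using c by (simp add: abs_if)
          from mult_right_mono[OF this, of "(?g i * v i)\<^sup>2"] show ?thesis using True by (simp add: distrib_right)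
        next
          case False
          have "C0 + 1 \<le> c * real i0" using i0 c by (simp add: field_simps)
          also have "\<dots> \<le> c * real i" using False c by simp
          finally have "1 \<le> c * real i - C0" by simp
          from mult_right_mono[OF this, of "(?g i * v i)\<^sup>2"] show ?thesis using False by simp
        qed
        then have "(\<Sum>i<l. (?g i * v i)\<^sup>2)
          \<le> (\<Sum>i<l. (c * real i - C0) * (?g i * v i)\<^sup>2 + (if i < i0 then ?A * (?g i * v i)\<^sup>2 else 0))"
          by (rule sum_mono)
        also have "\<dots> = (\<Sum>i<l. (c * real i - C0) * (?g i * v i)\<^sup>2) + (\<Sum>i<l. if i < i0 then ?A * (?g i * v i)\<^sup>2 else 0)"
          by (rule sum.distrib)
        also have "(\<Sum>i<l. (c * real i - C0) * (?g i * v i)\<^sup>2) \<le> ?T l"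
        proof -
          have "(\<Sum>i<l. (c * real i - C0) * (?g i * v i)\<^sup>2) =
            c * (norm (lowering (diag ?g (trunc l v))))\<^sup>2 - C0 * (norm (diag ?g (trunc l v)))\<^sup>2"
            unfolding norm_diag_trunc norm_low_diag_trunc
            by (simp add: sum_distrib_left sum_subtractf left_diff_distrib mult.assoc)
          then show ?thesis using C0[of p "trunc l v"] by simp
        qed
        also have "(\<Sum>i<l. if i < i0 then ?A * (?g i * v i)\<^sup>2 else 0) \<le> ?A * ?G"
        proof -
          have "(\<Sum>i<l. if i < i0 then ?A * (?g i * v i)\<^sup>2 else 0) = (\<Sum>i\<in>{..<l} \<inter> {i. i < i0}. ?A * (?g i * v i)\<^sup>2)"
            using sum.inter_restrict[of "{..<l}" "\<lambda>i. ?A * (?g i * v i)\<^sup>2" "{i. i < i0}"] by simp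
          also have "\<dots> \<le> (\<Sum>i<i0. ?A * (?g i * v i)\<^sup>2)" by (rule sum_mono2) auto
          finally show ?thesis by (simp add: sum_distrib_left)
        qed
        finally show ?thesis by simp
      qed
      have part: "(\<Sum>i<N. (?g i * v i)\<^sup>2) \<le> ?L + ?A * ?G" for N
      proof (rule LIMSEQ_le_const[OF tendsto_add[OF lim(2) tendsto_const]])
        have "(\<Sum>i<N. (?g i * v i)\<^sup>2) \<le> (\<Sum>i<l. (?g i * v i)\<^sup>2)" if "N \<le> l" for l
          using that by (intro sum_mono2) auto
        then show "\<exists>N'. \<forall>l\<ge>N'. (\<Sum>i<N. (?g i * v i)\<^sup>2) \<le> ?T l + ?A * ?G"
          using fin by (meson order_trans)
      qed
      \<comment> \<open>The uniform bound on the partial sums shows that the weighted square sum is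
        finite; only then may half of it be moved to the left.\<close>
      have sumQ: "summable (\<lambda>i. (?g i * v i)\<^sup>2)"
        by (rule summableI_nonneg_bounded[OF _ part]) simp
      have "?L \<le> (\<Sum>i. ((1 + real i) ^ s * BS v i)\<^sup>2 / 2 + (?g i * v i)\<^sup>2 / 2)"
      proof (rule suminf_le[OF _ lim(1)])
        fix i
        have "?g i * BS v i * (?g i * v i) \<le> (?g i * BS v i)\<^sup>2 / 2 + (?g i * v i)\<^sup>2 / 2"
          using sum_squares_bound[of "?g i * BS v i" "?g i * v i"] by (simp add: field_simps)
        also have "(?g i * BS v i)\<^sup>2 \<le> ((1 + real i) ^ s * BS v i)\<^sup>2"
          unfolding power_mult_distrib using weight_pos[of s "s + d" p i]
          by (intro mult_right_mono power_mono weight_le) auto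
        finally show "?g i * BS v i * (?g i * v i) \<le> ((1 + real i) ^ s * BS v i)\<^sup>2 / 2 + (?g i * v i)\<^sup>2 / 2"
          by simp
      qed (intro summable_add summable_divide sumF sumQ)
      also have "\<dots> = ?F / 2 + (\<Sum>i. (?g i * v i)\<^sup>2) / 2"
        by (simp add: suminf_add[symmetric] suminf_divide sumF sumQ summable_divide)
      finally have L: "?L \<le> ?F / 2 + (\<Sum>i. (?g i * v i)\<^sup>2) / 2" .
      have "(\<Sum>i. (?g i * v i)\<^sup>2) \<le> ?L + ?A * ?G"
        by (rule suminf_le_const[OF sumQ part])
      with L have "(\<Sum>i. (?g i * v i)\<^sup>2) \<le> ?F + 2 * (?A * ?G)" by linarith
      moreover have "(\<Sum>i<N. (?g i * v i)\<^sup>2) \<le> (\<Sum>i. (?g i * v i)\<^sup>2)"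
        by (rule sum_le_suminf[OF sumQ]) auto
      moreover have "?G \<le> (\<Sum>i<i0. ((1 + real i0) ^ s)\<^sup>2 * (v i)\<^sup>2)"
      proof (rule sum_mono)
        fix i assume "i \<in> {..<i0}"
        then have "?g i \<le> (1 + real i0) ^ s"
          by (intro order_trans[OF weight_le] power_mono) auto
        then show "(?g i * v i)\<^sup>2 \<le> ((1 + real i0) ^ s)\<^sup>2 * (v i)\<^sup>2"
          unfolding power_mult_distrib using weight_pos[of s "s + d" p i]
          by (intro mult_right_mono power_mono) auto
      qed
      then have "?A * ?G \<le> ?A * (((1 + real i0) ^ s)\<^sup>2 * (\<Sum>i<i0. (v i)\<^sup>2))"
        by (intro mult_left_mono) (simp_all add: sum_distrib_left)
      moreover have "y \<le> F + 2 * A * B * H" if "x \<le> F + 2 * (A * G)" "y \<le> x" "A * G \<le> A * (B * H)"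
        for x y A B F G H :: real
        using that by (simp add: mult.assoc)
      ultimately show ?thesis by blast
    qed
    \<comment> \<open>For fixed \<open>N\<close> the finite sum passes to the limit in
      \<open>p\<close>, where the weight becomes (1 + i)^s.\<close>
    have "(\<lambda>p. \<Sum>i<N. (weight s (s + d) p i * v i)\<^sup>2) \<longlonglongrightarrow> (\<Sum>i<N. ((1 + real i) ^ s * v i)\<^sup>2)"
      by (intro tendsto_intros weight_tendsto)
    then show "(\<Sum>i<N. ((1 + real i) ^ s * v i)\<^sup>2) \<le> ?F + 2 * ?A * ((1 + real i0) ^ s)\<^sup>2 * (\<Sum>i<i0. (v i)\<^sup>2)"
      by (rule LIMSEQ_le_const2) (use main in auto)
  qed
qed

lemma regular_imp_rapidly_decreasing:
  assumes v: "\<exists>C. \<forall>i. \<bar>v i\<bar> \<le> C * (1 + real i) ^ M" and f: "rapidly_decreasing (BS v)"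
  shows "rapidly_decreasing v"
  unfolding rapidly_decreasing_def
proof
  fix s
  obtain D i0 where D: "\<And>N. (\<Sum>i<N. ((1 + real i) ^ s * v i)\<^sup>2) \<le> (\<Sum>i. ((1 + real i) ^ s * BS v i)\<^sup>2) + D * (\<Sum>i<i0. (v i)\<^sup>2)"
    using weighted_bound[of M s] v f by blast
  let ?K = "(\<Sum>i. ((1 + real i) ^ s * BS v i)\<^sup>2) + D * (\<Sum>i<i0. (v i)\<^sup>2)"
  have "\<bar>v i\<bar> * (1 + real i) ^ s \<le> sqrt ?K" for i
  proof (rule real_le_rsqrt)
    have "(\<bar>v i\<bar> * (1 + real i) ^ s)\<^sup>2 = ((1 + real i) ^ s * v i)\<^sup>2" by (simp add: power_mult_distrib mult.commute)
    also have "\<dots> \<le> (\<Sum>i<Suc i. ((1 + real i) ^ s * v i)\<^sup>2)" by (intro member_le_sum) auto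
    also have "\<dots> \<le> ?K" by (rule D)
    finally show "(\<bar>v i\<bar> * (1 + real i) ^ s)\<^sup>2 \<le> ?K" .
  qed
  then show "\<exists>C. \<forall>i. \<bar>v i\<bar> * (1 + real i) ^ s \<le> C" by blast
qed

text \<open>Once \<open>v\<close> decays rapidly, the pairing makes sense with weight 1, and
  coercivity followed by completing the square bounds \<open>v\<close> by \<open>B v\<close>. The
  constant does not involve \<open>v\<close>, so the low entries left over in
  \<open>weighted_bound\<close> can be eliminated.\<close>

lemma square_sum_bound:
  "\<exists>E\<ge>0. \<forall>v. rapidly_decreasing v \<longrightarrow> rapidly_decreasing (BS v) \<longrightarrow> (\<forall>N. (\<Sum>i<N. (v i)\<^sup>2) \<le> E * (\<Sum>i. (BS v i)\<^sup>2))"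
proof -
  obtain c where c: "c > 0" and coer: "\<And>w. c * (norm w)\<^sup>2 \<le> inner (B_op h k m n lam mu nu sg X_op R_op w) w"
    using coercivity[OF hk mn coeffs] by blast
  show ?thesis
  proof (rule exI[of _ "1 / c\<^sup>2"], intro conjI allI impI)
    show "0 \<le> 1 / c\<^sup>2" by simp
    fix v N assume v: "rapidly_decreasing v" and f: "rapidly_decreasing (BS v)"
    have sv: "summable (\<lambda>i. (v i)\<^sup>2)" and sf: "summable (\<lambda>i. (BS v i)\<^sup>2)"
      using rapidly_decreasing_summable[OF v, of 0] rapidly_decreasing_summable[OF f, of 0] by auto
    obtain C where C: "\<And>i. \<bar>v i\<bar> \<le> C * (1 + real i) ^ 0"
      using v unfolding rapidly_decreasing_def by (metis power_0 mult_1_right)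
    obtain D where D: "\<And>i. 1\<^sup>2 * \<bar>v i\<bar> * (1 + real i) ^ (0 + deg + 2) \<le> D"
      using v unfolding rapidly_decreasing_def by (metis power_one mult_1)
    have id: "diag (\<lambda>i. 1) w = w" for w by (rule fseq_eqI) simp
    note lim = pairing_limit[OF C D, unfolded id mult_1]
    have "c * (\<Sum>i<l. (v i)\<^sup>2) \<le> inner (B_op h k m n lam mu nu sg X_op R_op (trunc l v)) (trunc l v)" for l
      using coer[of "trunc l v"] norm_diag_trunc[of "\<lambda>i. 1" l v] unfolding id by simp
    moreover have "(\<lambda>l. c * (\<Sum>i<l. (v i)\<^sup>2)) \<longlonglongrightarrow> c * (\<Sum>i. (v i)\<^sup>2)"
      by (intro tendsto_intros summable_LIMSEQ sv)
    ultimately have 1: "c * (\<Sum>i. (v i)\<^sup>2) \<le> (\<Sum>i. BS v i * v i)"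
      using lim(2) by (intro LIMSEQ_le) auto
    have "(\<Sum>i. BS v i * v i) \<le> (\<Sum>i. (BS v i)\<^sup>2 / (2 * c) + c / 2 * (v i)\<^sup>2)"
    proof (rule suminf_le[OF _ lim(1)])
      fix i
      have "0 \<le> (BS v i / c - v i)\<^sup>2 * (c / 2)" using c by simp
      also have "\<dots> = (BS v i)\<^sup>2 / (2 * c) + c / 2 * (v i)\<^sup>2 - BS v i * v i"
        using c by (simp add: power2_eq_square field_simps)
      finally show "BS v i * v i \<le> (BS v i)\<^sup>2 / (2 * c) + c / 2 * (v i)\<^sup>2" by simp
    qed (intro summable_add summable_divide summable_mult sv sf)
    also have "\<dots> = (\<Sum>i. (BS v i)\<^sup>2) / (2 * c) + c / 2 * (\<Sum>i. (v i)\<^sup>2)"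
      by (simp add: suminf_add[symmetric] suminf_divide suminf_mult sv sf summable_divide summable_mult)
    finally have "c / 2 * (\<Sum>i. (v i)\<^sup>2) \<le> (\<Sum>i. (BS v i)\<^sup>2) / (2 * c)" using 1 by linarith
    then have "(\<Sum>i. (v i)\<^sup>2) \<le> 1 / c\<^sup>2 * (\<Sum>i. (BS v i)\<^sup>2)"
      using c by (simp add: field_simps power2_eq_square)
    moreover have "(\<Sum>i<N. (v i)\<^sup>2) \<le> (\<Sum>i. (v i)\<^sup>2)" by (rule sum_le_suminf[OF sv]) auto
    ultimately show "(\<Sum>i<N. (v i)\<^sup>2) \<le> 1 / c\<^sup>2 * (\<Sum>i. (BS v i)\<^sup>2)" by simp
  qed
qed

text \<open>\<open>K\<close> is independent of \<open>v\<close> and the bound is linear in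
  \<open>A\<close>; applied for each Hermite index \<open>j\<close>, this transfers decay in
  \<open>j\<close> from the data. One power is lost between \<open>s + 1\<close> and
  \<open>s\<close> in passing from a supremum to a square sum.\<close>

theorem sequence_regularity:
  "\<exists>K\<ge>0. \<forall>v A. (\<exists>C. \<forall>i. \<bar>v i\<bar> \<le> C * (1 + real i) ^ M) \<longrightarrow> rapidly_decreasing (BS v) \<longrightarrow>
     (\<forall>i. \<bar>BS v i\<bar> * (1 + real i) ^ (s + 1) \<le> A) \<longrightarrow> (\<forall>i. \<bar>v i\<bar> * (1 + real i) ^ s \<le> K * A)"
proof -
  obtain D i0 where D0: "D \<ge> 0" and D: "\<And>v N. (\<exists>C. \<forall>i. \<bar>v i\<bar> \<le> C * (1 + real i) ^ M) \<Longrightarrow> rapidly_decreasing (BS v) \<Longrightarrow>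
      (\<Sum>i<N. ((1 + real i) ^ s * v i)\<^sup>2) \<le> (\<Sum>i. ((1 + real i) ^ s * BS v i)\<^sup>2) + D * (\<Sum>i<i0. (v i)\<^sup>2)"
    using weighted_bound[of M s] by blast
  obtain E where E0: "E \<ge> 0" and E: "\<And>v N. rapidly_decreasing v \<Longrightarrow> rapidly_decreasing (BS v) \<Longrightarrow>
      (\<Sum>i<N. (v i)\<^sup>2) \<le> E * (\<Sum>i. (BS v i)\<^sup>2)"
    using square_sum_bound by blast
  define Z where "Z = (\<Sum>i. 1 / (1 + real i)\<^sup>2)"
  have Z: "0 \<le> Z" unfolding Z_def by (intro suminf_nonneg summable_inverse_square) simp
  define K where "K = sqrt ((1 + D * E) * Z)"
  show ?thesis
  proof (rule exI[of _ K], intro conjI allI impI)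
    show "0 \<le> K" using D0 E0 Z by (simp add: K_def)
    fix v A i
    assume v: "\<exists>C. \<forall>i. \<bar>v i\<bar> \<le> C * (1 + real i) ^ M" and f: "rapidly_decreasing (BS v)"
      and A: "\<forall>i. \<bar>BS v i\<bar> * (1 + real i) ^ (s + 1) \<le> A"
    have A0: "0 \<le> A" using order_trans[OF mult_nonneg_nonneg A[rule_format]] by simp
    let ?F = "\<Sum>i. ((1 + real i) ^ s * BS v i)\<^sup>2"
    have sumF: "summable (\<lambda>i. ((1 + real i) ^ s * BS v i)\<^sup>2)" by (rule rapidly_decreasing_summable[OF f])
    have "?F \<le> (\<Sum>i. A\<^sup>2 * (1 / (1 + real i)\<^sup>2))"
    proof (rule suminf_le[OF _ sumF summable_mult[OF summable_inverse_square]])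
      fix i
      have "((1 + real i) ^ s * BS v i)\<^sup>2 = (\<bar>BS v i\<bar> * (1 + real i) ^ (s + 1))\<^sup>2 * (1 / (1 + real i)\<^sup>2)"
        by (rule weighted_square) simp
      also have "\<dots> \<le> A\<^sup>2 * (1 / (1 + real i)\<^sup>2)"
        using A by (intro mult_right_mono power_mono) auto
      finally show "((1 + real i) ^ s * BS v i)\<^sup>2 \<le> A\<^sup>2 * (1 / (1 + real i)\<^sup>2)" .
    qed
    then have F: "?F \<le> A\<^sup>2 * Z" by (simp only: Z_def suminf_mult[OF summable_inverse_square])
    have "(\<Sum>i. (BS v i)\<^sup>2) \<le> ?F"
    proof (rule suminf_le)
      show "summable (\<lambda>i. (BS v i)\<^sup>2)" using rapidly_decreasing_summable[OF f, of 0] by simp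
      fix i
      have "1 * (BS v i)\<^sup>2 \<le> ((1 + real i) ^ s)\<^sup>2 * (BS v i)\<^sup>2"
        by (intro mult_right_mono one_le_power) auto
      then show "(BS v i)\<^sup>2 \<le> ((1 + real i) ^ s * BS v i)\<^sup>2" by (simp add: power_mult_distrib)
    qed (rule sumF)
    then have "D * (\<Sum>i<i0. (v i)\<^sup>2) \<le> D * (E * ?F)"
      using E[OF regular_imp_rapidly_decreasing[OF v f] f, of i0] E0 D0
      by (intro mult_left_mono) (auto intro: order_trans mult_left_mono)
    moreover have "(\<bar>v i\<bar> * (1 + real i) ^ s)\<^sup>2 \<le> ?F + D * (\<Sum>i<i0. (v i)\<^sup>2)"
    proof -
      have "(\<bar>v i\<bar> * (1 + real i) ^ s)\<^sup>2 = ((1 + real i) ^ s * v i)\<^sup>2" by (simp add: power_mult_distrib mult.commute)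
      also have "\<dots> \<le> (\<Sum>i<Suc i. ((1 + real i) ^ s * v i)\<^sup>2)" by (intro member_le_sum) auto
      also have "\<dots> \<le> ?F + D * (\<Sum>i<i0. (v i)\<^sup>2)" by (rule D[OF v f])
      finally show ?thesis .
    qed
    ultimately have "(\<bar>v i\<bar> * (1 + real i) ^ s)\<^sup>2 \<le> (1 + D * E) * ?F" by (simp add: algebra_simps)
    also have "\<dots> \<le> (1 + D * E) * (A\<^sup>2 * Z)" using F D0 E0 by (intro mult_left_mono) auto
    also have "\<dots> = (K * A)\<^sup>2" using D0 E0 Z by (simp add: K_def power_mult_distrib)
    finally show "\<bar>v i\<bar> * (1 + real i) ^ s \<le> K * A"
      by (rule power2_le_imp_le) (use A0 \<open>0 \<le> K\<close> in auto)
  qed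
qed

end

section \<open>Integration and pairings of Schwartz functions on the plane\<close>

lemma sfun_simps [simp]:
  "sfun 0 z = 0" "sfun (f + g) z = sfun f z + sfun g z" "sfun (c *\<^sub>C f) z = c * sfun f z"
  "sfun (f - g) z = sfun f z - sfun g z" "sfun (- f) z = - sfun f z"
  by (simp_all add: zero_schwartz.rep_eq plus_schwartz.rep_eq scaleC_schwartz.rep_eq
      minus_schwartz.rep_eq uminus_schwartz.rep_eq)

lemma sfun_test [simp]:
  "sfun (test_x f) z = of_real (fst z) * sfun f z" "sfun (test_y f) z = of_real (snd z) * sfun f z"
  "sfun (test_Dx f) z = - \<i> * partial (1, 0) (sfun f) z" "sfun (test_Dy f) z = - \<i> * partial (0, 1) (sfun f) z"
  by (simp_all add: test_x.rep_eq test_y.rep_eq test_Dx.rep_eq test_Dy.rep_eq)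

lemma schwartz_eqI: "(\<And>z. sfun f z = sfun g z) \<Longrightarrow> f = g"
  by (simp add: sfun_inject[symmetric] fun_eq_iff)

lemma sfun_differentiable: "sfun f differentiable at z"
  using smoothD[OF smooth_sfun, of "[]"] by simp

lemma continuous_sfun: "continuous_on A (sfun f)"
  using sfun_differentiable differentiable_imp_continuous_within continuous_at_imp_continuous_on by blast

lemma measurable_sfun [measurable]: "sfun f \<in> borel_measurable borel"
  by (rule borel_measurable_continuous_onI[OF continuous_sfun])

lemma sfun_bounded: "cmod (sfun f z) \<le> seminorm 0 [] f"
  using seminorm_upper[of "[]" z 0 f] by simp

text \<open>Multiplication by (1 + x^2) (1 + y^2), composed of \<open>test_x\<close> and
  \<open>test_y\<close> so that it can be applied within Hermite families; \<open>decay\<close> is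
  its integrable inverse.\<close>

definition decay_op :: "(real \<times> real) schwartz \<Rightarrow> (real \<times> real) schwartz" where
  "decay_op f = (f + test_x (test_x f)) + test_y (test_y (f + test_x (test_x f)))"

definition decay :: "real \<times> real \<Rightarrow> real" where
  "decay z = inverse (1 + (fst z)\<^sup>2) * inverse (1 + (snd z)\<^sup>2)"

lemma decay_pos: "0 < decay z"
  unfolding decay_def by (simp add: add_pos_nonneg)

lemma decay_le_one: "decay z \<le> 1"
proof -
  have "inverse (1 + (fst z)\<^sup>2) * inverse (1 + (snd z)\<^sup>2) \<le> 1 * 1"
    by (intro mult_mono) (auto simp: field_simps add_pos_nonneg)
  then show ?thesis by (simp add: decay_def)
qed

lemma sfun_decay_op: "sfun f z = of_real (decay z) * sfun (decay_op f) z"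
proof -
  have pos: "1 + (fst z)\<^sup>2 \<noteq> 0" "1 + (snd z)\<^sup>2 \<noteq> 0"
    by (smt (verit) zero_le_power2)+
  have 1: "sfun (decay_op f) z = of_real ((1 + (snd z)\<^sup>2) * (1 + (fst z)\<^sup>2)) * sfun f z"
    by (simp add: decay_op_def power2_eq_square algebra_simps)
  have 2: "decay z * ((1 + (snd z)\<^sup>2) * (1 + (fst z)\<^sup>2)) = 1"
  proof -
    have "inverse a * inverse b * (b * a) = 1" if "a \<noteq> 0" "b \<noteq> 0" for a b :: real
      using that by (simp add: field_simps)
    from this[OF pos] show ?thesis by (simp only: decay_def)
  qed
  have "of_real (decay z) * sfun (decay_op f) z = of_real (decay z * ((1 + (snd z)\<^sup>2) * (1 + (fst z)\<^sup>2))) * sfun f z"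
    unfolding 1 by (simp only: of_real_mult mult.assoc)
  then show ?thesis unfolding 2 by simp
qed

lemma sfun_decay: "cmod (sfun f z) \<le> seminorm 0 [] (decay_op f) * decay z"
  using mult_right_mono[OF sfun_bounded[of "decay_op f" z], of "decay z"] decay_pos[of z]
  by (subst sfun_decay_op) (simp add: norm_mult mult.commute)

lemma integrable_cauchy: "integrable lborel (\<lambda>x::real. inverse (1 + x\<^sup>2))"
  using integrable_inverse_1_plus_square by (simp add: set_integrable_def)

lemma measurable_decay [measurable]: "decay \<in> borel_measurable borel"
proof -
  have "continuous_on UNIV decay" unfolding decay_def
    by (intro continuous_intros) (smt (verit) zero_le_power2)+
  then show ?thesis by (rule borel_measurable_continuous_onI)
qed

lemma integrable_decay: "integrable lborel decay"
proof -
  have "integrable (lborel \<Otimes>\<^sub>M lborel) decay"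
  proof (rule lborel_pair.Fubini_integrable)
    show "decay \<in> borel_measurable (lborel \<Otimes>\<^sub>M lborel)" by (simp add: lborel_prod)
    show "integrable lborel (\<lambda>x. \<integral>y. norm (decay (x, y)) \<partial>lborel)"
      using integrable_cauchy by (auto simp: decay_def abs_mult abs_of_nonneg)
    show "AE x in lborel. integrable lborel (\<lambda>y. decay (x, y))"
      using integrable_cauchy by (auto simp: decay_def)
  qed
  then show ?thesis by (simp add: lborel_prod)
qed

lemma integrable_decay_bound:
  fixes F :: "real \<times> real \<Rightarrow> complex"
  assumes "F \<in> borel_measurable borel" "\<And>z. cmod (F z) \<le> C * decay z"
  shows "integrable lborel F"
proof (rule Bochner_Integration.integrable_bound)
  show "integrable lborel (\<lambda>z. C * decay z)" using integrable_decay by simp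
  show "AE z in lborel. norm (F z) \<le> norm (C * decay z)"
  proof (rule AE_I2)
    show "norm (F z) \<le> norm (C * decay z)" for z using assms(2)[of z] unfolding real_norm_def by linarith
  qed
qed (use assms(1) in simp)

lemma integrable_sfun: "integrable lborel (sfun (f :: (real \<times> real) schwartz))"
  by (rule integrable_decay_bound[OF measurable_sfun sfun_decay])

lemma sfun_mult_bound:
  "cmod (sfun f z * sfun g z) \<le> (seminorm 0 [] (decay_op f) * seminorm 0 [] g) * decay z"
proof -
  have "cmod (sfun f z * sfun g z) \<le> (seminorm 0 [] (decay_op f) * decay z) * seminorm 0 [] g"
    unfolding norm_mult using decay_pos[of z] sfun_decay sfun_bounded
    by (intro mult_mono) (auto simp: seminorm_nonneg)
  then show ?thesis by (simp add: mult_ac)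
qed

lemma integrable_sfun_mult: "integrable lborel (\<lambda>z. sfun f z * sfun (g :: (real \<times> real) schwartz) z)"
  by (rule integrable_decay_bound[OF _ sfun_mult_bound]) measurable

lemma integrable_sfun_cnj: "integrable lborel (\<lambda>z. sfun f z * cnj (sfun (g :: (real \<times> real) schwartz) z))"
proof (rule integrable_decay_bound)
  show "cmod (sfun f z * cnj (sfun g z)) \<le> (seminorm 0 [] (decay_op f) * seminorm 0 [] g) * decay z" for z
    using sfun_mult_bound[of f z g] by (simp add: norm_mult)
  show "(\<lambda>z. sfun f z * cnj (sfun g z)) \<in> borel_measurable borel"
    by (rule borel_measurable_continuous_onI) (intro continuous_intros continuous_sfun)
qed

lemma has_vector_derivative_sfun:
  "((\<lambda>t. sfun f (t, y)) has_vector_derivative partial (1, 0) (sfun f) (x, y)) (at x)"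
  "((\<lambda>t. sfun f (x, t)) has_vector_derivative partial (0, 1) (sfun f) (x, y)) (at y)"
proof -
  let ?D = "frechet_derivative (sfun f) (at (x, y))"
  have D: "(sfun f has_derivative ?D) (at (x, y))"
    by (rule has_derivative_frechet[OF sfun_differentiable])
  then have lin: "linear ?D" by (rule has_derivative_linear)
  have "((\<lambda>t. sfun f (t, y)) has_derivative (\<lambda>t. ?D (t, 0))) (at x)"
    by (rule has_derivative_compose[of "\<lambda>t. (t, y)" "\<lambda>t. (t, 0)", OF _ D]) (auto intro!: derivative_eq_intros)
  moreover have "(\<lambda>t. ?D (t, 0)) = (\<lambda>t. t *\<^sub>R ?D (1, 0))"
  proof
    show "?D (t, 0) = t *\<^sub>R ?D (1, 0)" for t using linear_scale[OF lin, of t "(1, 0)"] by simp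
  qed
  ultimately show "((\<lambda>t. sfun f (t, y)) has_vector_derivative partial (1, 0) (sfun f) (x, y)) (at x)"
    unfolding has_vector_derivative_def partial_def by (simp only:)
  have "((\<lambda>t. sfun f (x, t)) has_derivative (\<lambda>t. ?D (0, t))) (at y)"
    by (rule has_derivative_compose[of "\<lambda>t. (x, t)" "\<lambda>t. (0, t)", OF _ D]) (auto intro!: derivative_eq_intros)
  moreover have "(\<lambda>t. ?D (0, t)) = (\<lambda>t. t *\<^sub>R ?D (0, 1))"
  proof
    show "?D (0, t) = t *\<^sub>R ?D (0, 1)" for t using linear_scale[OF lin, of t "(0, 1)"] by simp
  qed
  ultimately show "((\<lambda>t. sfun f (x, t)) has_vector_derivative partial (0, 1) (sfun f) (x, y)) (at y)"
    unfolding has_vector_derivative_def partial_def by (simp only:)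
qed

text \<open>The fundamental theorem of calculus on the line and on a half-line. The vanishing
  integral becomes integration by parts, the pointwise estimate a one-dimensional Sobolev
  bound.\<close>

lemma line_derivative_bounds:
  fixes F F' :: "real \<Rightarrow> complex"
  assumes F: "\<And>x. (F has_vector_derivative F' x) (at x)" and cont: "continuous_on UNIV F'"
    and bd: "\<And>x. cmod (F' x) \<le> C * inverse (1 + x\<^sup>2)" and bd0: "\<And>x. cmod (F x) \<le> D * inverse (1 + x\<^sup>2)"
  shows "integrable lborel F'" "(\<integral>x. F' x \<partial>lborel) = 0" "cmod (F x) \<le> (\<integral>x. cmod (F' x) \<partial>lborel)"
proof -
  have meas: "F' \<in> borel_measurable borel" by (rule borel_measurable_continuous_onI[OF cont])
  show int: "integrable lborel F'"
  proof (rule Bochner_Integration.integrable_bound)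
    show "integrable lborel (\<lambda>x. C * inverse (1 + x\<^sup>2))" using integrable_cauchy by simp
    show "AE x in lborel. norm (F' x) \<le> norm (C * inverse (1 + x\<^sup>2))"
    proof (rule AE_I2)
      show "norm (F' x) \<le> norm (C * inverse (1 + x\<^sup>2))" for x using bd[of x] unfolding real_norm_def by linarith
    qed
  qed (use meas in simp)
  have C': "isCont F' x" for x using cont by (simp add: continuous_on_eq_continuous_at)
  have "((\<lambda>x. D * inverse (1 + x\<^sup>2)) \<longlongrightarrow> D * 0) at_top" "((\<lambda>x. D * inverse (1 + x\<^sup>2)) \<longlongrightarrow> D * 0) at_bot"
    by (intro tendsto_mult tendsto_const tendsto_inverse_0_at_top filterlim_tendsto_add_at_top[OF tendsto_const]
        filterlim_pow_at_top filterlim_ident filterlim_pow_at_bot_even; simp)+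
  then have z: "((\<lambda>x. D * inverse (1 + x\<^sup>2)) \<longlongrightarrow> 0) at_top" "((\<lambda>x. D * inverse (1 + x\<^sup>2)) \<longlongrightarrow> 0) at_bot"
    by simp_all
  have top: "(F \<longlongrightarrow> 0) at_top" and bot: "(F \<longlongrightarrow> 0) at_bot"
    by (rule Lim_null_comparison[OF _ z(1)] Lim_null_comparison[OF _ z(2)], simp add: bd0)+
  have "(LBINT x=-\<infinity>..\<infinity>. F' x) = 0 - 0"
    by (rule interval_integral_FTC_integrable[OF _ F C'])
      (use int top bot in \<open>auto simp: ereal_tendsto_simps set_integrable_def\<close>)
  then show "(\<integral>x. F' x \<partial>lborel) = 0"
    by (simp add: interval_lebesgue_integral_def set_lebesgue_integral_def)
  have "(LBINT t=-\<infinity>..ereal x. F' t) = F x - 0"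
  proof (rule interval_integral_FTC_integrable[OF _ F C'])
    show "set_integrable lborel (einterval (- \<infinity>) (ereal x)) F'"
      unfolding set_integrable_def using int by (intro integrable_mult_indicator) auto
    show "((F \<circ> real_of_ereal) \<longlongrightarrow> 0) (at_right (- \<infinity>))" using bot by (simp add: ereal_tendsto_simps)
    have "isCont F x" using F has_vector_derivative_continuous by blast
    then show "((F \<circ> real_of_ereal) \<longlongrightarrow> F x) (at_left (ereal x))"
      by (simp add: ereal_tendsto_simps isCont_def filterlim_at_split)
  qed simp
  then have "F x = (\<integral>t. indicator (einterval (-\<infinity>) (ereal x)) t *\<^sub>R F' t \<partial>lborel)"
    by (simp add: interval_lebesgue_integral_def set_lebesgue_integral_def)
  also have "cmod \<dots> \<le> (\<integral>t. cmod (indicator (einterval (-\<infinity>) (ereal x)) t *\<^sub>R F' t) \<partial>lborel)"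
    by (rule integral_norm_bound)
  also have "\<dots> \<le> (\<integral>t. cmod (F' t) \<partial>lborel)"
  proof (rule integral_mono)
    show "integrable lborel (\<lambda>t. cmod (indicator (einterval (-\<infinity>) (ereal x)) t *\<^sub>R F' t))"
      using int by (intro integrable_norm integrable_mult_indicator) auto
  qed (use int in \<open>auto simp: indicator_def\<close>)
  finally show "cmod (F x) \<le> (\<integral>x. cmod (F' x) \<partial>lborel)" .
qed

lemma decay_le_lines: "decay (x, y) \<le> inverse (1 + x\<^sup>2)" "decay (x, y) \<le> inverse (1 + y\<^sup>2)"
proof -
  have "inverse (1 + t\<^sup>2) \<le> 1" "0 \<le> inverse (1 + t\<^sup>2)" for t :: real
    by (auto simp: field_simps add_pos_nonneg)
  then show "decay (x, y) \<le> inverse (1 + x\<^sup>2)" "decay (x, y) \<le> inverse (1 + y\<^sup>2)"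
    unfolding decay_def fst_conv snd_conv by (metis mult.right_neutral mult_left_mono, metis mult.left_neutral mult_right_mono)
qed

lemma integral_x_derivative:
  fixes F F' :: "real \<times> real \<Rightarrow> complex"
  assumes F: "\<And>x y. ((\<lambda>t. F (t, y)) has_vector_derivative F' (x, y)) (at x)" and cont: "continuous_on UNIV F'"
    and bd: "\<And>z. cmod (F' z) \<le> C * decay z" and bd0: "\<And>z. cmod (F z) \<le> D * decay z"
  shows "(\<integral>z. F' z \<partial>lborel) = 0"
proof -
  have int: "integrable lborel F'"
    by (rule integrable_decay_bound[OF borel_measurable_continuous_onI[OF cont] bd])
  have CD: "0 \<le> C" "0 \<le> D"
    using order_trans[OF norm_ge_zero bd[of 0]] order_trans[OF norm_ge_zero bd0[of 0]] decay_pos[of 0]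
    by (auto simp: zero_le_mult_iff)
  have line: "(\<integral>x. F' (x, y) \<partial>lborel) = 0" for y
  proof (rule line_derivative_bounds(2)[OF F])
    show "continuous_on UNIV (\<lambda>x. F' (x, y))"
      by (rule continuous_on_compose2[OF cont]) (auto intro!: continuous_intros)
    show "cmod (F' (x, y)) \<le> C * inverse (1 + x\<^sup>2)" "cmod (F (x, y)) \<le> D * inverse (1 + x\<^sup>2)" for x
      using bd bd0 mult_left_mono[OF decay_le_lines(1) CD(1)] mult_left_mono[OF decay_le_lines(1) CD(2)]
      by (blast intro: order_trans)+
  qed
  have "(\<integral>z. F' z \<partial>lborel) = (\<integral>z. (case z of (x, y) \<Rightarrow> F' (x, y)) \<partial>(lborel \<Otimes>\<^sub>M lborel))"
    by (simp add: lborel_prod)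
  also have "\<dots> = (\<integral>y. (\<integral>x. F' (x, y) \<partial>lborel) \<partial>lborel)"
    by (rule lborel_pair.integral_snd[symmetric]) (use int in \<open>simp add: lborel_prod\<close>)
  finally show ?thesis by (simp add: line)
qed

lemma integral_y_derivative:
  fixes F F' :: "real \<times> real \<Rightarrow> complex"
  assumes F: "\<And>x y. ((\<lambda>t. F (x, t)) has_vector_derivative F' (x, y)) (at y)" and cont: "continuous_on UNIV F'"
    and bd: "\<And>z. cmod (F' z) \<le> C * decay z" and bd0: "\<And>z. cmod (F z) \<le> D * decay z"
  shows "(\<integral>z. F' z \<partial>lborel) = 0"
proof -
  have int: "integrable lborel F'"
    by (rule integrable_decay_bound[OF borel_measurable_continuous_onI[OF cont] bd])
  have CD: "0 \<le> C" "0 \<le> D"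
    using order_trans[OF norm_ge_zero bd[of 0]] order_trans[OF norm_ge_zero bd0[of 0]] decay_pos[of 0]
    by (auto simp: zero_le_mult_iff)
  have line: "(\<integral>y. F' (x, y) \<partial>lborel) = 0" for x
  proof (rule line_derivative_bounds(2)[OF F])
    show "continuous_on UNIV (\<lambda>y. F' (x, y))"
      by (rule continuous_on_compose2[OF cont]) (auto intro!: continuous_intros)
    show "cmod (F' (x, y)) \<le> C * inverse (1 + y\<^sup>2)" "cmod (F (x, y)) \<le> D * inverse (1 + y\<^sup>2)" for y
      using bd bd0 mult_left_mono[OF decay_le_lines(2) CD(1)] mult_left_mono[OF decay_le_lines(2) CD(2)]
      by (blast intro: order_trans)+
  qed
  have "(\<integral>z. F' z \<partial>lborel) = (\<integral>x. (\<integral>y. F' (x, y) \<partial>lborel) \<partial>lborel)"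
    using lborel_pair.integral_fst'[of F'] int by (simp add: lborel_prod)
  then show ?thesis by (simp add: line)
qed

lemma sfun_i_test_D:
  fixes f :: "(real \<times> real) schwartz"
  shows "sfun (\<i> *\<^sub>C test_Dx f) = partial (1, 0) (sfun f)" "sfun (\<i> *\<^sub>C test_Dy f) = partial (0, 1) (sfun f)"
  by (simp_all add: fun_eq_iff mult.assoc[symmetric])

lemma integration_by_parts:
  fixes f g :: "(real \<times> real) schwartz"
  shows "(\<integral>z. partial (1, 0) (sfun f) z * sfun g z \<partial>lborel) = - (\<integral>z. sfun f z * partial (1, 0) (sfun g) z \<partial>lborel)"
  "(\<integral>z. partial (0, 1) (sfun f) z * sfun g z \<partial>lborel) = - (\<integral>z. sfun f z * partial (0, 1) (sfun g) z \<partial>lborel)"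
proof -
  have "(\<integral>z. sfun (\<i> *\<^sub>C test_Dx f) z * sfun g z + sfun f z * sfun (\<i> *\<^sub>C test_Dx g) z \<partial>lborel) = 0"
  proof (rule integral_x_derivative[where F = "\<lambda>z. sfun f z * sfun g z"])
    show "((\<lambda>t. sfun f (t, y) * sfun g (t, y)) has_vector_derivative
      sfun (\<i> *\<^sub>C test_Dx f) (x, y) * sfun g (x, y) + sfun f (x, y) * sfun (\<i> *\<^sub>C test_Dx g) (x, y)) (at x)" for x y
      unfolding sfun_i_test_D
      using has_vector_derivative_mult[OF has_vector_derivative_sfun(1)[of f y x] has_vector_derivative_sfun(1)[of g y x]]
      by (simp add: add.commute)
    show "continuous_on UNIV (\<lambda>z. sfun (\<i> *\<^sub>C test_Dx f) z * sfun g z + sfun f z * sfun (\<i> *\<^sub>C test_Dx g) z)"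
      by (intro continuous_intros continuous_sfun)
    show "cmod (sfun (\<i> *\<^sub>C test_Dx f) z * sfun g z + sfun f z * sfun (\<i> *\<^sub>C test_Dx g) z) \<le>
      (seminorm 0 [] (decay_op (\<i> *\<^sub>C test_Dx f)) * seminorm 0 [] g + seminorm 0 [] (decay_op f) * seminorm 0 [] (\<i> *\<^sub>C test_Dx g)) * decay z" for z
      unfolding distrib_right by (intro norm_triangle_mono sfun_mult_bound)
  qed (rule sfun_mult_bound)
  then have "(\<integral>z. sfun (\<i> *\<^sub>C test_Dx f) z * sfun g z \<partial>lborel) + (\<integral>z. sfun f z * sfun (\<i> *\<^sub>C test_Dx g) z \<partial>lborel) = 0"
    by (subst (asm) Bochner_Integration.integral_add) (intro integrable_sfun_mult)+
  then show "(\<integral>z. partial (1, 0) (sfun f) z * sfun g z \<partial>lborel) = - (\<integral>z. sfun f z * partial (1, 0) (sfun g) z \<partial>lborel)"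
    unfolding sfun_i_test_D by (simp only: eq_neg_iff_add_eq_0)
  have "(\<integral>z. sfun (\<i> *\<^sub>C test_Dy f) z * sfun g z + sfun f z * sfun (\<i> *\<^sub>C test_Dy g) z \<partial>lborel) = 0"
  proof (rule integral_y_derivative[where F = "\<lambda>z. sfun f z * sfun g z"])
    show "((\<lambda>t. sfun f (x, t) * sfun g (x, t)) has_vector_derivative
      sfun (\<i> *\<^sub>C test_Dy f) (x, y) * sfun g (x, y) + sfun f (x, y) * sfun (\<i> *\<^sub>C test_Dy g) (x, y)) (at y)" for x y
      unfolding sfun_i_test_D
      using has_vector_derivative_mult[OF has_vector_derivative_sfun(2)[of f x y] has_vector_derivative_sfun(2)[of g x y]]
      by (simp add: add.commute)
    show "continuous_on UNIV (\<lambda>z. sfun (\<i> *\<^sub>C test_Dy f) z * sfun g z + sfun f z * sfun (\<i> *\<^sub>C test_Dy g) z)"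
      by (intro continuous_intros continuous_sfun)
    show "cmod (sfun (\<i> *\<^sub>C test_Dy f) z * sfun g z + sfun f z * sfun (\<i> *\<^sub>C test_Dy g) z) \<le>
      (seminorm 0 [] (decay_op (\<i> *\<^sub>C test_Dy f)) * seminorm 0 [] g + seminorm 0 [] (decay_op f) * seminorm 0 [] (\<i> *\<^sub>C test_Dy g)) * decay z" for z
      unfolding distrib_right by (intro norm_triangle_mono sfun_mult_bound)
  qed (rule sfun_mult_bound)
  then have "(\<integral>z. sfun (\<i> *\<^sub>C test_Dy f) z * sfun g z \<partial>lborel) + (\<integral>z. sfun f z * sfun (\<i> *\<^sub>C test_Dy g) z \<partial>lborel) = 0"
    by (subst (asm) Bochner_Integration.integral_add) (intro integrable_sfun_mult)+
  then show "(\<integral>z. partial (0, 1) (sfun f) z * sfun g z \<partial>lborel) = - (\<integral>z. sfun f z * partial (0, 1) (sfun g) z \<partial>lborel)"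
    unfolding sfun_i_test_D by (simp only: eq_neg_iff_add_eq_0)
qed

section \<open>Square norms, a Sobolev bound and the sesquilinear pairing\<close>

definition sqnorm :: "(real \<times> real) schwartz \<Rightarrow> real" where
  "sqnorm f = (\<integral>z. (cmod (sfun f z))\<^sup>2 \<partial>lborel)"

lemma integrable_sqnorm: "integrable lborel (\<lambda>z. (cmod (sfun (f :: (real \<times> real) schwartz) z))\<^sup>2)"
  using integrable_norm[OF integrable_sfun_mult[of f f]] by (simp add: norm_mult power2_eq_square)

lemma sqnorm_nonneg: "0 \<le> sqnorm f"
  unfolding sqnorm_def by (rule Bochner_Integration.integral_nonneg) simp

definition sobolev_op :: "(real \<times> real) schwartz \<Rightarrow> (real \<times> real) schwartz" where
  "sobolev_op g = decay_op (\<i> *\<^sub>C test_Dy (\<i> *\<^sub>C test_Dx g))"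

text \<open>Sobolev embedding in crude form: \<open>g\<close> is recovered from its mixed
  derivative, whose modulus decay * |sobolev_op g| is split by decay * a <= decay + a^2. The bound
  is not homogeneous, which suffices for polynomial growth in the Hermite indices.\<close>

lemma sup_bound: "cmod (sfun g z) \<le> integral\<^sup>L lborel decay + sqnorm (sobolev_op g)"
proof -
  let ?gx = "\<i> *\<^sub>C test_Dx g"
  let ?gxy = "\<i> *\<^sub>C test_Dy ?gx"
  obtain x y where z: "z = (x, y)" by (cases z)
  have bd: "cmod (sfun f (s, t)) \<le> seminorm 0 [] (decay_op f) * inverse (1 + s\<^sup>2)"
    "cmod (sfun f (s, t)) \<le> seminorm 0 [] (decay_op f) * inverse (1 + t\<^sup>2)" for f s t
    using sfun_decay[of f "(s, t)"] mult_left_mono[OF decay_le_lines(1) seminorm_nonneg[of "[]" 0 "decay_op f"]]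
      mult_left_mono[OF decay_le_lines(2) seminorm_nonneg[of "[]" 0 "decay_op f"]]
    by (auto intro: order_trans)
  have cont: "continuous_on UNIV (\<lambda>s. sfun f (s, t))" "continuous_on UNIV (\<lambda>s. sfun f (t, s))" for f t
    by (rule continuous_on_compose2[OF continuous_sfun[of UNIV f]]; auto intro!: continuous_intros)+
  have intx: "integrable lborel (\<lambda>s. sfun ?gx (s, y))"
    by (rule line_derivative_bounds(1)[OF has_vector_derivative_sfun(1)[of g y, folded sfun_i_test_D] cont(1) bd(1) bd(1)])
  have "cmod (sfun g (x, y)) \<le> (\<integral>s. cmod (sfun ?gx (s, y)) \<partial>lborel)"
    by (rule line_derivative_bounds(3)[OF has_vector_derivative_sfun(1)[of g y, folded sfun_i_test_D] cont(1) bd(1) bd(1)])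
  also have "\<dots> \<le> (\<integral>s. (\<integral>t. cmod (sfun ?gxy (s, t)) \<partial>lborel) \<partial>lborel)"
  proof (rule integral_mono)
    show "integrable lborel (\<lambda>s. cmod (sfun ?gx (s, y)))" by (rule integrable_norm[OF intx])
    have "integrable (lborel \<Otimes>\<^sub>M lborel) (\<lambda>z. cmod (sfun ?gxy z))"
      unfolding lborel_prod by (rule integrable_norm[OF integrable_sfun])
    then show "integrable lborel (\<lambda>s. \<integral>t. cmod (sfun ?gxy (s, t)) \<partial>lborel)"
      by (rule lborel_pair.integrable_fst')
    show "cmod (sfun ?gx (s, y)) \<le> (\<integral>t. cmod (sfun ?gxy (s, t)) \<partial>lborel)" for s
      by (rule line_derivative_bounds(3)[OF has_vector_derivative_sfun(2)[of ?gx s, folded sfun_i_test_D] cont(2) bd(2) bd(2)])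
  qed
  also have "\<dots> = (\<integral>z. cmod (sfun ?gxy z) \<partial>(lborel \<Otimes>\<^sub>M lborel))"
    by (rule lborel_pair.integral_fst') (unfold lborel_prod, rule integrable_norm[OF integrable_sfun])
  also have "\<dots> \<le> (\<integral>z. decay z + (cmod (sfun (sobolev_op g) z))\<^sup>2 \<partial>lborel)"
    unfolding lborel_prod
  proof (rule integral_mono)
    show "integrable lborel (\<lambda>z. cmod (sfun ?gxy z))" by (rule integrable_norm[OF integrable_sfun])
    show "integrable lborel (\<lambda>z. decay z + (cmod (sfun (sobolev_op g) z))\<^sup>2)"
      using integrable_decay integrable_sqnorm by simp
    fix z
    let ?a = "cmod (sfun (sobolev_op g) z)"
    have "cmod (sfun ?gxy z) = decay z * ?a"
      using decay_pos[of z] by (subst sfun_decay_op) (simp add: norm_mult sobolev_op_def)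
    also have "\<dots> \<le> decay z + ?a\<^sup>2"
    proof (cases "?a \<le> 1")
      case True
      then have "decay z * ?a \<le> decay z * 1" using decay_pos[of z] by (intro mult_left_mono) auto
      then show ?thesis by (simp add: add_increasing2)
    next
      case False
      have "decay z * ?a \<le> 1 * ?a" by (intro mult_right_mono decay_le_one) auto
      also have "\<dots> \<le> ?a\<^sup>2" using mult_right_mono[of 1 ?a ?a] False by (simp add: power2_eq_square)
      finally show ?thesis using decay_pos[of z] by simp
    qed
    finally show "cmod (sfun ?gxy z) \<le> decay z + ?a\<^sup>2" .
  qed
  also have "\<dots> = integral\<^sup>L lborel decay + sqnorm (sobolev_op g)"
    unfolding sqnorm_def by (rule Bochner_Integration.integral_add[OF integrable_decay integrable_sqnorm])
  finally show ?thesis by (simp add: z)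
qed

lemma partials_cnj:
  assumes f: "smooth f" and "bs \<in> lists Basis"
  shows "partials bs (\<lambda>z. cnj (f z)) = (\<lambda>z. cnj (partials bs f z))"
  using assms(2)
proof (induction bs)
  case (Cons b bs)
  then have bs: "bs \<in> lists Basis" by simp
  have "partial b (\<lambda>z. cnj (partials bs f z)) = (\<lambda>z. cnj (frechet_derivative (partials bs f) (at z) b))"
    by (intro partial_eqI bounded_linear.has_derivative[OF bounded_linear_cnj] has_derivative_frechet smoothD f bs)
  then show ?case using Cons by (simp add: partial_def)
qed simp

lift_definition cnj_schwartz :: "'a::euclidean_space schwartz \<Rightarrow> 'a schwartz" is "\<lambda>f z. cnj (f z)"
proof (rule schwartz_functionI)
  fix f :: "'a \<Rightarrow> complex" assume f: "schwartz_function f"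
  note sf = schwartz_functionD(1)[OF f]
  show "smooth (\<lambda>z. cnj (f z))"
    unfolding smooth_def
  proof (intro ballI allI)
    fix bs :: "'a list" and z assume "bs \<in> lists Basis"
    then show "partials bs (\<lambda>z. cnj (f z)) differentiable at z"
      unfolding partials_cnj[OF sf \<open>bs \<in> lists Basis\<close>] using smoothD[OF sf]
      by (intro differentiableI[OF bounded_linear.has_derivative[OF bounded_linear_cnj has_derivative_frechet]]) auto
  qed
  fix N and bs :: "'a list" assume bs: "bs \<in> lists Basis"
  show "\<exists>C. \<forall>z. norm z ^ N * cmod (partials bs (\<lambda>z. cnj (f z)) z) \<le> C"
    using schwartz_functionD(2)[OF f bs] by (simp add: partials_cnj[OF sf bs])
qed

lemma sfun_cnj [simp]: "sfun (cnj_schwartz f) z = cnj (sfun f z)"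
  by (simp add: cnj_schwartz.rep_eq)

lemma partial_cnj: "b \<in> Basis \<Longrightarrow> partial b (sfun (cnj_schwartz f)) z = cnj (partial b (sfun f) z)"
  using partials_cnj[OF smooth_sfun, of "[b]" f] by (simp add: cnj_schwartz.rep_eq)

definition ip :: "(real \<times> real) schwartz \<Rightarrow> (real \<times> real) schwartz \<Rightarrow> complex" where
  "ip f g = (\<integral>z. sfun f z * cnj (sfun g z) \<partial>lborel)"

lemma ip_add: "ip (f + g) k = ip f k + ip g k" "ip k (f + g) = ip k f + ip k g"
  by (simp_all add: ip_def distrib_right distrib_left integrable_sfun_cnj)

lemma ip_scale: "ip (c *\<^sub>C f) g = c * ip f g" "ip f (c *\<^sub>C g) = cnj c * ip f g"
  by (simp_all add: ip_def mult.assoc mult.left_commute[of _ "cnj c"])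

lemma ip_zero: "ip 0 g = 0" "ip f 0 = 0"
  by (simp_all add: ip_def)

lemma ip_diff: "ip (f - g) k = ip f k - ip g k"
  by (simp add: ip_def left_diff_distrib integrable_sfun_cnj)

lemma ip_commute: "ip g f = cnj (ip f g)"
  unfolding ip_def Bochner_Integration.integral_cnj[symmetric] by (simp add: mult.commute)

lemma ip_self: "ip f f = of_real (sqnorm f)"
proof -
  have "(\<lambda>z. sfun f z * cnj (sfun f z)) = (\<lambda>z. of_real ((cmod (sfun f z))\<^sup>2))"
    by (intro ext) (simp only: complex_norm_square)
  then show ?thesis by (simp only: ip_def sqnorm_def integral_complex_of_real)
qed

lemma ip_test:
  "ip (test_x f) g = ip f (test_x g)" "ip (test_y f) g = ip f (test_y g)"
  "ip (test_Dx f) g = ip f (test_Dx g)" "ip (test_Dy f) g = ip f (test_Dy g)"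
proof -
  show "ip (test_x f) g = ip f (test_x g)" "ip (test_y f) g = ip f (test_y g)"
    by (simp_all add: ip_def mult_ac)
  have "ip (test_Dx f) g = - \<i> * (\<integral>z. partial (1, 0) (sfun f) z * sfun (cnj_schwartz g) z \<partial>lborel)"
    by (simp add: ip_def mult.assoc)
  also have "\<dots> = \<i> * (\<integral>z. sfun f z * partial (1, 0) (sfun (cnj_schwartz g)) z \<partial>lborel)"
    unfolding integration_by_parts(1) by simp
  also have "\<dots> = ip f (test_Dx g)"
    by (simp add: ip_def partial_cnj Basis_R2 mult.left_commute[of _ "\<i>"])
  finally show "ip (test_Dx f) g = ip f (test_Dx g)" .
  have "ip (test_Dy f) g = - \<i> * (\<integral>z. partial (0, 1) (sfun f) z * sfun (cnj_schwartz g) z \<partial>lborel)"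
    by (simp add: ip_def mult.assoc)
  also have "\<dots> = \<i> * (\<integral>z. sfun f z * partial (0, 1) (sfun (cnj_schwartz g)) z \<partial>lborel)"
    unfolding integration_by_parts(2) by simp
  also have "\<dots> = ip f (test_Dy g)"
    by (simp add: ip_def partial_cnj Basis_R2 mult.left_commute[of _ "\<i>"])
  finally show "ip (test_Dy f) g = ip f (test_Dy g)" .
qed

text \<open>The arithmetic-geometric inequality in place of Cauchy-Schwarz; this is enough because
  the second argument will be a normalized Hermite function.\<close>

lemma ip_bound: "cmod (ip f g) \<le> sqnorm f + sqnorm g"
proof -
  have "cmod (ip f g) \<le> (\<integral>z. cmod (sfun f z * cnj (sfun g z)) \<partial>lborel)"
    unfolding ip_def by (rule integral_norm_bound)
  also have "\<dots> \<le> (\<integral>z. (cmod (sfun f z))\<^sup>2 + (cmod (sfun g z))\<^sup>2 \<partial>lborel)"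
  proof (rule integral_mono)
    show "integrable lborel (\<lambda>z. cmod (sfun f z * cnj (sfun g z)))" using integrable_sfun_cnj by (rule integrable_norm)
    show "integrable lborel (\<lambda>z. (cmod (sfun f z))\<^sup>2 + (cmod (sfun g z))\<^sup>2)" using integrable_sqnorm by simp
    show "cmod (sfun f z * cnj (sfun g z)) \<le> (cmod (sfun f z))\<^sup>2 + (cmod (sfun g z))\<^sup>2" for z
      using sum_squares_bound[of "cmod (sfun f z)" "cmod (sfun g z)"] zero_le_power2[of "cmod (sfun f z)"] zero_le_power2[of "cmod (sfun g z)"]
      mult_nonneg_nonneg[OF norm_ge_zero[of "sfun f z"] norm_ge_zero[of "sfun g z"]]
      unfolding norm_mult complex_mod_cnj by linarith
  qed
  also have "\<dots> = sqnorm f + sqnorm g"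
    unfolding sqnorm_def by (rule Bochner_Integration.integral_add[OF integrable_sqnorm integrable_sqnorm])
  finally show ?thesis .
qed

lemma ip_continuous: "cmod (ip f g) \<le> (\<integral>z. cmod (sfun f z) \<partial>lborel) * seminorm 0 [] g"
proof -
  have "cmod (ip f g) \<le> (\<integral>z. cmod (sfun f z * cnj (sfun g z)) \<partial>lborel)"
    unfolding ip_def by (rule integral_norm_bound)
  also have "\<dots> \<le> (\<integral>z. cmod (sfun f z) * seminorm 0 [] g \<partial>lborel)"
    using integrable_norm[OF integrable_sfun_cnj[of f g]] integrable_sfun[of f]
    by (intro integral_mono) (auto simp: norm_mult intro!: mult_left_mono sfun_bounded)
  finally show ?thesis by simp
qed

lemma partial_add:
  assumes "\<And>z. f differentiable at z" "\<And>z. g differentiable at z"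
  shows "partial e (\<lambda>z. f z + g z) = (\<lambda>z. partial e f z + partial e g z)"
proof -
  have "partial e (\<lambda>z. f z + g z) = (\<lambda>z. frechet_derivative f (at z) e + frechet_derivative g (at z) e)"
    by (rule partial_eqI) (intro has_derivative_add has_derivative_frechet assms)
  then show ?thesis by (simp add: partial_def)
qed

lemma partial_scale:
  assumes "\<And>z. f differentiable at z"
  shows "partial e (\<lambda>z. c * f z) = (\<lambda>z. c * partial e f z)"
proof -
  have "partial e (\<lambda>z. c * f z) = (\<lambda>z. c * frechet_derivative f (at z) e)"
    by (rule partial_eqI) (intro has_derivative_mult_right has_derivative_frechet assms)
  then show ?thesis by (simp add: partial_def)
qed

lemma partial_linear_mult:
  fixes l :: "'a::euclidean_space \<Rightarrow> real"
  assumes "bounded_linear l" "\<And>z. f differentiable at z"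
  shows "partial e (\<lambda>z. of_real (l z) * f z) = (\<lambda>z. of_real (l e) * f z + of_real (l z) * partial e f z)"
    "(\<lambda>z. of_real (l z) * f z) differentiable at z"
proof -
  have l: "((\<lambda>z. complex_of_real (l z)) has_derivative (\<lambda>h. of_real (l h))) (at z)" for z
    using bounded_linear.has_derivative[OF bounded_linear_of_real bounded_linear_imp_has_derivative[OF assms(1)]] .
  have *: "((\<lambda>z. of_real (l z) * f z) has_derivative
    (\<lambda>h. of_real (l z) * frechet_derivative f (at z) h + of_real (l h) * f z)) (at z)" for z
    by (rule has_derivative_mult[OF l has_derivative_frechet[OF assms(2)]])
  show "partial e (\<lambda>z. of_real (l z) * f z) = (\<lambda>z. of_real (l e) * f z + of_real (l z) * partial e f z)"
    using partial_eqI[OF *, of e] by (simp add: partial_def add.commute)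
  show "(\<lambda>z. of_real (l z) * f z) differentiable at z" by (rule differentiableI[OF *])
qed

section \<open>The twisted Hermite functions\<close>

locale twisted_pair =
  fixes p q :: real
  assumes pq: "p + q = 1"
begin

text \<open>The exponent of \<open>gauss\<close> is forced by \<open>lad\<close> and \<open>lad'\<close> annihilating it.\<close>

definition gauss_rate :: real where "gauss_rate = 1 / (p\<^sup>2 + q\<^sup>2)"
definition gauss_tilt :: complex where "gauss_tilt = \<i> * of_real (gauss_rate * (p - q))"

lemma sum_squares_pos: "0 < p\<^sup>2 + q\<^sup>2"
  using pq by (metis add.right_neutral sum_power2_gt_zero_iff zero_neq_one)

lemma al_pos: "0 < gauss_rate" using sum_squares_pos by (simp add: gauss_rate_def)

lemma al_eq: "gauss_rate * (p\<^sup>2 + q\<^sup>2) = 1"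
proof -
  have "1 / x * x = 1" if "0 < x" for x :: real using that by simp
  from this[OF sum_squares_pos] show ?thesis unfolding gauss_rate_def .
qed

definition gauss :: "real \<times> real \<Rightarrow> complex" where
  "gauss z = exp (of_real (- gauss_rate * ((fst z)\<^sup>2 + (snd z)\<^sup>2) / 2) + gauss_tilt * of_real (fst z * snd z))"

lemma gauss_has_derivative:
  "(gauss has_derivative (\<lambda>h. gauss z * (of_real (- gauss_rate * (fst z * fst h + snd z * snd h)) +
     gauss_tilt * of_real (fst z * snd h + fst h * snd z)))) (at z)"
proof -
  have 1: "((\<lambda>z. - gauss_rate * ((fst z)\<^sup>2 + (snd z)\<^sup>2) / 2) has_derivative (\<lambda>h. - gauss_rate * (fst z * fst h + snd z * snd h))) (at z)" for z :: "real \<times> real"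
    by (auto intro!: derivative_eq_intros simp: fun_eq_iff field_simps)
  have 2: "((\<lambda>z. fst z * snd z) has_derivative (\<lambda>h. fst z * snd h + fst h * snd z)) (at z)" for z :: "real \<times> real"
    by (rule has_derivative_mult) (auto intro!: derivative_eq_intros)
  have 3: "((\<lambda>z. complex_of_real (- gauss_rate * ((fst z)\<^sup>2 + (snd z)\<^sup>2) / 2) + gauss_tilt * of_real (fst z * snd z)) has_derivative
    (\<lambda>h. of_real (- gauss_rate * (fst z * fst h + snd z * snd h)) + gauss_tilt * of_real (fst z * snd h + fst h * snd z))) (at z)"
    by (intro has_derivative_add has_derivative_mult_right bounded_linear.has_derivative[OF bounded_linear_of_real] 1 2)
  have "(exp has_derivative (*) (exp w)) (at w)" for w :: complex
    using DERIV_exp[of w] by (simp add: has_field_derivative_def)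
  from has_derivative_compose[OF 3 this] show ?thesis by (simp add: gauss_def[abs_def])
qed

lemma gauss_differentiable: "gauss differentiable at z"
  by (rule differentiableI[OF gauss_has_derivative])

lemma partial_gauss:
  "partial (1, 0) gauss = (\<lambda>z. of_real (- gauss_rate) * (of_real (fst z) * gauss z) + gauss_tilt * (of_real (snd z) * gauss z))"
  "partial (0, 1) gauss = (\<lambda>z. of_real (- gauss_rate) * (of_real (snd z) * gauss z) + gauss_tilt * (of_real (fst z) * gauss z))"
  unfolding partial_eqI[OF gauss_has_derivative] by (simp_all add: fun_eq_iff algebra_simps)

text \<open>Polynomials times \<open>gauss\<close>, generated so that closure under derivatives,
  decay and commutation of mixed partial derivatives all follow by rule induction. The commutation
  relations of the ladder operators are then established on this class.\<close>

inductive gauss_poly :: "(real \<times> real \<Rightarrow> complex) \<Rightarrow> bool" where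
  base: "gauss_poly gauss"
| x: "gauss_poly f \<Longrightarrow> gauss_poly (\<lambda>z. of_real (fst z) * f z)"
| y: "gauss_poly f \<Longrightarrow> gauss_poly (\<lambda>z. of_real (snd z) * f z)"
| add: "gauss_poly f \<Longrightarrow> gauss_poly g \<Longrightarrow> gauss_poly (\<lambda>z. f z + g z)"
| scale: "gauss_poly f \<Longrightarrow> gauss_poly (\<lambda>z. c * f z)"

lemma gauss_poly_differentiable: "gauss_poly f \<Longrightarrow> f differentiable at z"
proof (induction arbitrary: z rule: gauss_poly.induct)
  case (x f)
  show ?case by (rule partial_linear_mult(2)[OF bounded_linear_fst x.IH])
next
  case (y f)
  show ?case by (rule partial_linear_mult(2)[OF bounded_linear_snd y.IH])
qed (auto intro: gauss_differentiable differentiable_add differentiable_mult differentiable_const)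

lemmas partial_rules =
  partial_add[OF gauss_poly_differentiable gauss_poly_differentiable]
  partial_scale[OF gauss_poly_differentiable]
  partial_linear_mult(1)[OF bounded_linear_fst gauss_poly_differentiable]
  partial_linear_mult(1)[OF bounded_linear_snd gauss_poly_differentiable]

lemma gauss_poly_partial:
  assumes "gauss_poly f" "e = (1, 0) \<or> e = (0, 1)"
  shows "gauss_poly (partial e f)"
  using assms(1)
proof induction
  case base
  show ?case
    using assms(2)
  proof
    assume "e = (1, 0)"
    then show ?thesis by (simp only: partial_gauss) (intro gauss_poly.intros)
  next
    assume "e = (0, 1)"
    then show ?thesis by (simp only: partial_gauss) (intro gauss_poly.intros)
  qed
next
  case (x f)
  show ?case unfolding partial_rules(3)[OF x.hyps] by (intro gauss_poly.intros x)
next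
  case (y f)
  show ?case unfolding partial_rules(4)[OF y.hyps] by (intro gauss_poly.intros y)
next
  case (add f g)
  show ?case unfolding partial_rules(1)[OF add.hyps] by (intro gauss_poly.intros add)
next
  case (scale f c)
  show ?case unfolding partial_rules(2)[OF scale.hyps] by (intro gauss_poly.intros scale)
qed

lemma gauss_poly_mixed_partials:
  "gauss_poly f \<Longrightarrow> partial (1, 0) (partial (0, 1) f) = partial (0, 1) (partial (1, 0) f)"
proof (induction rule: gauss_poly.induct)
  case base
  show ?case
    unfolding partial_gauss
    by (simp only: partial_rules gauss_poly.intros partial_gauss fst_conv snd_conv)
      (simp add: fun_eq_iff algebra_simps)
next
  case (x f)
  note g = x.hyps gauss_poly_partial[OF x.hyps]
  show ?case using x.IH by (simp add: partial_rules g gauss_poly.intros fun_eq_iff)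
next
  case (y f)
  note g = y.hyps gauss_poly_partial[OF y.hyps]
  show ?case using y.IH by (simp add: partial_rules g gauss_poly.intros fun_eq_iff)
next
  case (add f g)
  note g = add.hyps gauss_poly_partial[OF add.hyps(1)] gauss_poly_partial[OF add.hyps(2)]
  show ?case using add.IH by (simp add: partial_rules g gauss_poly.intros fun_eq_iff)
next
  case (scale f c)
  note g = scale.hyps gauss_poly_partial[OF scale.hyps]
  show ?case using scale.IH by (simp add: partial_rules g gauss_poly.intros fun_eq_iff)
qed

lemma cmod_gauss: "cmod (gauss z) = exp (- gauss_rate * (norm z)\<^sup>2 / 2)"
proof -
  have "Re gauss_tilt = 0" by (simp add: gauss_tilt_def)
  then have "Re (of_real (- gauss_rate * ((fst z)\<^sup>2 + (snd z)\<^sup>2) / 2) + gauss_tilt * of_real (fst z * snd z)) = - gauss_rate * ((fst z)\<^sup>2 + (snd z)\<^sup>2) / 2"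
    by simp
  moreover have "(norm z)\<^sup>2 = (fst z)\<^sup>2 + (snd z)\<^sup>2"
    by (cases z) (simp add: norm_Pair)
  ultimately show ?thesis unfolding gauss_def norm_exp_eq_Re by simp
qed

lemma power_exp_bound:
  fixes c t :: real
  assumes "0 < c" "0 \<le> t"
  shows "t ^ N * exp (- c * t\<^sup>2) \<le> 1 + (real (Suc N) / c) ^ Suc N"
proof -
  define n where "n = Suc N"
  have n: "0 < real n" by (simp add: n_def)
  have "t ^ N \<le> 1 + (t\<^sup>2) ^ n"
  proof (cases "t \<le> 1")
    case True
    then have "t ^ N \<le> 1" using assms(2) by (simp add: power_le_one)
    then show ?thesis using assms(2) by (simp add: add_increasing2)
  next
    case False
    then have "t ^ N \<le> t ^ (2 * n)" by (intro power_increasing) (auto simp: n_def)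
    then show ?thesis by (simp add: power_mult add_increasing)
  qed
  then have "t ^ N * exp (- c * t\<^sup>2) \<le> (1 + (t\<^sup>2) ^ n) * exp (- c * t\<^sup>2)"
    by (rule mult_right_mono) simp
  also have "\<dots> = exp (- c * t\<^sup>2) + (t\<^sup>2) ^ n * exp (- c * t\<^sup>2)" by (simp add: distrib_right)
  finally have 1: "t ^ N * exp (- c * t\<^sup>2) \<le> exp (- c * t\<^sup>2) + (t\<^sup>2) ^ n * exp (- c * t\<^sup>2)" .
  have 2: "exp (- c * t\<^sup>2) \<le> 1" using assms by simp
  have 3: "(t\<^sup>2) ^ n * exp (- c * t\<^sup>2) \<le> (real n / c) ^ n"
  proof -
    \<comment> \<open>y <= exp y, raised to the power \<open>n\<close>, bounds (t^2)^n by the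
      growing exponential.\<close>
    let ?y = "c * t\<^sup>2 / real n"
    have "?y \<le> exp ?y" using exp_ge_add_one_self[of ?y] by linarith
    then have "?y ^ n \<le> exp ?y ^ n" using assms n by (intro power_mono) auto
    also have "\<dots> = exp (c * t\<^sup>2)" using n by (simp add: exp_of_nat_mult[symmetric])
    finally have "(t\<^sup>2) ^ n * (c / real n) ^ n \<le> exp (c * t\<^sup>2)"
      by (simp add: power_mult_distrib[symmetric] mult_ac)
    then have "(t\<^sup>2) ^ n * (c / real n) ^ n * exp (- c * t\<^sup>2) \<le> exp (c * t\<^sup>2) * exp (- c * t\<^sup>2)"
      by (rule mult_right_mono) simp
    then have "(t\<^sup>2) ^ n * (c / real n) ^ n * exp (- c * t\<^sup>2) \<le> 1" by (simp add: exp_add[symmetric])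
    then have "(real n / c) ^ n * ((t\<^sup>2) ^ n * (c / real n) ^ n * exp (- c * t\<^sup>2)) \<le> (real n / c) ^ n * 1"
      using assms n by (intro mult_left_mono) auto
    moreover have "(real n / c) ^ n * (c / real n) ^ n = 1"
      using assms n by (simp add: power_mult_distrib[symmetric])
    moreover have "x \<le> a" if "a * (x' * b * e) \<le> a * 1" "a * b = 1" "x = x' * e" for a b e x x' :: real
    proof -
      have "a * (x' * b * e) = (a * b) * (x' * e)" by (simp only: mult_ac)
      also have "\<dots> = x" by (simp only: that(2,3) mult_1)
      finally show ?thesis using that(1) by (simp only: mult_1_right)
    qed
    ultimately show ?thesis by blast
  qed
  from 1 2 3 show ?thesis unfolding n_def by linarith
qed

lemma gauss_poly_decay: "gauss_poly f \<Longrightarrow> \<exists>C. \<forall>z. norm z ^ N * cmod (f z) \<le> C"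
proof (induction arbitrary: N rule: gauss_poly.induct)
  case base
  have "norm z ^ N * cmod (gauss z) \<le> 1 + (real (Suc N) / (gauss_rate / 2)) ^ Suc N" for z
    using power_exp_bound[of "gauss_rate / 2" "norm z" N] al_pos by (simp add: cmod_gauss)
  then show ?case by blast
next
  case (x f)
  obtain C where C: "\<And>z. norm z ^ Suc N * cmod (f z) \<le> C" using x.IH by blast
  have "norm z ^ N * cmod (of_real (fst z) * f z) \<le> C" for z
  proof -
    have "norm z ^ N * (\<bar>fst z\<bar> * cmod (f z)) \<le> norm z ^ N * (norm z * cmod (f z))"
      using norm_fst_le[of "fst z" "snd z"] by (intro mult_left_mono mult_right_mono) auto
    then show ?thesis using C[of z] by (simp add: norm_mult mult_ac)
  qed
  then show ?case by blast
next
  case (y f)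
  obtain C where C: "\<And>z. norm z ^ Suc N * cmod (f z) \<le> C" using y.IH by blast
  have "norm z ^ N * cmod (of_real (snd z) * f z) \<le> C" for z
  proof -
    have "norm z ^ N * (\<bar>snd z\<bar> * cmod (f z)) \<le> norm z ^ N * (norm z * cmod (f z))"
      using norm_snd_le[of "snd z" "fst z"] by (intro mult_left_mono mult_right_mono) auto
    then show ?thesis using C[of z] by (simp add: norm_mult mult_ac)
  qed
  then show ?case by blast
next
  case (add f g)
  obtain C D where C: "\<And>z. norm z ^ N * cmod (f z) \<le> C" and D: "\<And>z. norm z ^ N * cmod (g z) \<le> D"
    using add.IH by meson
  have "norm z ^ N * cmod (f z + g z) \<le> C + D" for z
  proof -
    have "norm z ^ N * cmod (f z + g z) \<le> norm z ^ N * (cmod (f z) + cmod (g z))"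
      by (intro mult_left_mono norm_triangle_ineq) auto
    then show ?thesis using C[of z] D[of z] by (simp add: distrib_left)
  qed
  then show ?case by blast
next
  case (scale f c)
  obtain C where C: "\<And>z. norm z ^ N * cmod (f z) \<le> C" using scale.IH by blast
  have "norm z ^ N * cmod (c * f z) \<le> cmod c * C" for z
    using mult_left_mono[OF C[of z], of "cmod c"] by (simp add: norm_mult mult_ac)
  then show ?case by blast
qed

lemma Basis_R2_cases: "e \<in> (Basis :: (real \<times> real) set) \<Longrightarrow> e = (1, 0) \<or> e = (0, 1)"
  by (auto simp: Basis_prod_def)

lemma gauss_poly_partials: "gauss_poly f \<Longrightarrow> bs \<in> lists Basis \<Longrightarrow> gauss_poly (partials bs f)"
  by (induction bs) (auto intro!: gauss_poly_partial dest: Basis_R2_cases)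

lemma gauss_poly_schwartz:
  assumes "gauss_poly f"
  shows "schwartz_function f"
proof (rule schwartz_functionI)
  show "smooth f"
    unfolding smooth_def using gauss_poly_differentiable[OF gauss_poly_partials[OF assms]] by blast
  show "\<exists>C. \<forall>z. norm z ^ N * cmod (partials bs f z) \<le> C" if "bs \<in> lists Basis" for N bs
    by (rule gauss_poly_decay[OF gauss_poly_partials[OF assms that]])
qed

definition ground :: "(real \<times> real) schwartz" where "ground = Abs_schwartz gauss"

lemma sfun_ground: "sfun ground = gauss"
  unfolding ground_def by (rule Abs_schwartz_inverse) (simp add: gauss_poly_schwartz gauss_poly.base)

definition gauss_tests :: "(real \<times> real) schwartz set" where "gauss_tests = {f. gauss_poly (sfun f)}"

lemma G_ground: "ground \<in> gauss_tests" by (simp add: gauss_tests_def sfun_ground gauss_poly.base)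

lemma G_closed:
  "f \<in> gauss_tests \<Longrightarrow> test_x f \<in> gauss_tests" "f \<in> gauss_tests \<Longrightarrow> test_y f \<in> gauss_tests" "f \<in> gauss_tests \<Longrightarrow> test_Dx f \<in> gauss_tests" "f \<in> gauss_tests \<Longrightarrow> test_Dy f \<in> gauss_tests"
  "f \<in> gauss_tests \<Longrightarrow> g \<in> gauss_tests \<Longrightarrow> f + g \<in> gauss_tests" "f \<in> gauss_tests \<Longrightarrow> c *\<^sub>C f \<in> gauss_tests" "f \<in> gauss_tests \<Longrightarrow> g \<in> gauss_tests \<Longrightarrow> f - g \<in> gauss_tests"
proof -
  show sc: "c *\<^sub>C f \<in> gauss_tests" if "f \<in> gauss_tests" for c f
    using that by (simp add: gauss_tests_def scaleC_schwartz.rep_eq gauss_poly.scale)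
  show ad: "f + g \<in> gauss_tests" if "f \<in> gauss_tests" "g \<in> gauss_tests" for f g
    using that by (simp add: gauss_tests_def plus_schwartz.rep_eq gauss_poly.add)
  show "f - g \<in> gauss_tests" if "f \<in> gauss_tests" "g \<in> gauss_tests" for f g
  proof -
    have "f - g = f + (- 1) *\<^sub>C g" by (rule schwartz_eqI) simp
    then show ?thesis by (simp only:) (intro sc ad that)
  qed
  show "test_x f \<in> gauss_tests" "test_y f \<in> gauss_tests" if "f \<in> gauss_tests" for f
    using that unfolding gauss_tests_def mem_Collect_eq test_x.rep_eq test_y.rep_eq by (rule gauss_poly.x gauss_poly.y)+
  show "test_Dx f \<in> gauss_tests" if "f \<in> gauss_tests" for f
    using that unfolding gauss_tests_def mem_Collect_eq test_Dx.rep_eq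
    by (intro gauss_poly.scale gauss_poly_partial) auto
  show "test_Dy f \<in> gauss_tests" if "f \<in> gauss_tests" for f
    using that unfolding gauss_tests_def mem_Collect_eq test_Dy.rep_eq
    by (intro gauss_poly.scale gauss_poly_partial) auto
qed

end

lemma test_linear:
  "test_x (f + g) = test_x f + test_x g" "test_y (f + g) = test_y f + test_y g"
  "test_Dx (f + g) = test_Dx f + test_Dx g" "test_Dy (f + g) = test_Dy f + test_Dy g"
  "test_x (c *\<^sub>C f) = c *\<^sub>C test_x f" "test_y (c *\<^sub>C f) = c *\<^sub>C test_y f"
  "test_Dx (c *\<^sub>C f) = c *\<^sub>C test_Dx f" "test_Dy (c *\<^sub>C f) = c *\<^sub>C test_Dy f"
  "test_x (f - g) = test_x f - test_x g" "test_y (f - g) = test_y f - test_y g"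
  "test_Dx (f - g) = test_Dx f - test_Dx g" "test_Dy (f - g) = test_Dy f - test_Dy g"
  using clinear_test unfolding clinear_iff
  by (simp_all, (metis (no_types, lifting) diff_add_cancel eq_diff_eq)+)

lemma test_commute:
  "test_Dx (test_x f) = test_x (test_Dx f) - \<i> *\<^sub>C f" "test_Dx (test_y f) = test_y (test_Dx f)"
  "test_Dy (test_x f) = test_x (test_Dy f)" "test_Dy (test_y f) = test_y (test_Dy f) - \<i> *\<^sub>C f"
  "test_y (test_x f) = test_x (test_y f)"
proof -
  have px: "partial e (sfun (test_x f)) z = of_real (fst e) * sfun f z + of_real (fst z) * partial e (sfun f) z"
    and py: "partial e (sfun (test_y f)) z = of_real (snd e) * sfun f z + of_real (snd z) * partial e (sfun f) z" for e z
    using partial_linear_mult(1)[OF bounded_linear_fst sfun_differentiable, of e f]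
      partial_linear_mult(1)[OF bounded_linear_snd sfun_differentiable, of e f]
    by (simp_all add: test_x.rep_eq test_y.rep_eq)
  show "test_Dx (test_x f) = test_x (test_Dx f) - \<i> *\<^sub>C f" "test_Dx (test_y f) = test_y (test_Dx f)"
    "test_Dy (test_x f) = test_x (test_Dy f)" "test_Dy (test_y f) = test_y (test_Dy f) - \<i> *\<^sub>C f"
    "test_y (test_x f) = test_x (test_y f)"
    by (rule schwartz_eqI, simp add: px py algebra_simps)+
qed

lemma (in twisted_pair) test_D_commute:
  assumes "f \<in> gauss_tests"
  shows "test_Dy (test_Dx f) = test_Dx (test_Dy f)"
proof (rule schwartz_eqI)
  fix z
  have g: "gauss_poly (partial (1, 0) (sfun f))" "gauss_poly (partial (0, 1) (sfun f))"
    using assms by (simp_all add: gauss_tests_def gauss_poly_partial)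
  have *: "partial e (sfun (test_Dx f)) = (\<lambda>z. - \<i> * partial e (partial (1, 0) (sfun f)) z)"
     "partial e (sfun (test_Dy f)) = (\<lambda>z. - \<i> * partial e (partial (0, 1) (sfun f)) z)" for e
    unfolding test_Dx.rep_eq test_Dy.rep_eq by (rule partial_rules(2), rule g)+
  show "sfun (test_Dy (test_Dx f)) z = sfun (test_Dx (test_Dy f)) z"
    using gauss_poly_mixed_partials[of "sfun f"] assms by (simp add: * gauss_tests_def)
qed

section \<open>Ladder operators on test functions\<close>

definition sqrt_half :: complex where "sqrt_half = of_real (1 / sqrt 2)"

lemma r2_sq: "sqrt_half * (sqrt_half * w) = w / 2" "sqrt_half * sqrt_half = 1 / 2" "cnj sqrt_half = sqrt_half"
proof -
  have *: "sqrt_half * sqrt_half = 1 / 2" unfolding sqrt_half_def of_real_mult[symmetric] by simp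
  then show "sqrt_half * (sqrt_half * w) = w / 2" "sqrt_half * sqrt_half = 1 / 2" by (simp_all add: mult.assoc[symmetric])
  show "cnj sqrt_half = sqrt_half" by (simp add: sqrt_half_def)
qed

context twisted_pair
begin

text \<open>Transposes, on test functions, of the operators acting on distributions, whence the
  reversed signs of the derivatives; \<open>tX'\<close> and \<open>tY'\<close> belong to the
  commuting pair. Transposition also reverses the commutator, so [tX, tY] = - \<i>.\<close>

definition tX where "tX f = test_x f + of_real q *\<^sub>C test_Dy f"
definition tY where "tY f = test_y f - of_real p *\<^sub>C test_Dx f"
definition tX' where "tX' f = test_x f - of_real p *\<^sub>C test_Dy f"
definition tY' where "tY' f = test_y f + of_real q *\<^sub>C test_Dx f"

lemma q_eq: "complex_of_real q = 1 - of_real p"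
  using pq by (metis add_diff_cancel_left' of_real_1 of_real_diff)

lemma t_linear:
  "tX (f + g) = tX f + tX g" "tY (f + g) = tY f + tY g" "tX' (f + g) = tX' f + tX' g" "tY' (f + g) = tY' f + tY' g"
  "tX (f - g) = tX f - tX g" "tY (f - g) = tY f - tY g" "tX' (f - g) = tX' f - tX' g" "tY' (f - g) = tY' f - tY' g"
  "tX (c *\<^sub>C f) = c *\<^sub>C tX f" "tY (c *\<^sub>C f) = c *\<^sub>C tY f" "tX' (c *\<^sub>C f) = c *\<^sub>C tX' f" "tY' (c *\<^sub>C f) = c *\<^sub>C tY' f"
  unfolding tX_def tY_def tX'_def tY'_def test_linear
  by (rule schwartz_eqI, simp add: algebra_simps del: sfun_test)+

lemma t_commute:
  assumes "f \<in> gauss_tests"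
  shows "tX (tY f) = tY (tX f) - \<i> *\<^sub>C f" "tX' (tY' f) = tY' (tX' f) + \<i> *\<^sub>C f"
    "tX (tX' f) = tX' (tX f)" "tX (tY' f) = tY' (tX f)" "tY (tX' f) = tX' (tY f)" "tY (tY' f) = tY' (tY f)"
  unfolding tX_def tY_def tX'_def tY'_def test_linear test_commute test_D_commute[OF assms]
  by (rule schwartz_eqI, simp add: q_eq algebra_simps del: sfun_test)+

lemma t_G: "f \<in> gauss_tests \<Longrightarrow> tX f \<in> gauss_tests" "f \<in> gauss_tests \<Longrightarrow> tY f \<in> gauss_tests" "f \<in> gauss_tests \<Longrightarrow> tX' f \<in> gauss_tests" "f \<in> gauss_tests \<Longrightarrow> tY' f \<in> gauss_tests"
  unfolding tX_def tY_def tX'_def tY'_def by (intro G_closed; assumption)+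

lemma ip_diff_right: "ip k (f - g) = ip k f - ip k g"
  by (metis (no_types) complex_cnj_diff ip_commute ip_diff)

lemma ip_t: "ip (tX f) g = ip f (tX g)" "ip (tY f) g = ip f (tY g)" "ip (tX' f) g = ip f (tX' g)" "ip (tY' f) g = ip f (tY' g)"
  unfolding tX_def tY_def tX'_def tY'_def by (simp_all add: ip_add ip_diff ip_diff_right ip_scale ip_test)

text \<open>The signs follow the commutators: [tX, tY] = - \<i> makes tX - \<i> tY the lowering
  operator, while [tX', tY'] = \<i> requires the opposite sign for the primed pair.\<close>

definition lad where "lad f = sqrt_half *\<^sub>C (tX f - \<i> *\<^sub>C tY f)"
definition rad where "rad f = sqrt_half *\<^sub>C (tX f + \<i> *\<^sub>C tY f)"
definition lad' where "lad' f = sqrt_half *\<^sub>C (tX' f + \<i> *\<^sub>C tY' f)"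
definition rad' where "rad' f = sqrt_half *\<^sub>C (tX' f - \<i> *\<^sub>C tY' f)"

lemmas ladder_defs = lad_def rad_def lad'_def rad'_def

lemma ladder_linear:
  "lad (f + g) = lad f + lad g" "rad (f + g) = rad f + rad g" "lad' (f + g) = lad' f + lad' g" "rad' (f + g) = rad' f + rad' g"
  "lad (c *\<^sub>C f) = c *\<^sub>C lad f" "rad (c *\<^sub>C f) = c *\<^sub>C rad f" "lad' (c *\<^sub>C f) = c *\<^sub>C lad' f" "rad' (c *\<^sub>C f) = c *\<^sub>C rad' f"
  unfolding ladder_defs t_linear by (rule schwartz_eqI, simp add: algebra_simps)+

lemma ladder_zero: "lad 0 = 0" "rad 0 = 0" "lad' 0 = 0" "rad' 0 = 0"
  using ladder_linear(5-8)[of 0 0] by (simp_all add: complex_vector.scale_zero_left)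

lemma ladder_G: "f \<in> gauss_tests \<Longrightarrow> lad f \<in> gauss_tests" "f \<in> gauss_tests \<Longrightarrow> rad f \<in> gauss_tests" "f \<in> gauss_tests \<Longrightarrow> lad' f \<in> gauss_tests" "f \<in> gauss_tests \<Longrightarrow> rad' f \<in> gauss_tests"
  unfolding ladder_defs by (intro G_closed t_G; assumption)+

lemma ladder_commute:
  assumes "f \<in> gauss_tests"
  shows "lad (rad f) = rad (lad f) + f" "lad' (rad' f) = rad' (lad' f) + f"
    "lad (rad' f) = rad' (lad f)" "lad' (rad f) = rad (lad' f)" "rad (rad' f) = rad' (rad f)"
  unfolding ladder_defs t_linear t_commute[OF assms]
  by (rule schwartz_eqI, simp add: algebra_simps r2_sq)+

lemma ip_ladder: "ip (rad f) g = ip f (lad g)" "ip (rad' f) g = ip f (lad' g)"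
  "ip (lad f) g = ip f (rad g)" "ip (lad' f) g = ip f (rad' g)"
  unfolding ladder_defs
  by (simp_all add: ip_add ip_diff ip_diff_right ip_scale ip_t r2_sq)

lemma t_eq_ladder:
  "tX f = sqrt_half *\<^sub>C (lad f + rad f)" "tX' f = sqrt_half *\<^sub>C (lad' f + rad' f)"
  "tY f = (\<i> * sqrt_half) *\<^sub>C (lad f + (- 1) *\<^sub>C rad f)" "tY' f = (- \<i> * sqrt_half) *\<^sub>C (lad' f + (- 1) *\<^sub>C rad' f)"
  unfolding ladder_defs by (rule schwartz_eqI, simp add: algebra_simps r2_sq)+

text \<open>The defining relations are solved for the original operators by p + q = 1.
  Multiplications and derivatives thus become combinations of the four ladder operators, which is
  how seminorms of Hermite functions are reached.\<close>

lemma test_eq_t: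
  "test_x f = of_real p *\<^sub>C tX f + of_real q *\<^sub>C tX' f" "test_y f = of_real q *\<^sub>C tY f + of_real p *\<^sub>C tY' f"
  "test_Dx f = tY' f + (- 1) *\<^sub>C tY f" "test_Dy f = tX f + (- 1) *\<^sub>C tX' f"
  unfolding tX_def tY_def tX'_def tY'_def by (rule schwartz_eqI, simp add: q_eq algebra_simps del: sfun_test)+

lemma lad_ground: "lad ground = 0" "lad' ground = 0"
proof -
  have g: "sfun (test_Dx ground) z = - \<i> * (of_real (- gauss_rate) * (of_real (fst z) * gauss z) + gauss_tilt * (of_real (snd z) * gauss z))"
    "sfun (test_Dy ground) z = - \<i> * (of_real (- gauss_rate) * (of_real (snd z) * gauss z) + gauss_tilt * (of_real (fst z) * gauss z))"
    "sfun (test_x ground) z = of_real (fst z) * gauss z" "sfun (test_y ground) z = of_real (snd z) * gauss z" for z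
    by (simp_all add: sfun_ground partial_gauss)
  have qp: "q = 1 - p" using pq by simp
  \<comment> \<open>After substituting q = 1 - p, each identity is a form of gauss_rate * (p^2 +
    q^2) = 1.\<close>
  have e1: "1 + gauss_rate * q * (p - q) - gauss_rate * p = 0" "gauss_rate * q - 1 + gauss_rate * p * (p - q) = 0"
    "gauss_rate * p - 1 + - gauss_rate * q * (p - q) = 0" "1 - gauss_rate * q - gauss_rate * p * (p - q) = 0"
    using al_eq unfolding qp by (simp_all add: power2_eq_square algebra_simps)
  have e: "1 + of_real gauss_rate * of_real q * (of_real p - of_real q) - of_real gauss_rate * of_real p = (0::complex)"
     "of_real gauss_rate * of_real q - 1 + of_real gauss_rate * of_real p * (of_real p - of_real q) = (0::complex)"
    using arg_cong[OF e1(1), of complex_of_real] arg_cong[OF e1(2), of complex_of_real] by simp_all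
  show "lad ground = 0"
  proof (rule schwartz_eqI)
    fix z
    have "sfun (lad ground) z = sqrt_half * gauss z * (of_real (fst z) * (1 + of_real gauss_rate * of_real q * (of_real p - of_real q) - of_real gauss_rate * of_real p)
      + \<i> * of_real (snd z) * (of_real gauss_rate * of_real q - 1 + of_real gauss_rate * of_real p * (of_real p - of_real q)))"
      unfolding lad_def tX_def tY_def sfun_simps g gauss_tilt_def by (simp add: algebra_simps)
    then show "sfun (lad ground) z = sfun 0 z" unfolding e by simp
  qed
  show "lad' ground = 0"
  proof (rule schwartz_eqI)
    fix z
    have "sfun (lad' ground) z = sqrt_half * gauss z * (of_real (fst z) * (1 - of_real gauss_rate * of_real q - of_real gauss_rate * of_real p * (of_real p - of_real q))
      + \<i> * of_real (snd z) * (1 - of_real gauss_rate * of_real p + of_real gauss_rate * of_real q * (of_real p - of_real q)))"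
      unfolding lad'_def tX'_def tY'_def sfun_simps g gauss_tilt_def by (simp add: algebra_simps)
    moreover have "1 - of_real gauss_rate * of_real q - of_real gauss_rate * of_real p * (of_real p - of_real q) = (0::complex)"
      "1 - of_real gauss_rate * of_real p + of_real gauss_rate * of_real q * (of_real p - of_real q) = (0::complex)"
      using e by (simp_all add: algebra_simps)
    ultimately show "sfun (lad' ground) z = sfun 0 z" by simp
  qed
qed

lemma sqnorm_ground_pos: "0 < sqnorm ground"
proof -
  have "gauss z \<noteq> 0" for z by (simp add: gauss_def)
  have "sqnorm ground \<noteq> 0"
  proof
    assume "sqnorm ground = 0"
    then have "AE z in lborel. (cmod (sfun ground z))\<^sup>2 = 0"
      unfolding sqnorm_def using integrable_sqnorm
      by (subst (asm) integral_nonneg_eq_0_iff_AE) auto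
    then have "AE z in (lborel :: (real \<times> real) measure). False"
      using \<open>\<And>z. gauss z \<noteq> 0\<close> by (simp add: sfun_ground)
    then show False by (simp add: eventually_False ae_filter_eq_bot_iff)
  qed
  then show ?thesis using sqnorm_nonneg[of ground] by simp
qed

section \<open>The orthonormal Hermite family\<close>

primrec herm0 :: "nat \<Rightarrow> (real \<times> real) schwartz" where
  "herm0 0 = of_real (1 / sqrt (sqnorm ground)) *\<^sub>C ground"
| "herm0 (Suc i) = of_real (1 / sqrt (real (Suc i))) *\<^sub>C rad (herm0 i)"

primrec herm :: "nat \<Rightarrow> nat \<Rightarrow> (real \<times> real) schwartz" where
  "herm i 0 = herm0 i"
| "herm i (Suc j) = of_real (1 / sqrt (real (Suc j))) *\<^sub>C rad' (herm i j)"

lemma herm0_G: "herm0 i \<in> gauss_tests"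
  by (induction i) (auto intro!: G_closed ladder_G G_ground)

lemma herm_G: "herm i j \<in> gauss_tests"
  by (induction j) (auto intro!: G_closed ladder_G herm0_G)

lemma scaleC_scaleC': "c *\<^sub>C d *\<^sub>C (f :: (real \<times> real) schwartz) = (c * d) *\<^sub>C f"
  by (rule scaleC_scaleC)

lemma sqrt_cancel:
  "complex_of_real (sqrt (real (Suc n))) * of_real (1 / sqrt (real (Suc n))) = 1"
  "complex_of_real (1 / sqrt (real (Suc n))) * of_real (real (Suc n)) = of_real (sqrt (real (Suc n)))"
  unfolding of_real_mult[symmetric] by (simp_all add: real_div_sqrt)

lemma rad'_herm: "rad' (herm i j) = of_real (sqrt (real (Suc j))) *\<^sub>C herm i (Suc j)"
  by (simp add: scaleC_scaleC' sqrt_cancel scaleC_one del: of_nat_Suc)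

lemma rad_herm: "rad (herm i j) = of_real (sqrt (real (Suc i))) *\<^sub>C herm (Suc i) j"
proof (induction j)
  case 0
  show ?case by (simp add: scaleC_scaleC' sqrt_cancel scaleC_one del: of_nat_Suc)
next
  case (Suc j)
  then show ?case
    by (simp add: ladder_linear ladder_commute(5)[OF herm_G] scaleC_scaleC' mult.commute del: of_nat_Suc)
qed

lemma lad_herm0: "lad (herm0 i) = of_real (sqrt (real i)) *\<^sub>C herm0 (i - 1)"
proof (induction i)
  case 0
  show ?case by (rule schwartz_eqI) (simp add: ladder_linear lad_ground)
next
  case (Suc i)
  have "rad (of_real (sqrt (real i)) *\<^sub>C herm0 (i - 1)) = of_real (real i) *\<^sub>C herm0 i"
  proof (cases i)
    case 0
    then show ?thesis by (intro schwartz_eqI) (simp add: ladder_linear ladder_zero)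
  next
    case (Suc i')
    have "rad (herm0 i') = of_real (sqrt (real (Suc i'))) *\<^sub>C herm0 (Suc i')"
      using rad_herm[of i' 0] by (simp del: herm0.simps)
    then show ?thesis
      unfolding Suc diff_Suc_1 ladder_linear by (simp only: scaleC_scaleC' of_real_mult[symmetric] real_sqrt_mult_self abs_of_nat)
  qed
  then have "lad (rad (herm0 i)) = of_real (real (Suc i)) *\<^sub>C herm0 i"
    unfolding ladder_commute(1)[OF herm0_G] Suc.IH by (intro schwartz_eqI) (simp add: algebra_simps)
  then show ?case unfolding herm0.simps ladder_linear by (simp only: scaleC_scaleC' sqrt_cancel diff_Suc_1)
qed

lemma lad_herm: "lad (herm i j) = of_real (sqrt (real i)) *\<^sub>C herm (i - 1) j"
proof (induction j)
  case 0
  show ?case by (simp add: lad_herm0)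
next
  case (Suc j)
  then show ?case
    by (simp add: ladder_linear ladder_commute(3)[OF herm_G] scaleC_scaleC' mult.commute del: of_nat_Suc)
qed

lemma lad'_herm0: "lad' (herm0 i) = 0"
proof (induction i)
  case 0
  show ?case by (rule schwartz_eqI) (simp add: ladder_linear lad_ground)
next
  case (Suc i)
  then show ?case by (intro schwartz_eqI) (simp add: ladder_linear ladder_commute(4)[OF herm0_G] ladder_zero)
qed

lemma lad'_herm: "lad' (herm i j) = of_real (sqrt (real j)) *\<^sub>C herm i (j - 1)"
proof (induction j)
  case 0
  show ?case by (rule schwartz_eqI) (simp add: lad'_herm0)
next
  case (Suc j)
  have "rad' (of_real (sqrt (real j)) *\<^sub>C herm i (j - 1)) = of_real (real j) *\<^sub>C herm i j"
  proof (cases j)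
    case 0
    then show ?thesis by (intro schwartz_eqI) (simp add: ladder_linear ladder_zero)
  next
    case (Suc j')
    show ?thesis
      unfolding Suc diff_Suc_1 ladder_linear rad'_herm
      by (simp only: scaleC_scaleC' of_real_mult[symmetric] real_sqrt_mult_self abs_of_nat)
  qed
  then have "lad' (rad' (herm i j)) = of_real (real (Suc j)) *\<^sub>C herm i j"
    unfolding ladder_commute(2)[OF herm_G] Suc.IH by (intro schwartz_eqI) (simp add: algebra_simps)
  then show ?case unfolding herm.simps ladder_linear by (simp only: scaleC_scaleC' sqrt_cancel diff_Suc_1)
qed

lemma ip_herm0: "ip (herm0 i) (herm0 k) = (if i = k then 1 else 0)"
proof (induction i arbitrary: k)
  case 0
  show ?case
  proof (cases k)
    case 0
    have "complex_of_real (1 / sqrt (sqnorm ground)) * of_real (1 / sqrt (sqnorm ground)) * of_real (sqnorm ground) = 1"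
      unfolding of_real_mult[symmetric] using sqnorm_ground_pos by simp
    then have "ip (herm0 0) (herm0 0) = 1"
      unfolding herm0.simps(1) unfolding ip_scale unfolding ip_self complex_cnj_complex_of_real
      by (simp only: mult.assoc)
    then show ?thesis using 0 by simp
  next
    case (Suc k')
    have "lad (herm0 0) = 0" using lad_herm0[of 0] by (intro schwartz_eqI) simp
    then show ?thesis using Suc by (simp add: ip_scale(2) ip_ladder(3)[symmetric] ip_zero del: herm0.simps(1))
  qed
next
  case (Suc i)
  have *: "ip (herm0 (Suc i)) (herm0 k) = of_real (1 / sqrt (real (Suc i))) * (of_real (sqrt (real k)) * ip (herm0 i) (herm0 (k - 1)))"
    by (simp add: ip_scale ip_ladder lad_herm0)
  show ?case
  proof (cases k)
    case 0
    then show ?thesis unfolding * by simp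
  next
    case (Suc k')
    then show ?thesis unfolding * using Suc.IH[of k'] sqrt_cancel(1)[of i] by (auto simp: mult_ac)
  qed
qed

lemma ip_herm: "ip (herm i j) (herm k l) = (if i = k \<and> j = l then 1 else 0)"
proof (induction j arbitrary: l)
  case 0
  show ?case
  proof (cases l)
    case 0
    then show ?thesis by (simp add: ip_herm0)
  next
    case (Suc l')
    then show ?thesis by (simp add: ip_scale(2) ip_ladder(4)[symmetric] lad'_herm0 ip_zero)
  qed
next
  case (Suc j)
  have *: "ip (herm i (Suc j)) (herm k l) = of_real (1 / sqrt (real (Suc j))) * (of_real (sqrt (real l)) * ip (herm i j) (herm k (l - 1)))"
    by (simp add: ip_scale ip_ladder lad'_herm)
  show ?case
  proof (cases l)
    case 0
    then show ?thesis unfolding * by simp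
  next
    case (Suc l')
    then show ?thesis unfolding * using Suc.IH[of l'] sqrt_cancel(1)[of j] by (auto simp: mult_ac)
  qed
qed

lemma sqnorm_herm: "sqnorm (herm i j) = 1"
  using ip_herm[of i j i j] by (simp add: ip_self)

end

section \<open>Hermite series and completeness\<close>

definition poly_bounded :: "(nat \<Rightarrow> nat \<Rightarrow> real) \<Rightarrow> bool" where
  "poly_bounded \<Phi> \<longleftrightarrow> (\<exists>C M. 0 \<le> C \<and> (\<forall>i j. \<Phi> i j \<le> C * (1 + real i + real j) ^ M))"

lemma poly_bounded_mono: "poly_bounded \<Psi> \<Longrightarrow> (\<And>i j. \<Phi> i j \<le> \<Psi> i j) \<Longrightarrow> poly_bounded \<Phi>"
  unfolding poly_bounded_def by (meson order_trans)

lemma poly_bounded_add: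
  assumes "poly_bounded \<Phi>" "poly_bounded \<Psi>"
  shows "poly_bounded (\<lambda>i j. \<Phi> i j + \<Psi> i j)"
proof -
  obtain C M D N where C: "0 \<le> C" "\<And>i j. \<Phi> i j \<le> C * (1 + real i + real j) ^ M"
    and D: "0 \<le> D" "\<And>i j. \<Psi> i j \<le> D * (1 + real i + real j) ^ N"
    using assms unfolding poly_bounded_def by blast
  have "\<Phi> i j + \<Psi> i j \<le> (C + D) * (1 + real i + real j) ^ max M N" for i j
  proof -
    have "C * (1 + real i + real j) ^ M \<le> C * (1 + real i + real j) ^ max M N"
      using C(1) by (intro mult_left_mono power_increasing) auto
    moreover have "D * (1 + real i + real j) ^ N \<le> D * (1 + real i + real j) ^ max M N"
      using D(1) by (intro mult_left_mono power_increasing) auto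
    ultimately show ?thesis using C(2)[of i j] D(2)[of i j] by (simp add: distrib_right)
  qed
  then show ?thesis unfolding poly_bounded_def using C(1) D(1) by (intro exI[of _ "C + D"] exI[of _ "max M N"]) auto
qed

lemma poly_bounded_scale:
  assumes "poly_bounded \<Phi>" "0 \<le> c"
  shows "poly_bounded (\<lambda>i j. c * \<Phi> i j)"
proof -
  obtain C M where C: "0 \<le> C" "\<And>i j. \<Phi> i j \<le> C * (1 + real i + real j) ^ M"
    using assms unfolding poly_bounded_def by blast
  have "c * \<Phi> i j \<le> (c * C) * (1 + real i + real j) ^ M" for i j
    using mult_left_mono[OF C(2)[of i j] assms(2)] by (simp add: mult.assoc)
  then show ?thesis unfolding poly_bounded_def using C(1) assms(2) by (intro exI[of _ "c * C"] exI[of _ M]) auto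
qed

lemma poly_bounded_const: "poly_bounded (\<lambda>i j. c)"
  unfolding poly_bounded_def by (intro exI[of _ "\<bar>c\<bar>"] exI[of _ 0]) auto

lemma poly_bounded_sum:
  "finite A \<Longrightarrow> (\<And>a. a \<in> A \<Longrightarrow> poly_bounded (\<Phi> a)) \<Longrightarrow> poly_bounded (\<lambda>i j. \<Sum>a\<in>A. \<Phi> a i j)"
  by (induction A rule: finite_induct) (auto intro: poly_bounded_const poly_bounded_add)

lemma sqnorm_scale: "sqnorm (c *\<^sub>C f) = (cmod c)\<^sup>2 * sqnorm f"
  by (simp add: sqnorm_def norm_mult power_mult_distrib)

lemma sqnorm_add: "sqnorm (f + g) \<le> 2 * sqnorm f + 2 * sqnorm g"
proof -
  have "sqnorm (f + g) \<le> (\<integral>z. 2 * (cmod (sfun f z))\<^sup>2 + 2 * (cmod (sfun g z))\<^sup>2 \<partial>lborel)"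
    unfolding sqnorm_def
  proof (rule integral_mono)
    show "integrable lborel (\<lambda>z. (cmod (sfun (f + g) z))\<^sup>2)" by (rule integrable_sqnorm)
    show "integrable lborel (\<lambda>z. 2 * (cmod (sfun f z))\<^sup>2 + 2 * (cmod (sfun g z))\<^sup>2)"
      using integrable_sqnorm[of f] integrable_sqnorm[of g] by simp
    fix z
    have "(cmod (sfun (f + g) z))\<^sup>2 \<le> (cmod (sfun f z) + cmod (sfun g z))\<^sup>2"
      by (intro power_mono) (simp_all add: norm_triangle_ineq)
    also have "\<dots> \<le> 2 * (cmod (sfun f z))\<^sup>2 + 2 * (cmod (sfun g z))\<^sup>2"
      using sum_squares_bound[of "cmod (sfun f z)" "cmod (sfun g z)"] by (simp add: power2_sum)
    finally show "(cmod (sfun (f + g) z))\<^sup>2 \<le> 2 * (cmod (sfun f z))\<^sup>2 + 2 * (cmod (sfun g z))\<^sup>2" .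
  qed
  also have "\<dots> = 2 * sqnorm f + 2 * sqnorm g"
    using integrable_sqnorm[of f] integrable_sqnorm[of g] by (simp add: sqnorm_def)
  finally show ?thesis .
qed

context twisted_pair
begin

text \<open>Shaped to be closed under the ladder operators: each contributes the square root of an
  index, and the bound \<open>L\<close> on the index shift keeps that factor polynomial in
  \<open>i\<close> and \<open>j\<close>. Seminorms of Hermite functions are thereby reduced to
  square norms.\<close>

inductive herm_family :: "(nat \<Rightarrow> nat \<Rightarrow> (real \<times> real) schwartz) \<Rightarrow> bool" where
  base: "poly_bounded (\<lambda>i j. cmod (c i j)) \<Longrightarrow> (\<And>i j. s i j + t i j \<le> i + j + L) \<Longrightarrow>
    herm_family (\<lambda>i j. c i j *\<^sub>C herm (s i j) (t i j))"
| add: "herm_family F \<Longrightarrow> herm_family F' \<Longrightarrow> herm_family (\<lambda>i j. F i j + F' i j)"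

lemma poly_bounded_mult_sqrt:
  assumes "poly_bounded (\<lambda>i j. cmod (c i j))" "\<And>i j. s i j \<le> i + j + L"
  shows "poly_bounded (\<lambda>i j. cmod (c i j * of_real (sqrt (real (s i j)))))"
proof -
  obtain C M where C: "0 \<le> C" "\<And>i j. cmod (c i j) \<le> C * (1 + real i + real j) ^ M"
    using assms unfolding poly_bounded_def by blast
  have "cmod (c i j * of_real (sqrt (real (s i j)))) \<le> (C * (1 + real L)) * (1 + real i + real j) ^ Suc M" for i j
  proof -
    have "sqrt (real (s i j)) \<le> 1 + real (s i j)"
      by (intro real_le_lsqrt) (auto simp: power2_eq_square algebra_simps)
    also have "\<dots> \<le> 1 + (real i + real j + real L)"
      using assms(2)[of i j] by (simp add: of_nat_add[symmetric] del: of_nat_add)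
    also have "\<dots> \<le> (1 + real L) * (1 + real i + real j)" by (simp add: algebra_simps)
    finally have "cmod (c i j) * sqrt (real (s i j)) \<le> (C * (1 + real i + real j) ^ M) * ((1 + real L) * (1 + real i + real j))"
      using C by (intro mult_mono) auto
    then show ?thesis by (simp add: norm_mult mult_ac)
  qed
  then show ?thesis unfolding poly_bounded_def using C(1) by (intro exI[of _ "C * (1 + real L)"] exI[of _ "Suc M"]) auto
qed

lemma herm_family_ladder:
  assumes "herm_family F"
  shows "herm_family (\<lambda>i j. lad (F i j))" "herm_family (\<lambda>i j. rad (F i j))"
    "herm_family (\<lambda>i j. lad' (F i j))" "herm_family (\<lambda>i j. rad' (F i j))"
  using assms
proof (induction)
  case (base c s t L)
  { case 1
    have "s i j \<le> i + j + L" for i j using base(2)[of i j] by simp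
    from herm_family.base[OF poly_bounded_mult_sqrt[OF base(1) this], of "\<lambda>i j. s i j - 1" t L] show ?case
      using base(2) by (simp add: ladder_linear lad_herm scaleC_scaleC') (meson diff_le_self add_le_mono1 order_trans) }
  { case 2
    have "Suc (s i j) \<le> i + j + Suc L" for i j using base(2)[of i j] by simp
    from herm_family.base[OF poly_bounded_mult_sqrt[OF base(1) this], of "\<lambda>i j. Suc (s i j)" t "Suc L"] show ?case
      using base(2) by (simp add: ladder_linear rad_herm scaleC_scaleC') }
  { case 3
    have "t i j \<le> i + j + L" for i j using base(2)[of i j] by simp
    from herm_family.base[OF poly_bounded_mult_sqrt[OF base(1) this], of s "\<lambda>i j. t i j - 1" L] show ?case
      using base(2) by (simp add: ladder_linear lad'_herm scaleC_scaleC') (meson diff_le_self add_le_mono order_refl order_trans) }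
  { case 4
    have "Suc (t i j) \<le> i + j + Suc L" for i j using base(2)[of i j] by simp
    from herm_family.base[OF poly_bounded_mult_sqrt[OF base(1) this], of s "\<lambda>i j. Suc (t i j)" "Suc L"] show ?case
      using base(2) by (simp add: ladder_linear rad'_herm scaleC_scaleC' del: herm.simps) }
next
  case (add F F')
  { case 1 then show ?case using add.IH by (simp add: ladder_linear herm_family.add) }
  { case 2 then show ?case using add.IH by (simp add: ladder_linear herm_family.add) }
  { case 3 then show ?case using add.IH by (simp add: ladder_linear herm_family.add) }
  { case 4 then show ?case using add.IH by (simp add: ladder_linear herm_family.add) }
qed

lemma herm_family_scale: "herm_family F \<Longrightarrow> herm_family (\<lambda>i j. c *\<^sub>C F i j)"
proof (induction rule: herm_family.induct)
  case (base d s t L)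
  have "poly_bounded (\<lambda>i j. cmod (c * d i j))"
    using poly_bounded_scale[OF base(1), of "cmod c"] by (simp add: norm_mult)
  from herm_family.base[of "\<lambda>i j. c * d i j", OF this base(2)] show ?case by (simp add: scaleC_scaleC')
next
  case (add F F')
  then show ?case using herm_family.add[OF add.IH] by (simp add: scaleC_add_right)
qed

lemma herm_family_test:
  assumes "herm_family F"
  shows "herm_family (\<lambda>i j. test_x (F i j))" "herm_family (\<lambda>i j. test_y (F i j))"
    "herm_family (\<lambda>i j. test_Dx (F i j))" "herm_family (\<lambda>i j. test_Dy (F i j))"
  unfolding test_eq_t t_eq_ladder
  by (intro herm_family.add herm_family_scale herm_family_ladder assms)+

lemma herm_family_herm: "herm_family herm"
proof -
  have "herm_family (\<lambda>i j. 1 *\<^sub>C herm i j)"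
    by (rule herm_family.base[of "\<lambda>i j. 1" _ _ 0]) (auto intro: poly_bounded_const)
  then show ?thesis by (simp add: scaleC_one)
qed

lemma herm_family_sqnorm: "herm_family F \<Longrightarrow> poly_bounded (\<lambda>i j. sqnorm (F i j))"
proof (induction rule: herm_family.induct)
  case (base c s t L)
  obtain C M where C: "0 \<le> C" "\<And>i j. cmod (c i j) \<le> C * (1 + real i + real j) ^ M"
    using base unfolding poly_bounded_def by blast
  have "sqnorm (c i j *\<^sub>C herm (s i j) (t i j)) \<le> C\<^sup>2 * (1 + real i + real j) ^ (M * 2)" for i j
  proof -
    have "(cmod (c i j))\<^sup>2 \<le> (C * (1 + real i + real j) ^ M)\<^sup>2" by (intro power_mono C) auto
    then show ?thesis by (simp add: sqnorm_scale sqnorm_herm power_mult_distrib power_mult)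
  qed
  then show ?case unfolding poly_bounded_def by (intro exI[of _ "C\<^sup>2"] exI[of _ "M * 2"]) auto
next
  case (add F F')
  from poly_bounded_add[OF poly_bounded_scale[OF add.IH(1), of 2] poly_bounded_scale[OF add.IH(2), of 2]] show ?case
    by (rule poly_bounded_mono[rotated, OF sqnorm_add]) auto
qed

lemma herm_family_sup:
  assumes "herm_family F"
  shows "poly_bounded (\<lambda>i j. seminorm 0 [] (F i j))"
proof -
  have "herm_family (\<lambda>i j. sobolev_op (F i j))"
    unfolding sobolev_op_def decay_op_def
    by (intro herm_family.add herm_family_test herm_family_scale assms)
  from poly_bounded_add[OF poly_bounded_const[of "integral\<^sup>L lborel decay"] herm_family_sqnorm[OF this]]
  show ?thesis
    by (rule poly_bounded_mono[of _ "\<lambda>i j. seminorm 0 [] (F i j)"]) (intro seminorm_least, simp add: sup_bound)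
qed

lemma herm_family_partials:
  assumes "herm_family F" "bs \<in> lists Basis"
  shows "\<exists>F'. herm_family F' \<and> (\<forall>i j. sfun (F' i j) = partials bs (sfun (F i j)))"
  using assms(2)
proof (induction bs)
  case Nil
  show ?case using assms(1) by auto
next
  case (Cons b bs)
  then obtain F' where F': "herm_family F'" "\<And>i j. sfun (F' i j) = partials bs (sfun (F i j))" by auto
  have "b \<in> Basis" using Cons.hyps by simp
  then have "b = (1, 0) \<or> b = (0, 1)" by (rule Basis_R2_cases)
  then show ?case
  proof
    assume b: "b = (1, 0)"
    show ?thesis
      by (rule exI[of _ "\<lambda>i j. \<i> *\<^sub>C test_Dx (F' i j)"])
        (simp only: b sfun_i_test_D F' partials_Cons herm_family_scale[OF herm_family_test(3)[OF F'(1)]] simp_thms)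
  next
    assume b: "b = (0, 1)"
    show ?thesis
      by (rule exI[of _ "\<lambda>i j. \<i> *\<^sub>C test_Dy (F' i j)"])
        (simp only: b sfun_i_test_D F' partials_Cons herm_family_scale[OF herm_family_test(4)[OF F'(1)]] simp_thms)
  qed
qed

lemma herm_family_weighted:
  assumes "herm_family F"
  shows "\<exists>F'. herm_family F' \<and> (\<forall>i j z. norm z ^ N * cmod (sfun (F i j) z) \<le> cmod (sfun (F' i j) z))"
proof (induction N)
  case 0
  show ?case using assms by auto
next
  case (Suc N)
  then obtain F' where F': "herm_family F'" "\<And>i j z. norm z ^ N * cmod (sfun (F i j) z) \<le> cmod (sfun (F' i j) z)"
    by blast
  let ?F = "\<lambda>i j. F' i j + (test_x (test_x (F' i j)) + test_y (test_y (F' i j)))"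
  have "norm z ^ Suc N * cmod (sfun (F i j) z) \<le> cmod (sfun (?F i j) z)" for i j z
  proof -
    have n: "(norm z)\<^sup>2 = (fst z)\<^sup>2 + (snd z)\<^sup>2" by (cases z) (simp add: norm_Pair)
    have "norm z \<le> 1 + (norm z)\<^sup>2" using sum_squares_bound[of 1 "norm z"] norm_ge_zero[of z] unfolding power_one mult_1_right by linarith
    then have "norm z ^ Suc N * cmod (sfun (F i j) z) \<le> (1 + (norm z)\<^sup>2) * cmod (sfun (F' i j) z)"
      using mult_mono[OF _ F'(2)[of z i j], of "norm z" "1 + (norm z)\<^sup>2"] by (simp add: mult_ac)
    also have "\<dots> = cmod (of_real (1 + (norm z)\<^sup>2) * sfun (F' i j) z)"
      unfolding norm_mult norm_of_real by simp
    also have "of_real (1 + (norm z)\<^sup>2) * sfun (F' i j) z = sfun (?F i j) z"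
      unfolding n by (simp add: power2_eq_square algebra_simps)
    finally show ?thesis .
  qed
  moreover have "herm_family ?F" by (intro herm_family.add herm_family_test F')
  ultimately show ?case by blast
qed

text \<open>Derivatives and powers of |z| are absorbed by passing to other Hermite families; the
  remaining supremum is bounded through \<open>sup_bound\<close> by square norms, which are
  controlled by normalization. The consequence is polynomial growth of the coefficients of any
  tempered distribution.\<close>

lemma herm_seminorm:
  assumes "bs \<in> lists Basis"
  shows "poly_bounded (\<lambda>i j. seminorm N bs (herm i j))"
proof -
  obtain F where F: "herm_family F" "\<And>i j. sfun (F i j) = partials bs (sfun (herm i j))"
    using herm_family_partials[OF herm_family_herm assms] by blast
  obtain F' where F': "herm_family F'" "\<And>i j z. norm z ^ N * cmod (sfun (F i j) z) \<le> cmod (sfun (F' i j) z)"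
    using herm_family_weighted[OF F(1)] by blast
  show ?thesis
  proof (rule poly_bounded_mono[OF herm_family_sup[OF F'(1)]])
    fix i j
    show "seminorm N bs (herm i j) \<le> seminorm 0 [] (F' i j)"
      by (rule seminorm_least) (metis F(2) F'(2) order_trans sfun_bounded)
  qed
qed

lemma herm_total_seminorm: "poly_bounded (\<lambda>i j. total_seminorm n (herm i j))"
  unfolding total_seminorm_def
  by (intro poly_bounded_sum finite_words finite_atMost herm_seminorm) auto

text \<open>\<open>lad (rad f)\<close> multiplies \<open>herm i j\<close> by 1 + i, and the primed
  pair multiplies it by 1 + j; moving \<open>t\<close> powers of each onto \<open>f\<close> leaves a
  pairing bounded by a constant. Raising before lowering avoids the eigenvalue 0.\<close>

lemma coefficient_decay: "\<exists>C. \<forall>i j. cmod (ip f (herm i j)) * ((1 + real i) * (1 + real j)) ^ t \<le> C"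
proof -
  let ?F = "((\<lambda>f. lad' (rad' f)) ^^ t) (((\<lambda>f. lad (rad f)) ^^ t) f)"
  have num: "lad (rad (herm i j)) = of_real (1 + real i) *\<^sub>C herm i j" "lad' (rad' (herm i j)) = of_real (1 + real j) *\<^sub>C herm i j" for i j
  proof -
    have "sqrt (real (Suc i)) * sqrt (real (Suc i)) = 1 + real i" for i by simp
    then show "lad (rad (herm i j)) = of_real (1 + real i) *\<^sub>C herm i j" "lad' (rad' (herm i j)) = of_real (1 + real j) *\<^sub>C herm i j"
      unfolding rad_herm rad'_herm ladder_linear lad_herm lad'_herm diff_Suc_1
      by (simp_all only: scaleC_scaleC' of_real_mult[symmetric])
  qed
  have 1: "ip (((\<lambda>f. lad (rad f)) ^^ t) f) (herm i j) = of_real (1 + real i) ^ t * ip f (herm i j)" for f t i j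
    by (induction t) (simp_all add: ip_ladder num ip_scale del: of_real_add)
  have 2: "ip (((\<lambda>f. lad' (rad' f)) ^^ t) f) (herm i j) = of_real (1 + real j) ^ t * ip f (herm i j)" for f t i j
    by (induction t) (simp_all add: ip_ladder num ip_scale del: of_real_add)
  have "cmod (ip f (herm i j)) * ((1 + real i) * (1 + real j)) ^ t \<le> sqnorm ?F + 1" for i j
  proof -
    have "ip ?F (herm i j) = of_real (((1 + real i) * (1 + real j)) ^ t) * ip f (herm i j)"
      unfolding 1 2 by (simp add: power_mult_distrib mult_ac del: of_real_add)
    moreover have "\<bar>((1 + real i) * (1 + real j)) ^ t\<bar> = ((1 + real i) * (1 + real j)) ^ t" by simp
    ultimately have "cmod (ip ?F (herm i j)) = ((1 + real i) * (1 + real j)) ^ t * cmod (ip f (herm i j))"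
      by (simp only: norm_mult norm_of_real)
    then show ?thesis using ip_bound[of ?F "herm i j"] by (simp add: sqnorm_herm mult.commute)
  qed
  then show ?thesis by blast
qed

end

section \<open>Convergent series of Schwartz functions\<close>

lemma partials_zero: "partials bs (\<lambda>z::'a::euclidean_space. 0) = (\<lambda>z. 0)"
  by (induction bs) (auto simp: partial_def frechet_derivative_const)

lemma partials_sum_schwartz:
  fixes f :: "nat \<Rightarrow> 'a::euclidean_space schwartz"
  assumes "bs \<in> lists Basis"
  shows "partials bs (sfun (\<Sum>n<k. f n)) z = (\<Sum>n<k. partials bs (sfun (f n)) z)"
proof (induction k)
  case 0
  show ?case by (simp add: zero_schwartz.rep_eq partials_zero)
next
  case (Suc k)
  then show ?case by (simp add: plus_schwartz.rep_eq partials_add[OF smooth_sfun smooth_sfun assms])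
qed

lemma suminf_tail_le:
  fixes a :: "nat \<Rightarrow> complex"
  assumes "\<And>n. cmod (a n) \<le> s n" "summable s"
  shows "cmod ((\<Sum>n<k. a n) - (\<Sum>n. a n)) \<le> (\<Sum>n. s (n + k))"
proof -
  have na: "summable (\<lambda>n. cmod (a n))" by (rule summable_comparison_test'[OF assms(2), of 0]) (simp add: assms(1))
  then have sa: "summable a" by (rule summable_norm_cancel)
  have "(\<Sum>n<k. a n) - (\<Sum>n. a n) = - (\<Sum>n. a (n + k))"
    unfolding suminf_split_initial_segment[OF sa, of k] by simp
  then have "cmod ((\<Sum>n<k. a n) - (\<Sum>n. a n)) = cmod (\<Sum>n. a (n + k))" by simp
  also have "\<dots> \<le> (\<Sum>n. cmod (a (n + k)))"
    by (rule summable_norm[OF summable_ignore_initial_segment[OF na]])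
  also have "\<dots> \<le> (\<Sum>n. s (n + k))"
    by (intro suminf_le assms summable_ignore_initial_segment[OF na] summable_ignore_initial_segment[OF assms(2)])
  finally show ?thesis .
qed

lemma tail_tendsto_0:
  fixes s :: "nat \<Rightarrow> real"
  assumes "summable s"
  shows "(\<lambda>k. \<Sum>n. s (n + k)) \<longlonglongrightarrow> 0"
proof -
  have "(\<lambda>k. (\<Sum>n. s n) - (\<Sum>n<k. s n)) \<longlonglongrightarrow> (\<Sum>n. s n) - (\<Sum>n. s n)"
    by (intro tendsto_intros summable_LIMSEQ assms)
  moreover have "(\<Sum>n. s n) - (\<Sum>n<k. s n) = (\<Sum>n. s (n + k))" for k
    unfolding suminf_split_initial_segment[OF assms, of k] by simp
  ultimately show ?thesis by simp
qed

lemma frechet_derivative_Basis: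
  fixes f :: "'a::euclidean_space \<Rightarrow> complex"
  assumes "f differentiable at z"
  shows "frechet_derivative f (at z) h = (\<Sum>b\<in>Basis. (h \<bullet> b) *\<^sub>R partial b f z)"
proof -
  have lin: "linear (frechet_derivative f (at z))" by (rule linear_frechet_derivative[OF assms])
  have "frechet_derivative f (at z) h = frechet_derivative f (at z) (\<Sum>b\<in>Basis. (h \<bullet> b) *\<^sub>R b)"
    by (simp add: euclidean_representation)
  also have "\<dots> = (\<Sum>b\<in>Basis. (h \<bullet> b) *\<^sub>R partial b f z)"
    by (simp add: linear_sum[OF lin] linear_scale[OF lin] partial_def)
  finally show ?thesis .
qed

text \<open>Completeness of the Schwartz space, for absolutely convergent series. The candidates
  \<open>P bs\<close> for all derivatives are defined at once by the differentiated series; uniform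
  convergence shows that they are derivatives of one another.\<close>

theorem schwartz_series:
  fixes f :: "nat \<Rightarrow> 'a::euclidean_space schwartz"
  assumes sm: "\<And>N bs. bs \<in> lists Basis \<Longrightarrow> summable (\<lambda>n. seminorm N bs (f n))"
  shows "\<exists>F. \<forall>N. \<forall>bs\<in>lists Basis. (\<lambda>k. seminorm N bs (F - (\<Sum>n<k. f n))) \<longlonglongrightarrow> 0"
proof -
  define P where "P bs z = (\<Sum>n. partials bs (sfun (f n)) z)" for bs z
  have pb: "cmod (partials bs (sfun (f n)) z) \<le> seminorm 0 bs (f n)" if "bs \<in> lists Basis" for bs n z
    using seminorm_upper[OF that, of z 0 "f n"] by simp
  have der: "(P bs has_derivative (\<lambda>h. \<Sum>b\<in>Basis. (h \<bullet> b) *\<^sub>R P (b # bs) z)) (at z)" if bs: "bs \<in> lists Basis" for bs z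
  proof -
    let ?f' = "\<lambda>n z h. \<Sum>b\<in>Basis. (h \<bullet> b) *\<^sub>R partials (b # bs) (sfun (f n)) z"
    let ?g' = "\<lambda>z h. \<Sum>b\<in>Basis. (h \<bullet> b) *\<^sub>R P (b # bs) z"
    have summ: "summable (\<lambda>n. partials bs (sfun (f n)) z)" for z
      by (rule summable_norm_cancel, rule summable_comparison_test'[OF sm[OF bs, of 0], of 0]) (simp add: pb[OF bs])
    have "\<exists>g. \<forall>z\<in>UNIV. (\<lambda>n. partials bs (sfun (f n)) z) sums (g z) \<and> (g has_derivative ?g' z) (at z within UNIV)"
    proof (rule has_derivative_series[where f' = ?f'])
      show "(partials bs (sfun (f n)) has_derivative ?f' n z) (at z within UNIV)" for n z
        using has_derivative_frechet[OF smoothD[OF smooth_sfun bs, of "f n" z]]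
        unfolding frechet_derivative_Basis[OF smoothD[OF smooth_sfun bs, of "f n" z], abs_def] by simp
      show "(\<lambda>n. partials bs (sfun (f n)) 0) sums P bs 0" unfolding P_def by (rule summable_sums[OF summ])
      fix e :: real assume e: "0 < e"
      let ?t = "\<lambda>k. \<Sum>b\<in>(Basis::'a set). \<Sum>n. seminorm 0 (b # bs) (f (n + k))"
      have "(\<lambda>k. \<Sum>n. seminorm 0 (b # bs) (f (n + k))) \<longlonglongrightarrow> 0" if "b \<in> Basis" for b
        using tail_tendsto_0[OF sm[of "b # bs" 0]] that bs by simp
      then have "?t \<longlonglongrightarrow> (\<Sum>b\<in>(Basis::'a set). 0)" by (intro tendsto_sum)
      then have "\<forall>\<^sub>F k in sequentially. ?t k < e" using e by (simp add: order_tendstoD(2))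
      then show "\<forall>\<^sub>F k in sequentially. \<forall>z\<in>UNIV. \<forall>h. norm ((\<Sum>n<k. ?f' n z h) - ?g' z h) \<le> e * norm h"
      proof eventually_elim
        case (elim k)
        show ?case
        proof (intro ballI allI)
          fix z h :: 'a
          have "(\<Sum>n<k. ?f' n z h) - ?g' z h =
            (\<Sum>b\<in>Basis. (h \<bullet> b) *\<^sub>R ((\<Sum>n<k. partials (b # bs) (sfun (f n)) z) - P (b # bs) z))"
            by (subst sum.swap) (simp add: scaleR_sum_right[symmetric] sum_subtractf[symmetric] scaleR_diff_right[symmetric])
          then have "norm ((\<Sum>n<k. ?f' n z h) - ?g' z h) \<le>
            (\<Sum>b\<in>Basis. norm ((h \<bullet> b) *\<^sub>R ((\<Sum>n<k. partials (b # bs) (sfun (f n)) z) - P (b # bs) z)))"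
            by (simp only: norm_sum)
          also have "\<dots> \<le> (\<Sum>b\<in>(Basis::'a set). norm h * (\<Sum>n. seminorm 0 (b # bs) (f (n + k))))"
          proof (rule sum_mono)
            fix b :: 'a assume b: "b \<in> Basis"
            then have bbs: "b # bs \<in> lists Basis" using bs by simp
            have "cmod ((\<Sum>n<k. partials (b # bs) (sfun (f n)) z) - P (b # bs) z) \<le> (\<Sum>n. seminorm 0 (b # bs) (f (n + k)))"
              unfolding P_def by (rule suminf_tail_le[OF pb[OF bbs] sm[OF bbs]])
            then show "norm ((h \<bullet> b) *\<^sub>R ((\<Sum>n<k. partials (b # bs) (sfun (f n)) z) - P (b # bs) z))
              \<le> norm h * (\<Sum>n. seminorm 0 (b # bs) (f (n + k)))"
              unfolding norm_scaleR using Basis_le_norm[OF b, of h] by (intro mult_mono) auto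
          qed
          also have "\<dots> = ?t k * norm h" by (simp add: sum_distrib_left mult.commute)
          also have "\<dots> \<le> e * norm h" using elim by (intro mult_right_mono) auto
          finally show "norm ((\<Sum>n<k. ?f' n z h) - ?g' z h) \<le> e * norm h" .
        qed
      qed
    qed auto
    then obtain g where g: "\<And>z. (\<lambda>n. partials bs (sfun (f n)) z) sums (g z)" "\<And>z. (g has_derivative ?g' z) (at z)"
      by auto
    have "g = P bs" by (rule ext) (simp add: P_def sums_unique[OF g(1)])
    then show ?thesis using g(2) by simp
  qed
  have parP: "partials bs (P []) = P bs" if "bs \<in> lists Basis" for bs
    using that
  proof (induction bs)
    case (Cons b bs)
    then have bs: "bs \<in> lists Basis" and b: "b \<in> Basis" by auto
    have "partial b (P bs) = (\<lambda>z. \<Sum>b'\<in>Basis. (b \<bullet> b') *\<^sub>R P (b' # bs) z)"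
      by (rule partial_eqI[OF der[OF bs]])
    also have "\<dots> = P (b # bs)"
    proof
      fix z
      have "(\<Sum>b'\<in>Basis. (b \<bullet> b') *\<^sub>R P (b' # bs) z) = (\<Sum>b'\<in>Basis. if b' = b then P (b' # bs) z else 0)"
        using b by (intro sum.cong) (auto simp: inner_Basis)
      then show "(\<Sum>b'\<in>Basis. (b \<bullet> b') *\<^sub>R P (b' # bs) z) = P (b # bs) z" using b by simp
    qed
    finally show ?case using Cons bs by simp
  qed simp
  have wb: "norm z ^ N * cmod ((\<Sum>n<k. partials bs (sfun (f n)) z) - P bs z) \<le> (\<Sum>n. seminorm N bs (f (n + k)))"
    if bs: "bs \<in> lists Basis" for bs z N k
  proof -
    let ?c = "complex_of_real (norm z ^ N)"
    have sP: "summable (\<lambda>n. partials bs (sfun (f n)) z)"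
      by (rule summable_norm_cancel, rule summable_comparison_test'[OF sm[OF bs, of 0], of 0]) (simp add: pb[OF bs])
    have "norm z ^ N * cmod ((\<Sum>n<k. partials bs (sfun (f n)) z) - P bs z) =
      cmod (?c * ((\<Sum>n<k. partials bs (sfun (f n)) z) - P bs z))"
      unfolding norm_mult norm_of_real by simp
    also have "?c * ((\<Sum>n<k. partials bs (sfun (f n)) z) - P bs z) =
       (\<Sum>n<k. ?c * partials bs (sfun (f n)) z) - (\<Sum>n. ?c * partials bs (sfun (f n)) z)"
      unfolding P_def suminf_mult[OF sP] sum_distrib_left[symmetric] by (rule right_diff_distrib)
    also have "cmod \<dots> \<le> (\<Sum>n. seminorm N bs (f (n + k)))"
    proof (rule suminf_tail_le[OF _ sm[OF bs]])
      show "cmod (?c * partials bs (sfun (f n)) z) \<le> seminorm N bs (f n)" for n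
        unfolding norm_mult norm_of_real using seminorm_upper[OF bs, of z N "f n"] by simp
    qed
    finally show ?thesis .
  qed
  have S: "schwartz_function (P [])"
  proof (rule schwartz_functionI)
    show "smooth (P [])"
      unfolding smooth_def
    proof (intro ballI allI)
      fix bs :: "'a list" and z assume bs: "bs \<in> lists Basis"
      show "partials bs (P []) differentiable at z"
        unfolding parP[OF bs] by (rule differentiableI[OF der[OF bs]])
    qed
    show "\<exists>C. \<forall>z. norm z ^ N * cmod (partials bs (P []) z) \<le> C" if "bs \<in> lists Basis" for N bs
      using wb[OF that, of _ N 0] by (auto simp: parP[OF that])
  qed
  define F where "F = Abs_schwartz (P [])"
  have sF: "sfun F = P []" unfolding F_def using S by (simp add: Abs_schwartz_inverse)
  have "(\<lambda>k. seminorm N bs (F - (\<Sum>n<k. f n))) \<longlonglongrightarrow> 0" if bs: "bs \<in> lists Basis" for N bs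
  proof (rule tendsto_sandwich[OF _ _ tendsto_const tail_tendsto_0[OF sm[OF bs]]])
    show "\<forall>\<^sub>F k in sequentially. 0 \<le> seminorm N bs (F - (\<Sum>n<k. f n))"
      by (simp add: seminorm_nonneg[OF bs])
    have "seminorm N bs (F - (\<Sum>n<k. f n)) \<le> (\<Sum>n. seminorm N bs (f (n + k)))" for k
    proof (rule seminorm_least)
      fix z
      have "F - (\<Sum>n<k. f n) = F + (- 1) *\<^sub>C (\<Sum>n<k. f n)"
        by (simp add: sfun_inject[symmetric] fun_eq_iff minus_schwartz.rep_eq plus_schwartz.rep_eq scaleC_schwartz.rep_eq)
      then have "partials bs (sfun (F - (\<Sum>n<k. f n))) z = P bs z - (\<Sum>n<k. partials bs (sfun (f n)) z)"
        by (simp only: plus_schwartz.rep_eq scaleC_schwartz.rep_eq partials_add[OF smooth_sfun smooth_scale[OF smooth_sfun] bs]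
            partials_scale[OF smooth_sfun bs] partials_sum_schwartz[OF bs]) (simp add: sF parP[OF bs])
      then show "norm z ^ N * cmod (partials bs (sfun (F - (\<Sum>n<k. f n))) z) \<le> (\<Sum>n. seminorm N bs (f (n + k)))"
        using wb[OF bs, of z N k] by (simp add: norm_minus_commute)
    qed
    then show "\<forall>\<^sub>F k in sequentially. seminorm N bs (F - (\<Sum>n<k. f n)) \<le> (\<Sum>n. seminorm N bs (f (n + k)))"
      by simp
  qed
  then show ?thesis by blast
qed

text \<open>The Taylor polynomials of exp h are bounded by exp |h|, so integration term by term is
  dominated convergence.\<close>

lemma integral_mult_exp_zero:
  fixes g :: "'a \<Rightarrow> complex" and h :: "'a \<Rightarrow> real"
  assumes [measurable]: "g \<in> borel_measurable M" "h \<in> borel_measurable M"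
    and int: "integrable M (\<lambda>z. cmod (g z) * exp \<bar>h z\<bar>)"
    and zero: "\<And>r. (\<integral>z. g z * of_real (h z ^ r) \<partial>M) = 0"
  shows "(\<integral>z. g z * of_real (exp (h z)) \<partial>M) = 0"
proof -
  let ?s = "\<lambda>R z. g z * of_real (\<Sum>r<R. h z ^ r / fact r)"
  have bd: "\<bar>\<Sum>r<R. x ^ r / fact r\<bar> \<le> exp \<bar>x\<bar>" for x :: real and R
  proof -
    have "\<bar>\<Sum>r<R. x ^ r / fact r\<bar> \<le> (\<Sum>r<R. \<bar>x\<bar> ^ r / fact r)"
      by (rule order_trans[OF sum_abs]) (simp add: power_abs)
    also have "\<dots> \<le> (\<Sum>r. \<bar>x\<bar> ^ r / fact r)"
      using summable_exp[of "\<bar>x\<bar>"] by (intro sum_le_suminf) (auto simp: divide_inverse mult.commute)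
    also have "\<dots> = exp \<bar>x\<bar>" by (simp add: exp_def divide_inverse mult.commute)
    finally show ?thesis .
  qed
  have "(\<lambda>R. \<integral>z. ?s R z \<partial>M) \<longlonglongrightarrow> (\<integral>z. g z * of_real (exp (h z)) \<partial>M)"
  proof (rule integral_dominated_convergence[where w = "\<lambda>z. cmod (g z) * exp \<bar>h z\<bar>"])
    show "AE z in M. (\<lambda>R. ?s R z) \<longlonglongrightarrow> g z * of_real (exp (h z))"
    proof (rule AE_I2)
      fix z
      have "(\<lambda>r. h z ^ r / fact r) sums exp (h z)"
        using exp_converges[of "h z"] by (simp add: divide_inverse mult.commute)
      then show "(\<lambda>R. ?s R z) \<longlonglongrightarrow> g z * of_real (exp (h z))"
        by (intro tendsto_intros) (simp add: sums_def)
    qed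
    show "AE z in M. norm (?s R z) \<le> cmod (g z) * exp \<bar>h z\<bar>" for R
      unfolding norm_mult norm_of_real using bd by (intro AE_I2 mult_left_mono) auto
  qed (use int in measurable)
  moreover have "(\<integral>z. ?s R z \<partial>M) = 0" for R
  proof -
    have i: "integrable M (\<lambda>z. g z * of_real (h z ^ r))" for r
    proof (rule Bochner_Integration.integrable_bound[OF integrable_mult_right[OF int, of "fact r"]])
      show "AE z in M. norm (g z * complex_of_real (h z ^ r)) \<le> norm (fact r * (cmod (g z) * exp \<bar>h z\<bar>))"
      proof (rule AE_I2)
        fix z
        have "\<bar>h z\<bar> ^ r / fact r \<le> (\<Sum>r'<Suc r. \<bar>h z\<bar> ^ r' / fact r')"
          by (rule member_le_sum[of r "{..<Suc r}" "\<lambda>r'. \<bar>h z\<bar> ^ r' / fact r'"]) auto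
        also have "\<dots> \<le> exp \<bar>h z\<bar>" using bd[of "\<bar>h z\<bar>" "Suc r"] by (simp only: abs_abs abs_le_iff)
        finally have "\<bar>h z\<bar> ^ r \<le> fact r * exp \<bar>h z\<bar>" by (simp add: field_simps)
        then have "cmod (g z) * \<bar>h z\<bar> ^ r \<le> cmod (g z) * (fact r * exp \<bar>h z\<bar>)" by (rule mult_left_mono) simp
        then show "norm (g z * complex_of_real (h z ^ r)) \<le> norm (fact r * (cmod (g z) * exp \<bar>h z\<bar>))"
          by (simp add: norm_mult norm_power mult_ac)
      qed
    qed measurable
    have "?s R = (\<lambda>z. \<Sum>r<R. g z * of_real (h z ^ r) * of_real (1 / fact r))"
      by (simp add: fun_eq_iff sum_distrib_left)
    then have "(\<integral>z. ?s R z \<partial>M) = (\<Sum>r<R. \<integral>z. g z * of_real (h z ^ r) * of_real (1 / fact r) \<partial>M)"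
      by (simp only:) (rule Bochner_Integration.integral_sum, intro integrable_mult_left i)
    also have "\<dots> = 0" using zero by (simp only: integral_mult_left_zero) simp
    finally show ?thesis .
  qed
  ultimately show ?thesis by (simp add: LIMSEQ_const_iff)
qed

text \<open>The Gaussian kernels peaked at \<open>w\<close> concentrate there, so a continuous function orthogonal to
  all of them vanishes at \<open>w\<close>.\<close>

lemma gaussian_localization:
  fixes g :: "real \<times> real \<Rightarrow> real"
  assumes kap: "0 < kap" and cont: "continuous_on UNIV g" and int: "integrable lborel g"
    and zero: "\<And>N::nat. (\<integral>z. g z * exp (- (kap * real N) * (norm (z - w))\<^sup>2) \<partial>lborel) = 0"
  shows "g w \<le> 0"
proof (rule ccontr)
  assume "\<not> g w \<le> 0"
  then have pos: "0 < g w" by simp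
  let ?E = "\<lambda>N z. exp (- (kap * real N) * (norm (z - w))\<^sup>2)"
  have meas: "(\<lambda>z. ?E N z) \<in> borel_measurable borel" for N
    by (intro borel_measurable_continuous_onI continuous_intros)
  obtain d where d: "d > 0" "\<And>z. dist z w < d \<Longrightarrow> dist (g z) (g w) < g w / 2"
    using cont pos unfolding continuous_on_iff by (metis UNIV_I half_gt_zero)
  have gd: "g w / 2 \<le> g z" if "dist z w < d" for z
    using d(2)[OF that] by (simp add: dist_real_def abs_if split: if_splits)
  define V where "V = measure lborel (ball w (d / 2))"
  have V: "0 < V" unfolding V_def using d(1) by (simp add: content_ball_pos)
  have finV: "emeasure lborel (ball w (d / 2)) < \<infinity>" by (rule emeasure_bounded_finite) simp
  define A where "A = (\<integral>z. \<bar>g z\<bar> \<partial>lborel)"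
  \<comment> \<open>On the ball of radius d / 2 the kernel is at least its value at distance d / 2,
    beyond distance \<open>d\<close> it is at most its value there, and in the shell between
    \<open>g\<close> is nonnegative. Since the whole integral vanishes, the inner part is bounded by
    the outer one.\<close>
  have key: "g w / 2 * V * exp (- (kap * real N) * (d / 2)\<^sup>2) \<le> A * exp (- (kap * real N) * d\<^sup>2)" for N
  proof -
    have iE: "integrable lborel (\<lambda>z. g z * ?E N z)"
    proof (rule Bochner_Integration.integrable_bound[OF int])
      show "(\<lambda>z. g z * ?E N z) \<in> borel_measurable lborel"
        using meas borel_measurable_integrable[OF int] by (intro borel_measurable_times) simp_all
      show "AE z in lborel. norm (g z * ?E N z) \<le> norm (g z)"
      proof (rule AE_I2)
        fix z
        have "?E N z \<le> 1" using kap by simp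
        then have "\<bar>g z\<bar> * ?E N z \<le> \<bar>g z\<bar> * 1" by (rule mult_left_mono) simp
        then show "norm (g z * ?E N z) \<le> norm (g z)" by (simp add: abs_mult)
      qed
    qed
    have iA: "integrable lborel (\<lambda>z. \<bar>g z\<bar> * exp (- (kap * real N) * d\<^sup>2))" using int by simp
    have iV: "integrable lborel (\<lambda>z. indicator (ball w (d / 2)) z * (g w / 2 * exp (- (kap * real N) * (d / 2)\<^sup>2)))"
      using finV by (intro integrable_mult_left integrable_real_indicator) auto
    have "(\<integral>z. indicator (ball w (d / 2)) z * (g w / 2 * exp (- (kap * real N) * (d / 2)\<^sup>2)) \<partial>lborel)
      \<le> (\<integral>z. g z * ?E N z + \<bar>g z\<bar> * exp (- (kap * real N) * d\<^sup>2) \<partial>lborel)"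
    proof (rule integral_mono[OF iV Bochner_Integration.integrable_add[OF iE iA]])
      fix z :: "real \<times> real"
      show "indicator (ball w (d / 2)) z * (g w / 2 * exp (- (kap * real N) * (d / 2)\<^sup>2))
        \<le> g z * ?E N z + \<bar>g z\<bar> * exp (- (kap * real N) * d\<^sup>2)"
      proof (cases "dist z w < d")
        case True
        then have gz: "g w / 2 \<le> g z" by (rule gd)
        then have gz0: "0 \<le> g z" using pos by linarith
        show ?thesis
        proof (cases "z \<in> ball w (d / 2)")
          case True
          then have "norm (z - w) \<le> d / 2" by (simp add: dist_norm norm_minus_commute)
          then have "(norm (z - w))\<^sup>2 \<le> (d / 2)\<^sup>2" by (intro power_mono) auto
          then have "exp (- (kap * real N) * (d / 2)\<^sup>2) \<le> ?E N z" using kap by (simp add: mult_left_mono)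
          then have "g w / 2 * exp (- (kap * real N) * (d / 2)\<^sup>2) \<le> g z * ?E N z"
            using gz pos by (intro mult_mono) auto
          moreover have "0 \<le> \<bar>g z\<bar> * exp (- (kap * real N) * d\<^sup>2)" by simp
          moreover have "indicator (ball w (d / 2)) z = (1 :: real)" using True by simp
          ultimately show ?thesis by (simp only: mult_1)
        qed (use gz0 in simp)
      next
        case False
        then have "d \<le> norm (z - w)" by (simp add: dist_norm)
        then have "d\<^sup>2 \<le> (norm (z - w))\<^sup>2" using d(1) by (intro power_mono) auto
        then have "?E N z \<le> exp (- (kap * real N) * d\<^sup>2)" using kap by (simp add: mult_left_mono)
        then have "\<bar>g z\<bar> * ?E N z \<le> \<bar>g z\<bar> * exp (- (kap * real N) * d\<^sup>2)" by (rule mult_left_mono) simp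
        moreover have "- \<bar>g z\<bar> * ?E N z \<le> g z * ?E N z" by (rule mult_right_mono) auto
        moreover have "z \<notin> ball w (d / 2)" using False d(1) by (simp add: dist_commute)
        ultimately show ?thesis by simp
      qed
    qed
    also have "\<dots> = A * exp (- (kap * real N) * d\<^sup>2)"
      using Bochner_Integration.integral_add[OF iE iA] zero[of N] by (simp add: A_def)
    finally show ?thesis by (simp add: V_def mult_ac)
  qed
  \<comment> \<open>Dividing by the inner exponential leaves the rate d^2 - (d / 2)^2 = 3 / 4
    d^2.\<close>
  have "g w / 2 * V \<le> A * exp (- (3 / 4 * d\<^sup>2 * kap) * real N)" for N
  proof -
    have "exp (- (kap * real N) * (d / 2)\<^sup>2) * exp (kap * real N * (d / 2)\<^sup>2) = 1"
      "exp (- (kap * real N) * d\<^sup>2) * exp (kap * real N * (d / 2)\<^sup>2) = exp (- (3 / 4 * d\<^sup>2 * kap) * real N)"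
      unfolding exp_add[symmetric] by (simp_all add: power_divide algebra_simps)
    then show ?thesis
      using mult_right_mono[OF key[of N], of "exp (kap * real N * (d / 2)\<^sup>2)"] by (simp only: mult.assoc) simp
  qed
  moreover have "(\<lambda>N. A * exp (- (3 / 4 * d\<^sup>2 * kap) * real N)) \<longlonglongrightarrow> A * 0"
  proof (intro tendsto_mult tendsto_const)
    have "filterlim (\<lambda>N. (- (3 / 4 * d\<^sup>2 * kap)) * real N) at_bot sequentially"
      using d(1) kap by (intro filterlim_tendsto_neg_mult_at_bot[OF tendsto_const _ filterlim_real_sequentially]) simp
    then show "(\<lambda>N. exp (- (3 / 4 * d\<^sup>2 * kap) * real N)) \<longlonglongrightarrow> 0"
      by (rule filterlim_compose[OF exp_at_bot])
  qed
  ultimately have "g w / 2 * V \<le> A * 0" by (intro LIMSEQ_le_const) auto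
  then show False using pos V by (simp add: mult_le_0_iff)
qed

context twisted_pair
begin

inductive herm_span :: "(real \<times> real) schwartz \<Rightarrow> bool" where
  base: "herm_span (herm i j)"
| add: "herm_span f \<Longrightarrow> herm_span g \<Longrightarrow> herm_span (f + g)"
| scale: "herm_span f \<Longrightarrow> herm_span (c *\<^sub>C f)"

lemma herm_span_ladder: "herm_span f \<Longrightarrow> herm_span (lad f) \<and> herm_span (rad f) \<and> herm_span (lad' f) \<and> herm_span (rad' f)"
proof (induction rule: herm_span.induct)
  case (base i j)
  show ?case unfolding lad_herm rad_herm lad'_herm rad'_herm by (intro conjI herm_span.intros)
qed (auto simp: ladder_linear intro: herm_span.intros)

lemma herm_span_test: "herm_span f \<Longrightarrow> herm_span (test_x f)" "herm_span f \<Longrightarrow> herm_span (test_y f)"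
  unfolding test_eq_t t_eq_ladder by (intro herm_span.add herm_span.scale; simp add: herm_span_ladder)+

lemma herm_span_ground: "herm_span ground"
proof -
  have "ground = of_real (sqrt (sqnorm ground)) *\<^sub>C herm 0 0"
    using sqnorm_ground_pos by (simp add: scaleC_scaleC' scaleC_one)
  then show ?thesis using herm_span.scale[OF herm_span.base] by metis
qed

text \<open>Polynomials times \<open>ground\<close> are finite combinations of Hermite functions,
  because their span contains \<open>ground\<close> and is stable under \<open>test_x\<close> and
  \<open>test_y\<close>.\<close>

lemma moments_zero:
  assumes "\<And>i j. ip f (herm i j) = 0"
  shows "(\<integral>z. sfun f z * cnj (gauss z) * of_real (fst z ^ i * snd z ^ j) \<partial>lborel) = 0"
proof -
  have z: "ip f k = 0" if "herm_span k" for k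
    using that by induction (auto simp: assms ip_add ip_scale)
  have "herm_span ((test_y ^^ j) ground)" for j
    by (induction j) (auto intro: herm_span_ground herm_span_test)
  then have "herm_span ((test_x ^^ i) ((test_y ^^ j) ground))"
    by (induction i) (auto intro: herm_span_test)
  moreover have "sfun ((test_y ^^ j) ground) z = of_real (snd z) ^ j * gauss z" for j z
    by (induction j) (simp_all add: sfun_ground)
  then have "sfun ((test_x ^^ i) ((test_y ^^ j) ground)) z = of_real (fst z) ^ i * (of_real (snd z) ^ j * gauss z)" for z
    by (induction i) simp_all
  ultimately show ?thesis
    using z[of "(test_x ^^ i) ((test_y ^^ j) ground)"] by (simp add: ip_def mult_ac)
qed

lemma gaussian_integrable:
  fixes g :: "real \<times> real \<Rightarrow> complex"
  assumes [measurable]: "g \<in> borel_measurable borel" and c: "0 < c"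
    and bd: "\<And>z. cmod (g z) \<le> C * exp (- c * (norm z)\<^sup>2)"
  shows "integrable lborel g"
proof -
  obtain K where K: "\<And>z :: real \<times> real. exp (- c * (norm z)\<^sup>2) \<le> K * decay z"
  proof -
    have b: "norm z ^ N * exp (- c * (norm z)\<^sup>2) \<le> 1 + (real (Suc N) / c) ^ Suc N" for z :: "real \<times> real" and N
      by (rule power_exp_bound[OF c]) simp
    let ?K = "\<lambda>N. 1 + (real (Suc N) / c) ^ Suc N"
    have "exp (- c * (norm z)\<^sup>2) \<le> (?K 0 + 2 * ?K 2 + ?K 4) * decay z" for z :: "real \<times> real"
    proof -
      have n: "(norm z)\<^sup>2 = (fst z)\<^sup>2 + (snd z)\<^sup>2" by (cases z) (simp add: norm_Pair)
      let ?e = "exp (- c * (norm z)\<^sup>2)"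
      let ?D = "(1 + (fst z)\<^sup>2) * (1 + (snd z)\<^sup>2)"
      have D: "?D > 0" by (intro mult_pos_pos) (simp_all add: add_pos_nonneg)
      have "?D \<le> (1 + (norm z)\<^sup>2) * (1 + (norm z)\<^sup>2)" unfolding n by (intro mult_mono) auto
      also have "\<dots> = norm z ^ 0 + 2 * norm z ^ 2 + norm z ^ 4"
        by (simp add: power2_eq_square power4_eq_xxxx algebra_simps)
      finally have "?D * ?e \<le> (norm z ^ 0 + 2 * norm z ^ 2 + norm z ^ 4) * ?e" by (rule mult_right_mono) simp
      also have "\<dots> = norm z ^ 0 * ?e + 2 * (norm z ^ 2 * ?e) + norm z ^ 4 * ?e" by (simp add: algebra_simps)
      also have "\<dots> \<le> ?K 0 + 2 * ?K 2 + ?K 4"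
        by (intro add_mono mult_left_mono b) simp
      finally have "?e \<le> (?K 0 + 2 * ?K 2 + ?K 4) / ?D" using D by (simp add: pos_le_divide_eq mult.commute)
      then show ?thesis by (simp add: decay_def divide_inverse)
    qed
    then show thesis using that by blast
  qed
  have C: "0 \<le> C"
  proof -
    have "0 \<le> C * exp (- c * (norm (0 :: real \<times> real))\<^sup>2)" by (rule order_trans[OF norm_ge_zero bd])
    then show ?thesis by simp
  qed
  have "cmod (g z) \<le> C * K * decay z" for z
    using order_trans[OF bd[of z] mult_left_mono[OF K[of z] C]] by (simp add: mult.assoc)
  then show ?thesis by (intro integrable_decay_bound) measurable
qed

lemma monomial_le: "\<bar>fst z ^ i * snd z ^ j\<bar> \<le> norm z ^ (i + j)"
  for z :: "real \<times> real"
proof -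
  have "\<bar>fst z\<bar> ^ i * \<bar>snd z\<bar> ^ j \<le> norm z ^ i * norm z ^ j"
    using norm_fst_le[of "fst z" "snd z"] norm_snd_le[of "snd z" "fst z"]
    by (intro mult_mono power_mono) auto
  then show ?thesis by (simp add: abs_mult power_abs power_add)
qed

text \<open>Vanishing of all moments passes from the weight \<open>exp H\<close> to \<open>exp (H + h)\<close> by expanding \<open>exp h\<close>.\<close>

lemma moments_exp_step:
  fixes g :: "real \<times> real \<Rightarrow> complex" and H :: "real \<times> real \<Rightarrow> real"
  assumes g: "continuous_on UNIV g" "\<And>z. cmod (g z) \<le> B * exp (- (gauss_rate / 2) * (norm z)\<^sup>2)"
    and H: "continuous_on UNIV H" "\<And>z. H z \<le> C + gauss_rate / 4 * (norm z)\<^sup>2"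
    and h: "\<And>z. \<bar>a * (fst z ^ k * snd z ^ l)\<bar> \<le> D + gauss_rate / 8 * (norm z)\<^sup>2"
    and zero: "\<And>i j. (\<integral>z. g z * of_real (fst z ^ i * snd z ^ j * exp (H z)) \<partial>lborel) = 0"
  shows "(\<integral>z. g z * of_real (fst z ^ i * snd z ^ j * exp (H z + a * (fst z ^ k * snd z ^ l))) \<partial>lborel) = 0"
proof -
  let ?h = "\<lambda>z :: real \<times> real. a * (fst z ^ k * snd z ^ l)"
  let ?g = "\<lambda>z. g z * of_real (fst z ^ i * snd z ^ j * exp (H z))"
  have cg: "continuous_on UNIV ?g" by (intro continuous_intros g H)
  have ch: "continuous_on UNIV ?h" by (intro continuous_intros)
  have B: "0 \<le> B"
    using order_trans[OF norm_ge_zero g(2)[of 0]] by simp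
  let ?K = "1 + (real (Suc (i + j)) / (gauss_rate / 16)) ^ Suc (i + j)"
  have "(\<integral>z. ?g z * of_real (exp (?h z)) \<partial>lborel) = 0"
  proof (rule integral_mult_exp_zero)
    show "?g \<in> borel_measurable lborel" "?h \<in> borel_measurable lborel"
      using borel_measurable_continuous_onI[OF cg] borel_measurable_continuous_onI[OF ch] by simp_all
    have "integrable lborel (\<lambda>z. complex_of_real (cmod (?g z) * exp \<bar>?h z\<bar>))"
    proof (rule gaussian_integrable)
      show "(\<lambda>z. complex_of_real (cmod (?g z) * exp \<bar>?h z\<bar>)) \<in> borel_measurable borel"
        by (intro borel_measurable_continuous_onI continuous_intros cg ch g H)
      \<comment> \<open>In units of \<open>gauss_rate\<close>: of the decay 1 / 2, \<open>H\<close>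
        may consume 1 / 4 and the new exponent 1 / 8. The remaining 1 / 8 is split evenly, 1 / 16
        for the monomial and 1 / 16 for integrability.\<close>
      show "0 < gauss_rate / 16" using al_pos by simp
      fix z
      have "cmod (?g z) * exp \<bar>?h z\<bar> = cmod (g z) * (\<bar>fst z ^ i * snd z ^ j\<bar> * exp (H z)) * exp \<bar>?h z\<bar>"
        unfolding norm_mult norm_of_real abs_mult[of _ "exp (H z)"] by simp
      also have "\<dots> \<le> (B * exp (- (gauss_rate / 2) * (norm z)\<^sup>2)) * (norm z ^ (i + j) * exp (C + gauss_rate / 4 * (norm z)\<^sup>2)) * exp (D + gauss_rate / 8 * (norm z)\<^sup>2)"
        using B H(2)[of z] h[of z] monomial_le[of z i j] by (intro mult_mono g) auto
      also have "\<dots> = (B * exp (C + D)) * (norm z ^ (i + j) * exp (- (gauss_rate / 16) * (norm z)\<^sup>2)) * exp (- (gauss_rate / 16) * (norm z)\<^sup>2)"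
      proof -
        have "exp (- (gauss_rate / 2) * (norm z)\<^sup>2) * exp (C + gauss_rate / 4 * (norm z)\<^sup>2) * exp (D + gauss_rate / 8 * (norm z)\<^sup>2)
          = exp (C + D) * exp (- (gauss_rate / 16) * (norm z)\<^sup>2) * exp (- (gauss_rate / 16) * (norm z)\<^sup>2)"
          unfolding exp_add[symmetric] by (simp add: algebra_simps)
        moreover have "B * e1 * (n * e2) * e3 = B * c * (n * e4) * e4" if "e1 * e2 * e3 = c * e4 * e4" for e1 e2 e3 e4 c n :: real
        proof -
          have "B * e1 * (n * e2) * e3 = B * n * (e1 * e2 * e3)" by (simp only: mult_ac)
          also have "\<dots> = B * c * (n * e4) * e4" unfolding that by (simp only: mult_ac)
          finally show ?thesis .
        qed
        ultimately show ?thesis by blast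
      qed
      also have "\<dots> \<le> (B * exp (C + D)) * ?K * exp (- (gauss_rate / 16) * (norm z)\<^sup>2)"
        using B al_pos by (intro mult_right_mono mult_left_mono power_exp_bound) auto
      finally show "cmod (complex_of_real (cmod (?g z) * exp \<bar>?h z\<bar>)) \<le> (B * exp (C + D)) * ?K * exp (- (gauss_rate / 16) * (norm z)\<^sup>2)"
        unfolding norm_of_real by (simp add: abs_mult)
    qed
    from integrable_Re[OF this] show "integrable lborel (\<lambda>z. cmod (?g z) * exp \<bar>?h z\<bar>)"
      by (simp only: Re_complex_of_real)
    fix r
    have "(\<lambda>z. ?g z * of_real (?h z ^ r)) = (\<lambda>z. of_real (a ^ r) * (g z * of_real (fst z ^ (i + k * r) * snd z ^ (j + l * r) * exp (H z))))"
      by (intro ext) (simp add: power_mult_distrib power_add power_mult mult_ac)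
    then show "(\<integral>z. ?g z * of_real (?h z ^ r) \<partial>lborel) = 0"
      using zero[of "i + k * r" "j + l * r"] by (simp only: integral_mult_right_zero) simp
  qed
  moreover have "?g z * of_real (exp (?h z)) = g z * of_real (fst z ^ i * snd z ^ j * exp (H z + ?h z))" for z
    by (simp add: exp_add mult_ac)
  ultimately show ?thesis by (simp only:)
qed

text \<open>From vanishing moments one has to reach Gaussian kernels of arbitrary sharpness. A
  single expansion of exp (- c |z|^2) is dominated only for small \<open>c\<close>, since exp (c
  |z|^2) must be outweighed by \<open>gauss\<close>; so the exponent is built up in small steps,
  each keeping the gain of the previous ones as the weight \<open>H\<close> of
  \<open>moments_exp_step\<close>.\<close>

theorem herm_complete:
  assumes "\<And>i j. ip f (herm i j) = 0"
  shows "f = 0"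
proof (rule schwartz_eqI)
  fix w
  define g where "g = (\<lambda>z. sfun f z * cnj (gauss z))"
  define B where "B = seminorm 0 [] f"
  define kap where "kap = gauss_rate / 8"
  have kap: "0 < kap" using al_pos by (simp add: kap_def)
  have cgauss: "continuous_on UNIV gauss"
    using continuous_sfun[of UNIV ground] by (simp add: sfun_ground)
  have cg: "continuous_on UNIV g" unfolding g_def by (intro continuous_intros continuous_sfun cgauss)
  have gb: "cmod (g z) \<le> B * exp (- (gauss_rate / 2) * (norm z)\<^sup>2)" for z
    unfolding g_def B_def norm_mult complex_mod_cnj cmod_gauss using sfun_bounded[of f z]
    by (simp add: mult_right_mono)
  have sq: "(norm z)\<^sup>2 = (fst z)\<^sup>2 + (snd z)\<^sup>2" for z :: "real \<times> real" by (cases z) (simp add: norm_Pair)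
  let ?Z = "\<lambda>H. \<forall>i j. (\<integral>z. g z * of_real (fst z ^ i * snd z ^ j * exp (H z)) \<partial>lborel) = 0"
  have gaussian: "?Z (\<lambda>z. - (kap * real N) * (norm z)\<^sup>2)" for N
  proof (induction N)
    case 0
    show ?case using moments_zero[OF assms] by (simp add: g_def)
  next
    case (Suc N)
    have c: "\<bar>- kap * (fst z ^ 2 * snd z ^ 0)\<bar> \<le> 0 + gauss_rate / 8 * (norm z)\<^sup>2"
      "\<bar>- kap * (fst z ^ 0 * snd z ^ 2)\<bar> \<le> 0 + gauss_rate / 8 * (norm z)\<^sup>2" for z :: "real \<times> real"
      using al_pos unfolding sq by (simp_all add: kap_def abs_mult)
    have n0: "0 \<le> gauss_rate / 4 * (norm z)\<^sup>2" "0 \<le> kap * real N * (norm z)\<^sup>2" "0 \<le> kap * (fst z)\<^sup>2" for z :: "real \<times> real"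
      using al_pos kap by auto
    have 1: "?Z (\<lambda>z. - (kap * real N) * (norm z)\<^sup>2 + - kap * (fst z ^ 2 * snd z ^ 0))"
    proof (intro allI moments_exp_step[OF cg gb _ _ c(1)])
      show "continuous_on UNIV (\<lambda>z :: real \<times> real. - (kap * real N) * (norm z)\<^sup>2)" by (intro continuous_intros)
      show "- (kap * real N) * (norm z)\<^sup>2 \<le> 0 + gauss_rate / 4 * (norm z)\<^sup>2" for z :: "real \<times> real"
        using n0(1,2)[of z] by simp
    qed (use Suc in blast)
    have 2: "?Z (\<lambda>z. (- (kap * real N) * (norm z)\<^sup>2 + - kap * (fst z ^ 2 * snd z ^ 0)) + - kap * (fst z ^ 0 * snd z ^ 2))"
    proof (intro allI moments_exp_step[OF cg gb _ _ c(2)])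
      show "continuous_on UNIV (\<lambda>z :: real \<times> real. - (kap * real N) * (norm z)\<^sup>2 + - kap * (fst z ^ 2 * snd z ^ 0))"
        by (intro continuous_intros)
      show "- (kap * real N) * (norm z)\<^sup>2 + - kap * (fst z ^ 2 * snd z ^ 0) \<le> 0 + gauss_rate / 4 * (norm z)\<^sup>2" for z :: "real \<times> real"
        using n0[of z] by simp
    qed (use 1 in blast)
    have eq: "(- (kap * real N) * (norm z)\<^sup>2 + - kap * (fst z ^ 2 * snd z ^ 0)) + - kap * (fst z ^ 0 * snd z ^ 2)
      = - (kap * real (Suc N)) * (norm z)\<^sup>2" for z :: "real \<times> real"
      unfolding sq by (simp add: algebra_simps)
    show ?case using 2 unfolding eq .
  qed
  \<comment> \<open>Bounds the linear exponents, which recentre the kernel at \<open>w\<close>, by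
    the admissible quadratic one at the price of a constant.\<close>
  have young: "\<bar>b * t\<bar> \<le> 2 * b\<^sup>2 / gauss_rate + gauss_rate / 8 * s\<^sup>2" if "\<bar>t\<bar> \<le> s" for b t s :: real
  proof -
    have "\<bar>b * t\<bar> \<le> \<bar>b\<bar> * s" using that by (simp add: abs_mult mult_left_mono)
    also have "\<dots> \<le> 2 * b\<^sup>2 / gauss_rate + gauss_rate / 8 * s\<^sup>2"
    proof -
      have "0 \<le> (gauss_rate * s - 4 * \<bar>b\<bar>)\<^sup>2 / (8 * gauss_rate)" using al_pos by simp
      also have "\<dots> = 2 * b\<^sup>2 / gauss_rate + gauss_rate / 8 * s\<^sup>2 - \<bar>b\<bar> * s"
        using al_pos by (simp add: power2_diff power_mult_distrib field_simps) (simp add: power2_eq_square algebra_simps)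
      finally show ?thesis by simp
    qed
    finally show ?thesis .
  qed
  have kernel: "(\<integral>z. g z * of_real (exp (- (kap * real N) * (norm (z - w))\<^sup>2)) \<partial>lborel) = 0" for N
  proof -
    let ?b1 = "2 * kap * real N * fst w" and ?b2 = "2 * kap * real N * snd w"
    have c1: "\<bar>?b1 * (fst z ^ 1 * snd z ^ 0)\<bar> \<le> 2 * ?b1\<^sup>2 / gauss_rate + gauss_rate / 8 * (norm z)\<^sup>2" for z :: "real \<times> real"
      using young[of "fst z" "norm z" ?b1] norm_fst_le[of "fst z" "snd z"] by simp
    have c2: "\<bar>?b2 * (fst z ^ 0 * snd z ^ 1)\<bar> \<le> 2 * ?b2\<^sup>2 / gauss_rate + gauss_rate / 8 * (norm z)\<^sup>2" for z :: "real \<times> real"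
      using young[of "snd z" "norm z" ?b2] norm_snd_le[of "snd z" "fst z"] by simp
    have n0: "0 \<le> gauss_rate / 4 * (norm z)\<^sup>2" "0 \<le> gauss_rate / 8 * (norm z)\<^sup>2" "0 \<le> kap * real N * (norm z)\<^sup>2" for z :: "real \<times> real"
      using al_pos kap by auto
    have 1: "?Z (\<lambda>z. - (kap * real N) * (norm z)\<^sup>2 + ?b1 * (fst z ^ 1 * snd z ^ 0))"
    proof (intro allI moments_exp_step[OF cg gb _ _ c1])
      show "continuous_on UNIV (\<lambda>z :: real \<times> real. - (kap * real N) * (norm z)\<^sup>2)" by (intro continuous_intros)
      show "- (kap * real N) * (norm z)\<^sup>2 \<le> 0 + gauss_rate / 4 * (norm z)\<^sup>2" for z :: "real \<times> real"
        using n0(1,3)[of z] by simp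
    qed (use gaussian in blast)
    have 2: "?Z (\<lambda>z. (- (kap * real N) * (norm z)\<^sup>2 + ?b1 * (fst z ^ 1 * snd z ^ 0)) + ?b2 * (fst z ^ 0 * snd z ^ 1))"
    proof (intro allI moments_exp_step[OF cg gb _ _ c2])
      show "continuous_on UNIV (\<lambda>z :: real \<times> real. - (kap * real N) * (norm z)\<^sup>2 + ?b1 * (fst z ^ 1 * snd z ^ 0))"
        by (intro continuous_intros)
      show "- (kap * real N) * (norm z)\<^sup>2 + ?b1 * (fst z ^ 1 * snd z ^ 0) \<le> 2 * ?b1\<^sup>2 / gauss_rate + gauss_rate / 4 * (norm z)\<^sup>2" for z :: "real \<times> real"
      proof -
        have "(- a) * s + b \<le> C + x / 4 * s" if "b \<le> C + x / 8 * s" "0 \<le> a * s" "0 \<le> x / 8 * s" for a b s C x :: real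
          using that by simp
        from this[OF abs_le_D1[OF c1[of z]] n0(3)[of z] n0(2)[of z]] show ?thesis .
      qed
    qed (use 1 in blast)
    have "g z * of_real (exp (- (kap * real N) * (norm (z - w))\<^sup>2)) =
      of_real (exp (- (kap * real N) * (norm w)\<^sup>2)) * (g z * of_real (fst z ^ 0 * snd z ^ 0 *
        exp ((- (kap * real N) * (norm z)\<^sup>2 + ?b1 * (fst z ^ 1 * snd z ^ 0)) + ?b2 * (fst z ^ 0 * snd z ^ 1))))" for z
    proof -
      have "exp (- (kap * real N) * (norm (z - w))\<^sup>2) = exp (- (kap * real N) * (norm w)\<^sup>2) *
        exp ((- (kap * real N) * (norm z)\<^sup>2 + ?b1 * (fst z ^ 1 * snd z ^ 0)) + ?b2 * (fst z ^ 0 * snd z ^ 1))"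
        unfolding exp_add[symmetric] sq by (simp add: power2_diff algebra_simps)
      then show ?thesis by (simp only: of_real_mult power_0 mult_1 of_real_1) (simp only: mult_ac)
    qed
    then show ?thesis using 2[rule_format, of 0 0] by (simp only: integral_mult_right_zero mult_zero_right)
  qed
  have "Re (c * g w) \<le> 0" for c
  proof (rule gaussian_localization[OF kap, where g = "\<lambda>z. Re (c * g z)"])
    show "continuous_on UNIV (\<lambda>z. Re (c * g z))" by (intro continuous_intros cg)
    have int: "integrable lborel g"
      by (rule gaussian_integrable[OF borel_measurable_continuous_onI[OF cg] _ gb]) (use al_pos in simp)
    then show "integrable lborel (\<lambda>z. Re (c * g z))" by (intro integrable_Re integrable_mult_right)
    fix N
    let ?E = "\<lambda>z. exp (- (kap * real N) * (norm (z - w))\<^sup>2)"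
    have iE: "integrable lborel (\<lambda>z. c * (g z * of_real (?E z)))"
    proof (rule integrable_mult_right, rule Bochner_Integration.integrable_bound[OF int])
      show "(\<lambda>z. g z * of_real (?E z)) \<in> borel_measurable lborel"
        using borel_measurable_continuous_onI[of "\<lambda>z. g z * of_real (?E z)"] by (simp add: continuous_intros cg)
      have "?E z \<le> 1" for z using kap by simp
      then show "AE z in lborel. norm (g z * of_real (?E z)) \<le> norm (g z)"
        unfolding norm_mult norm_of_real by (intro AE_I2 mult_left_le) auto
    qed
    have "(\<integral>z. Re (c * g z) * ?E z \<partial>lborel) = (\<integral>z. Re (c * (g z * of_real (?E z))) \<partial>lborel)"
      by (simp add: algebra_simps)
    also have "\<dots> = Re (\<integral>z. c * (g z * of_real (?E z)) \<partial>lborel)" by (rule integral_Re[OF iE])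
    also have "\<dots> = 0" unfolding integral_mult_right_zero kernel by simp
    finally show "(\<integral>z. Re (c * g z) * ?E z \<partial>lborel) = 0" .
  qed
  \<comment> \<open>Four one-sided bounds give both parts of \<open>g w\<close>; the Gaussian factor
    of \<open>g\<close> has no zeros.\<close>
  from this[of 1] this[of "- 1"] this[of \<i>] this[of "- \<i>"] have "g w = 0" by (simp add: complex_eq_iff)
  then show "sfun f w = sfun 0 w" by (simp add: g_def gauss_def)
qed

end

section \<open>Regularity of tempered distributions\<close>

lemma dapply_linear:
  "dapply u (f + g) = dapply u f + dapply u g" "dapply u (c *\<^sub>C f) = c * dapply u f"
  "dapply u (f - g) = dapply u f - dapply u g"
proof -
  have lin: "clinear (dapply u)" using dapply[of u] by simp
  then show a: "dapply u (f + g) = dapply u f + dapply u g" for f g by (simp add: clinear_iff)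
  from lin show c: "dapply u (c *\<^sub>C f) = c * dapply u f" for c f by (simp add: clinear_iff scaleC_complex_def)
  have "dapply u (f - g) + dapply u g = dapply u f" unfolding a[symmetric] by simp
  then show "dapply u (f - g) = dapply u f - dapply u g" by (simp only: eq_diff_eq)
qed

lemma dapply_sum: "dapply u (\<Sum>n\<in>A. f n) = (\<Sum>n\<in>A. dapply u (f n))"
proof -
  have "dapply u 0 = 0" using dapply_linear(3)[of u 0 0] by simp
  then show ?thesis by (induction A rule: infinite_finite_induct) (simp_all add: dapply_linear)
qed

lemma dapply_continuous:
  obtains C n where "0 \<le> C" "\<And>f. cmod (dapply u f) \<le> C * total_seminorm n f"
proof -
  obtain C n where C: "\<And>f. cmod (dapply u f) \<le> C * total_seminorm n f" using dapply[of u] by auto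
  have "cmod (dapply u f) \<le> \<bar>C\<bar> * total_seminorm n f" for f
    by (rule order_trans[OF C]) (intro mult_right_mono total_seminorm_nonneg, simp)
  then show ?thesis using that[of "\<bar>C\<bar>" n] by simp
qed

lemma dapply_sums:
  assumes "\<And>N bs. bs \<in> lists Basis \<Longrightarrow> (\<lambda>k. seminorm N bs (F - (\<Sum>n<k. f n))) \<longlonglongrightarrow> 0"
  shows "(\<lambda>n. dapply u (f n)) sums dapply u F"
proof -
  obtain C m where C: "0 \<le> C" "\<And>f. cmod (dapply u f) \<le> C * total_seminorm m f" using dapply_continuous[of u] by blast
  have "(\<lambda>k. total_seminorm m (F - (\<Sum>n<k. f n))) \<longlonglongrightarrow> 0"
    unfolding total_seminorm_def by (intro tendsto_null_sum assms) auto
  note lim = this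
  have lim0: "(\<lambda>k. C * total_seminorm m (F - (\<Sum>n<k. f n))) \<longlonglongrightarrow> 0"
    using tendsto_mult[OF tendsto_const[of C] lim] by (simp only: mult_zero_right)
  have "(\<lambda>k. dapply u (F - (\<Sum>n<k. f n))) \<longlonglongrightarrow> 0"
    by (rule Lim_null_comparison[OF always_eventually[OF allI[OF C(2)]] lim0])
  then have "(\<lambda>k. dapply u F - (\<Sum>n<k. dapply u (f n))) \<longlonglongrightarrow> 0" by (simp add: dapply_linear dapply_sum)
  then show ?thesis unfolding sums_def
    using tendsto_diff[OF tendsto_const[of "dapply u F"], of "\<lambda>k. dapply u F - (\<Sum>n<k. dapply u (f n))" 0 sequentially] by simp
qed

lemma ip_sum: "ip k (\<Sum>n\<in>A. f n) = (\<Sum>n\<in>A. ip k (f n))"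
  by (induction A rule: infinite_finite_induct) (simp_all add: ip_add ip_zero)

lemma ip_sums:
  assumes "\<And>N bs. bs \<in> lists Basis \<Longrightarrow> (\<lambda>k. seminorm N bs (F - (\<Sum>n<k. f n))) \<longlonglongrightarrow> 0"
  shows "(\<lambda>n. ip g (f n)) sums ip g F"
proof -
  let ?I = "\<integral>z. cmod (sfun g z) \<partial>lborel"
  have "[] \<in> lists Basis" by simp
  from tendsto_mult[OF tendsto_const[of ?I] assms[OF this, of 0]]
  have lim0: "(\<lambda>k. ?I * seminorm 0 [] (F - (\<Sum>n<k. f n))) \<longlonglongrightarrow> 0" by (simp only: mult_zero_right)
  have "(\<lambda>k. ip g (F - (\<Sum>n<k. f n))) \<longlonglongrightarrow> 0"
    by (rule Lim_null_comparison[OF always_eventually[OF allI[OF ip_continuous]] lim0])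
  moreover have "ip g (F - K) = ip g F - ip g K" for K
  proof -
    have "ip g (F - K) + ip g K = ip g F" unfolding ip_add(2)[symmetric] by simp
    then show ?thesis by (simp add: eq_diff_eq)
  qed
  ultimately have "(\<lambda>k. ip g F - (\<Sum>n<k. ip g (f n))) \<longlonglongrightarrow> 0" by (simp add: ip_sum)
  then show ?thesis unfolding sums_def
    using tendsto_diff[OF tendsto_const[of "ip g F"], of "\<lambda>k. ip g F - (\<Sum>n<k. ip g (f n))" 0 sequentially] by simp
qed

lemma seminorm_scale:
  fixes f :: "'a::euclidean_space schwartz"
  assumes bs: "bs \<in> lists Basis"
  shows "seminorm N bs (c *\<^sub>C f) \<le> cmod c * seminorm N bs f"
proof (rule seminorm_least)
  fix z
  have "partials bs (sfun (c *\<^sub>C f)) z = c * partials bs (sfun f) z"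
    unfolding scaleC_schwartz.rep_eq partials_scale[OF smooth_sfun bs] ..
  then show "norm z ^ N * cmod (partials bs (sfun (c *\<^sub>C f)) z) \<le> cmod c * seminorm N bs f"
    using mult_left_mono[OF seminorm_upper[OF bs, of z N f], of "cmod c"] by (simp add: norm_mult mult_ac)
qed

text \<open>The pairing function is quadratic in i + j, so powers of (1 + i) (1 + j) control powers
  of the enumeration index.\<close>

lemma prod_decode_bounds:
  assumes "prod_decode n = (i, j)"
  shows "1 + real n \<le> ((1 + real i) * (1 + real j))\<^sup>2"
proof -
  have n: "n = triangle (i + j) + i"
    using prod_decode_inverse[of n] assms by (simp add: prod_encode_def)
  have "2 * triangle (i + j) = (i + j) * Suc (i + j)" by (simp add: triangle_def)
  then have "real (2 * triangle (i + j)) = real ((i + j) * Suc (i + j))" by (simp only:)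
  then have "2 * real (triangle (i + j)) = (real i + real j) * (real i + real j + 1)"
    by (simp add: algebra_simps)
  then have "1 + real n \<le> (1 + real i + real j)\<^sup>2"
    unfolding n by (simp add: power2_eq_square algebra_simps)
  also have "\<dots> \<le> ((1 + real i) * (1 + real j))\<^sup>2"
    by (intro power_mono) (simp_all add: algebra_simps)
  finally show ?thesis .
qed

context twisted_pair
begin

section \<open>Hermite expansions\<close>

definition herm_enum :: "nat \<Rightarrow> (real \<times> real) schwartz" where
  "herm_enum n = (case prod_decode n of (i, j) \<Rightarrow> herm i j)"

lemma herm_expansion_converges:
  assumes d: "\<And>t. \<exists>C. \<forall>i j. cmod (d i j) * ((1 + real i) * (1 + real j)) ^ t \<le> C"
  shows "\<exists>F. \<forall>N. \<forall>bs\<in>lists Basis. (\<lambda>k. seminorm N bs (F - (\<Sum>n<k. (case prod_decode n of (i, j) \<Rightarrow> d i j) *\<^sub>C herm_enum n))) \<longlonglongrightarrow> 0"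
proof (rule schwartz_series)
  fix N and bs :: "(real \<times> real) list" assume bs: "bs \<in> lists Basis"
  obtain C M where C: "0 \<le> C" "\<And>i j. seminorm N bs (herm i j) \<le> C * (1 + real i + real j) ^ M"
    using herm_seminorm[OF bs, of N] unfolding poly_bounded_def by blast
  \<comment> \<open>\<open>M\<close> powers beat the seminorm of \<open>herm i j\<close>; four more
    give at least (1 + n)^2 and hence a summable series.\<close>
  obtain D where D: "\<And>i j. cmod (d i j) * ((1 + real i) * (1 + real j)) ^ (M + 4) \<le> D" using d by blast
  show "summable (\<lambda>n. seminorm N bs ((case prod_decode n of (i, j) \<Rightarrow> d i j) *\<^sub>C herm_enum n))"
  proof (rule summable_comparison_test'[OF summable_mult[OF summable_inverse_square, of "C * D"], of 0])
    fix n
    obtain i j where ij: "prod_decode n = (i, j)" by (cases "prod_decode n")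
    let ?E = "(1 + real i) * (1 + real j)"
    have E: "1 \<le> ?E" "1 + real i + real j \<le> ?E" by (simp_all add: algebra_simps)
    have "seminorm N bs (d i j *\<^sub>C herm i j) \<le> cmod (d i j) * (C * (1 + real i + real j) ^ M)"
      by (rule order_trans[OF seminorm_scale[OF bs]]) (intro mult_left_mono C norm_ge_zero)
    also have "\<dots> \<le> cmod (d i j) * (C * ?E ^ M)"
      using C(1) E(2) by (intro mult_left_mono power_mono) auto
    also have "\<dots> = C * (cmod (d i j) * ?E ^ (M + 4)) * (1 / ?E ^ 4)"
      using E(1) by (simp only: power_add) (simp add: mult_ac)
    also have "\<dots> \<le> C * D * (1 / (1 + real n)\<^sup>2)"
    proof (rule mult_mono)
      show "C * (cmod (d i j) * ?E ^ (M + 4)) \<le> C * D" by (intro mult_left_mono D C)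
      have "(1 + real n)\<^sup>2 \<le> (?E\<^sup>2)\<^sup>2" using prod_decode_bounds[OF ij] by (intro power_mono) auto
      then have "(1 + real n)\<^sup>2 \<le> ?E ^ 4" by (simp only: power_mult[symmetric]) simp
      then show "1 / ?E ^ 4 \<le> 1 / (1 + real n)\<^sup>2" by (intro divide_left_mono) auto
      have "0 \<le> D" by (rule order_trans[OF _ D[of 0 0]]) simp
      then show "0 \<le> C * D" using C(1) by simp
    qed auto
    finally show "norm (seminorm N bs ((case prod_decode n of (i, j) \<Rightarrow> d i j) *\<^sub>C herm_enum n)) \<le> C * D * (1 / (1 + real n)\<^sup>2)"
      by (simp add: ij herm_enum_def seminorm_nonneg[OF bs])
  qed
qed

text \<open>The expansion converges to some Schwartz function with the same coefficients as
  \<open>f\<close>; completeness identifies the two.\<close>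

lemma herm_expansion:
  "\<forall>N. \<forall>bs\<in>lists Basis. (\<lambda>k. seminorm N bs (f - (\<Sum>n<k. ip f (herm_enum n) *\<^sub>C herm_enum n))) \<longlonglongrightarrow> 0"
proof -
  have eq: "(case prod_decode n of (i, j) \<Rightarrow> ip f (herm i j)) = ip f (herm_enum n)" for n
    by (simp add: herm_enum_def split: prod.split)
  obtain F where F: "\<forall>N. \<forall>bs\<in>lists Basis. (\<lambda>k. seminorm N bs (F - (\<Sum>n<k. ip f (herm_enum n) *\<^sub>C herm_enum n))) \<longlonglongrightarrow> 0"
    using herm_expansion_converges[of "\<lambda>i j. ip f (herm i j)", OF coefficient_decay] unfolding eq by blast
  have "ip (F - f) (herm i j) = 0" for i j
  proof -
    have "(\<lambda>n. ip (herm i j) (ip f (herm_enum n) *\<^sub>C herm_enum n)) sums ip (herm i j) F"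
      by (rule ip_sums) (use F in blast)
    moreover have "ip (herm i j) (ip f (herm_enum n) *\<^sub>C herm_enum n) = (if n = prod_encode (i, j) then cnj (ip f (herm i j)) else 0)" for n
    proof (cases "prod_decode n")
      case (Pair i' j')
      then have "n = prod_encode (i', j')" by (metis prod_decode_inverse)
      then show ?thesis using Pair by (auto simp: herm_enum_def ip_scale ip_herm)
    qed
    ultimately have "(\<lambda>n. if n = prod_encode (i, j) then cnj (ip f (herm i j)) else 0) sums ip (herm i j) F" by simp
    then have "ip (herm i j) F = cnj (ip f (herm i j))"
      using sums_single[of "prod_encode (i, j)" "\<lambda>n. cnj (ip f (herm i j))"] by (rule sums_unique2)
    then have "ip F (herm i j) = ip f (herm i j)" using ip_commute[of F "herm i j"] by simp
    then show ?thesis by (simp add: ip_diff)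
  qed
  then have "F - f = 0" by (rule herm_complete)
  then show ?thesis using F by simp
qed

text \<open>Expanding the test function and using continuity of \<open>u\<close> exhibits
  \<open>u\<close> as the pairing with a convergent Hermite series. The conjugations translate
  between the bilinear pairing of \<open>in_schwartz\<close> and the sesquilinear
  \<open>ip\<close>.\<close>

lemma in_schwartz_of_coefficients:
  assumes d: "\<And>t. \<exists>C. \<forall>i j. cmod (dapply u (herm i j)) * ((1 + real i) * (1 + real j)) ^ t \<le> C"
  shows "in_schwartz u"
proof -
  let ?d = "\<lambda>i j. cnj (dapply u (herm i j))"
  have eq: "(case prod_decode n of (i, j) \<Rightarrow> ?d i j) = cnj (dapply u (herm_enum n))" for n
    by (simp add: herm_enum_def split: prod.split)
  have "\<exists>C. \<forall>i j. cmod (?d i j) * ((1 + real i) * (1 + real j)) ^ t \<le> C" for t using d[of t] by simp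
  from herm_expansion_converges[of ?d, OF this] obtain F where
    F: "\<forall>N. \<forall>bs\<in>lists Basis. (\<lambda>k. seminorm N bs (F - (\<Sum>n<k. cnj (dapply u (herm_enum n)) *\<^sub>C herm_enum n))) \<longlonglongrightarrow> 0"
    unfolding eq by blast
  have "dapply u f = (\<integral>z. sfun (cnj_schwartz F) z * sfun f z \<partial>lborel)" for f
  proof -
    have "(\<lambda>n. dapply u (ip f (herm_enum n) *\<^sub>C herm_enum n)) sums dapply u f"
      by (rule dapply_sums) (use herm_expansion in blast)
    moreover have "(\<lambda>n. ip f (cnj (dapply u (herm_enum n)) *\<^sub>C herm_enum n)) sums ip f F"
      by (rule ip_sums) (use F in blast)
    ultimately have "dapply u f = ip f F"
      unfolding dapply_linear ip_scale complex_cnj_cnj by (subst (asm) mult.commute) (rule sums_unique2)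
    then show ?thesis by (simp add: ip_def mult.commute)
  qed
  then show ?thesis unfolding in_schwartz_def by blast
qed

lemma coefficients_of_in_schwartz:
  assumes "in_schwartz u"
  shows "\<exists>C. \<forall>i j. cmod (dapply u (herm i j)) * ((1 + real i) * (1 + real j)) ^ t \<le> C"
proof -
  obtain g where g: "\<And>f. dapply u f = (\<integral>z. sfun g z * sfun f z \<partial>lborel)"
    using assms unfolding in_schwartz_def by blast
  have "dapply u f = cnj (ip (cnj_schwartz g) f)" for f
    unfolding g ip_def Bochner_Integration.integral_cnj[symmetric] by simp
  then show ?thesis using coefficient_decay[of "cnj_schwartz g" t] by simp
qed

section \<open>Coefficients of the twisted operators\<close>

lemma dapply_twisted:
  "dapply (twisted_x q u) f = dapply u (tX f)" "dapply (twisted_y p u) f = dapply u (tY f)"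
  by (simp_all add: twisted_x_def twisted_y_def tX_def tY_def dapply_ops dapply_linear)

lemma dapply_twisted_power:
  "dapply ((twisted_x q ^^ l) u) f = dapply u ((tX ^^ l) f)" "dapply ((twisted_y p ^^ l) u) f = dapply u ((tY ^^ l) f)"
  by (induction l arbitrary: f) (simp_all add: dapply_twisted funpow_swap1[of tX] funpow_swap1[of tY])

definition X_cseq :: "(nat \<Rightarrow> complex) \<Rightarrow> nat \<Rightarrow> complex" where
  "X_cseq c = (\<lambda>i. sqrt_half * (of_real (sqrt (real i)) * c (i - 1) + of_real (sqrt (real (Suc i))) * c (Suc i)))"

definition R_cseq :: "(nat \<Rightarrow> complex) \<Rightarrow> nat \<Rightarrow> complex" where
  "R_cseq c = (\<lambda>i. sqrt_half * (of_real (sqrt (real (Suc i))) * c (Suc i) - of_real (sqrt (real i)) * c (i - 1)))"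

definition coeffs :: "(real \<times> real) tempered \<Rightarrow> nat \<Rightarrow> nat \<Rightarrow> complex" where
  "coeffs u j = (\<lambda>i. dapply u (herm i j))"

lemma coeffs_twisted:
  "coeffs (twisted_x q u) j = X_cseq (coeffs u j)" "coeffs (twisted_y p u) j = (\<lambda>i. - \<i> * R_cseq (coeffs u j) i)"
  unfolding coeffs_def dapply_twisted t_eq_ladder lad_herm rad_herm X_cseq_def R_cseq_def
  by (simp_all add: fun_eq_iff dapply_linear algebra_simps del: of_nat_Suc)

lemma XC_RC_scale:
  "(X_cseq ^^ l) (\<lambda>i. a * c i) = (\<lambda>i. a * (X_cseq ^^ l) c i)" "(R_cseq ^^ l) (\<lambda>i. a * c i) = (\<lambda>i. a * (R_cseq ^^ l) c i)"
proof -
  have x: "X_cseq (\<lambda>i. a * c i) = (\<lambda>i. a * X_cseq c i)" and r: "R_cseq (\<lambda>i. a * c i) = (\<lambda>i. a * R_cseq c i)" for c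
    by (simp_all add: X_cseq_def R_cseq_def fun_eq_iff algebra_simps del: of_nat_Suc)
  show "(X_cseq ^^ l) (\<lambda>i. a * c i) = (\<lambda>i. a * (X_cseq ^^ l) c i)" by (induction l) (simp_all add: x)
  show "(R_cseq ^^ l) (\<lambda>i. a * c i) = (\<lambda>i. a * (R_cseq ^^ l) c i)" by (induction l) (simp_all add: r)
qed

lemma coeffs_twisted_power:
  "coeffs ((twisted_x q ^^ l) u) j = (X_cseq ^^ l) (coeffs u j)"
  "coeffs ((twisted_y p ^^ l) u) j = (\<lambda>i. (- \<i>) ^ l * (R_cseq ^^ l) (coeffs u j) i)"
proof -
  show "coeffs ((twisted_x q ^^ l) u) j = (X_cseq ^^ l) (coeffs u j)"
    by (induction l) (simp_all add: coeffs_twisted)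
  have r: "R_cseq (\<lambda>i. a * c i) = (\<lambda>i. a * R_cseq c i)" for a c using XC_RC_scale(2)[of 1 a c] by simp
  show "coeffs ((twisted_y p ^^ l) u) j = (\<lambda>i. (- \<i>) ^ l * (R_cseq ^^ l) (coeffs u j) i)"
    by (induction l) (simp_all add: coeffs_twisted r mult.assoc)
qed

definition B_dist where
  "B_dist h k m n lam mu nu sg u =
      complex_of_real lam *\<^sub>C (twisted_x q ^^ (2 * h)) u
    + complex_of_real mu *\<^sub>C (twisted_x q ^^ m \<circ> twisted_y p ^^ (2 * n) \<circ> twisted_x q ^^ m) u
    + complex_of_real nu *\<^sub>C (twisted_y p ^^ n \<circ> twisted_x q ^^ (2 * m) \<circ> twisted_y p ^^ n) u
    + complex_of_real sg *\<^sub>C (twisted_y p ^^ (2 * k)) u"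

lemma clinear_B_dist: "clinear (B_dist h k m n lam mu nu sg)"
  unfolding clinear_iff B_dist_def o_def
  by (intro conjI allI tempered_eqI) (simp_all add: dapply_twisted_power algebra_simps)

text \<open>The factors - \<i> from \<open>twisted_y\<close> occur in even number in every term, so
  all matrix entries are real, and real and imaginary parts of the coefficients satisfy the same
  real equation separately.\<close>

lemma coeffs_B_dist:
  assumes L: "L = Re \<or> L = Im"
  shows "(\<lambda>i. L (coeffs (B_dist h k m n lam mu nu sg u) j i)) = B_seq h k m n lam mu nu sg (\<lambda>i. L (coeffs u j i))"
proof -
  have Lx: "(\<lambda>i. L ((X_cseq ^^ l) c i)) = (X_seq ^^ l) (\<lambda>i. L (c i))" for l c
    by (rule funpow_intertwine[where D = "\<lambda>c i. L (c i)"]) (use L in \<open>auto simp: X_cseq_def X_seq_def sqrt_half_def fun_eq_iff\<close>)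
  have Lr: "(\<lambda>i. L ((R_cseq ^^ l) c i)) = (R_seq ^^ l) (\<lambda>i. L (c i))" for l c
    by (rule funpow_intertwine[where D = "\<lambda>c i. L (c i)"]) (use L in \<open>auto simp: R_cseq_def R_seq_def sqrt_half_def fun_eq_iff\<close>)
  have Ladd: "L (x + y) = L x + L y" "L (of_real a * x) = a * L x" for x y a
    using L by auto
  have sgn: "(- \<i>) ^ (2 * l) = of_real ((- 1) ^ l)" "(- \<i>) ^ l * ((- \<i>) ^ l * x) = of_real ((- 1) ^ l) * x" for l x
  proof -
    show *: "(- \<i>) ^ (2 * l) = of_real ((- 1) ^ l)" by (simp add: power_mult)
    show "(- \<i>) ^ l * ((- \<i>) ^ l * x) = of_real ((- 1) ^ l) * x"
      unfolding mult.assoc[symmetric] power_add[symmetric] mult_2[symmetric] * ..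
  qed
  let ?c = "coeffs u j"
  have "coeffs (B_dist h k m n lam mu nu sg u) j i =
      of_real lam * (X_cseq ^^ (2 * h)) ?c i
    + of_real ((- 1) ^ n * mu) * (X_cseq ^^ m) ((R_cseq ^^ (2 * n)) ((X_cseq ^^ m) ?c)) i
    + of_real ((- 1) ^ n * nu) * (R_cseq ^^ n) ((X_cseq ^^ (2 * m)) ((R_cseq ^^ n) ?c)) i
    + of_real ((- 1) ^ k * sg) * (R_cseq ^^ (2 * k)) ?c i" for i
  proof -
    have "coeffs (B_dist h k m n lam mu nu sg u) j i =
        of_real lam * coeffs ((twisted_x q ^^ (2 * h)) u) j i
      + of_real mu * coeffs ((twisted_x q ^^ m) ((twisted_y p ^^ (2 * n)) ((twisted_x q ^^ m) u))) j i
      + of_real nu * coeffs ((twisted_y p ^^ n) ((twisted_x q ^^ (2 * m)) ((twisted_y p ^^ n) u))) j i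
      + of_real sg * coeffs ((twisted_y p ^^ (2 * k)) u) j i"
      by (simp add: B_dist_def coeffs_def)
    then show ?thesis
      unfolding coeffs_twisted_power XC_RC_scale sgn by (simp add: mult_ac)
  qed
  then have "L (coeffs (B_dist h k m n lam mu nu sg u) j i) =
      lam * L ((X_cseq ^^ (2 * h)) ?c i)
    + (- 1) ^ n * mu * L ((X_cseq ^^ m) ((R_cseq ^^ (2 * n)) ((X_cseq ^^ m) ?c)) i)
    + (- 1) ^ n * nu * L ((R_cseq ^^ n) ((X_cseq ^^ (2 * m)) ((R_cseq ^^ n) ?c)) i)
    + (- 1) ^ k * sg * L ((R_cseq ^^ (2 * k)) ?c i)" for i
    by (simp only: Ladd)
  then show ?thesis
    unfolding B_seq_def Lx[symmetric] Lr[symmetric] by (simp only:)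
qed

text \<open>For fixed \<open>j\<close> the a priori growth in \<open>i\<close> has a constant
  depending on \<open>j\<close>, but the constant of \<open>sequence_regularity\<close> depends on
  the growth exponent only and not on that constant; the decay in \<open>j\<close> comes from the
  data.\<close>

theorem regular_B_dist:
  assumes hk: "0 < h" "0 < k" and mn: "m < h" "n < k"
    and coeffs: "0 < lam" "0 < sg" "0 \<le> mu" "0 \<le> nu"
  shows "regular (B_dist h k m n lam mu nu sg)"
  unfolding regular_def
proof (intro conjI allI impI clinear_B_dist)
  fix u :: "(real \<times> real) tempered"
  let ?B = "B_dist h k m n lam mu nu sg u"
  assume B: "in_schwartz ?B"
  have f: "\<exists>C. \<forall>i j. cmod (coeffs ?B j i) * ((1 + real i) * (1 + real j)) ^ t \<le> C" for t
    using coefficients_of_in_schwartz[OF B, of t] by (simp add: coeffs_def)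
  obtain C M where C: "0 \<le> C" and growth: "\<And>i j. cmod (coeffs u j i) \<le> C * (1 + real i + real j) ^ M"
  proof -
    obtain C0 N where C0: "0 \<le> C0" "\<And>f. cmod (dapply u f) \<le> C0 * total_seminorm N f"
      using dapply_continuous[of u] by blast
    have "poly_bounded (\<lambda>i j. cmod (coeffs u j i))"
      unfolding coeffs_def by (rule poly_bounded_mono[OF poly_bounded_scale[OF herm_total_seminorm C0(1)] C0(2)])
    then show thesis using that unfolding poly_bounded_def by blast
  qed
  show "in_schwartz u"
  proof (rule in_schwartz_of_coefficients)
    fix t
    obtain K where K: "0 \<le> K" and reg: "\<And>v A. (\<exists>C. \<forall>i. \<bar>v i\<bar> \<le> C * (1 + real i) ^ M) \<Longrightarrow>
        rapidly_decreasing (B_seq h k m n lam mu nu sg v) \<Longrightarrow>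
        (\<forall>i. \<bar>B_seq h k m n lam mu nu sg v i\<bar> * (1 + real i) ^ (t + 1) \<le> A) \<Longrightarrow>
        (\<forall>i. \<bar>v i\<bar> * (1 + real i) ^ t \<le> K * A)"
      using sequence_regularity[OF hk mn coeffs, of M t] by blast
    obtain D where D: "\<And>i j. cmod (coeffs ?B j i) * ((1 + real i) * (1 + real j)) ^ (t + 1) \<le> D"
      using f by blast
    have D0: "0 \<le> D" by (rule order_trans[OF _ D[of 0 0]]) simp
    have part: "\<bar>L (coeffs u j i)\<bar> * ((1 + real i) * (1 + real j)) ^ t \<le> K * D" if L: "L = Re \<or> L = Im" for L i j
    proof -
      have Lle: "\<bar>L x\<bar> \<le> cmod x" for x using L abs_Re_le_cmod abs_Im_le_cmod by auto
      let ?v = "\<lambda>i. L (coeffs u j i)"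
      have BL: "B_seq h k m n lam mu nu sg ?v i = L (coeffs ?B j i)" for i
        using coeffs_B_dist[OF L, of h k m n lam mu nu sg u j] by (simp add: fun_eq_iff)
      have "\<bar>?v i\<bar> \<le> (C * (1 + real j) ^ M) * (1 + real i) ^ M" for i
      proof -
        have "C * (1 + real i + real j) ^ M \<le> C * ((1 + real j) * (1 + real i)) ^ M"
          using C by (intro mult_left_mono power_mono) (auto simp: algebra_simps)
        then show ?thesis using order_trans[OF Lle growth] by (auto simp: power_mult_distrib mult.assoc intro: order_trans)
      qed
      then have 1: "\<exists>C. \<forall>i. \<bar>?v i\<bar> \<le> C * (1 + real i) ^ M" by blast
      have 2: "rapidly_decreasing (B_seq h k m n lam mu nu sg ?v)"
        unfolding rapidly_decreasing_def BL
      proof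
        fix r
        obtain E where E: "\<And>i j. cmod (coeffs ?B j i) * ((1 + real i) * (1 + real j)) ^ r \<le> E" using f by blast
        have "\<bar>L (coeffs ?B j i)\<bar> * (1 + real i) ^ r \<le> E" for i
        proof -
          have "(1 + real i) ^ r \<le> ((1 + real i) * (1 + real j)) ^ r" by (intro power_mono) (auto simp: algebra_simps)
          then have "\<bar>L (coeffs ?B j i)\<bar> * (1 + real i) ^ r \<le> cmod (coeffs ?B j i) * ((1 + real i) * (1 + real j)) ^ r"
            by (intro mult_mono Lle) auto
          then show ?thesis using E[where i = i and j = j] by linarith
        qed
        then show "\<exists>C. \<forall>i. \<bar>L (coeffs ?B j i)\<bar> * (1 + real i) ^ r \<le> C" by blast
      qed
      \<comment> \<open>The decay of \<open>B u\<close> in \<open>j\<close> is put into the constant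
        \<open>A\<close> of \<open>sequence_regularity\<close>.\<close>
      have 3: "\<forall>i. \<bar>B_seq h k m n lam mu nu sg ?v i\<bar> * (1 + real i) ^ (t + 1) \<le> D / (1 + real j) ^ (t + 1)"
        unfolding BL
      proof
        fix i
        have "\<bar>L (coeffs ?B j i)\<bar> * (1 + real i) ^ (t + 1) * (1 + real j) ^ (t + 1) \<le>
          cmod (coeffs ?B j i) * (1 + real i) ^ (t + 1) * (1 + real j) ^ (t + 1)"
          by (intro mult_right_mono Lle) auto
        also have "\<dots> \<le> D" using D[where i = i and j = j] by (simp only: power_mult_distrib mult.assoc)
        finally show "\<bar>L (coeffs ?B j i)\<bar> * (1 + real i) ^ (t + 1) \<le> D / (1 + real j) ^ (t + 1)"
          by (simp only: pos_le_divide_eq zero_less_power add_pos_nonneg zero_less_one of_nat_0_le_iff)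
      qed
      have "\<bar>?v i\<bar> * (1 + real i) ^ t \<le> K * (D / (1 + real j) ^ (t + 1))" using reg[OF 1 2 3] by blast
      also have "\<dots> \<le> K * (D / (1 + real j) ^ t)"
        using K D0 by (intro mult_left_mono divide_left_mono power_increasing) auto
      finally have "\<bar>?v i\<bar> * (1 + real i) ^ t * (1 + real j) ^ t \<le> K * (D / (1 + real j) ^ t) * (1 + real j) ^ t"
        by (rule mult_right_mono) simp
      then show ?thesis by (simp add: power_mult_distrib mult.assoc)
    qed
    have "cmod (dapply u (herm i j)) * ((1 + real i) * (1 + real j)) ^ t \<le> K * D + K * D" for i j
    proof -
      have "cmod (coeffs u j i) * ((1 + real i) * (1 + real j)) ^ t \<le>
        (\<bar>Re (coeffs u j i)\<bar> + \<bar>Im (coeffs u j i)\<bar>) * ((1 + real i) * (1 + real j)) ^ t"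
        by (intro mult_right_mono cmod_le) auto
      also have "\<dots> \<le> K * D + K * D"
        unfolding distrib_right[of "\<bar>Re (coeffs u j i)\<bar>"] by (intro add_mono part) auto
      finally show ?thesis by (simp add: coeffs_def)
    qed
    then show "\<exists>C. \<forall>i j. cmod (dapply u (herm i j)) * ((1 + real i) * (1 + real j)) ^ t \<le> C" by blast
  qed
qed

end

theorem proposition11:
  fixes h k m n :: nat and lam sigma mu nu p q :: real
  assumes "h > 0" "k > 0" "m > 0" "n > 0"
    and "m < h" "n < k" "n * h + m * k \<ge> h * k"
    and "lam > 0" "sigma > 0" "mu \<ge> 0" "nu \<ge> 0"
    and "q = 1 - p"
  shows "regular (\<lambda>u.
      complex_of_real lam *\<^sub>C (twisted_x q ^^ (2 * h)) u
    + complex_of_real mu *\<^sub>C (twisted_x q ^^ m \<circ> twisted_y p ^^ (2 * n) \<circ> twisted_x q ^^ m) u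
    + complex_of_real nu *\<^sub>C (twisted_y p ^^ n \<circ> twisted_x q ^^ (2 * m) \<circ> twisted_y p ^^ n) u
    + complex_of_real sigma *\<^sub>C (twisted_y p ^^ (2 * k)) u)"
proof -
  interpret twisted_pair p q by unfold_locales (simp add: assms)
  show ?thesis
    using regular_B_dist[of h k m n lam sigma mu nu] assms unfolding B_dist_def[abs_def] by simp
qed

end
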